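(* Let $R$ be a commutative Noetherian local ring, and let $M$ and $N$ be non-zero finitely generated $R$-modules such that $q = q^R(M,N) < \infty$ and $\operatorname{qpd}_R M < \infty$. If $\operatorname{depth}(\operatorname{Tor}_q^R(M,N)) \leq 1$, then $$\operatorname{depth} N = \operatorname{depth}(\operatorname{Tor}_q^R(M,N)) + \operatorname{qpd}_R M - q.$$
   Context: All rings are commutative Noetherian local and all modules are finitely generated. For $R$-modules $M,N$, set $q^R(M,N) := \sup\{ i \ge 0 : \operatorname{Tor}_i^R(M,N) \neq 0\}$. For a complex $X$ of $R$-modules (homological indexing), $\sup X = \sup\{i : X_i \neq 0\}$, $\inf X = \inf\{i : X_i \neq 0\}$, $\operatorname{hsup} X = \sup\{i : \operatorname{H}_i(X) \neq 0\}$; $X$ is bounded if $\sup X - \inf X < \infty$ and bounded below if $\inf X > -\infty$. A quasi-projective resolution of an $R$-module $M$ is a bounded below complex $P$ of projective $R$-modules such that for all $i \ge \inf P$ there are non-negative integers $a_i$, not all zero, with $\operatorname{H}_i(P) \cong M^{\oplus a_i}$. The quasi-projective dimension of $M \ne 0$ is $\operatorname{qpd}_R M = \inf\{ \sup P - \operatorname{hsup} P \mid P \text{ is a bounded quasi-projective resolution of } M\}$ (so it is $\infty$ if no bounded quasi-projective resolution exists), and $\operatorname{qpd}_R 0 = -\infty$. The depth of the zero module is $\infty$. *)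

theory Defs
  imports
    "HOL-Algebra.Module"
    "HOL-Algebra.Ideal"
    "HOL-Algebra.AbelCoset"
    "HOL-Algebra.Ring_Divisibility"
    "HOL-Library.Extended_Real"
begin

section \<open>Local rings\<close>

definition local_ring :: "('a, 'r) ring_scheme \<Rightarrow> bool" where
  "local_ring R \<longleftrightarrow> cring R \<and> (\<exists>!\<mm>. maximalideal \<mm> R)"

definition max_ideal :: "('a, 'r) ring_scheme \<Rightarrow> 'a set" where
  "max_ideal R = (THE \<mm>. maximalideal \<mm> R)"


section \<open>Modules\<close>

text \<open>The fields \<^const>\<open>mult\<close> and \<^const>\<open>one\<close>, which a module record inherits from
  the ring record, carry no information about a module.\<close>

definition zero_module :: "('a, 'b, 'm) module_scheme \<Rightarrow> bool" where
  "zero_module M \<longleftrightarrow> carrier M = {\<zero>\<^bsub>M\<^esub>}"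

definition mod_hom ::
  "('a, 'r) ring_scheme \<Rightarrow> ('a, 'b, 'm) module_scheme \<Rightarrow> ('a, 'c, 'n) module_scheme \<Rightarrow> ('b \<Rightarrow> 'c) set" where
  "mod_hom R M N = {f \<in> carrier M \<rightarrow> carrier N.
     (\<forall>x\<in>carrier M. \<forall>y\<in>carrier M. f (x \<oplus>\<^bsub>M\<^esub> y) = f x \<oplus>\<^bsub>N\<^esub> f y) \<and>
     (\<forall>r\<in>carrier R. \<forall>x\<in>carrier M. f (r \<odot>\<^bsub>M\<^esub> x) = r \<odot>\<^bsub>N\<^esub> f x)}"

definition mod_iso ::
  "('a, 'r) ring_scheme \<Rightarrow> ('a, 'b, 'm) module_scheme \<Rightarrow> ('a, 'c, 'n) module_scheme \<Rightarrow> bool" where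
  "mod_iso R M N \<longleftrightarrow> (\<exists>f\<in>mod_hom R M N. bij_betw f (carrier M) (carrier N))"

definition mod_span ::
  "('a, 'r) ring_scheme \<Rightarrow> ('a, 'b, 'm) module_scheme \<Rightarrow> 'b set \<Rightarrow> 'b set" where
  "mod_span R M S = \<Inter>{H. submodule H R M \<and> S \<subseteq> H}"

definition fin_gen_module :: "('a, 'r) ring_scheme \<Rightarrow> ('a, 'b, 'm) module_scheme \<Rightarrow> bool" where
  "fin_gen_module R M \<longleftrightarrow>
     module R M \<and> (\<exists>S. finite S \<and> S \<subseteq> carrier M \<and> mod_span R M S = carrier M)"

definition quot_module :: "('a, 'b, 'm) module_scheme \<Rightarrow> 'b set \<Rightarrow> ('a, 'b set) module" where
  "quot_module M H =
     \<lparr>carrier = a_rcosets\<^bsub>M\<^esub> H, mult = undefined, one = undefined,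
      zero = H, add = set_add M,
      smult = (\<lambda>r X. \<Union>x\<in>X. H +>\<^bsub>M\<^esub> (r \<odot>\<^bsub>M\<^esub> x))\<rparr>"

text \<open>The direct sum of \<open>n\<close> copies of \<open>M\<close>.\<close>
definition power_module :: "('a, 'b, 'm) module_scheme \<Rightarrow> nat \<Rightarrow> ('a, nat \<Rightarrow> 'b) module" where
  "power_module M n =
     \<lparr>carrier = {..<n} \<rightarrow>\<^sub>E carrier M, mult = undefined, one = undefined,
      zero = (\<lambda>i\<in>{..<n}. \<zero>\<^bsub>M\<^esub>),
      add = (\<lambda>x y. \<lambda>i\<in>{..<n}. x i \<oplus>\<^bsub>M\<^esub> y i),
      smult = (\<lambda>r x. \<lambda>i\<in>{..<n}. r \<odot>\<^bsub>M\<^esub> x i)\<rparr>"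

text \<open>HOL cannot quantify over the carrier types of all modules. The type \<open>(nat \<Rightarrow> 'a) set\<close>
  is large enough for every finitely generated module over a ring with elements in \<open>'a\<close>: such a
  module is a quotient of a finite power of the ring, and its elements are cosets of tuples
  (lemma \<open>fin_gen_module_representable\<close> below). Wherever a notion quantifies
  over modules, these are the modules quantified over.\<close>
type_synonym 'a univ_elem = "(nat \<Rightarrow> 'a) set"
type_synonym 'a univ_module = "('a, 'a univ_elem) module"

lemma (in module) finsum_comb_submodule:
  assumes S: "finite S" "S \<subseteq> carrier M"
  shows "submodule {\<Oplus>\<^bsub>M\<^esub>s\<in>S. c s \<odot>\<^bsub>M\<^esub> s | c. c \<in> S \<rightarrow> carrier R} R M"
proof -
  have cl: "c s \<odot>\<^bsub>M\<^esub> s \<in> carrier M" if "c \<in> S \<rightarrow> carrier R" "s \<in> S" for c s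
    using that S by (auto simp: Pi_def)
  show ?thesis
  proof (rule submoduleI)
    show "{\<Oplus>\<^bsub>M\<^esub>s\<in>S. c s \<odot>\<^bsub>M\<^esub> s | c. c \<in> S \<rightarrow> carrier R} \<subseteq> carrier M"
      using cl by (auto intro!: M.finsum_closed)
    have "(\<Oplus>\<^bsub>M\<^esub>s\<in>S. \<zero> \<odot>\<^bsub>M\<^esub> s) = (\<Oplus>\<^bsub>M\<^esub>s\<in>S. \<zero>\<^bsub>M\<^esub>)"
      using S by (intro M.finsum_cong') auto
    then have "\<zero>\<^bsub>M\<^esub> = (\<Oplus>\<^bsub>M\<^esub>s\<in>S. \<zero> \<odot>\<^bsub>M\<^esub> s)" by simp
    then show "\<zero>\<^bsub>M\<^esub> \<in> {\<Oplus>\<^bsub>M\<^esub>s\<in>S. c s \<odot>\<^bsub>M\<^esub> s | c. c \<in> S \<rightarrow> carrier R}"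
      by (auto intro!: exI[of _ "\<lambda>_. \<zero>"])
  next
    fix a b assume "a \<in> {\<Oplus>\<^bsub>M\<^esub>s\<in>S. c s \<odot>\<^bsub>M\<^esub> s | c. c \<in> S \<rightarrow> carrier R}"
      "b \<in> {\<Oplus>\<^bsub>M\<^esub>s\<in>S. c s \<odot>\<^bsub>M\<^esub> s | c. c \<in> S \<rightarrow> carrier R}"
    then obtain c d where c: "c \<in> S \<rightarrow> carrier R" "a = (\<Oplus>\<^bsub>M\<^esub>s\<in>S. c s \<odot>\<^bsub>M\<^esub> s)"
      and d: "d \<in> S \<rightarrow> carrier R" "b = (\<Oplus>\<^bsub>M\<^esub>s\<in>S. d s \<odot>\<^bsub>M\<^esub> s)" by auto
    have "a \<oplus>\<^bsub>M\<^esub> b = (\<Oplus>\<^bsub>M\<^esub>s\<in>S. c s \<odot>\<^bsub>M\<^esub> s \<oplus>\<^bsub>M\<^esub> d s \<odot>\<^bsub>M\<^esub> s)"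
      unfolding c d by (rule M.finsum_addf[symmetric]) (use cl c d in auto)
    also have "\<dots> = (\<Oplus>\<^bsub>M\<^esub>s\<in>S. (c s \<oplus> d s) \<odot>\<^bsub>M\<^esub> s)"
      using S c d by (intro M.finsum_cong') (auto simp: Pi_def smult_l_distr subset_iff)
    finally show "a \<oplus>\<^bsub>M\<^esub> b \<in> {\<Oplus>\<^bsub>M\<^esub>s\<in>S. c s \<odot>\<^bsub>M\<^esub> s | c. c \<in> S \<rightarrow> carrier R}"
      using c d by (intro CollectI exI[of _ "\<lambda>s. c s \<oplus> d s"]) auto
  next
    fix r a assume r: "r \<in> carrier R"
      and "a \<in> {\<Oplus>\<^bsub>M\<^esub>s\<in>S. c s \<odot>\<^bsub>M\<^esub> s | c. c \<in> S \<rightarrow> carrier R}"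
    then obtain c where c: "c \<in> S \<rightarrow> carrier R" "a = (\<Oplus>\<^bsub>M\<^esub>s\<in>S. c s \<odot>\<^bsub>M\<^esub> s)" by auto
    have "r \<odot>\<^bsub>M\<^esub> a = (\<Oplus>\<^bsub>M\<^esub>s\<in>S. r \<odot>\<^bsub>M\<^esub> (c s \<odot>\<^bsub>M\<^esub> s))"
      unfolding c by (rule finsum_smult_ldistr) (use cl c r S in auto)
    also have "\<dots> = (\<Oplus>\<^bsub>M\<^esub>s\<in>S. (r \<otimes> c s) \<odot>\<^bsub>M\<^esub> s)"
      using S c r by (intro M.finsum_cong') (auto simp: Pi_def smult_assoc1 subset_iff)
    finally show *: "r \<odot>\<^bsub>M\<^esub> a \<in> {\<Oplus>\<^bsub>M\<^esub>s\<in>S. c s \<odot>\<^bsub>M\<^esub> s | c. c \<in> S \<rightarrow> carrier R}"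
      using c r by (intro CollectI exI[of _ "\<lambda>s. r \<otimes> c s"]) auto
  next
    fix a assume "a \<in> {\<Oplus>\<^bsub>M\<^esub>s\<in>S. c s \<odot>\<^bsub>M\<^esub> s | c. c \<in> S \<rightarrow> carrier R}"
    then obtain c where c: "c \<in> S \<rightarrow> carrier R" "a = (\<Oplus>\<^bsub>M\<^esub>s\<in>S. c s \<odot>\<^bsub>M\<^esub> s)" by auto
    have acl: "a \<in> carrier M" unfolding c using cl c by (auto intro!: M.finsum_closed)
    have "\<ominus>\<^bsub>M\<^esub> a = (\<ominus> \<one>) \<odot>\<^bsub>M\<^esub> a" using acl by (simp add: smult_l_minus)
    also have "\<dots> = (\<Oplus>\<^bsub>M\<^esub>s\<in>S. (\<ominus> \<one>) \<odot>\<^bsub>M\<^esub> (c s \<odot>\<^bsub>M\<^esub> s))"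
      unfolding c by (rule finsum_smult_ldistr) (use cl c S in auto)
    also have "\<dots> = (\<Oplus>\<^bsub>M\<^esub>s\<in>S. ((\<ominus> \<one>) \<otimes> c s) \<odot>\<^bsub>M\<^esub> s)"
      using S c by (intro M.finsum_cong') (auto simp: Pi_def smult_assoc1 subset_iff)
    finally show "\<ominus>\<^bsub>M\<^esub> a \<in> {\<Oplus>\<^bsub>M\<^esub>s\<in>S. c s \<odot>\<^bsub>M\<^esub> s | c. c \<in> S \<rightarrow> carrier R}"
      using c by (intro CollectI exI[of _ "\<lambda>s. (\<ominus> \<one>) \<otimes> c s"]) auto
  qed
qed

lemma (in module) mod_span_subset_combinations:
  assumes S: "finite S" "S \<subseteq> carrier M"
  shows "mod_span R M S \<subseteq> {\<Oplus>\<^bsub>M\<^esub>s\<in>S. c s \<odot>\<^bsub>M\<^esub> s | c. c \<in> S \<rightarrow> carrier R}"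
proof -
  have "s \<in> {\<Oplus>\<^bsub>M\<^esub>s\<in>S. c s \<odot>\<^bsub>M\<^esub> s | c. c \<in> S \<rightarrow> carrier R}" if s: "s \<in> S" for s
  proof -
    have "(\<Oplus>\<^bsub>M\<^esub>t\<in>S. (if s = t then \<one> else \<zero>) \<odot>\<^bsub>M\<^esub> t) = (\<Oplus>\<^bsub>M\<^esub>t\<in>S. if s = t then t else \<zero>\<^bsub>M\<^esub>)"
      using S by (intro M.finsum_cong') auto
    also have "\<dots> = s" using s S by (intro M.finsum_singleton) auto
    finally show ?thesis
      by (intro CollectI exI[of _ "\<lambda>t. if s = t then \<one> else \<zero>"]) auto
  qed
  then show ?thesis
    unfolding mod_span_def using finsum_comb_submodule[OF S] by blast
qed

lemma fin_gen_module_representable: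
  fixes R :: "('a, 'r) ring_scheme"
  assumes "fin_gen_module R M"
  shows "\<exists>M' :: 'a univ_module. module R M' \<and> mod_iso R M M'"
proof -
  from assms obtain S where S: "finite S" "S \<subseteq> carrier M" "mod_span R M S = carrier M"
    and "module R M" by (auto simp: fin_gen_module_def)
  interpret module R M by fact
  obtain b where b: "bij_betw b {..<card S} S"
    using S(1) ex_bij_betw_nat_finite atLeast0LessThan by metis
  define j where "j m = {c \<in> {..<card S} \<rightarrow>\<^sub>E carrier R.
      (\<Oplus>\<^bsub>M\<^esub>s\<in>S. c (the_inv_into {..<card S} b s) \<odot>\<^bsub>M\<^esub> s) = m}" for m
  have ne: "j m \<noteq> {}" if m: "m \<in> carrier M" for m
  proof -
    obtain c where c: "c \<in> S \<rightarrow> carrier R" "m = (\<Oplus>\<^bsub>M\<^esub>s\<in>S. c s \<odot>\<^bsub>M\<^esub> s)"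
      using mod_span_subset_combinations[OF S(1,2)] m S(3) by auto
    let ?c = "\<lambda>i\<in>{..<card S}. c (b i)"
    have inv: "the_inv_into {..<card S} b s < card S \<and> b (the_inv_into {..<card S} b s) = s"
      if "s \<in> S" for s
      using b that by (metis bij_betw_def f_the_inv_into_f lessThan_iff subset_refl the_inv_into_into)
    have "(\<Oplus>\<^bsub>M\<^esub>s\<in>S. ?c (the_inv_into {..<card S} b s) \<odot>\<^bsub>M\<^esub> s) = m"
      unfolding c using S c inv by (intro M.finsum_cong') (auto simp: Pi_def subset_iff)
    moreover have "?c \<in> {..<card S} \<rightarrow>\<^sub>E carrier R"
      using c b by (auto simp: bij_betw_def)
    ultimately have "?c \<in> j m" unfolding j_def by blast
    then show ?thesis by blast
  qed
  have inj: "inj_on j (carrier M)"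
    using ne by (intro inj_onI) (auto simp: j_def)
  define k where "k = the_inv_into (carrier M) j"
  have kj [simp]: "k (j m) = m" if "m \<in> carrier M" for m
    using inj that by (simp add: k_def the_inv_into_f_f)
  define M' :: "'a univ_module" where "M' =
    \<lparr>carrier = j ` carrier M, mult = undefined, one = undefined, zero = j \<zero>\<^bsub>M\<^esub>,
     add = (\<lambda>x y. j (k x \<oplus>\<^bsub>M\<^esub> k y)), smult = (\<lambda>r x. j (r \<odot>\<^bsub>M\<^esub> k x))\<rparr>"
  have "abelian_group M'"
  proof (rule abelian_groupI)
    fix x assume "x \<in> carrier M'"
    then obtain m where m: "m \<in> carrier M" "x = j m" by (auto simp: M'_def)
    then show "\<exists>y\<in>carrier M'. y \<oplus>\<^bsub>M'\<^esub> x = \<zero>\<^bsub>M'\<^esub>"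
      by (auto simp: M'_def M.l_neg intro!: bexI[of _ "\<ominus>\<^bsub>M\<^esub> m"])
  qed (auto simp: M'_def M.a_ac)
  then have "module R M'"
    by (intro moduleI R.is_cring)
      (auto simp: M'_def smult_l_distr smult_r_distr smult_assoc1)
  moreover have "mod_iso R M M'"
    unfolding mod_iso_def mod_hom_def
    using inj by (intro bexI[of _ j]) (auto simp: M'_def bij_betw_def)
  ultimately show ?thesis by blast
qed

text \<open>Projectivity is the usual lifting property; for a finitely generated module the test modules
  over the universe above suffice, since the surjections onto it from finite free modules are
  among the tests.\<close>
definition projective_module :: "('a, 'r) ring_scheme \<Rightarrow> ('a, 'b, 'm) module_scheme \<Rightarrow> bool" where
  "projective_module R P \<longleftrightarrow> module R P \<and>
     (\<forall>(A :: 'a univ_module) (B :: 'a univ_module). \<forall>g\<in>mod_hom R A B. \<forall>h\<in>mod_hom R P B.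
        module R A \<and> module R B \<and> g ` carrier A = carrier B \<longrightarrow>
        (\<exists>k\<in>mod_hom R P A. \<forall>x\<in>carrier P. g (k x) = h x))"


section \<open>Depth\<close>

text \<open>The submodule generated by all products \<open>x m\<close> with \<open>x\<close> in the given set of scalars.\<close>
definition scalars_times ::
  "('a, 'r) ring_scheme \<Rightarrow> 'a set \<Rightarrow> ('a, 'b, 'm) module_scheme \<Rightarrow> 'b set" where
  "scalars_times R X M = mod_span R M {x \<odot>\<^bsub>M\<^esub> m | x m. x \<in> X \<and> m \<in> carrier M}"

definition nonzerodivisor_on :: "'a \<Rightarrow> ('a, 'b, 'm) module_scheme \<Rightarrow> bool" where
  "nonzerodivisor_on x M \<longleftrightarrow> (\<forall>m\<in>carrier M. x \<odot>\<^bsub>M\<^esub> m = \<zero>\<^bsub>M\<^esub> \<longrightarrow> m = \<zero>\<^bsub>M\<^esub>)"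

definition regular_sequence ::
  "('a, 'r) ring_scheme \<Rightarrow> ('a, 'b, 'm) module_scheme \<Rightarrow> 'a list \<Rightarrow> bool" where
  "regular_sequence R M xs \<longleftrightarrow> set xs \<subseteq> carrier R \<and>
     (\<forall>i<length xs. nonzerodivisor_on (xs ! i) (quot_module M (scalars_times R (set (take i xs)) M))) \<and>
     \<not> zero_module (quot_module M (scalars_times R (set xs) M))"

definition depth :: "('a, 'r) ring_scheme \<Rightarrow> ('a, 'b, 'm) module_scheme \<Rightarrow> enat" where
  "depth R M = (if zero_module M then \<infinity>
     else (SUP xs\<in>{xs. set xs \<subseteq> max_ideal R \<and> regular_sequence R M xs}. enat (length xs)))"


section \<open>Complexes\<close>

text \<open>Homological indexing: \<open>bd X i\<close> maps \<open>obj X i\<close> to \<open>obj X (i - 1)\<close>.\<close>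
record ('a, 'b) cpx =
  obj :: "int \<Rightarrow> ('a, 'b) module"
  bd :: "int \<Rightarrow> 'b \<Rightarrow> 'b"

definition is_complex :: "('a, 'r) ring_scheme \<Rightarrow> ('a, 'b) cpx \<Rightarrow> bool" where
  "is_complex R X \<longleftrightarrow> (\<forall>i. fin_gen_module R (obj X i)) \<and>
     (\<forall>i. bd X i \<in> mod_hom R (obj X i) (obj X (i - 1))) \<and>
     (\<forall>i. \<forall>x\<in>carrier (obj X i). bd X (i - 1) (bd X i x) = \<zero>\<^bsub>obj X (i - 2)\<^esub>)"

definition cycles :: "('a, 'b) cpx \<Rightarrow> int \<Rightarrow> 'b set" where
  "cycles X i = {x \<in> carrier (obj X i). bd X i x = \<zero>\<^bsub>obj X (i - 1)\<^esub>}"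

definition boundaries :: "('a, 'b) cpx \<Rightarrow> int \<Rightarrow> 'b set" where
  "boundaries X i = bd X (i + 1) ` carrier (obj X (i + 1))"

definition homology :: "('a, 'b) cpx \<Rightarrow> int \<Rightarrow> ('a, 'b set) module" where
  "homology X i = quot_module (obj X i\<lparr>carrier := cycles X i\<rparr>) (boundaries X i)"

definition csup :: "('a, 'b) cpx \<Rightarrow> ereal" where
  "csup X = (SUP i\<in>{i. \<not> zero_module (obj X i)}. ereal (of_int i))"

definition cinf :: "('a, 'b) cpx \<Rightarrow> ereal" where
  "cinf X = (INF i\<in>{i. \<not> zero_module (obj X i)}. ereal (of_int i))"

definition hsup :: "('a, 'b) cpx \<Rightarrow> ereal" where
  "hsup X = (SUP i\<in>{i. \<not> zero_module (homology X i)}. ereal (of_int i))"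

definition bounded_cpx :: "('a, 'b) cpx \<Rightarrow> bool" where
  "bounded_cpx X \<longleftrightarrow> csup X - cinf X < \<infinity>"

definition bounded_below_cpx :: "('a, 'b) cpx \<Rightarrow> bool" where
  "bounded_below_cpx X \<longleftrightarrow> cinf X > -\<infinity>"


section \<open>Quasi-projective dimension\<close>

definition quasi_projective_resolution ::
  "('a, 'r) ring_scheme \<Rightarrow> ('a, 'b, 'm) module_scheme \<Rightarrow> ('a, 'c) cpx \<Rightarrow> bool" where
  "quasi_projective_resolution R M P \<longleftrightarrow>
     is_complex R P \<and> bounded_below_cpx P \<and> (\<forall>i. projective_module R (obj P i)) \<and>
     (\<exists>a :: int \<Rightarrow> nat.
        (\<forall>i. ereal (of_int i) \<ge> cinf P \<longrightarrow> mod_iso R (homology P i) (power_module M (a i))) \<and>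
        (\<exists>i. ereal (of_int i) \<ge> cinf P \<and> a i \<noteq> 0))"

definition qpd :: "('a, 'r) ring_scheme \<Rightarrow> ('a, 'b, 'm) module_scheme \<Rightarrow> ereal" where
  "qpd R M = (if zero_module M then -\<infinity>
     else (INF P\<in>{P :: ('a, 'a univ_elem) cpx. quasi_projective_resolution R M P \<and> bounded_cpx P}.
             csup P - hsup P))"


section \<open>Tensor products\<close>

text \<open>The free module on \<open>S\<close>, as finitely supported functions vanishing off \<open>S\<close>.\<close>
definition free_module :: "('a, 'r) ring_scheme \<Rightarrow> 's set \<Rightarrow> ('a, 's \<Rightarrow> 'a) module" where
  "free_module R S =
     \<lparr>carrier = {\<phi>. range \<phi> \<subseteq> carrier R \<and> finite {s. \<phi> s \<noteq> \<zero>\<^bsub>R\<^esub>} \<and> {s. \<phi> s \<noteq> \<zero>\<^bsub>R\<^esub>} \<subseteq> S},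
      mult = undefined, one = undefined,
      zero = (\<lambda>s. \<zero>\<^bsub>R\<^esub>),
      add = (\<lambda>\<phi> \<psi> s. \<phi> s \<oplus>\<^bsub>R\<^esub> \<psi> s),
      smult = (\<lambda>r \<phi> s. r \<otimes>\<^bsub>R\<^esub> \<phi> s)\<rparr>"

definition free_basis :: "('a, 'r) ring_scheme \<Rightarrow> 's \<Rightarrow> 's \<Rightarrow> 'a" where
  "free_basis R s = (\<lambda>t. if t = s then \<one>\<^bsub>R\<^esub> else \<zero>\<^bsub>R\<^esub>)"

definition bilinear_relations ::
  "('a, 'r) ring_scheme \<Rightarrow> ('a, 'b, 'm) module_scheme \<Rightarrow> ('a, 'c, 'n) module_scheme \<Rightarrow> ('b \<times> 'c \<Rightarrow> 'a) set" where
  "bilinear_relations R M N =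
     (let F = free_module R (carrier M \<times> carrier N); e = free_basis R in
      mod_span R F
       ({e (x \<oplus>\<^bsub>M\<^esub> x', y) \<ominus>\<^bsub>F\<^esub> (e (x, y) \<oplus>\<^bsub>F\<^esub> e (x', y)) | x x' y.
           x \<in> carrier M \<and> x' \<in> carrier M \<and> y \<in> carrier N} \<union>
        {e (x, y \<oplus>\<^bsub>N\<^esub> y') \<ominus>\<^bsub>F\<^esub> (e (x, y) \<oplus>\<^bsub>F\<^esub> e (x, y')) | x y y'.
           x \<in> carrier M \<and> y \<in> carrier N \<and> y' \<in> carrier N} \<union>
        {e (r \<odot>\<^bsub>M\<^esub> x, y) \<ominus>\<^bsub>F\<^esub> (r \<odot>\<^bsub>F\<^esub> e (x, y)) | r x y.
           r \<in> carrier R \<and> x \<in> carrier M \<and> y \<in> carrier N} \<union>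
        {e (x, r \<odot>\<^bsub>N\<^esub> y) \<ominus>\<^bsub>F\<^esub> (r \<odot>\<^bsub>F\<^esub> e (x, y)) | r x y.
           r \<in> carrier R \<and> x \<in> carrier M \<and> y \<in> carrier N}))"

definition tensor ::
  "('a, 'r) ring_scheme \<Rightarrow> ('a, 'b, 'm) module_scheme \<Rightarrow> ('a, 'c, 'n) module_scheme
     \<Rightarrow> ('a, ('b \<times> 'c \<Rightarrow> 'a) set) module" where
  "tensor R M N =
     quot_module (free_module R (carrier M \<times> carrier N)) (bilinear_relations R M N)"

definition pure_tensor ::
  "('a, 'r) ring_scheme \<Rightarrow> ('a, 'b, 'm) module_scheme \<Rightarrow> ('a, 'c, 'n) module_scheme
     \<Rightarrow> 'b \<Rightarrow> 'c \<Rightarrow> ('b \<times> 'c \<Rightarrow> 'a) set" where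
  "pure_tensor R M N x y =
     bilinear_relations R M N +>\<^bsub>free_module R (carrier M \<times> carrier N)\<^esub> free_basis R (x, y)"

text \<open>The map \<open>f \<otimes> id\<close>: the universal property determines it on the carrier of
  \<open>tensor R M N\<close>.\<close>
definition tensor_map ::
  "('a, 'r) ring_scheme \<Rightarrow> ('a, 'b, 'm) module_scheme \<Rightarrow> ('a, 'd, 'k) module_scheme
     \<Rightarrow> ('a, 'c, 'n) module_scheme \<Rightarrow> ('b \<Rightarrow> 'd) \<Rightarrow> ('b \<times> 'c \<Rightarrow> 'a) set \<Rightarrow> ('d \<times> 'c \<Rightarrow> 'a) set" where
  "tensor_map R M M' N f = (SOME h. h \<in> mod_hom R (tensor R M N) (tensor R M' N) \<and>
     (\<forall>x\<in>carrier M. \<forall>y\<in>carrier N. h (pure_tensor R M N x y) = pure_tensor R M' N (f x) y))"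

definition tensor_cpx ::
  "('a, 'r) ring_scheme \<Rightarrow> ('a, 'b) cpx \<Rightarrow> ('a, 'c, 'n) module_scheme
     \<Rightarrow> ('a, ('b \<times> 'c \<Rightarrow> 'a) set) cpx" where
  "tensor_cpx R X N = \<lparr>obj = (\<lambda>i. tensor R (obj X i) N),
     bd = (\<lambda>i. tensor_map R (obj X i) (obj X (i - 1)) N (bd X i))\<rparr>"


section \<open>Tor\<close>

definition projective_resolution ::
  "('a, 'r) ring_scheme \<Rightarrow> ('a, 'b, 'm) module_scheme \<Rightarrow> ('a, 'c) cpx \<Rightarrow> bool" where
  "projective_resolution R M P \<longleftrightarrow>
     is_complex R P \<and> (\<forall>i. projective_module R (obj P i)) \<and>
     (\<forall>i<0. zero_module (obj P i)) \<and>
     (\<forall>i\<noteq>0. zero_module (homology P i)) \<and> mod_iso R (homology P 0) M"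

text \<open>A chosen resolution by finitely generated projectives; over a Noetherian ring one exists for
  every finitely generated module, and up to isomorphism Tor does not depend on the choice.\<close>
definition resolution ::
  "('a, 'r) ring_scheme \<Rightarrow> ('a, 'b, 'm) module_scheme \<Rightarrow> ('a, 'a univ_elem) cpx" where
  "resolution R M = (SOME P. projective_resolution R M P)"

definition Tor ::
  "('a, 'r) ring_scheme \<Rightarrow> nat \<Rightarrow> ('a, 'b, 'm) module_scheme \<Rightarrow> ('a, 'c, 'n) module_scheme
     \<Rightarrow> ('a, ('a univ_elem \<times> 'c \<Rightarrow> 'a) set set) module" where
  "Tor R i M N = homology (tensor_cpx R (resolution R M) N) (int i)"

text \<open>The value is \<open>0\<close> if all Tor vanish, which cannot happen for non-zero finitely
  generated modules over a local ring, where \<open>Tor\<^sub>0\<close> is non-zero.\<close>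
definition tor_sup ::
  "('a, 'r) ring_scheme \<Rightarrow> ('a, 'b, 'm) module_scheme \<Rightarrow> ('a, 'c, 'n) module_scheme \<Rightarrow> enat" where
  "tor_sup R M N = (SUP i\<in>{i. \<not> zero_module (Tor R i M N)}. enat i)"

end

theory Submission
  imports Defs
begin

text \<open>
  Write \<open>\<mm>\<close> for the maximal ideal, and for a bounded quasi-projective resolution \<open>P\<close> of \<open>M\<close> let \<open>s\<close> be its
  top degree and \<open>h\<close> the top degree of its homology.  If \<open>dP\<^sub>s\<close> is not contained in \<open>\<mm>P\<^sub>s\<^sub>-\<^sub>1\<close>, then a contractible
  complex \<open>R \<rightarrow> R\<close> in the degrees \<open>s\<close> and \<open>s - 1\<close> splits off (\<open>split_off_unit\<close>).  The quasi-projective dimension is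
  therefore attained as \<open>s - h\<close> by a \<open>P\<close> with \<open>dP\<^sub>s \<subseteq> \<mm>P\<^sub>s\<^sub>-\<^sub>1\<close> (\<open>minimal_top\<close>, \<open>qpd_attained\<close>).

  The homology of \<open>P\<close> consists of powers of \<open>M\<close>, and so the homology of \<open>P \<otimes> N\<close> is controlled by \<open>Tor(M, N)\<close>.
  If \<open>F\<close> resolves \<open>M\<close> and \<open>H\<^sub>h(P) \<cong> M\<^sup>a\<close>, the cone of a comparison map from \<open>F\<^sup>a\<close>, shifted to degree \<open>h\<close>, to \<open>P\<close>
  has the homology of \<open>P\<close> except that the top module is killed (\<open>kill_top_homology\<close>).  After finitely many
  cones the complex is exact, and bounded below exact complexes of projective modules stay exact after
  tensoring (\<open>exact_tensor\<close>).  Going back through the cones, one finds that \<open>H\<^sub>i(P \<otimes> N)\<close> vanishes for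
  \<open>i > u = h + q\<close> and that \<open>H\<^sub>u(P \<otimes> N) \<cong> Tor\<^sub>q(M, N)\<^sup>a\<close> with \<open>a > 0\<close> (\<open>tensor_vanishing\<close>, \<open>tensor_top_homology\<close>).

  It remains to show that \<open>depth N = depth H\<^sub>u(X) + s - u\<close> for \<open>X = P \<otimes> N\<close>, if the depth of \<open>H\<^sub>u(X)\<close> is at most one
  (\<open>depth_formula\<close>).  A maximal \<open>N\<close>-regular sequence \<open>xs\<close> of length \<open>t\<close> is regular on all \<open>X\<^sub>i\<close>.  If \<open>H\<^sub>u(X)\<close> has a socle
  element, then passing to \<open>X/xX\<close> for a regular \<open>x\<close> moves it to a socle element of the top homology one degree higher
  (\<open>socle_shift\<close>), so that the top homology of \<open>X/(xs)X\<close> is in degree \<open>u + t\<close>.  But \<open>d\<close> is zero on a socle element of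
  \<open>N/(xs)N\<close> tensored with an element of \<open>P\<^sub>s\<close> outside \<open>\<mm>P\<^sub>s\<close>, because \<open>dP\<^sub>s \<subseteq> \<mm>P\<^sub>s\<^sub>-\<^sub>1\<close> (\<open>top_socle_element\<close>).
  Hence this degree is \<open>s\<close>, and \<open>t = s - u\<close>.  If \<open>H\<^sub>u(X)\<close> has depth one, a first element that is regular on
  \<open>N\<close> and on \<open>H\<^sub>u(X)\<close> leaves the top degree where it is and produces a socle element there
  (\<open>socle_shift_depth_one\<close>), and \<open>t - 1 = s - u\<close>.

  The argument reads off depth from one maximal regular sequence that may be chosen freely.  That all maximal
  regular sequences have the same length is \<open>depth_is_cut\<close>; regular elements exist by prime avoidance
  (\<open>nzd_outside_finitely_many_primes\<close>, \<open>nzd_exists\<close>).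
\<close>

section \<open>Modules, homomorphisms and quotients\<close>

text \<open>The operations of a module that is named by a single letter, with a plain subscript.\<close>
abbreviation (input) zero_of ("\<zero>\<^sub>_" [1000] 1000) where "\<zero>\<^sub>M \<equiv> zero M"
abbreviation (input) add_of ("_ \<oplus>\<^sub>_ _" [65,1000,66] 65) where "x \<oplus>\<^sub>M y \<equiv> add M x y"
abbreviation (input) minus_of ("_ \<ominus>\<^sub>_ _" [65,1000,66] 65) where "x \<ominus>\<^sub>M y \<equiv> a_minus M x y"
abbreviation (input) uminus_of ("\<ominus>\<^sub>_ _" [1000,81] 80) where "\<ominus>\<^sub>M x \<equiv> a_inv M x"
abbreviation (input) smult_of ("_ \<odot>\<^sub>_ _" [70,1000,71] 70) where "r \<odot>\<^sub>M x \<equiv> smult M r x"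

abbreviation (input) "elems X i \<equiv> carrier (obj X i)"
abbreviation (input) "exact_at X i \<equiv> cycles X i \<subseteq> boundaries X i"


lemma (in abelian_group) neg_zero [simp]: "\<ominus> \<zero> = \<zero>"
  by (simp add: a_inv_def)

lemma module_cring: "module R A ==> cring R"
  by (simp add: module_def)

lemma module_abelian_group: "module R A ==> abelian_group A"
  by (simp add: module_def)

subsection \<open>Homomorphisms\<close>

lemma mod_homI:
  assumes "!!x. x \<in> carrier A ==> f x \<in> carrier B"
    and "!!x y. x \<in> carrier A ==> y \<in> carrier A ==> f (x \<oplus>\<^sub>A y) = f x \<oplus>\<^sub>B f y"
    and "!!r x. r \<in> carrier R ==> x \<in> carrier A ==> f (r \<odot>\<^sub>A x) = r \<odot>\<^sub>B f x"
  shows "f \<in> mod_hom R A B"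
  using assms by (auto simp: mod_hom_def)

lemma mod_hom_closed: "f \<in> mod_hom R A B ==> x \<in> carrier A ==> f x \<in> carrier B"
  by (auto simp: mod_hom_def)

lemma mod_hom_add:
  "f \<in> mod_hom R A B ==> x \<in> carrier A ==> y \<in> carrier A ==> f (x \<oplus>\<^sub>A y) = f x \<oplus>\<^sub>B f y"
  by (auto simp: mod_hom_def)

lemma mod_hom_smult:
  "f \<in> mod_hom R A B ==> r \<in> carrier R ==> x \<in> carrier A ==> f (r \<odot>\<^sub>A x) = r \<odot>\<^sub>B f x"
  by (auto simp: mod_hom_def)

lemma mod_hom_zero:
  assumes "module R A" "module R B" "f \<in> mod_hom R A B"
  shows "f \<zero>\<^sub>A = \<zero>\<^sub>B"
proof -
  interpret A: module R A by fact
  interpret B: module R B by fact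
  have "f (\<zero>\<^sub>R \<odot>\<^sub>A \<zero>\<^sub>A) = \<zero>\<^sub>R \<odot>\<^sub>B f \<zero>\<^sub>A"
    using assms(3) by (intro mod_hom_smult) auto
  then show ?thesis using mod_hom_closed[OF assms(3)] by simp
qed

lemma mod_hom_neg:
  assumes "module R A" "module R B" "f \<in> mod_hom R A B" "x \<in> carrier A"
  shows "f (\<ominus>\<^sub>A x) = \<ominus>\<^sub>B f x"
proof -
  interpret A: module R A by fact
  interpret B: module R B by fact
  have "f ((\<ominus>\<^sub>R \<one>\<^bsub>R\<^esub>) \<odot>\<^sub>A x) = (\<ominus>\<^sub>R \<one>\<^bsub>R\<^esub>) \<odot>\<^sub>B f x"
    using assms(3,4) by (intro mod_hom_smult) auto
  then show ?thesis
    using mod_hom_closed[OF assms(3)] assms(4) by (simp add: A.smult_l_minus B.smult_l_minus)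
qed

lemma mod_hom_diff:
  assumes "module R A" "module R B" "f \<in> mod_hom R A B" "x \<in> carrier A" "y \<in> carrier A"
  shows "f (x \<ominus>\<^sub>A y) = f x \<ominus>\<^sub>B f y"
proof -
  interpret A: module R A by fact
  interpret B: module R B by fact
  show ?thesis using assms by (simp add: A.minus_eq B.minus_eq mod_hom_add mod_hom_neg[OF assms(1-3)])
qed

lemma mod_hom_finsum:
  assumes "module R A" "module R B" "f \<in> mod_hom R A B" "finite I" "g \<in> I \<rightarrow> carrier A"
  shows "f (finsum A g I) = finsum B (\<lambda>i. f (g i)) I"
  using assms(4,5)
proof (induction I rule: finite_induct)
  case empty
  interpret A: module R A by fact
  interpret B: module R B by fact
  show ?case using mod_hom_zero[OF assms(1-3)] by simp
next
  case (insert i I)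
  interpret A: module R A by fact
  interpret B: module R B by fact
  have c: "g i \<in> carrier A" "g \<in> I \<rightarrow> carrier A" using insert.prems by auto
  have fc: "(\<lambda>i. f (g i)) \<in> I \<rightarrow> carrier B" using c mod_hom_closed[OF assms(3)] by auto
  show ?case
    using insert c fc mod_hom_closed[OF assms(3)] by (simp add: mod_hom_add[OF assms(3)])
qed

lemma mod_hom_comp:
  "f \<in> mod_hom R A B ==> g \<in> mod_hom R B C ==> (\<lambda>x. g (f x)) \<in> mod_hom R A C"
  by (auto simp: mod_hom_def Pi_def)

lemma mod_hom_id: "(\<lambda>x. x) \<in> mod_hom R A A"
  by (auto simp: mod_hom_def)

lemma mod_hom_zerof:
  assumes "module R B"
  shows "(\<lambda>x. \<zero>\<^sub>B) \<in> mod_hom R A B"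
proof -
  interpret B: module R B by fact
  show ?thesis by (auto simp: mod_hom_def)
qed

lemma mod_hom_addf:
  assumes "module R B" "f \<in> mod_hom R A B" "g \<in> mod_hom R A B"
  shows "(\<lambda>x. f x \<oplus>\<^sub>B g x) \<in> mod_hom R A B"
proof -
  interpret B: module R B by fact
  show ?thesis
    by (rule mod_homI)
      (use assms in \<open>auto simp: mod_hom_closed mod_hom_add mod_hom_smult B.smult_r_distr B.a_ac\<close>)
qed

lemma mod_hom_negf:
  assumes "module R B" "f \<in> mod_hom R A B"
  shows "(\<lambda>x. \<ominus>\<^sub>B f x) \<in> mod_hom R A B"
proof -
  interpret B: module R B by fact
  show ?thesis
    by (rule mod_homI)
      (use assms in \<open>auto simp: mod_hom_closed mod_hom_add mod_hom_smult B.smult_r_minus B.minus_add\<close>)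
qed

lemma mod_hom_difff:
  assumes "module R B" "f \<in> mod_hom R A B" "g \<in> mod_hom R A B"
  shows "(\<lambda>x. f x \<ominus>\<^sub>B g x) \<in> mod_hom R A B"
proof -
  interpret B: module R B by fact
  have "(\<lambda>x. f x \<oplus>\<^sub>B (\<ominus>\<^sub>B g x)) \<in> mod_hom R A B"
    using assms by (intro mod_hom_addf mod_hom_negf)
  then show ?thesis by (simp add: B.minus_eq)
qed

lemma mod_hom_finsumf:
  assumes "module R B" "finite I" "!!i. i \<in> I ==> f i \<in> mod_hom R A B"
  shows "(\<lambda>x. finsum B (\<lambda>i. f i x) I) \<in> mod_hom R A B"
  using assms(2,3)
proof (induction I rule: finite_induct)
  case empty
  interpret B: module R B by fact
  show ?case using mod_hom_zerof[OF assms(1)] by simp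
next
  case (insert i I)
  interpret B: module R B by fact
  have *: "(\<lambda>x. f i x \<oplus>\<^sub>B finsum B (\<lambda>i. f i x) I) \<in> mod_hom R A B"
    using insert by (intro mod_hom_addf assms(1)) auto
  have c: "f j x \<in> carrier B" if "x \<in> carrier A" "j \<in> insert i I" for j x
    using insert.prems that by (auto intro: mod_hom_closed)
  have eq: "finsum B (\<lambda>i. f i x) (insert i I) = f i x \<oplus>\<^sub>B finsum B (\<lambda>i. f i x) I"
    if "x \<in> carrier A" for x
    using insert.hyps c[OF that] by (intro B.finsum_insert) auto
  show ?case
  proof (rule mod_homI)
    fix x assume "x \<in> carrier A"
    then show "finsum B (\<lambda>i. f i x) (insert i I) \<in> carrier B"
      using c by (intro B.finsum_closed) auto
  next
    fix x y assume xy: "x \<in> carrier A" "y \<in> carrier A"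
    have "finsum B (\<lambda>i. f i (x \<oplus>\<^sub>A y)) (insert i I) = finsum B (\<lambda>i. f i x \<oplus>\<^sub>B f i y) (insert i I)"
      using xy c insert.prems by (intro B.finsum_cong') (auto intro: mod_hom_add)
    also have "\<dots> = finsum B (\<lambda>i. f i x) (insert i I) \<oplus>\<^sub>B finsum B (\<lambda>i. f i y) (insert i I)"
      using c xy by (intro B.finsum_addf) auto
    finally show "finsum B (\<lambda>i. f i (x \<oplus>\<^sub>A y)) (insert i I) =
      finsum B (\<lambda>i. f i x) (insert i I) \<oplus>\<^sub>B finsum B (\<lambda>i. f i y) (insert i I)" .
  next
    fix r x assume rx: "r \<in> carrier R" "x \<in> carrier A"
    have "finsum B (\<lambda>i. f i (r \<odot>\<^sub>A x)) (insert i I) = finsum B (\<lambda>i. r \<odot>\<^sub>B f i x) (insert i I)"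
      using rx c insert.prems by (intro B.finsum_cong') (auto intro: mod_hom_smult)
    also have "\<dots> = r \<odot>\<^sub>B finsum B (\<lambda>i. f i x) (insert i I)"
      using c rx insert.hyps by (intro B.finsum_smult_ldistr[symmetric]) auto
    finally show "finsum B (\<lambda>i. f i (r \<odot>\<^sub>A x)) (insert i I) = r \<odot>\<^sub>B finsum B (\<lambda>i. f i x) (insert i I)" .
  qed
qed

subsection \<open>Submodules\<close>

lemma (in module) submodule_closed:
  assumes "submodule H R M"
  shows "\<zero>\<^sub>M \<in> H" "x \<in> H ==> y \<in> H ==> x \<oplus>\<^sub>M y \<in> H" "x \<in> H ==> \<ominus>\<^sub>M x \<in> H"
    "x \<in> H ==> y \<in> H ==> x \<ominus>\<^sub>M y \<in> H" "r \<in> carrier R ==> x \<in> H ==> r \<odot>\<^sub>M x \<in> H"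
    "x \<in> H ==> x \<in> carrier M"
proof -
  note E = submoduleE[OF assms]
  show z: "\<zero>\<^sub>M \<in> H" using submodule.axioms(1)[OF assms] subgroup.one_closed by force
  show "x \<in> H ==> y \<in> H ==> x \<ominus>\<^sub>M y \<in> H" using E by (simp add: minus_eq)
qed (use submoduleE[OF assms] in auto)

lemma (in module) submodule_add_iff:
  assumes "submodule H R M" "x \<in> carrier M" "y \<in> H"
  shows "x \<oplus>\<^sub>M y \<in> H \<longleftrightarrow> x \<in> H" "y \<oplus>\<^sub>M x \<in> H \<longleftrightarrow> x \<in> H"
    "x \<ominus>\<^sub>M y \<in> H \<longleftrightarrow> x \<in> H" "y \<ominus>\<^sub>M x \<in> H \<longleftrightarrow> x \<in> H"
proof -
  note c = submodule_closed[OF assms(1)]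
  have yc: "y \<in> carrier M" using c(6)[OF assms(3)] .
  have "x \<in> H" if "x \<oplus>\<^sub>M y \<in> H"
    using c(4)[OF that assms(3)] assms(2) yc by (simp add: minus_eq a_assoc r_neg)
  moreover have "x \<in> H" if "x \<ominus>\<^sub>M y \<in> H"
    using c(2)[OF that assms(3)] assms(2) yc by (simp add: minus_eq a_assoc l_neg)
  moreover have "x \<in> H" if "y \<ominus>\<^sub>M x \<in> H"
    using c(4)[OF assms(3) that] assms(2) yc by (simp add: minus_eq minus_add r_neg2)
  ultimately show "x \<oplus>\<^sub>M y \<in> H \<longleftrightarrow> x \<in> H" "y \<oplus>\<^sub>M x \<in> H \<longleftrightarrow> x \<in> H"
    "x \<ominus>\<^sub>M y \<in> H \<longleftrightarrow> x \<in> H" "y \<ominus>\<^sub>M x \<in> H \<longleftrightarrow> x \<in> H"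
    unfolding a_comm[OF yc assms(2)]
    using c(2)[OF _ assms(3)] c(4)[OF _ assms(3)] c(4)[OF assms(3)] by blast+
qed

lemma (in module) submodule_finsum:
  assumes "submodule H R M" "f \<in> I \<rightarrow> H"
  shows "finsum M f I \<in> H"
proof (cases "finite I")
  case False then show ?thesis using submodule_closed(1)[OF assms(1)] by simp
next
  case True
  then show ?thesis using assms(2)
  proof (induction I rule: finite_induct)
    case empty then show ?case using submodule_closed(1)[OF assms(1)] by simp
  next
    case (insert i I)
    have "f i \<in> H" "f \<in> I \<rightarrow> carrier M" "f i \<in> carrier M"
      using insert.prems submodule_closed(6)[OF assms(1)] by auto
    then show ?case using insert submodule_closed(2)[OF assms(1)] by (simp add: Pi_def)
  qed
qed

lemma (in module) zero_submodule: "submodule {\<zero>\<^sub>M} R M"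
  by (rule submoduleI) auto

lemma (in module) submodule_Int:
  "submodule H R M ==> submodule K R M ==> submodule (H \<inter> K) R M"
  by (rule submoduleI) (auto dest: submodule_closed)

lemma (in module) submodule_Inter:
  "[|!!H. H \<in> HH ==> submodule H R M; HH \<noteq> {}|] ==> submodule (\<Inter>HH) R M"
  by (rule submoduleI) (auto dest: submodule_closed)

lemma (in module) mod_span_submodule: "S \<subseteq> carrier M ==> submodule (mod_span R M S) R M"
  unfolding mod_span_def using carrier_is_submodule by (intro submodule_Inter) auto

lemma mod_span_base: "S \<subseteq> mod_span R M S"
  by (auto simp: mod_span_def)

lemma mod_span_least: "submodule H R M ==> S \<subseteq> H ==> mod_span R M S \<subseteq> H"
  by (auto simp: mod_span_def)

lemma preimage_submodule:
  assumes "module R A" "module R B" "f \<in> mod_hom R A B" "submodule K R B"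
  shows "submodule {x \<in> carrier A. f x \<in> K} R A"
proof -
  interpret A: module R A by fact
  interpret B: module R B by fact
  show ?thesis
    using assms B.submodule_closed[OF assms(4)]
    by (intro A.submoduleI) (auto simp: mod_hom_zero mod_hom_neg mod_hom_add mod_hom_smult)
qed

lemma kernel_submodule:
  assumes "module R A" "module R B" "f \<in> mod_hom R A B"
  shows "submodule {x \<in> carrier A. f x = \<zero>\<^sub>B} R A"
  using preimage_submodule[OF assms module.zero_submodule[OF assms(2)]] by simp

lemma image_submodule:
  assumes "module R A" "module R B" "f \<in> mod_hom R A B" "submodule K R A"
  shows "submodule (f ` K) R B"
proof -
  interpret A: module R A by fact
  interpret B: module R B by fact
  note c = A.submodule_closed[OF assms(4)]
  show ?thesis
  proof (rule B.submoduleI)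
    show "f ` K \<subseteq> carrier B" using c(6) mod_hom_closed[OF assms(3)] by blast
    show "\<zero>\<^sub>B \<in> f ` K" using c(1) mod_hom_zero[OF assms(1-3)] by force
    show "\<ominus>\<^sub>B a \<in> f ` K" if a: "a \<in> f ` K" for a
      using c(3,6) mod_hom_neg[OF assms(1-3)] that by (force simp: image_iff)
    show "a \<oplus>\<^sub>B b \<in> f ` K" if ab: "a \<in> f ` K" "b \<in> f ` K" for a b
    proof -
      obtain x y where "a = f x" "b = f y" "x \<in> K" "y \<in> K" using ab by auto
      then show ?thesis using mod_hom_add[OF assms(3)] c by (intro image_eqI[of _ _ "x \<oplus>\<^sub>A y"]) auto
    qed
    show "r \<odot>\<^sub>B b \<in> f ` K" if r: "r \<in> carrier R" and b: "b \<in> f ` K" for r b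
    proof -
      obtain y where "b = f y" "y \<in> K" using b by auto
      then show ?thesis using mod_hom_smult[OF assms(3)] r c by (intro image_eqI[of _ _ "r \<odot>\<^sub>A y"]) auto
    qed
  qed
qed

lemma submodule_module: "module R M ==> submodule H R M ==> module R (M\<lparr>carrier := H\<rparr>)"
  by (rule submodule.submodule_is_module)

lemma submodule_of_sub:
  assumes "module R M" "submodule H R M" "submodule K R M" "K \<subseteq> H"
  shows "submodule K R (M\<lparr>carrier := H\<rparr>)"
proof -
  interpret H: module R "M\<lparr>carrier := H\<rparr>" using assms(1,2) by (rule submodule_module)
  show ?thesis
  proof (rule H.module_incl_imp_submodule)
    show "module R (M\<lparr>carrier := H, carrier := K\<rparr>)"
      using submodule_module[OF assms(1,3)] by simp
  qed (use assms in auto)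
qed

lemma submodule_in_sub:
  assumes "module R M" "submodule H R M" "submodule K R (M\<lparr>carrier := H\<rparr>)"
  shows "submodule K R M"
proof -
  interpret M: module R M by fact
  interpret H: module R "M\<lparr>carrier := H\<rparr>" using assms(1,2) by (rule submodule_module)
  have "K \<subseteq> H" using H.submoduleE(1)[OF assms(3)] by simp
  moreover have "module R (M\<lparr>carrier := K\<rparr>)"
    using submodule_module[OF H.module_axioms assms(3)] by simp
  ultimately show ?thesis
    using M.submoduleE(1)[OF assms(2)] by (intro M.module_incl_imp_submodule) auto
qed

lemma mod_hom_sub_domain:
  "f \<in> mod_hom R A B ==> H \<subseteq> carrier A ==> f \<in> mod_hom R (A\<lparr>carrier := H\<rparr>) B"
  unfolding mod_hom_def by (auto simp: Pi_def subset_iff)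

lemma mod_hom_sub_codomain:
  "f \<in> mod_hom R A B ==> f ` carrier A \<subseteq> H ==> f \<in> mod_hom R A (B\<lparr>carrier := H\<rparr>)"
  by (auto simp: mod_hom_def)

lemma mod_hom_sub_codomainD:
  "f \<in> mod_hom R A (B\<lparr>carrier := H\<rparr>) ==> H \<subseteq> carrier B ==> f \<in> mod_hom R A B"
  by (auto simp: mod_hom_def)

definition plus_mult :: "('a, 'b, 'm) module_scheme \<Rightarrow> 'b set \<Rightarrow> 'a \<Rightarrow> 'b set" where
  "plus_mult M K x = {k \<oplus>\<^sub>M x \<odot>\<^sub>M v | k v. k \<in> K \<and> v \<in> carrier M}"

lemma plus_multI: "k \<in> K ==> v \<in> carrier M ==> k \<oplus>\<^sub>M x \<odot>\<^sub>M v \<in> plus_mult M K x"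
  by (auto simp: plus_mult_def)

lemma (in module) smult_hom: "x \<in> carrier R ==> (\<lambda>v. x \<odot>\<^sub>M v) \<in> mod_hom R M M"
  by (rule mod_homI) (auto simp: smult_r_distr smult_assoc1[symmetric] R.m_comm)

lemma (in module) plus_mult_submodule:
  assumes K: "submodule K R M" and x: "x \<in> carrier R"
  shows "submodule (plus_mult M K x) R M"
proof -
  note c = submodule_closed[OF K]
  show ?thesis
  proof (rule submoduleI)
    show "plus_mult M K x \<subseteq> carrier M" using c x by (auto simp: plus_mult_def)
    show "\<zero>\<^sub>M \<in> plus_mult M K x"
      unfolding plus_mult_def using c x by (intro CollectI exI[of _ "\<zero>\<^sub>M"]) auto
  next
    fix a assume "a \<in> plus_mult M K x"
    then obtain k v where kv: "k \<in> K" "v \<in> carrier M" "a = k \<oplus>\<^sub>M x \<odot>\<^sub>M v" by (auto simp: plus_mult_def)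
    then have "\<ominus>\<^sub>M a = (\<ominus>\<^sub>M k) \<oplus>\<^sub>M x \<odot>\<^sub>M (\<ominus>\<^sub>M v)"
      using c x by (simp add: minus_add smult_r_minus)
    then show "\<ominus>\<^sub>M a \<in> plus_mult M K x" using plus_multI[of "\<ominus>\<^sub>M k" K "\<ominus>\<^sub>M v" M x] kv c(3) by simp
  next
    fix a b assume "a \<in> plus_mult M K x" "b \<in> plus_mult M K x"
    then obtain k v l w where kv: "k \<in> K" "v \<in> carrier M" "a = k \<oplus>\<^sub>M x \<odot>\<^sub>M v"
      "l \<in> K" "w \<in> carrier M" "b = l \<oplus>\<^sub>M x \<odot>\<^sub>M w" by (auto simp: plus_mult_def)
    then have "a \<oplus>\<^sub>M b = (k \<oplus>\<^sub>M l) \<oplus>\<^sub>M x \<odot>\<^sub>M (v \<oplus>\<^sub>M w)"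
      using c(6) x by (simp add: a_ac smult_r_distr)
    then show "a \<oplus>\<^sub>M b \<in> plus_mult M K x" using plus_multI[of "k \<oplus>\<^sub>M l" K "v \<oplus>\<^sub>M w" M x] kv c(2) by simp
  next
    fix r b assume r: "r \<in> carrier R" and "b \<in> plus_mult M K x"
    then obtain k v where kv: "k \<in> K" "v \<in> carrier M" "b = k \<oplus>\<^sub>M x \<odot>\<^sub>M v" by (auto simp: plus_mult_def)
    have "r \<odot>\<^sub>M b = (r \<odot>\<^sub>M k) \<oplus>\<^sub>M x \<odot>\<^sub>M (r \<odot>\<^sub>M v)"
      using kv c(6) x r by (simp add: smult_r_distr smult_assoc1[symmetric] R.m_comm)
    then show "r \<odot>\<^sub>M b \<in> plus_mult M K x" using plus_multI[of "r \<odot>\<^sub>M k" K "r \<odot>\<^sub>M v" M x] kv c(5) r by simp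
  qed
qed

lemma plus_multE:
  assumes "w \<in> plus_mult M K x"
  obtains k v where "k \<in> K" "v \<in> carrier M" "w = k \<oplus>\<^sub>M x \<odot>\<^sub>M v"
  using assms by (auto simp: plus_mult_def)

lemma (in module) plus_mult_incl:
  assumes K: "submodule K R M" and x: "x \<in> carrier R"
  shows "K \<subseteq> plus_mult M K x" "v \<in> carrier M ==> x \<odot>\<^sub>M v \<in> plus_mult M K x"
proof -
  note c = submodule_closed[OF K]
  show "K \<subseteq> plus_mult M K x"
  proof
    fix k assume "k \<in> K"
    then show "k \<in> plus_mult M K x"
      using c x plus_multI[of k K "\<zero>\<^sub>M" M x] by simp
  qed
  show "x \<odot>\<^sub>M v \<in> plus_mult M K x" if "v \<in> carrier M"
    using c x that plus_multI[of "\<zero>\<^sub>M" K v M x] by simp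
qed

lemma (in module) plus_mult_least:
  assumes "submodule H R M" "K \<subseteq> H" "!!v. v \<in> carrier M ==> x \<odot>\<^sub>M v \<in> H"
  shows "plus_mult M K x \<subseteq> H"
  using assms submodule_closed[OF assms(1)] by (auto simp: plus_mult_def)

lemma (in module) plus_mult_commute:
  assumes K: "submodule K R M" and x: "x \<in> carrier R" and y: "y \<in> carrier R"
  shows "plus_mult M (plus_mult M K x) y = plus_mult M (plus_mult M K y) x"
proof -
  have "plus_mult M (plus_mult M K x) y \<subseteq> plus_mult M (plus_mult M K y) x"
    if x: "x \<in> carrier R" and y: "y \<in> carrier R" for x y
  proof (intro plus_mult_least plus_mult_submodule K x y)
    note s = plus_mult_submodule[OF K y]
    show "K \<subseteq> plus_mult M (plus_mult M K y) x"
      using plus_mult_incl(1)[OF K y] plus_mult_incl(1)[OF s x] by blast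
    show "!!v. v \<in> carrier M ==> x \<odot>\<^sub>M v \<in> plus_mult M (plus_mult M K y) x"
      using plus_mult_incl(2)[OF s x] .
    show "!!v. v \<in> carrier M ==> y \<odot>\<^sub>M v \<in> plus_mult M (plus_mult M K y) x"
      using plus_mult_incl(2)[OF K y] plus_mult_incl(1)[OF s x] by blast
  qed
  then show ?thesis using x y by blast
qed

subsection \<open>Quotients\<close>

lemma (in module) submodule_abelian_subgroup:
  "submodule H R M ==> abelian_subgroup H M"
  using a_comm_group by (intro abelian_subgroupI3 additive_subgroupI) (auto simp: submodule_def comm_group_def abelian_group_axioms)

lemma (in module) coset_eq_iff:
  assumes "submodule H R M" "x \<in> carrier M" "y \<in> carrier M"
  shows "H +>\<^bsub>M\<^esub> x = H +>\<^bsub>M\<^esub> y \<longleftrightarrow> x \<ominus>\<^sub>M y \<in> H"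
proof -
  interpret H: abelian_subgroup H M using assms(1) by (rule submodule_abelian_subgroup)
  show ?thesis
    using assms H.a_repr_independence'[of x y] H.a_rcos_module[of y x] H.a_rcos_self[of x]
    unfolding minus_eq by metis
qed

lemma (in module) quot_simps:
  assumes H: "submodule H R M"
  shows "carrier (quot_module M H) = (\<lambda>x. H +>\<^bsub>M\<^esub> x) ` carrier M"
    and "x \<in> carrier M ==> y \<in> carrier M ==>
      (H +>\<^bsub>M\<^esub> x) \<oplus>\<^bsub>quot_module M H\<^esub> (H +>\<^bsub>M\<^esub> y) = H +>\<^bsub>M\<^esub> (x \<oplus>\<^sub>M y)"
    and "r \<in> carrier R ==> x \<in> carrier M ==>
      r \<odot>\<^bsub>quot_module M H\<^esub> (H +>\<^bsub>M\<^esub> x) = H +>\<^bsub>M\<^esub> (r \<odot>\<^sub>M x)"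
    and "\<zero>\<^bsub>quot_module M H\<^esub> = H +>\<^bsub>M\<^esub> \<zero>\<^sub>M"
proof -
  interpret H: abelian_subgroup H M using H by (rule submodule_abelian_subgroup)
  show "carrier (quot_module M H) = (\<lambda>x. H +>\<^bsub>M\<^esub> x) ` carrier M"
    by (auto simp: quot_module_def A_RCOSETS_def')
  show "x \<in> carrier M ==> y \<in> carrier M ==>
      (H +>\<^bsub>M\<^esub> x) \<oplus>\<^bsub>quot_module M H\<^esub> (H +>\<^bsub>M\<^esub> y) = H +>\<^bsub>M\<^esub> (x \<oplus>\<^sub>M y)"
    by (simp add: quot_module_def H.a_rcos_sum)
  show "\<zero>\<^bsub>quot_module M H\<^esub> = H +>\<^bsub>M\<^esub> \<zero>\<^sub>M"
    using submodule_closed[OF H] by (simp add: quot_module_def H.a_rcos_const)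
  assume r: "r \<in> carrier R" and x: "x \<in> carrier M"
  have "H +>\<^bsub>M\<^esub> (r \<odot>\<^sub>M y) = H +>\<^bsub>M\<^esub> (r \<odot>\<^sub>M x)" if y: "y \<in> H +>\<^bsub>M\<^esub> x" for y
  proof -
    have yc: "y \<in> carrier M" using y x by (rule H.a_elemrcos_carrier[rotated])
    have "y \<oplus>\<^sub>M \<ominus>\<^sub>M x \<in> H" using H.a_rcos_module_imp[OF x y] .
    then have "r \<odot>\<^sub>M (y \<ominus>\<^sub>M x) \<in> H" using submodule_closed(5)[OF H r] by (simp add: minus_eq)
    then have "(r \<odot>\<^sub>M y) \<ominus>\<^sub>M (r \<odot>\<^sub>M x) \<in> H"
      using r x yc by (simp add: minus_eq smult_r_distr smult_r_minus)
    then show ?thesis using coset_eq_iff[OF H] r x yc by simp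
  qed
  moreover have "x \<in> H +>\<^bsub>M\<^esub> x" using x by (rule H.a_rcos_self)
  ultimately have "(\<Union>y\<in>H +>\<^bsub>M\<^esub> x. H +>\<^bsub>M\<^esub> (r \<odot>\<^sub>M y)) = H +>\<^bsub>M\<^esub> (r \<odot>\<^sub>M x)"
    by blast
  then show "r \<odot>\<^bsub>quot_module M H\<^esub> (H +>\<^bsub>M\<^esub> x) = H +>\<^bsub>M\<^esub> (r \<odot>\<^sub>M x)"
    by (simp add: quot_module_def)
qed

lemma (in module) quot_module_module:
  assumes H: "submodule H R M"
  shows "module R (quot_module M H)"
proof -
  note q = quot_simps[OF H]
  have rep: "\<exists>m\<in>carrier M. x = H +>\<^bsub>M\<^esub> m" if "x \<in> carrier (quot_module M H)" for x
    using that unfolding q(1) by blast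
  have mem: "H +>\<^bsub>M\<^esub> m \<in> carrier (quot_module M H)" if "m \<in> carrier M" for m
    using that unfolding q(1) by blast
  have "abelian_group (quot_module M H)"
  proof (rule abelian_groupI)
    fix x assume "x \<in> carrier (quot_module M H)"
    then obtain m where m: "m \<in> carrier M" "x = H +>\<^bsub>M\<^esub> m" using rep by blast
    then show "\<exists>y\<in>carrier (quot_module M H). y \<oplus>\<^bsub>quot_module M H\<^esub> x = \<zero>\<^bsub>quot_module M H\<^esub>"
      unfolding q(4) using mem
      by (intro bexI[of _ "H +>\<^bsub>M\<^esub> (\<ominus>\<^sub>M m)"]) (simp_all add: q(2) l_neg del: a_coset_add_zero)
    show "\<zero>\<^bsub>quot_module M H\<^esub> \<oplus>\<^bsub>quot_module M H\<^esub> x = x"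
      unfolding q(4) m(2) using m(1) by (simp add: q(2) del: a_coset_add_zero)
  next
    show "\<zero>\<^bsub>quot_module M H\<^esub> \<in> carrier (quot_module M H)" unfolding q(4) using mem by blast
  next
    fix x y assume "x \<in> carrier (quot_module M H)" "y \<in> carrier (quot_module M H)"
    then show "x \<oplus>\<^bsub>quot_module M H\<^esub> y \<in> carrier (quot_module M H)"
      "x \<oplus>\<^bsub>quot_module M H\<^esub> y = y \<oplus>\<^bsub>quot_module M H\<^esub> x"
      using mem by (auto dest!: rep simp: q(2) a_comm)
  next
    fix x y z assume "x \<in> carrier (quot_module M H)" "y \<in> carrier (quot_module M H)"
      "z \<in> carrier (quot_module M H)"
    then show "x \<oplus>\<^bsub>quot_module M H\<^esub> y \<oplus>\<^bsub>quot_module M H\<^esub> z = x \<oplus>\<^bsub>quot_module M H\<^esub> (y \<oplus>\<^bsub>quot_module M H\<^esub> z)"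
      by (auto dest!: rep simp: q(2) a_assoc)
  qed
  then show ?thesis
    by (intro moduleI R.is_cring)
      (auto dest!: rep simp: mem q(2,3) smult_l_distr smult_r_distr smult_assoc1 simp del: a_coset_add_zero)
qed

lemma (in module) quot_proj:
  assumes H: "submodule H R M"
  shows "(\<lambda>x. H +>\<^bsub>M\<^esub> x) \<in> mod_hom R M (quot_module M H)"
    and "(\<lambda>x. H +>\<^bsub>M\<^esub> x) ` carrier M = carrier (quot_module M H)"
    and "x \<in> carrier M ==> H +>\<^bsub>M\<^esub> x = \<zero>\<^bsub>quot_module M H\<^esub> \<longleftrightarrow> x \<in> H"
proof -
  show "(\<lambda>x. H +>\<^bsub>M\<^esub> x) \<in> mod_hom R M (quot_module M H)"
    by (rule mod_homI) (auto simp: quot_simps(1-3)[OF H])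
  show "x \<in> carrier M ==> H +>\<^bsub>M\<^esub> x = \<zero>\<^bsub>quot_module M H\<^esub> \<longleftrightarrow> x \<in> H"
    using coset_eq_iff[OF H, of x "\<zero>\<^sub>M"] by (simp add: quot_simps(4)[OF H] minus_eq del: a_coset_add_zero)
qed (simp add: quot_simps(1)[OF H])

lemma (in module) zero_quot_iff:
  assumes H: "submodule H R M"
  shows "zero_module (quot_module M H) \<longleftrightarrow> carrier M \<subseteq> H"
proof -
  have "carrier (quot_module M H) = {\<zero>\<^bsub>quot_module M H\<^esub>} \<longleftrightarrow>
      (\<forall>x\<in>carrier M. H +>\<^bsub>M\<^esub> x = \<zero>\<^bsub>quot_module M H\<^esub>)"
    unfolding quot_proj(2)[OF H, symmetric] using zero_closed by blast
  also have "\<dots> \<longleftrightarrow> carrier M \<subseteq> H" using quot_proj(3)[OF H] by auto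
  finally show ?thesis unfolding zero_module_def .
qed

text \<open>All the maps out of quotients and tensor products come from this lemma, and so do the
  isomorphism theorems.\<close>
lemma hom_factor:
  assumes A: "module R A" and B: "module R B" and C: "module R C"
    and f: "f \<in> mod_hom R A B" "f ` carrier A = carrier B"
    and g: "g \<in> mod_hom R A C" "!!x. x \<in> carrier A ==> f x = \<zero>\<^sub>B ==> g x = \<zero>\<^sub>C"
  obtains h where "h \<in> mod_hom R B C" "!!x. x \<in> carrier A ==> h (f x) = g x"
proof -
  interpret A: module R A by fact
  interpret B: module R B by fact
  interpret C: module R C by fact
  have gg: "g x = g y" if xy: "x \<in> carrier A" "y \<in> carrier A" "f x = f y" for x y
  proof -
    have "f (x \<ominus>\<^sub>A y) = \<zero>\<^sub>B"
      using xy mod_hom_closed[OF f(1)] by (simp add: mod_hom_diff[OF A B f(1)] B.minus_eq B.r_neg)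
    then have "g x \<ominus>\<^sub>C g y = \<zero>\<^sub>C" using g(2)[of "x \<ominus>\<^sub>A y"] xy by (simp add: mod_hom_diff[OF A C g(1)])
    then show ?thesis using xy mod_hom_closed[OF g(1)] C.minus_equality C.minus_eq
      by (metis C.a_inv_closed C.minus_minus)
  qed
  define h where "h y = g (inv_into (carrier A) f y)" for y
  have hf: "h (f x) = g x" if "x \<in> carrier A" for x
    unfolding h_def using that by (intro gg) (auto simp: inv_into_into f_inv_into_f)
  have "h \<in> mod_hom R B C"
  proof (rule mod_homI)
    fix x assume "x \<in> carrier B"
    then obtain a where "a \<in> carrier A" "x = f a" using f(2) by auto
    then show "h x \<in> carrier C" using hf mod_hom_closed[OF g(1)] by simp
  next
    fix x y assume "x \<in> carrier B" "y \<in> carrier B"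
    then obtain a b where ab: "a \<in> carrier A" "x = f a" "b \<in> carrier A" "y = f b" using f(2) by blast
    then have "h (f (a \<oplus>\<^sub>A b)) = h (f a) \<oplus>\<^sub>C h (f b)" by (simp add: hf mod_hom_add[OF g(1)])
    then show "h (x \<oplus>\<^sub>B y) = h x \<oplus>\<^sub>C h y" using ab by (simp add: mod_hom_add[OF f(1)])
  next
    fix r x assume r: "r \<in> carrier R" and "x \<in> carrier B"
    then obtain a where ab: "a \<in> carrier A" "x = f a" using f(2) by blast
    then have "h (f (r \<odot>\<^sub>A a)) = r \<odot>\<^sub>C h (f a)" using r by (simp add: hf mod_hom_smult[OF g(1)])
    then show "h (r \<odot>\<^sub>B x) = r \<odot>\<^sub>C h x" using ab r by (simp add: mod_hom_smult[OF f(1)])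
  qed
  then show ?thesis using hf that by blast
qed

lemma hom_inj_onI:
  assumes A: "module R A" and B: "module R B" and f: "f \<in> mod_hom R A B"
    and ker: "!!x. x \<in> carrier A ==> f x = \<zero>\<^sub>B ==> x = \<zero>\<^sub>A"
  shows "inj_on f (carrier A)"
proof (rule inj_onI)
  interpret A: module R A by fact
  interpret B: module R B by fact
  fix x y assume xy: "x \<in> carrier A" "y \<in> carrier A" "f x = f y"
  have "f (x \<ominus>\<^sub>A y) = \<zero>\<^sub>B"
    using xy mod_hom_closed[OF f(1)] by (simp add: mod_hom_diff[OF A B f(1)] B.minus_eq B.r_neg)
  then have "x \<ominus>\<^sub>A y = \<zero>\<^sub>A" using ker xy by simp
  then show "x = y" using xy by (metis A.a_inv_closed A.minus_eq A.minus_equality A.minus_minus)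
qed

lemma mod_iso_refl: "mod_iso R A A"
  unfolding mod_iso_def using mod_hom_id by (intro bexI[of _ "\<lambda>x. x"]) (auto simp: bij_betw_def)

lemma mod_iso_inverse:
  assumes A: "module R A" and B: "module R B" and f: "f \<in> mod_hom R A B" "bij_betw f (carrier A) (carrier B)"
  shows "the_inv_into (carrier A) f \<in> mod_hom R B A"
proof -
  interpret A: module R A by fact
  interpret B: module R B by fact
  have inj: "inj_on f (carrier A)" and im: "f ` carrier A = carrier B" using f by (auto simp: bij_betw_def)
  have k: "the_inv_into (carrier A) f (f x) = x" if "x \<in> carrier A" for x
    using inj that by (rule the_inv_into_f_f)
  obtain h where h: "h \<in> mod_hom R B A" "!!x. x \<in> carrier A ==> h (f x) = x"
  proof (rule hom_factor[OF A B A f(1) im mod_hom_id])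
    show "!!x. x \<in> carrier A ==> f x = \<zero>\<^sub>B ==> x = \<zero>\<^sub>A"
      using inj mod_hom_zero[OF A B f(1)] by (metis A.zero_closed inj_onD)
  qed blast
  have eq: "the_inv_into (carrier A) f y = h y" if y: "y \<in> carrier B" for y
  proof -
    obtain x where "x \<in> carrier A" "y = f x" using y im by blast
    then show ?thesis using h(2) k by simp
  qed
  show ?thesis
    by (rule mod_homI) (use h(1) in \<open>auto simp: eq mod_hom_closed mod_hom_add mod_hom_smult\<close>)
qed

lemma mod_iso_sym:
  assumes "module R A" "module R B" "mod_iso R A B"
  shows "mod_iso R B A"
proof -
  obtain f where f: "f \<in> mod_hom R A B" "bij_betw f (carrier A) (carrier B)"
    using assms(3) by (auto simp: mod_iso_def)
  show ?thesis unfolding mod_iso_def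
    using mod_iso_inverse[OF assms(1,2) f] bij_betw_the_inv_into[OF f(2)] by blast
qed

lemma mod_iso_trans:
  assumes "mod_iso R A B" "mod_iso R B C"
  shows "mod_iso R A C"
proof -
  obtain f g where "f \<in> mod_hom R A B" "bij_betw f (carrier A) (carrier B)"
    "g \<in> mod_hom R B C" "bij_betw g (carrier B) (carrier C)" using assms by (auto simp: mod_iso_def)
  then show ?thesis unfolding mod_iso_def
    using mod_hom_comp[of f R A B g C] bij_betw_trans[of f _ _ g]
    by (intro bexI[of _ "\<lambda>x. g (f x)"]) (auto simp: comp_def)
qed

lemma (in module) quot_iso_iff:
  assumes H: "submodule H R M" and B: "module R B"
  shows "mod_iso R (quot_module M H) B \<longleftrightarrow>
    (\<exists>f\<in>mod_hom R M B. f ` carrier M = carrier B \<and> (\<forall>x\<in>carrier M. f x = \<zero>\<^sub>B \<longleftrightarrow> x \<in> H))" (is "?L \<longleftrightarrow> ?R")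
proof
  interpret Q: module R "quot_module M H" using H by (rule quot_module_module)
  note p = quot_proj[OF H]
  {
    assume ?L
    then obtain g where g: "g \<in> mod_hom R (quot_module M H) B"
      "bij_betw g (carrier (quot_module M H)) (carrier B)" by (auto simp: mod_iso_def)
    let ?f = "\<lambda>x. g (H +>\<^bsub>M\<^esub> x)"
    have "?f \<in> mod_hom R M B" using mod_hom_comp[OF p(1) g(1)] .
    moreover have "?f ` carrier M = carrier B"
      using g(2) unfolding bij_betw_def p(2)[symmetric] image_image by blast
    moreover have "?f x = \<zero>\<^sub>B \<longleftrightarrow> x \<in> H" if x: "x \<in> carrier M" for x
    proof -
      have "?f x = \<zero>\<^sub>B \<longleftrightarrow> H +>\<^bsub>M\<^esub> x = \<zero>\<^bsub>quot_module M H\<^esub>"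
        using inj_on_eq_iff[OF bij_betw_imp_inj_on[OF g(2)] mod_hom_closed[OF p(1) x] Q.zero_closed]
          mod_hom_zero[OF Q.module_axioms B g(1)] by simp
      then show ?thesis using p(3) x by simp
    qed
    ultimately show ?R by blast
  next
    assume ?R
    then obtain f where f: "f \<in> mod_hom R M B" "f ` carrier M = carrier B"
      "!!x. x \<in> carrier M ==> f x = \<zero>\<^sub>B \<longleftrightarrow> x \<in> H" by blast
    obtain h where h: "h \<in> mod_hom R (quot_module M H) B" "!!x. x \<in> carrier M ==> h (H +>\<^bsub>M\<^esub> x) = f x"
    proof (rule hom_factor[OF module_axioms Q.module_axioms B p(1,2) f(1)])
      show "f x = \<zero>\<^sub>B" if "x \<in> carrier M" "H +>\<^bsub>M\<^esub> x = \<zero>\<^bsub>quot_module M H\<^esub>" for x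
        using that p(3) f(3) by simp
    qed blast
    have "inj_on h (carrier (quot_module M H))"
    proof (rule hom_inj_onI[OF Q.module_axioms B h(1)])
      fix y assume "y \<in> carrier (quot_module M H)" and y: "h y = \<zero>\<^sub>B"
      then obtain x where x: "x \<in> carrier M" "y = H +>\<^bsub>M\<^esub> x" unfolding p(2)[symmetric] by blast
      then show "y = \<zero>\<^bsub>quot_module M H\<^esub>" using y h(2) f(3) p(3) by simp
    qed
    moreover have "h ` carrier (quot_module M H) = carrier B"
      unfolding p(2)[symmetric] f(2)[symmetric] image_image using h(2) by (rule image_cong[OF refl])
    ultimately show ?L using h(1) by (auto simp: mod_iso_def bij_betw_def)
  }
qed

lemmas (in abelian_group) group_normalise = minus_eq minus_add a_ac r_neg1 r_neg2 r_neg l_neg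

section \<open>Noetherian modules\<close>

definition noeth_module :: "('a, 'r) ring_scheme \<Rightarrow> ('a, 'b, 'm) module_scheme \<Rightarrow> bool" where
  "noeth_module R M \<longleftrightarrow> module R M \<and>
     wf {(K', K). submodule K R M \<and> submodule K' R M \<and> K \<subset> K'}"

lemma noeth_module_module: "noeth_module R M ==> module R M"
  by (simp add: noeth_module_def)

lemma noeth_module_wf:
  "noeth_module R M ==> wf {(K', K). submodule K R M \<and> submodule K' R M \<and> K \<subset> K'}"
  by (simp add: noeth_module_def)

lemma noeth_module_max:
  assumes "noeth_module R M" "K \<in> F" "!!K. K \<in> F ==> submodule K R M"
  obtains L where "L \<in> F" "!!H. H \<in> F ==> L \<subseteq> H ==> H = L"
proof -
  obtain L where L: "L \<in> F"
    "!!H. (H, L) \<in> {(K', K). submodule K R M \<and> submodule K' R M \<and> K \<subset> K'} ==> H \<notin> F"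
    using wfE_min[OF noeth_module_wf[OF assms(1)] assms(2)] by blast
  then have "H = L" if "H \<in> F" "L \<subseteq> H" for H using that assms(3) by blast
  then show ?thesis using that L(1) by blast
qed

text \<open>Chains of submodules are transported by the map \<open>F\<close>.\<close>
lemma noeth_module_mapI:
  assumes "noeth_module R M" "module R N"
    and "!!K. submodule K R N ==> submodule (F K) R M"
    and "!!K K'. submodule K R N ==> submodule K' R N ==> K \<subset> K' ==> F K \<subset> F K'"
  shows "noeth_module R N"
  unfolding noeth_module_def
proof (intro conjI assms(2))
  have "wf (inv_image {(K', K). submodule K R M \<and> submodule K' R M \<and> K \<subset> K'} F)"
    using noeth_module_wf[OF assms(1)] by (rule wf_inv_image)
  then show "wf {(K', K). submodule K R N \<and> submodule K' R N \<and> K \<subset> K'}"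
    by (rule wf_subset) (auto simp: inv_image_def intro: assms(3) dest: assms(4))
qed

lemma noeth_module_sub:
  assumes "noeth_module R M" "submodule H R M"
  shows "noeth_module R (M\<lparr>carrier := H\<rparr>)"
  using assms(1)
proof (rule noeth_module_mapI[where F = "\<lambda>K. K"])
  show "module R (M\<lparr>carrier := H\<rparr>)"
    using noeth_module_module[OF assms(1)] assms(2) by (rule submodule_module)
  show "!!K. submodule K R (M\<lparr>carrier := H\<rparr>) ==> submodule K R M"
    using noeth_module_module[OF assms(1)] assms(2) by (rule submodule_in_sub)
qed

lemma noeth_module_image:
  assumes "noeth_module R M" "module R N" "f \<in> mod_hom R M N" "f ` carrier M = carrier N"
  shows "noeth_module R N"
  using assms(1,2)
proof (rule noeth_module_mapI[where F = "\<lambda>K. {x \<in> carrier M. f x \<in> K}"])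
  note M = noeth_module_module[OF assms(1)]
  show "submodule {x \<in> carrier M. f x \<in> K} R M" if "submodule K R N" for K
    using M assms(2,3) that by (rule preimage_submodule)
  fix K K' assume K: "submodule K R N" "submodule K' R N" "K \<subset> K'"
  then obtain y where y: "y \<in> K'" "y \<notin> K" by blast
  then have "y \<in> carrier N" using module.submodule_closed(6)[OF assms(2) K(2)] by blast
  then obtain x where "x \<in> carrier M" "y = f x" unfolding assms(4)[symmetric] by blast
  then show "{x \<in> carrier M. f x \<in> K} \<subset> {x \<in> carrier M. f x \<in> K'}" using y K(3) by blast
qed

lemma noeth_module_quot:
  assumes "noeth_module R M" "submodule H R M"
  shows "noeth_module R (quot_module M H)"
  using assms(1) module.quot_module_module[OF noeth_module_module[OF assms(1)] assms(2)]
    module.quot_proj(1,2)[OF noeth_module_module[OF assms(1)] assms(2)]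
  by (rule noeth_module_image)

lemma noeth_module_fin_gen:
  assumes "noeth_module R M"
  shows "fin_gen_module R M"
proof -
  interpret M: module R M using assms by (rule noeth_module_module)
  obtain L where L: "L \<in> {mod_span R M S | S. finite S \<and> S \<subseteq> carrier M}"
    and max: "!!H. H \<in> {mod_span R M S | S. finite S \<and> S \<subseteq> carrier M} ==> L \<subseteq> H ==> H = L"
    using assms
  proof (rule noeth_module_max)
    show "mod_span R M {} \<in> {mod_span R M S | S. finite S \<and> S \<subseteq> carrier M}" by blast
  qed (auto intro: M.mod_span_submodule)
  then obtain S where S: "finite S" "S \<subseteq> carrier M" "L = mod_span R M S" by blast
  have "carrier M \<subseteq> L"
  proof
    fix x assume x: "x \<in> carrier M"
    have xS: "insert x S \<subseteq> carrier M" using x S by blast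
    have "mod_span R M (insert x S) = L"
    proof (rule max)
      show "L \<subseteq> mod_span R M (insert x S)"
        unfolding S(3) using mod_span_base[of "insert x S" R M]
        by (intro mod_span_least M.mod_span_submodule xS) auto
    qed (use S x in blast)
    then show "x \<in> L" using mod_span_base[of "insert x S" R M] by blast
  qed
  then have "mod_span R M S = carrier M"
    using S M.submodule_closed(6)[OF M.mod_span_submodule[OF S(2)]] by blast
  then show ?thesis unfolding fin_gen_module_def using S M.module_axioms by blast
qed

lemma (in cring) idealI_cring:
  assumes "I \<subseteq> carrier R" "\<zero> \<in> I" "!!a b. a \<in> I ==> b \<in> I ==> a \<oplus> b \<in> I"
    "!!a x. a \<in> I ==> x \<in> carrier R ==> x \<otimes> a \<in> I"
  shows "ideal I R"
proof (rule idealI)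
  show "ring R" by (rule ring_axioms)
  have "\<ominus> a \<in> I" if "a \<in> I" for a
  proof -
    have "(\<ominus> \<one>) \<otimes> a \<in> I" using assms(4)[OF that] by simp
    then show ?thesis using assms(1) that by (simp add: l_minus subset_iff)
  qed
  then show "subgroup I (add_monoid R)"
    using assms by (intro add.subgroupI) (auto simp: a_inv_def)
  show "!!a x. a \<in> I ==> x \<in> carrier R ==> x \<otimes> a \<in> I" by fact
  show "!!a x. a \<in> I ==> x \<in> carrier R ==> a \<otimes> x \<in> I"
    using assms(1,4) m_comm by (metis subsetD)
qed

lemma (in noetherian_ring) wf_ideals: "wf {(J, I). ideal I R \<and> ideal J R \<and> I \<subset> J}"
proof (rule ccontr)
  assume "\<not> ?thesis"
  then obtain f where f: "!!i. (f (Suc i), f i) \<in> {(J, I). ideal I R \<and> ideal J R \<and> I \<subset> J}"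
    unfolding wf_iff_no_infinite_down_chain by blast
  have mono: "f i \<subseteq> f j" if "i \<le> j" for i j :: nat
    using f by (intro lift_Suc_mono_le[OF _ that]) auto
  have "\<Union>(range f) \<in> range f"
  proof (rule ideal_chain_is_trivial)
    show "subset.chain {I. ideal I R} (range f)"
    proof (rule pred_on.chainI)
      show "range f \<subseteq> {I. ideal I R}" using f by blast
      fix x y assume "x \<in> range f" "y \<in> range f"
      then obtain i j where "x = f i" "y = f j" by blast
      then have "x \<subseteq> y \<or> y \<subseteq> x" using mono[of i j] mono[of j i] by (cases "i \<le> j") auto
      then show "(\<subset>)\<^sup>=\<^sup>= x y \<or> (\<subset>)\<^sup>=\<^sup>= y x" by blast
    qed
  qed simp
  then obtain i where "\<Union>(range f) = f i" by blast
  then show False using f[of i] by blast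
qed

lemma fin_gen_noeth_module:
  fixes M :: "('a, 'b, 'm) module_scheme"
  assumes R: "noetherian_ring R" and M: "fin_gen_module R M"
  shows "noeth_module R M"
proof -
  interpret M: module R M using M by (simp add: fin_gen_module_def)
  interpret R: noetherian_ring R by fact
  obtain S where S: "finite S" "S \<subseteq> carrier M" "mod_span R M S = carrier M"
    using M by (auto simp: fin_gen_module_def)
  let ?W = "\<lambda>L. {(K', K). submodule K R M \<and> submodule K' R M \<and> K \<subset> K' \<and> K' \<subseteq> L}"
  have "wf (?W (mod_span R M S))"
    using S(1,2)
  proof (induction S rule: finite_induct)
    case empty
    have "mod_span R M {} \<subseteq> {\<zero>\<^sub>M}" by (rule mod_span_least[OF M.zero_submodule]) simp
    then have "?W (mod_span R M {}) = {}" using M.submodule_closed(1) by blast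
    moreover have "wf ({} :: ('b set \<times> 'b set) set)" by simp
    ultimately show ?case by (simp only:)
  next
    case (insert s S)
    define L where "L = mod_span R M S"
    have s: "s \<in> carrier M" and Sc: "S \<subseteq> carrier M" using insert.prems by auto
    have L: "submodule L R M" unfolding L_def using Sc by (rule M.mod_span_submodule)
    note Lc = M.submodule_closed[OF L]
    \<comment> \<open>a submodule of \<open>Rs + L\<close> is determined by its trace on \<open>L\<close> and the ideal of
      coefficients of \<open>s\<close> that occur in it\<close>
    define I where "I K = {r \<in> carrier R. \<exists>l\<in>L. r \<odot>\<^sub>M s \<oplus>\<^sub>M l \<in> K}" for K
    have I: "ideal (I K) R" if K: "submodule K R M" for K
    proof (rule M.R.idealI_cring)
      note Kc = M.submodule_closed[OF K]
      show "I K \<subseteq> carrier R" by (auto simp: I_def)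
      show "\<zero>\<^sub>R \<in> I K" unfolding I_def using Lc(1) Kc(1) s by (auto intro!: bexI[of _ "\<zero>\<^sub>M"])
      show "a \<oplus>\<^sub>R b \<in> I K" if "a \<in> I K" "b \<in> I K" for a b
      proof -
        obtain l l' where l: "a \<in> carrier R" "b \<in> carrier R" "l \<in> L" "l' \<in> L" "a \<odot>\<^sub>M s \<oplus>\<^sub>M l \<in> K" "b \<odot>\<^sub>M s \<oplus>\<^sub>M l' \<in> K"
          using \<open>a \<in> I K\<close> \<open>b \<in> I K\<close> unfolding I_def by blast
        have "(a \<oplus>\<^sub>R b) \<odot>\<^sub>M s \<oplus>\<^sub>M (l \<oplus>\<^sub>M l') = (a \<odot>\<^sub>M s \<oplus>\<^sub>M l) \<oplus>\<^sub>M (b \<odot>\<^sub>M s \<oplus>\<^sub>M l')"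
          using l(1-4) s Lc(6) by (simp add: M.smult_l_distr M.a_ac)
        then have "(a \<oplus>\<^sub>R b) \<odot>\<^sub>M s \<oplus>\<^sub>M (l \<oplus>\<^sub>M l') \<in> K" using Kc(2)[OF l(5,6)] by simp
        then show ?thesis unfolding I_def using Lc(2)[OF l(3,4)] l(1,2) by blast
      qed
      show "x \<otimes>\<^bsub>R\<^esub> a \<in> I K" if "a \<in> I K" "x \<in> carrier R" for a x
      proof -
        obtain l where l: "a \<in> carrier R" "l \<in> L" "a \<odot>\<^sub>M s \<oplus>\<^sub>M l \<in> K"
          using \<open>a \<in> I K\<close> unfolding I_def by blast
        have "(x \<otimes>\<^bsub>R\<^esub> a) \<odot>\<^sub>M s \<oplus>\<^sub>M (x \<odot>\<^sub>M l) = x \<odot>\<^sub>M (a \<odot>\<^sub>M s \<oplus>\<^sub>M l)"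
          using l(1-2) s Lc(6) that by (simp add: M.smult_r_distr M.smult_assoc1)
        then have "(x \<otimes>\<^bsub>R\<^esub> a) \<odot>\<^sub>M s \<oplus>\<^sub>M (x \<odot>\<^sub>M l) \<in> K" using Kc(5)[OF that(2) l(3)] by simp
        then show ?thesis unfolding I_def using Lc(5)[OF that(2) l(2)] l(1) that(2) by blast
      qed
    qed
    have dec: "k \<in> mod_span R M (insert s S) ==> \<exists>r\<in>carrier R. \<exists>l\<in>L. k = r \<odot>\<^sub>M s \<oplus>\<^sub>M l" for k
    proof -
      assume "k \<in> mod_span R M (insert s S)"
      then obtain c where c: "c \<in> insert s S \<rightarrow> carrier R"
        "k = (\<Oplus>\<^bsub>M\<^esub>t\<in>insert s S. c t \<odot>\<^sub>M t)"
        using M.mod_span_subset_combinations[of "insert s S"] insert.hyps(1) insert.prems by blast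
      have cl: "(\<lambda>t. c t \<odot>\<^sub>M t) \<in> S \<rightarrow> carrier M" using c(1) Sc by auto
      have "k = c s \<odot>\<^sub>M s \<oplus>\<^sub>M (\<Oplus>\<^bsub>M\<^esub>t\<in>S. c t \<odot>\<^sub>M t)"
        unfolding c(2) using insert.hyps cl c(1) s by (subst M.finsum_insert) auto
      moreover have "(\<Oplus>\<^bsub>M\<^esub>t\<in>S. c t \<odot>\<^sub>M t) \<in> L"
      proof (rule M.submodule_finsum[OF L])
        show "(\<lambda>t. c t \<odot>\<^sub>M t) \<in> S \<rightarrow> L"
          using c(1) Lc(5) mod_span_base[of S R M] unfolding L_def by blast
      qed
      ultimately show ?thesis using c(1) by blast
    qed
    let ?r1 = "?W L" and ?r2 = "{(J, I). ideal I R \<and> ideal J R \<and> I \<subset> J}"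
    have "wf (inv_image (?r1 <*lex*> ?r2) (\<lambda>K. (K \<inter> L, I K)))"
      using insert.IH[OF Sc] R.wf_ideals unfolding L_def by (intro wf_inv_image wf_lex_prod)
    then show ?case
    proof (rule wf_subset)
      show "?W (mod_span R M (insert s S)) \<subseteq> inv_image (?r1 <*lex*> ?r2) (\<lambda>K. (K \<inter> L, I K))"
      proof
        fix p assume "p \<in> ?W (mod_span R M (insert s S))"
        then obtain K' K where p: "p = (K', K)" and K: "submodule K R M" "submodule K' R M" "K \<subset> K'"
          and K'S: "K' \<subseteq> mod_span R M (insert s S)" by blast
        note Kc = M.submodule_closed[OF K(1)] and K'c = M.submodule_closed[OF K(2)]
        have sub: "K \<inter> L \<subseteq> K' \<inter> L" "I K \<subseteq> I K'" using K(3) unfolding I_def by blast+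
        have "\<not> (K \<inter> L = K' \<inter> L \<and> I K = I K')"
        proof
          assume eq: "K \<inter> L = K' \<inter> L \<and> I K = I K'"
          obtain k' where k': "k' \<in> K'" "k' \<notin> K" using K(3) by blast
          obtain r l where r: "r \<in> carrier R" "l \<in> L" "k' = r \<odot>\<^sub>M s \<oplus>\<^sub>M l" using dec k' K'S by blast
          then have "r \<in> I K'" unfolding I_def using k' by blast
          then obtain l' where l': "l' \<in> L" "r \<odot>\<^sub>M s \<oplus>\<^sub>M l' \<in> K" using eq unfolding I_def by blast
          have e: "k' \<ominus>\<^sub>M (r \<odot>\<^sub>M s \<oplus>\<^sub>M l') = l \<ominus>\<^sub>M l'"
            unfolding r(3) using r(1,2) l'(1) s Lc(6) by (simp add: M.group_normalise)
          have "k' \<ominus>\<^sub>M (r \<odot>\<^sub>M s \<oplus>\<^sub>M l') \<in> K'" using K'c(4) k'(1) l'(2) K(3) by blast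
          moreover have "k' \<ominus>\<^sub>M (r \<odot>\<^sub>M s \<oplus>\<^sub>M l') \<in> L" unfolding e using Lc(4) r l' by blast
          ultimately have "k' \<ominus>\<^sub>M (r \<odot>\<^sub>M s \<oplus>\<^sub>M l') \<in> K" using eq by blast
          then have "k' \<in> K" using M.submodule_add_iff(3)[OF K(1) _ l'(2)] K'c(6)[OF k'(1)] by blast
          then show False using k'(2) by blast
        qed
        then have "K \<inter> L \<subset> K' \<inter> L \<or> K \<inter> L = K' \<inter> L \<and> ideal (I K) R \<and> ideal (I K') R \<and> I K \<subset> I K'"
          using sub I[OF K(1)] I[OF K(2)] by blast
        then show "p \<in> inv_image (?r1 <*lex*> ?r2) (\<lambda>K. (K \<inter> L, I K))"
          unfolding p using M.submodule_Int[OF K(1) L] M.submodule_Int[OF K(2) L]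
          by (simp add: in_lex_prod) blast
      qed
    qed
  qed
  then have "wf {(K', K). submodule K R M \<and> submodule K' R M \<and> K \<subset> K'}"
    by (rule wf_subset) (use S(3) M.submodule_closed(6) in blast)
  then show ?thesis unfolding noeth_module_def using M.module_axioms by blast
qed

section \<open>Noetherian local rings\<close>

locale noeth_local_ring = cring R + noetherian_ring R for R (structure) +
  assumes local: "local_ring R"
begin

lemma max_ideal_maximal: "maximalideal (max_ideal R) R"
  unfolding max_ideal_def using local unfolding local_ring_def by (metis theI')

lemma maximal_unique: "maximalideal I R ==> I = max_ideal R"
  using local max_ideal_maximal unfolding local_ring_def by blast

lemma max_ideal_ideal: "ideal (max_ideal R) R"
  using max_ideal_maximal by (rule maximalideal.axioms)

lemma max_ideal_carr: "x \<in> max_ideal R ==> x \<in> carrier R"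
  using max_ideal_ideal by (rule ideal.Icarr)

lemma max_ideal_closed:
  "\<zero> \<in> max_ideal R"
  "x \<in> max_ideal R ==> y \<in> max_ideal R ==> x \<oplus> y \<in> max_ideal R"
  "x \<in> max_ideal R ==> r \<in> carrier R ==> r \<otimes> x \<in> max_ideal R"
  "x \<in> max_ideal R ==> r \<in> carrier R ==> x \<otimes> r \<in> max_ideal R"
  using max_ideal_ideal
  by (auto intro: additive_subgroup.zero_closed additive_subgroup.a_closed ideal.axioms(1)
      ideal.I_l_closed ideal.I_r_closed)

lemma one_not_max: "\<one> \<notin> max_ideal R"
  using ideal.one_imp_carrier[OF max_ideal_ideal] maximalideal.I_notcarr[OF max_ideal_maximal] by blast

lemma proper_ideal_max:
  assumes I: "ideal I R" "I \<noteq> carrier R"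
  shows "I \<subseteq> max_ideal R"
proof -
  let ?Q = "{J. ideal J R \<and> I \<subseteq> J \<and> J \<noteq> carrier R}"
  have "I \<in> ?Q" using I by blast
  then obtain J where J: "J \<in> ?Q" and
    max: "!!J'. (J', J) \<in> {(J, I). ideal I R \<and> ideal J R \<and> I \<subset> J} ==> J' \<notin> ?Q"
    using wfE_min[OF wf_ideals] by (metis (no_types, lifting))
  have "maximalideal J R"
  proof (rule maximalidealI)
    fix J' assume "ideal J' R" "J \<subseteq> J'" "J' \<subseteq> carrier R"
    then show "J' = J \<or> J' = carrier R" using max[of J'] J by blast
  qed (use J in auto)
  then have "J = max_ideal R" by (rule maximal_unique)
  then show ?thesis using J by blast
qed

lemma unit_of_not_max:
  assumes "x \<in> carrier R" "x \<notin> max_ideal R"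
  obtains y where "y \<in> carrier R" "y \<otimes> x = \<one>"
proof -
  have "ideal (PIdl x) R" using assms(1) by (rule cgenideal_ideal)
  moreover have "x \<in> PIdl x" using assms(1) by (rule cgenideal_self)
  ultimately have "PIdl x = carrier R" using proper_ideal_max assms(2) by blast
  then have "\<one> \<in> PIdl x" by simp
  then show ?thesis using that unfolding cgenideal_def by auto
qed

text \<open>A maximal proper submodule \<open>L\<close> exists by the Noetherian property, and the quotient by it is
  simple, hence killed by the maximal ideal.\<close>
lemma nakayama:
  assumes M: "noeth_module R M" and K: "submodule K R M" "K \<noteq> carrier M"
  obtains L where "submodule L R M" "K \<subseteq> L" "L \<noteq> carrier M"
    "!!a v. a \<in> max_ideal R ==> v \<in> carrier M ==> a \<odot>\<^sub>M v \<in> L"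
proof -
  interpret M: module R M using M by (rule noeth_module_module)
  let ?F = "{L. submodule L R M \<and> K \<subseteq> L \<and> L \<noteq> carrier M}"
  obtain L where L: "L \<in> ?F" and max: "!!H. H \<in> ?F ==> L \<subseteq> H ==> H = L"
    by (rule noeth_module_max[OF M, of K ?F]) (use K in auto)
  have Ls: "submodule L R M" using L by blast
  note Lc = M.submodule_closed[OF Ls]
  have kill: "a \<odot>\<^sub>M v \<in> L" if a: "a \<in> max_ideal R" and v: "v \<in> carrier M" for a v
  proof (rule ccontr)
    assume n: "a \<odot>\<^sub>M v \<notin> L"
    have ac: "a \<in> carrier R" using a by (rule max_ideal_carr)
    have vL: "v \<notin> L" using n Lc(5)[OF ac] by blast
    let ?H = "{w \<in> carrier M. \<exists>r\<in>carrier R. \<exists>l\<in>L. w = l \<oplus>\<^sub>M r \<odot>\<^sub>M (a \<odot>\<^sub>M v)}"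
    have H: "submodule ?H R M"
    proof (rule M.submoduleI)
      show "?H \<subseteq> carrier M" by blast
      show "\<zero>\<^sub>M \<in> ?H" using Lc(1) ac v by (auto intro!: bexI[of _ \<zero>] bexI[of _ "\<zero>\<^sub>M"])
    next
      fix w assume "w \<in> ?H"
      then obtain r l where w: "r \<in> carrier R" "l \<in> L" "w = l \<oplus>\<^sub>M r \<odot>\<^sub>M (a \<odot>\<^sub>M v)" by blast
      have "\<ominus>\<^sub>M w = (\<ominus>\<^sub>M l) \<oplus>\<^sub>M (\<ominus> r) \<odot>\<^sub>M (a \<odot>\<^sub>M v)"
        unfolding w(3) using w(1) Lc(6)[OF w(2)] ac v by (simp add: M.minus_add M.smult_l_minus)
      then show "\<ominus>\<^sub>M w \<in> ?H" using Lc(3)[OF w(2)] Lc(6) w(1) ac v by auto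
    next
      fix w w' assume "w \<in> ?H" "w' \<in> ?H"
      then obtain r l r' l' where w: "r \<in> carrier R" "l \<in> L" "w = l \<oplus>\<^sub>M r \<odot>\<^sub>M (a \<odot>\<^sub>M v)"
        "r' \<in> carrier R" "l' \<in> L" "w' = l' \<oplus>\<^sub>M r' \<odot>\<^sub>M (a \<odot>\<^sub>M v)" by blast
      have "w \<oplus>\<^sub>M w' = (l \<oplus>\<^sub>M l') \<oplus>\<^sub>M (r \<oplus> r') \<odot>\<^sub>M (a \<odot>\<^sub>M v)"
        unfolding w(3,6) using w Lc(6) ac v by (simp add: M.smult_l_distr M.a_ac)
      moreover have "w \<oplus>\<^sub>M w' \<in> carrier M" unfolding w(3,6) using w(1,2,4,5) Lc(6) ac v by simp
      ultimately show "w \<oplus>\<^sub>M w' \<in> ?H" using Lc(2)[OF w(2,5)] w(1,4) by blast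
    next
      fix c w assume c: "c \<in> carrier R" and "w \<in> ?H"
      then obtain r l where w: "r \<in> carrier R" "l \<in> L" "w = l \<oplus>\<^sub>M r \<odot>\<^sub>M (a \<odot>\<^sub>M v)" by blast
      have "c \<odot>\<^sub>M w = (c \<odot>\<^sub>M l) \<oplus>\<^sub>M (c \<otimes> r) \<odot>\<^sub>M (a \<odot>\<^sub>M v)"
        unfolding w(3) using w(1) Lc(6)[OF w(2)] ac v c by (simp add: M.smult_r_distr M.smult_assoc1)
      moreover have "c \<odot>\<^sub>M w \<in> carrier M" unfolding w(3) using w(1,2) Lc(6) ac v c by simp
      ultimately show "c \<odot>\<^sub>M w \<in> ?H" using Lc(5)[OF c w(2)] w(1) c by blast
    qed
    have LH: "L \<subseteq> ?H"
    proof
      fix l assume "l \<in> L"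
      then show "l \<in> ?H" using Lc(6) ac v by (auto intro!: bexI[of _ \<zero>] bexI[of _ l])
    qed
    have "a \<odot>\<^sub>M v \<in> ?H" using Lc(1) ac v by (auto intro!: bexI[of _ \<one>] bexI[of _ "\<zero>\<^sub>M"])
    then have "?H = carrier M" using max[of ?H] H LH L n by blast
    then have "v \<in> ?H" using v by blast
    then obtain r l where r: "r \<in> carrier R" "l \<in> L" "v = l \<oplus>\<^sub>M r \<odot>\<^sub>M (a \<odot>\<^sub>M v)" by blast
    \<comment> \<open>so \<open>(1 - ra) v\<close> lies in \<open>L\<close>, and \<open>1 - ra\<close> is a unit\<close>
    have ra: "r \<otimes> a \<in> max_ideal R" using max_ideal_closed(3)[OF a r(1)] .
    have "(\<one> \<ominus> r \<otimes> a) \<odot>\<^sub>M v = v \<ominus>\<^sub>M r \<odot>\<^sub>M (a \<odot>\<^sub>M v)"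
      using r(1) ac v by (simp add: minus_eq M.minus_eq M.smult_l_distr M.smult_l_minus M.smult_assoc1)
    also have "\<dots> = l"
      using r(1,2) Lc(6) ac v by (subst r(3)) (simp add: M.minus_eq M.a_assoc M.r_neg)
    finally have lv: "(\<one> \<ominus> r \<otimes> a) \<odot>\<^sub>M v = l" .
    have "\<one> \<ominus> r \<otimes> a \<notin> max_ideal R"
    proof
      assume "\<one> \<ominus> r \<otimes> a \<in> max_ideal R"
      then have "(\<one> \<ominus> r \<otimes> a) \<oplus> r \<otimes> a \<in> max_ideal R" using ra max_ideal_closed(2) by blast
      then show False using r(1) ac one_not_max by (simp add: minus_eq a_assoc l_neg)
    qed
    then obtain u where u: "u \<in> carrier R" "u \<otimes> (\<one> \<ominus> r \<otimes> a) = \<one>"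
      using unit_of_not_max[of "\<one> \<ominus> r \<otimes> a"] r(1) ac by auto
    have "u \<odot>\<^sub>M ((\<one> \<ominus> r \<otimes> a) \<odot>\<^sub>M v) = v"
      using u r(1) ac v by (simp add: M.smult_assoc1[symmetric])
    then show False using lv Lc(5)[OF u(1) r(2)] vL by simp
  qed
  show ?thesis by (rule that[of L]) (use L kill in auto)
qed

subsection \<open>Prime avoidance\<close>

text \<open>If one prime of the family contains another, the smaller one can be dropped.  Otherwise let \<open>x\<close> avoid all the
  primes except \<open>p\<close>.  If \<open>x\<close> lies in \<open>p\<close>, then \<open>x + y\<close> avoids them all, where \<open>y\<close> lies in \<open>I\<close> and in all the primes
  except \<open>p\<close>: such a \<open>y\<close> is a product of an element of \<open>I\<close> and elements of the other primes, all outside \<open>p\<close>.\<close>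
lemma prime_avoidance:
  assumes "finite P" "!!p. p \<in> P ==> primeideal p R" "!!p. p \<in> P ==> \<not> I \<subseteq> p" "ideal I R"
  shows "\<exists>x\<in>I. \<forall>p\<in>P. x \<notin> p"
  using assms(1-3)
proof (induction P rule: finite_psubset_induct)
  case (psubset P)
  have pid: "ideal p R" if "p \<in> P" for p using psubset.prems(1)[OF that] by (rule primeideal.axioms)
  show ?case
  proof (cases "\<exists>p\<in>P. \<exists>p'\<in>P. p' \<subset> p")
    case True
    then obtain p p' where p: "p \<in> P" "p' \<in> P" "p' \<subset> p" by blast
    then have "P - {p'} \<subset> P" by blast
    then obtain x where "x \<in> I" "\<forall>r\<in>P - {p'}. x \<notin> r" using psubset.IH[of "P - {p'}"] psubset.prems by blast
    then show ?thesis using p by (intro bexI[of _ x]) auto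
  next
    case False
    show ?thesis
    proof (cases "P = {}")
      case True
      then show ?thesis using additive_subgroup.zero_closed[OF ideal.axioms(1)[OF assms(4)]] by blast
    next
      case ne: False
      then obtain p where p: "p \<in> P" by blast
      then have "P - {p} \<subset> P" by blast
      then obtain x where x: "x \<in> I" "\<forall>r\<in>P - {p}. x \<notin> r" using psubset.IH[of "P - {p}"] psubset.prems by blast
      show ?thesis
      proof (cases "x \<in> p")
        case False then show ?thesis using x by blast
      next
        case True
        interpret p: primeideal p R using psubset.prems(1)[OF p] .
        have "\<exists>y\<in>I. y \<notin> p \<and> (\<forall>r\<in>Q. y \<in> r)" if "finite Q" "Q \<subseteq> P - {p}" for Q
          using that
        proof (induction Q rule: finite_induct)
          case empty then show ?case using psubset.prems(2)[OF p] by blast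
        next
          case (insert r Q)
          then obtain y where y: "y \<in> I" "y \<notin> p" "\<forall>r\<in>Q. y \<in> r" by blast
          have r: "r \<in> P" "r \<noteq> p" using insert.prems by auto
          then obtain z where z: "z \<in> r" "z \<notin> p" using False p by blast
          have yc: "y \<in> carrier R" using y(1) ideal.Icarr[OF assms(4)] by blast
          have zc: "z \<in> carrier R" using z(1) ideal.Icarr[OF pid[OF r(1)]] by blast
          have "z \<otimes> y \<in> I" using ideal.I_l_closed[OF assms(4) y(1) zc] .
          moreover have "z \<otimes> y \<notin> p" using p.I_prime[OF zc yc] y z by blast
          moreover have "z \<otimes> y \<in> r" using ideal.I_r_closed[OF pid[OF r(1)] z(1) yc] .
          moreover have "z \<otimes> y \<in> s" if "s \<in> Q" for s
            using ideal.I_l_closed[OF pid, of s y z] y(3) that zc insert.prems by blast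
          ultimately show ?case by blast
        qed
        then obtain y where y: "y \<in> I" "y \<notin> p" "\<forall>r\<in>P - {p}. y \<in> r"
          using psubset.hyps(1) by (metis finite_Diff order_refl)
        have c: "x \<in> carrier R" "y \<in> carrier R" using x y ideal.Icarr[OF assms(4)] by auto
        have sub: "b \<in> r" if "ideal r R" "a \<in> r" "a \<oplus> b \<in> r" "a \<in> carrier R" "b \<in> carrier R" for a b r
        proof -
          have "\<ominus> a \<in> r" using additive_subgroup.a_inv_closed[OF ideal.axioms(1)[OF that(1)] that(2)] is_abelian_group by simp
          then have "\<ominus> a \<oplus> (a \<oplus> b) \<in> r"
            using additive_subgroup.a_closed[OF ideal.axioms(1)[OF that(1)]] that(3) by blast
          then show ?thesis using that by (simp add: r_neg1)
        qed
        show ?thesis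
        proof (intro bexI[of _ "x \<oplus> y"] ballI notI)
          show "x \<oplus> y \<in> I" using additive_subgroup.a_closed[OF ideal.axioms(1)[OF assms(4)] x(1) y(1)] .
          fix r assume r: "r \<in> P" "x \<oplus> y \<in> r"
          show False
          proof (cases "r = p")
            case True then show ?thesis using sub[OF pid[OF p], of x y] c \<open>x \<in> p\<close> r y by blast
          next
            case False
            then have "x \<in> r" using sub[OF pid[OF r(1)], of y x] c r y by (simp add: a_comm)
            then show ?thesis using x False r by blast
          qed
        qed
      qed
    qed
  qed
qed

end

section \<open>Regular elements and depth\<close>

definition nzd :: "('a, 'b, 'm) module_scheme \<Rightarrow> 'b set \<Rightarrow> 'a \<Rightarrow> bool" where
  "nzd M K x \<longleftrightarrow> (\<forall>v\<in>carrier M. x \<odot>\<^sub>M v \<in> K \<longrightarrow> v \<in> K)"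

definition has_socle :: "('a, 'r) ring_scheme \<Rightarrow> ('a, 'b, 'm) module_scheme \<Rightarrow> 'b set \<Rightarrow> bool" where
  "has_socle R M K \<longleftrightarrow> (\<exists>z\<in>carrier M. z \<notin> K \<and> (\<forall>a\<in>max_ideal R. a \<odot>\<^sub>M z \<in> K))"

text \<open>\<open>depth_is R M t K\<close> says that \<open>M/K\<close> has a maximal regular sequence of length \<open>t\<close> in the
  maximal ideal.  Working with the submodules \<open>K\<close> of one module, rather than with the
  quotients, keeps the induction on the sequence inside one type.\<close>
primrec depth_is :: "('a, 'r) ring_scheme \<Rightarrow> ('a, 'b, 'm) module_scheme \<Rightarrow> nat \<Rightarrow> 'b set \<Rightarrow> bool" where
  "depth_is R M 0 K \<longleftrightarrow> has_socle R M K"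
| "depth_is R M (Suc t) K \<longleftrightarrow> (\<exists>x\<in>max_ideal R. nzd M K x \<and> depth_is R M t (plus_mult M K x))"

lemma nzdD: "nzd M K x ==> v \<in> carrier M ==> x \<odot>\<^sub>M v \<in> K ==> v \<in> K"
  by (simp add: nzd_def)

lemma has_socleE:
  assumes "has_socle R M K"
  obtains z where "z \<in> carrier M" "z \<notin> K" "!!a. a \<in> max_ideal R ==> a \<odot>\<^sub>M z \<in> K"
  using assms by (auto simp: has_socle_def)

context noeth_local_ring
begin

lemma nzd_no_socle:
  assumes "nzd M K x" "x \<in> max_ideal R"
  shows "\<not> has_socle R M K"
  using assms unfolding nzd_def has_socle_def by blast

text \<open>The maximal annihilators of elements of \<open>M/K\<close> are prime, and their union is the set of zero divisors.  There are
  finitely many: if \<open>z\<^sub>0, z\<^sub>1, \<dots>\<close> had distinct ones, some \<open>z\<^sub>n\<close> would be a combination of its predecessors modulo \<open>K\<close>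
  by the ascending chain condition, so that the product of their annihilators, and hence one of these, would lie in
  the annihilator of \<open>z\<^sub>n\<close>, against maximality.\<close>
lemma nzd_outside_finitely_many_primes:
  assumes M: "noeth_module R M" and K: "submodule K R M" and ns: "\<not> has_socle R M K"
  obtains P where "finite P" "!!p. p \<in> P ==> primeideal p R" "!!p. p \<in> P ==> \<not> max_ideal R \<subseteq> p"
    "!!x. x \<in> carrier R ==> (\<forall>p\<in>P. x \<notin> p) ==> nzd M K x"
proof -
  interpret M: module R M using M by (rule noeth_module_module)
  note Kc = M.submodule_closed[OF K]
  define ann where "ann z = {r \<in> carrier R. r \<odot>\<^sub>M z \<in> K}" for z
  let ?N = "carrier M - K"
  have annI: "ideal (ann z) R" if z: "z \<in> carrier M" for z
  proof (rule idealI_cring)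
    show "a \<oplus> b \<in> ann z" if "a \<in> ann z" "b \<in> ann z" for a b
      using that z Kc(2) by (auto simp: ann_def M.smult_l_distr)
    show "x \<otimes> a \<in> ann z" if "a \<in> ann z" "x \<in> carrier R" for a x
      using that z Kc(5) by (auto simp: ann_def M.smult_assoc1)
  qed (use z Kc(1) in \<open>auto simp: ann_def\<close>)
  define P where "P = {ann z | z. z \<in> ?N \<and> (\<forall>w\<in>?N. ann z \<subseteq> ann w \<longrightarrow> ann w = ann z)}"
  have big: "\<exists>p\<in>P. ann z \<subseteq> p" if z: "z \<in> ?N" for z
  proof -
    have "ann z \<in> {ann w | w. w \<in> ?N \<and> ann z \<subseteq> ann w}" using z by blast
    then obtain J where J: "J \<in> {ann w | w. w \<in> ?N \<and> ann z \<subseteq> ann w}"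
      and max: "!!J'. (J', J) \<in> {(J, I). ideal I R \<and> ideal J R \<and> I \<subset> J} ==>
        J' \<notin> {ann w | w. w \<in> ?N \<and> ann z \<subseteq> ann w}"
      using wfE_min[OF wf_ideals] by (metis (no_types, lifting))
    obtain w where w: "w \<in> ?N" "ann z \<subseteq> ann w" "J = ann w" using J by blast
    have "ann v = ann w" if v: "v \<in> ?N" "ann w \<subseteq> ann v" for v
    proof (rule ccontr)
      assume "ann v \<noteq> ann w"
      then have "(ann v, J) \<in> {(J, I). ideal I R \<and> ideal J R \<and> I \<subset> J}"
        using v w annI[of v] annI[of w] by blast
      then have "ann v \<notin> {ann w | w. w \<in> ?N \<and> ann z \<subseteq> ann w}" by (rule max)
      then show False using v w by blast
    qed
    then have "ann w \<in> P" unfolding P_def using w by blast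
    then show ?thesis using w by blast
  qed
  have prime: "primeideal p R" if p: "p \<in> P" for p
  proof -
    obtain z where z: "z \<in> ?N" "p = ann z" and mx: "!!w. w \<in> ?N ==> ann z \<subseteq> ann w ==> ann w = ann z"
      using p unfolding P_def by blast
    have zc: "z \<in> carrier M" "z \<notin> K" using z by auto
    have "\<one> \<notin> ann z" using zc by (simp add: ann_def)
    then have ne: "carrier R \<noteq> ann z" by auto
    show ?thesis unfolding z(2)
    proof (rule primeidealI[OF annI[OF zc(1)] is_cring ne])
      fix a b assume ab: "a \<in> carrier R" "b \<in> carrier R" "a \<otimes> b \<in> ann z"
      show "a \<in> ann z \<or> b \<in> ann z"
      proof (cases "b \<odot>\<^sub>M z \<in> K")
        case True then show ?thesis using ab by (simp add: ann_def)
      next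
        case False
        then have bz: "b \<odot>\<^sub>M z \<in> ?N" using ab zc by simp
        have "ann z \<subseteq> ann (b \<odot>\<^sub>M z)"
        proof
          fix r assume r: "r \<in> ann z"
          then have rc: "r \<in> carrier R" "r \<odot>\<^sub>M z \<in> K" by (auto simp: ann_def)
          have "r \<odot>\<^sub>M (b \<odot>\<^sub>M z) = b \<odot>\<^sub>M (r \<odot>\<^sub>M z)"
            using rc ab zc by (simp add: M.smult_assoc1[symmetric] m_comm)
          then show "r \<in> ann (b \<odot>\<^sub>M z)" using rc Kc(5)[OF ab(2) rc(2)] by (simp add: ann_def)
        qed
        then have "ann (b \<odot>\<^sub>M z) = ann z" using mx bz by blast
        moreover have "a \<in> ann (b \<odot>\<^sub>M z)" using ab zc by (simp add: ann_def M.smult_assoc1)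
        ultimately show ?thesis by blast
      qed
    qed
  qed
  have fin: "finite P"
  proof (rule ccontr)
    assume "infinite P"
    then obtain p :: "nat \<Rightarrow> 'a set" where p: "inj p" "range p \<subseteq> P"
      by (meson infinite_countable_subset)
    have "\<exists>z. z \<in> ?N \<and> p n = ann z \<and> (\<forall>w\<in>?N. ann z \<subseteq> ann w \<longrightarrow> ann w = ann z)" for n
    proof -
      have "p n \<in> P" using p(2) by blast
      then show ?thesis unfolding P_def by blast
    qed
    then have "\<exists>z. \<forall>n. z n \<in> ?N \<and> p n = ann (z n) \<and> (\<forall>w\<in>?N. ann (z n) \<subseteq> ann w \<longrightarrow> ann w = ann (z n))"
      by (intro choice allI)
    then obtain z where z: "!!n. z n \<in> ?N" "!!n. p n = ann (z n)"
      and mx: "!!n w. w \<in> ?N ==> ann (z n) \<subseteq> ann w ==> ann w = ann (z n)"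
      by blast
    have zc: "z n \<in> carrier M" "z n \<notin> K" for n using z(1)[of n] by auto
    have KM: "K \<union> z ` I \<subseteq> carrier M" for I using Kc(6) zc(1) by blast
    let ?L = "\<lambda>n. mod_span R M (K \<union> z ` {..<n})"
    obtain L where L: "L \<in> range ?L" and max: "!!H. H \<in> range ?L ==> L \<subseteq> H ==> H = L"
    proof (rule noeth_module_max[OF M, of "?L 0" "range ?L"])
      show "!!H. H \<in> range ?L ==> submodule H R M" using M.mod_span_submodule[OF KM] by blast
    qed blast+
    obtain n where n: "L = ?L n" using L by blast
    have "L \<subseteq> ?L (Suc n)"
      unfolding n using mod_span_base[of "K \<union> z ` {..<Suc n}" R M]
      by (intro mod_span_least M.mod_span_submodule KM) (auto simp: less_Suc_eq)
    then have "?L (Suc n) = L" using max by blast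
    moreover have "z n \<in> ?L (Suc n)" using mod_span_base[of "K \<union> z ` {..<Suc n}" R M] by auto
    ultimately have zn: "z n \<in> ?L n" unfolding n by blast
    have prn: "primeideal (ann (z n)) R" using prime[of "p n"] p(2) z(2) by auto
    have "\<exists>r\<in>carrier R. r \<notin> ann (z n) \<and> (\<forall>i<k. r \<in> ann (z i))" if "k \<le> n" for k
      using that
    proof (induction k)
      case 0
      have "\<one> \<notin> ann (z n)" using zc by (simp add: ann_def)
      then show ?case by (intro bexI[of _ \<one>]) auto
    next
      case (Suc k)
      then obtain r where r: "r \<in> carrier R" "r \<notin> ann (z n)" "\<forall>i<k. r \<in> ann (z i)" by auto
      have "\<not> ann (z k) \<subseteq> ann (z n)"
      proof
        assume "ann (z k) \<subseteq> ann (z n)"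
        then have "ann (z n) = ann (z k)" using mx z(1) by blast
        then have "p n = p k" using z(2) by simp
        then show False using p(1) Suc.prems by (simp add: inj_eq)
      qed
      then obtain s where s: "s \<in> ann (z k)" "s \<notin> ann (z n)" by blast
      have sc: "s \<in> carrier R" using s(1) by (simp add: ann_def)
      have "s \<otimes> r \<notin> ann (z n)" using primeideal.I_prime[OF prn sc r(1)] r(2) s(2) by blast
      moreover have "s \<otimes> r \<in> ann (z i)" if "i < Suc k" for i
        using that r(3) ideal.I_l_closed[OF annI[OF zc(1)] _ sc, of r i]
          ideal.I_r_closed[OF annI[OF zc(1)] s(1) r(1)] by (auto simp: less_Suc_eq)
      ultimately show ?case using sc r(1) by blast
    qed
    then obtain r where r: "r \<in> carrier R" "r \<notin> ann (z n)" "\<forall>i<n. r \<in> ann (z i)" by blast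
    have "?L n \<subseteq> {v \<in> carrier M. r \<odot>\<^sub>M v \<in> K}"
    proof (rule mod_span_least)
      show "submodule {v \<in> carrier M. r \<odot>\<^sub>M v \<in> K} R M"
        using preimage_submodule[OF M.module_axioms M.module_axioms M.smult_hom[OF r(1)] K] .
      show "K \<union> z ` {..<n} \<subseteq> {v \<in> carrier M. r \<odot>\<^sub>M v \<in> K}"
        using Kc(5)[OF r(1)] Kc(6) zc(1) r(3) by (auto simp: ann_def)
    qed
    then show False using zn r(1,2) by (auto simp: ann_def)
  qed
  show ?thesis
  proof (rule that[OF fin prime])
    fix p assume "p \<in> P"
    then obtain z where z: "z \<in> ?N" "p = ann z" unfolding P_def by blast
    show "\<not> max_ideal R \<subseteq> p"
    proof
      assume "max_ideal R \<subseteq> p"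
      then have "has_socle R M K" unfolding has_socle_def using z by (auto simp: ann_def)
      then show False using ns by blast
    qed
  next
    fix x assume x: "x \<in> carrier R" "\<forall>p\<in>P. x \<notin> p"
    show "nzd M K x" unfolding nzd_def
    proof (intro ballI impI)
      fix v assume v: "v \<in> carrier M" "x \<odot>\<^sub>M v \<in> K"
      show "v \<in> K"
      proof (rule ccontr)
        assume "v \<notin> K"
        then obtain p where "p \<in> P" "ann v \<subseteq> p" using big v(1) by blast
        moreover have "x \<in> ann v" using v x by (simp add: ann_def)
        ultimately show False using x(2) by blast
      qed
    qed
  qed
qed

text \<open>Prime avoidance, applied to the primes of all the quotients together.  Two ambient modules are allowed because
  an element that is regular both on \<open>N\<close> and on a homology module of \<open>P \<otimes> N\<close> is wanted later.\<close>
lemma nzd_exists: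
  assumes M: "noeth_module R M" and F: "finite F" "!!K. K \<in> F ==> submodule K R M \<and> \<not> has_socle R M K"
    and N: "noeth_module R N" and G: "finite G" "!!K. K \<in> G ==> submodule K R N \<and> \<not> has_socle R N K"
  obtains x where "x \<in> max_ideal R" "!!K. K \<in> F ==> nzd M K x" "!!K. K \<in> G ==> nzd N K x"
proof -
  have "\<exists>P. finite P \<and> (\<forall>p\<in>P. primeideal p R \<and> \<not> max_ideal R \<subseteq> p) \<and>
      (\<forall>x\<in>carrier R. (\<forall>p\<in>P. x \<notin> p) \<longrightarrow> nzd M K x)" if "K \<in> F" for K
    using nzd_outside_finitely_many_primes[OF M, of K] F(2)[OF that] by metis
  then obtain P where P: "!!K. K \<in> F ==> finite (P K)"
    "!!K p. K \<in> F ==> p \<in> P K ==> primeideal p R \<and> \<not> max_ideal R \<subseteq> p"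
    "!!K x. K \<in> F ==> x \<in> carrier R ==> (\<forall>p\<in>P K. x \<notin> p) ==> nzd M K x" by metis
  have "\<exists>P. finite P \<and> (\<forall>p\<in>P. primeideal p R \<and> \<not> max_ideal R \<subseteq> p) \<and>
      (\<forall>x\<in>carrier R. (\<forall>p\<in>P. x \<notin> p) \<longrightarrow> nzd N K x)" if "K \<in> G" for K
    using nzd_outside_finitely_many_primes[OF N, of K] G(2)[OF that] by metis
  then obtain Q where Q: "!!K. K \<in> G ==> finite (Q K)"
    "!!K p. K \<in> G ==> p \<in> Q K ==> primeideal p R \<and> \<not> max_ideal R \<subseteq> p"
    "!!K x. K \<in> G ==> x \<in> carrier R ==> (\<forall>p\<in>Q K. x \<notin> p) ==> nzd N K x" by metis
  have "\<exists>x\<in>max_ideal R. \<forall>p\<in>(\<Union>K\<in>F. P K) \<union> (\<Union>K\<in>G. Q K). x \<notin> p"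
  proof (rule prime_avoidance)
    show "finite ((\<Union>K\<in>F. P K) \<union> (\<Union>K\<in>G. Q K))" using F(1) G(1) P(1) Q(1) by blast
  qed (use P(2) Q(2) max_ideal_ideal in blast)+
  then obtain x where x: "x \<in> max_ideal R" "\<forall>p\<in>(\<Union>K\<in>F. P K) \<union> (\<Union>K\<in>G. Q K). x \<notin> p" by blast
  note xc = max_ideal_carr[OF x(1)]
  show ?thesis
  proof (rule that[OF x(1)])
    show "nzd M K x" if "K \<in> F" for K using x(2) that by (intro P(3)[OF that xc]) blast
    show "nzd N K x" if "K \<in> G" for K using x(2) that by (intro Q(3)[OF that xc]) blast
  qed
qed

end

lemmas (in module) module_normalise = smult_r_distr smult_r_minus smult_assoc1[symmetric]
  R.m_comm R.m_lcomm R.m_assoc group_normalise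

context noeth_local_ring
begin

text \<open>If \<open>z\<close> represents a socle element of \<open>M/(K + xM)\<close> and \<open>yz = k + xw\<close>, then \<open>w\<close> represents
  one of \<open>M/(K + yM)\<close>.\<close>
lemma has_socle_exchange:
  assumes M: "module R M" and K: "submodule K R M"
    and x: "x \<in> max_ideal R" "nzd M K x" and y: "y \<in> max_ideal R" "nzd M K y"
    and s: "has_socle R M (plus_mult M K x)"
  shows "has_socle R M (plus_mult M K y)"
proof -
  interpret M: module R M by fact
  note Kc = M.submodule_closed[OF K]
  have c: "x \<in> carrier R" "y \<in> carrier R" using x y max_ideal_carr by auto
  note Sx = M.plus_mult_submodule[OF K c(1)]
  obtain z where z: "z \<in> carrier M" "z \<notin> plus_mult M K x"
    "!!a. a \<in> max_ideal R ==> a \<odot>\<^sub>M z \<in> plus_mult M K x" using s by (rule has_socleE) blast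
  obtain k w where w: "k \<in> K" "w \<in> carrier M" "y \<odot>\<^sub>M z = k \<oplus>\<^sub>M x \<odot>\<^sub>M w"
    using z(3)[OF y(1)] by (rule plus_multE)
  have kc: "k \<in> carrier M" using Kc(6) w(1) .
  show ?thesis unfolding has_socle_def
  proof (intro bexI[OF _ w(2)] conjI ballI notI)
    assume "w \<in> plus_mult M K y"
    then obtain k' w' where w': "k' \<in> K" "w' \<in> carrier M" "w = k' \<oplus>\<^sub>M y \<odot>\<^sub>M w'" by (rule plus_multE)
    have k'c: "k' \<in> carrier M" using Kc(6) w'(1) .
    have "y \<odot>\<^sub>M (z \<ominus>\<^sub>M x \<odot>\<^sub>M w') = y \<odot>\<^sub>M z \<ominus>\<^sub>M y \<odot>\<^sub>M (x \<odot>\<^sub>M w')"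
      using c z(1) w'(2) by (simp add: M.module_normalise)
    also have "\<dots> = k \<oplus>\<^sub>M x \<odot>\<^sub>M k'"
      unfolding w(3) w'(3) using c kc k'c w'(2) by (simp add: M.module_normalise)
    finally have "y \<odot>\<^sub>M (z \<ominus>\<^sub>M x \<odot>\<^sub>M w') \<in> K" using Kc(2)[OF w(1) Kc(5)[OF c(1) w'(1)]] by simp
    then have "z \<ominus>\<^sub>M x \<odot>\<^sub>M w' \<in> K" using nzdD[OF y(2)] z(1) w'(2) c by simp
    then have "z \<ominus>\<^sub>M x \<odot>\<^sub>M w' \<in> plus_mult M K x" using M.plus_mult_incl(1)[OF K c(1)] by blast
    then show False
      using M.submodule_add_iff(3)[OF Sx z(1) M.plus_mult_incl(2)[OF K c(1) w'(2)]] z(2) by simp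
  next
    fix a assume a: "a \<in> max_ideal R"
    have ac: "a \<in> carrier R" using a by (rule max_ideal_carr)
    obtain k' w' where w': "k' \<in> K" "w' \<in> carrier M" "a \<odot>\<^sub>M z = k' \<oplus>\<^sub>M x \<odot>\<^sub>M w'"
      using z(3)[OF a] by (rule plus_multE)
    have k'c: "k' \<in> carrier M" using Kc(6) w'(1) .
    have xw: "x \<odot>\<^sub>M w = y \<odot>\<^sub>M z \<ominus>\<^sub>M k"
      unfolding w(3) using kc w(2) c by (simp add: M.module_normalise)
    have "x \<odot>\<^sub>M (a \<odot>\<^sub>M w \<ominus>\<^sub>M y \<odot>\<^sub>M w') = a \<odot>\<^sub>M (x \<odot>\<^sub>M w) \<ominus>\<^sub>M x \<odot>\<^sub>M (y \<odot>\<^sub>M w')"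
      using c ac w(2) w'(2) by (simp add: M.module_normalise)
    also have "\<dots> = y \<odot>\<^sub>M (a \<odot>\<^sub>M z) \<ominus>\<^sub>M a \<odot>\<^sub>M k \<ominus>\<^sub>M x \<odot>\<^sub>M (y \<odot>\<^sub>M w')"
      unfolding xw using c ac z(1) kc w'(2) by (simp add: M.module_normalise)
    also have "\<dots> = y \<odot>\<^sub>M k' \<ominus>\<^sub>M a \<odot>\<^sub>M k"
      unfolding w'(3) using c ac kc k'c w'(2) by (simp add: M.module_normalise)
    finally have "x \<odot>\<^sub>M (a \<odot>\<^sub>M w \<ominus>\<^sub>M y \<odot>\<^sub>M w') \<in> K"
      using Kc(4)[OF Kc(5)[OF c(2) w'(1)] Kc(5)[OF ac w(1)]] by simp
    then have "a \<odot>\<^sub>M w \<ominus>\<^sub>M y \<odot>\<^sub>M w' \<in> K" using nzdD[OF x(2)] w(2) w'(2) c ac by simp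
    then have "a \<odot>\<^sub>M w \<ominus>\<^sub>M y \<odot>\<^sub>M w' \<in> plus_mult M K y" using M.plus_mult_incl(1)[OF K c(2)] by blast
    then show "a \<odot>\<^sub>M w \<in> plus_mult M K y"
      using M.submodule_add_iff(3)[OF M.plus_mult_submodule[OF K c(2)] _ M.plus_mult_incl(2)[OF K c(2) w'(2)]]
        ac w(2) by simp
  qed
qed

text \<open>If \<open>xv = k + zw\<close>, then \<open>w = k' + xw'\<close> since \<open>z\<close> is regular on \<open>M/(K + xM)\<close>, and \<open>x(v - zw')\<close> lies in \<open>K\<close>.\<close>
lemma nzd_swap:
  assumes M: "module R M" and K: "submodule K R M" and c: "x \<in> carrier R" "z \<in> carrier R"
    and x: "nzd M K x" and z: "nzd M (plus_mult M K x) z"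
  shows "nzd M (plus_mult M K z) x"
  unfolding nzd_def
proof (intro ballI impI)
  interpret M: module R M by fact
  note Kc = M.submodule_closed[OF K]
  fix n assume n: "n \<in> carrier M" "x \<odot>\<^sub>M n \<in> plus_mult M K z"
  obtain k w where w: "k \<in> K" "w \<in> carrier M" "x \<odot>\<^sub>M n = k \<oplus>\<^sub>M z \<odot>\<^sub>M w" using n(2) by (rule plus_multE)
  have kc: "k \<in> carrier M" using Kc(6) w(1) .
  have "z \<odot>\<^sub>M w = (\<ominus>\<^sub>M k) \<oplus>\<^sub>M x \<odot>\<^sub>M n" unfolding w(3) using kc w(2) c by (simp add: M.module_normalise)
  then have "z \<odot>\<^sub>M w \<in> plus_mult M K x" using plus_multI[OF Kc(3)[OF w(1)] n(1)] by simp
  then have "w \<in> plus_mult M K x" using nzdD[OF z w(2)] by simp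
  then obtain k' w' where w': "k' \<in> K" "w' \<in> carrier M" "w = k' \<oplus>\<^sub>M x \<odot>\<^sub>M w'" by (rule plus_multE)
  have k'c: "k' \<in> carrier M" using Kc(6) w'(1) .
  have "x \<odot>\<^sub>M (n \<ominus>\<^sub>M z \<odot>\<^sub>M w') = x \<odot>\<^sub>M n \<ominus>\<^sub>M x \<odot>\<^sub>M (z \<odot>\<^sub>M w')"
    using c n(1) w'(2) by (simp add: M.module_normalise)
  also have "\<dots> = k \<oplus>\<^sub>M z \<odot>\<^sub>M k'"
    unfolding w(3) w'(3) using c kc k'c w'(2) by (simp add: M.module_normalise)
  finally have "x \<odot>\<^sub>M (n \<ominus>\<^sub>M z \<odot>\<^sub>M w') \<in> K" using Kc(2)[OF w(1) Kc(5)[OF c(2) w'(1)]] by simp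
  then have d: "n \<ominus>\<^sub>M z \<odot>\<^sub>M w' \<in> K" using nzdD[OF x] n(1) w'(2) c by simp
  have "n = (n \<ominus>\<^sub>M z \<odot>\<^sub>M w') \<oplus>\<^sub>M z \<odot>\<^sub>M w'" using n(1) w'(2) c by (simp add: M.module_normalise)
  then show "n \<in> plus_mult M K z" using plus_multI[OF d w'(2)] by metis
qed

text \<open>All maximal regular sequences have the same length.  To pass from a sequence that starts
  with \<open>y\<close> to one that starts with \<open>x\<close>, choose \<open>z\<close> regular on \<open>M/K\<close>, \<open>M/(K + xM)\<close> and
  \<open>M/(K + yM)\<close> and go through sequences that start with \<open>y, z\<close>, then \<open>z, y\<close>, \<open>z, x\<close> and \<open>x, z\<close>.\<close>
lemma depth_is_cut:
  assumes M: "noeth_module R M" and K: "submodule K R M"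
    and x: "x \<in> max_ideal R" "nzd M K x" and d: "depth_is R M t K"
  shows "\<exists>t'. t = Suc t' \<and> depth_is R M t' (plus_mult M K x)"
  using K x d
proof (induction t arbitrary: K x)
  case 0
  then show ?case using nzd_no_socle[OF 0(3,2)] by simp
next
  case (Suc t)
  have Mm: "module R M" using M by (rule noeth_module_module)
  interpret M: module R M by (rule Mm)
  note K = Suc.prems(1) and x = Suc.prems(2,3)
  obtain y where y: "y \<in> max_ideal R" "nzd M K y" "depth_is R M t (plus_mult M K y)"
    using Suc.prems(4) by auto
  note xc = max_ideal_carr[OF x(1)] and yc = max_ideal_carr[OF y(1)]
  note Kx = M.plus_mult_submodule[OF K xc] and Ky = M.plus_mult_submodule[OF K yc]
  show ?case
  proof (cases t)
    case 0
    then show ?thesis using has_socle_exchange[OF Mm K y(1,2) x] y(3) by auto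
  next
    case (Suc t0)
    have nsy: "\<not> has_socle R M (plus_mult M K y)"
      using y(3) nzd_no_socle unfolding Suc by auto
    then have nsx: "\<not> has_socle R M (plus_mult M K x)"
      using has_socle_exchange[OF Mm K x y(1,2)] by blast
    have ns: "\<not> has_socle R M K" using nzd_no_socle[OF x(2,1)] .
    obtain z where z: "z \<in> max_ideal R"
      and zn: "!!L. L \<in> {K, plus_mult M K x, plus_mult M K y} ==> nzd M L z"
      using nzd_exists[OF M, of "{K, plus_mult M K x, plus_mult M K y}", OF _ _ M, of "{}"]
        K Kx Ky ns nsx nsy by auto
    note zc = max_ideal_carr[OF z]
    note Kz = M.plus_mult_submodule[OF K zc]
    obtain t1 where t1: "t = Suc t1" "depth_is R M t1 (plus_mult M (plus_mult M K y) z)"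
      using Suc.IH[OF Ky z zn y(3)] by auto
    have "depth_is R M t (plus_mult M K z)"
      unfolding t1(1) depth_is.simps
      using y(1) nzd_swap[OF Mm K yc zc y(2) zn] t1(2) M.plus_mult_commute[OF K yc zc] by auto
    then obtain t2 where t2: "t = Suc t2" "depth_is R M t2 (plus_mult M (plus_mult M K z) x)"
      using Suc.IH[OF Kz x(1) nzd_swap[OF Mm K xc zc x(2) zn]] by auto
    have "depth_is R M t (plus_mult M K x)"
      unfolding t2(1) depth_is.simps
      using z zn[of "plus_mult M K x"] t2(2) M.plus_mult_commute[OF K xc zc] by auto
    then show ?thesis by blast
  qed
qed

text \<open>Cutting by a regular element enlarges \<open>K\<close> strictly and keeps it proper by Nakayama's lemma, so the chain
  condition brings the process to a submodule with a socle element.\<close>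
lemma depth_is_exists:
  assumes M: "noeth_module R M" and K: "submodule K R M" "K \<noteq> carrier M"
  shows "\<exists>t. depth_is R M t K"
  using noeth_module_wf[OF M] K
proof (induction K rule: wf_induct_rule)
  case (less K)
  interpret M: module R M using M by (rule noeth_module_module)
  note K = less.prems
  show ?case
  proof (cases "has_socle R M K")
    case True
    then have "depth_is R M 0 K" by simp
    then show ?thesis by blast
  next
    case False
    obtain x where x: "x \<in> max_ideal R" "nzd M K x"
      using nzd_exists[OF M, of "{K}", OF _ _ M, of "{}"] K False by auto
    note xc = max_ideal_carr[OF x(1)]
    note Kx = M.plus_mult_submodule[OF K(1) xc]
    obtain L where L: "submodule L R M" "K \<subseteq> L" "L \<noteq> carrier M"
      "!!a v. a \<in> max_ideal R ==> v \<in> carrier M ==> a \<odot>\<^sub>M v \<in> L" using nakayama[OF M K] by blast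
    have "plus_mult M K x \<subseteq> L" using L(1,2) L(4)[OF x(1)] by (rule M.plus_mult_least)
    then have ne: "plus_mult M K x \<noteq> carrier M" using L(3) M.submodule_closed(6)[OF L(1)] by blast
    have "K \<noteq> plus_mult M K x"
    proof
      assume e: "K = plus_mult M K x"
      have "v \<in> K" if v: "v \<in> carrier M" for v
        using nzdD[OF x(2) v] M.plus_mult_incl(2)[OF K(1) xc v] e by simp
      then show False using K(2) M.submodule_closed(6)[OF K(1)] by blast
    qed
    then have "K \<subset> plus_mult M K x" using M.plus_mult_incl(1)[OF K(1) xc] by blast
    then obtain t where "depth_is R M t (plus_mult M K x)" using less.IH[OF _ Kx ne] K(1) Kx by blast
    then have "depth_is R M (Suc t) K" using x by auto
    then show ?thesis by blast
  qed
qed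

subsection \<open>Comparison with regular sequences\<close>

lemma scalars_times_insert:
  assumes M: "module R M" and X: "insert x X \<subseteq> carrier R"
  shows "scalars_times R (insert x X) M = plus_mult M (scalars_times R X M) x"
proof -
  interpret M: module R M by fact
  let ?G = "\<lambda>X. {x \<odot>\<^sub>M m | x m. x \<in> X \<and> m \<in> carrier M}"
  have G: "?G X \<subseteq> carrier M" "?G (insert x X) \<subseteq> carrier M" using X by blast+
  note SX = M.mod_span_submodule[OF G(1)] and SxX = M.mod_span_submodule[OF G(2)]
  have xc: "x \<in> carrier R" using X by blast
  have "mod_span R M (?G (insert x X)) \<subseteq> plus_mult M (mod_span R M (?G X)) x"
  proof (rule mod_span_least[OF M.plus_mult_submodule[OF SX xc]])
    have "?G X \<subseteq> plus_mult M (mod_span R M (?G X)) x"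
      using M.plus_mult_incl(1)[OF SX xc] mod_span_base[of "?G X" R M] by blast
    then show "?G (insert x X) \<subseteq> plus_mult M (mod_span R M (?G X)) x"
      using M.plus_mult_incl(2)[OF SX xc] by blast
  qed
  moreover have "plus_mult M (mod_span R M (?G X)) x \<subseteq> mod_span R M (?G (insert x X))"
  proof (rule M.plus_mult_least[OF SxX])
    show "mod_span R M (?G X) \<subseteq> mod_span R M (?G (insert x X))"
      using mod_span_base[of "?G (insert x X)" R M] by (intro mod_span_least[OF SxX]) blast
    show "x \<odot>\<^sub>M v \<in> mod_span R M (?G (insert x X))" if "v \<in> carrier M" for v
      using mod_span_base[of "?G (insert x X)" R M] that by blast
  qed
  ultimately show ?thesis unfolding scalars_times_def by blast
qed

lemma scalars_times_foldl:
  assumes M: "module R M" and X: "set xs \<subseteq> carrier R"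
  shows "submodule (foldl (plus_mult M) {\<zero>\<^sub>M} xs) R M"
    "scalars_times R (set xs) M = foldl (plus_mult M) {\<zero>\<^sub>M} xs"
proof -
  interpret M: module R M by fact
  have "submodule (foldl (plus_mult M) {\<zero>\<^sub>M} xs) R M \<and>
    scalars_times R (set xs) M = foldl (plus_mult M) {\<zero>\<^sub>M} xs"
    using X
  proof (induction xs rule: rev_induct)
    case Nil
    have "mod_span R M {} \<subseteq> {\<zero>\<^sub>M}" by (rule mod_span_least[OF M.zero_submodule]) simp
    moreover have "\<zero>\<^sub>M \<in> mod_span R M {}"
      by (rule M.submodule_closed(1)[OF M.mod_span_submodule]) simp
    ultimately show ?case using M.zero_submodule by (auto simp: scalars_times_def)
  next
    case (snoc x xs)
    then show ?case
      using scalars_times_insert[OF M, of x "set xs"] M.plus_mult_submodule[of _ x] by simp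
  qed
  then show "submodule (foldl (plus_mult M) {\<zero>\<^sub>M} xs) R M"
    "scalars_times R (set xs) M = foldl (plus_mult M) {\<zero>\<^sub>M} xs" by auto
qed

lemma nonzerodivisor_on_quot:
  assumes M: "module R M" and K: "submodule K R M" and x: "x \<in> carrier R"
  shows "nonzerodivisor_on x (quot_module M K) \<longleftrightarrow> nzd M K x"
proof -
  interpret M: module R M by fact
  note q = M.quot_simps[OF K] and p = M.quot_proj[OF K]
  have "nonzerodivisor_on x (quot_module M K) \<longleftrightarrow> (\<forall>v\<in>carrier M.
      x \<odot>\<^bsub>quot_module M K\<^esub> (K +>\<^bsub>M\<^esub> v) = \<zero>\<^bsub>quot_module M K\<^esub> \<longrightarrow> K +>\<^bsub>M\<^esub> v = \<zero>\<^bsub>quot_module M K\<^esub>)"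
    unfolding nonzerodivisor_on_def q(1) by blast
  also have "\<dots> \<longleftrightarrow> nzd M K x" unfolding nzd_def using p(3) q(3) x by simp
  finally show ?thesis .
qed

end

fun regular_mod :: "('a, 'b, 'm) module_scheme \<Rightarrow> 'b set \<Rightarrow> 'a list \<Rightarrow> bool" where
  "regular_mod M K [] \<longleftrightarrow> True"
| "regular_mod M K (x # xs) \<longleftrightarrow> nzd M K x \<and> regular_mod M (plus_mult M K x) xs"

lemma regular_mod_iff_nth:
  "regular_mod M K xs \<longleftrightarrow> (\<forall>i<length xs. nzd M (foldl (plus_mult M) K (take i xs)) (xs ! i))"
proof (induction xs arbitrary: K)
  case (Cons x xs)
  show ?case unfolding regular_mod.simps Cons.IH
    by (auto simp: less_Suc_eq_0_disj)
qed simp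

context noeth_local_ring
begin

lemma depth_is_sequence:
  assumes "depth_is R M t K"
  obtains xs where "length xs = t" "set xs \<subseteq> max_ideal R" "regular_mod M K xs"
    "has_socle R M (foldl (plus_mult M) K xs)"
proof -
  have "\<exists>xs. length xs = t \<and> set xs \<subseteq> max_ideal R \<and> regular_mod M K xs \<and>
    has_socle R M (foldl (plus_mult M) K xs)"
    using assms
  proof (induction t arbitrary: K)
    case (Suc t)
    then obtain x where x: "x \<in> max_ideal R" "nzd M K x" "depth_is R M t (plus_mult M K x)" by auto
    obtain xs where "length xs = t \<and> set xs \<subseteq> max_ideal R \<and> regular_mod M (plus_mult M K x) xs \<and>
      has_socle R M (foldl (plus_mult M) (plus_mult M K x) xs)" using Suc.IH[OF x(3)] by blast
    then show ?case using x by (intro exI[of _ "x # xs"]) auto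
  qed simp
  then show ?thesis using that by blast
qed

lemma regular_mod_length:
  assumes M: "noeth_module R M" and K: "submodule K R M" and d: "depth_is R M t K"
    and xs: "set xs \<subseteq> max_ideal R" "regular_mod M K xs"
  shows "length xs \<le> t"
  using K d xs
proof (induction xs arbitrary: K t)
  case (Cons x xs)
  interpret M: module R M using M by (rule noeth_module_module)
  have x: "x \<in> max_ideal R" "nzd M K x" using Cons.prems by auto
  obtain t' where "t = Suc t'" "depth_is R M t' (plus_mult M K x)"
    using depth_is_cut[OF M Cons.prems(1) x Cons.prems(2)] by blast
  then show ?case
    using Cons.IH[OF M.plus_mult_submodule[OF Cons.prems(1) max_ideal_carr[OF x(1)]]] Cons.prems by auto
qed simp

lemma depth_eqI:
  assumes M: "noeth_module R M" and d: "depth_is R M t {\<zero>\<^sub>M}"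
  shows "depth R M = enat t"
proof -
  have Mm: "module R M" using M by (rule noeth_module_module)
  interpret M: module R M by (rule Mm)
  obtain xs where xs: "length xs = t" "set xs \<subseteq> max_ideal R" "regular_mod M {\<zero>\<^sub>M} xs"
    "has_socle R M (foldl (plus_mult M) {\<zero>\<^sub>M} xs)" using d by (rule depth_is_sequence)
  have reg: "regular_sequence R M ys \<longleftrightarrow> regular_mod M {\<zero>\<^sub>M} ys \<and>
      \<not> carrier M \<subseteq> foldl (plus_mult M) {\<zero>\<^sub>M} ys" if ys: "set ys \<subseteq> max_ideal R" for ys
  proof -
    have c: "set ys \<subseteq> carrier R" using ys max_ideal_carr by blast
    have t: "set (take i ys) \<subseteq> carrier R" for i using c set_take_subset[of i ys] by blast
    have "nonzerodivisor_on (ys ! i) (quot_module M (scalars_times R (set (take i ys)) M)) \<longleftrightarrow>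
        nzd M (foldl (plus_mult M) {\<zero>\<^sub>M} (take i ys)) (ys ! i)" if "i < length ys" for i
    proof -
      have "ys ! i \<in> carrier R" using c that by auto
      then show ?thesis
        unfolding scalars_times_foldl(2)[OF Mm t]
        by (rule nonzerodivisor_on_quot[OF Mm scalars_times_foldl(1)[OF Mm t]])
    qed
    moreover have "zero_module (quot_module M (scalars_times R (set ys) M)) \<longleftrightarrow>
        carrier M \<subseteq> foldl (plus_mult M) {\<zero>\<^sub>M} ys"
      unfolding scalars_times_foldl(2)[OF Mm c] by (rule M.zero_quot_iff[OF scalars_times_foldl(1)[OF Mm c]])
    ultimately show ?thesis unfolding regular_sequence_def regular_mod_iff_nth using c by auto
  qed
  have c: "set xs \<subseteq> carrier R" using xs(2) max_ideal_carr by blast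
  obtain z where z: "z \<in> carrier M" "z \<notin> foldl (plus_mult M) {\<zero>\<^sub>M} xs" using xs(4) by (rule has_socleE) blast
  then have "z \<noteq> \<zero>\<^sub>M" using M.submodule_closed(1)[OF scalars_times_foldl(1)[OF Mm c]] by blast
  then have "\<not> zero_module M" using z(1) by (auto simp: zero_module_def)
  moreover have "(SUP xs\<in>{xs. set xs \<subseteq> max_ideal R \<and> regular_sequence R M xs}. enat (length xs)) = enat t"
  proof (rule antisym)
    show "(SUP xs\<in>{xs. set xs \<subseteq> max_ideal R \<and> regular_sequence R M xs}. enat (length xs)) \<le> enat t"
      using regular_mod_length[OF M M.zero_submodule d] reg by (intro SUP_least) auto
    have "xs \<in> {xs. set xs \<subseteq> max_ideal R \<and> regular_sequence R M xs}" using reg xs z by blast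
    then have "enat (length xs) \<le> (SUP xs\<in>{xs. set xs \<subseteq> max_ideal R \<and> regular_sequence R M xs}. enat (length xs))"
      by (rule SUP_upper)
    then show "enat t \<le> (SUP xs\<in>{xs. set xs \<subseteq> max_ideal R \<and> regular_sequence R M xs}. enat (length xs))"
      using xs(1) by simp
  qed
  ultimately show ?thesis unfolding depth_def by simp
qed

text \<open>Submodules of \<open>N\<close> correspond to submodules of \<open>M\<close> that contain the kernel.\<close>
lemma depth_is_image:
  assumes M: "module R M" and N: "module R N"
    and f: "f \<in> mod_hom R M N" "f ` carrier M = carrier N"
    and K: "submodule K R M" "!!x. x \<in> carrier M ==> f x = \<zero>\<^sub>N ==> x \<in> K"
    and d: "depth_is R M t K"
  shows "depth_is R N t (f ` K)"
  using K d
proof (induction t arbitrary: K)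
  interpret M: module R M by (rule M)
  interpret N: module R N by (rule N)
  have mem: "f x \<in> f ` K \<longleftrightarrow> x \<in> K" if K: "submodule K R M" "!!x. x \<in> carrier M ==> f x = \<zero>\<^sub>N ==> x \<in> K"
    and x: "x \<in> carrier M" for x K
  proof
    assume "f x \<in> f ` K"
    then obtain k where k: "k \<in> K" "f x = f k" by blast
    have kc: "k \<in> carrier M" using M.submodule_closed(6)[OF K(1) k(1)] .
    have "f (x \<ominus>\<^sub>M k) = \<zero>\<^sub>N"
      unfolding mod_hom_diff[OF M N f(1) x kc] k(2)
      using mod_hom_closed[OF f(1) kc] by (simp add: N.minus_eq N.r_neg)
    then have "x \<ominus>\<^sub>M k \<in> K" using K(2) x kc by simp
    then show "x \<in> K" using M.submodule_add_iff(3)[OF K(1) x k(1)] by simp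
  qed blast
  {
    case 0
    obtain z where z: "z \<in> carrier M" "z \<notin> K" "!!a. a \<in> max_ideal R ==> a \<odot>\<^sub>M z \<in> K"
      using 0(3) by (auto elim: has_socleE)
    show ?case unfolding depth_is.simps has_socle_def
    proof (intro bexI[OF _ mod_hom_closed[OF f(1) z(1)]] conjI ballI)
      show "f z \<notin> f ` K" using mem[OF 0(1,2) z(1)] z(2) by simp
      fix a assume a: "a \<in> max_ideal R"
      show "a \<odot>\<^sub>N f z \<in> f ` K"
        unfolding mod_hom_smult[OF f(1) max_ideal_carr[OF a] z(1), symmetric] using z(3)[OF a] by blast
    qed
  next
    case (Suc t)
    note K = Suc.prems(1)
    note Kc = M.submodule_closed[OF K]
    obtain x where x: "x \<in> max_ideal R" "nzd M K x" "depth_is R M t (plus_mult M K x)" using Suc.prems(3) by auto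
    note xc = max_ideal_carr[OF x(1)]
    have fe: "f (k \<oplus>\<^sub>M x \<odot>\<^sub>M v) = f k \<oplus>\<^sub>N x \<odot>\<^sub>N f v" if "k \<in> K" "v \<in> carrier M" for k v
      using mod_hom_add[OF f(1) Kc(6)[OF that(1)]] mod_hom_smult[OF f(1) xc that(2)] xc that(2) by simp
    have eq: "plus_mult N (f ` K) x = f ` plus_mult M K x"
    proof (intro equalityI subsetI)
      fix w assume "w \<in> plus_mult N (f ` K) x"
      then obtain k v where "k \<in> K" "v \<in> carrier N" "w = f k \<oplus>\<^sub>N x \<odot>\<^sub>N v" by (auto elim: plus_multE)
      moreover then obtain v' where "v' \<in> carrier M" "v = f v'" unfolding f(2)[symmetric] by blast
      ultimately have "w = f (k \<oplus>\<^sub>M x \<odot>\<^sub>M v')" "k \<oplus>\<^sub>M x \<odot>\<^sub>M v' \<in> plus_mult M K x"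
        using fe by (auto intro: plus_multI)
      then show "w \<in> f ` plus_mult M K x" by blast
    next
      fix w assume "w \<in> f ` plus_mult M K x"
      then obtain k v where "k \<in> K" "v \<in> carrier M" "w = f (k \<oplus>\<^sub>M x \<odot>\<^sub>M v)" by (auto elim: plus_multE)
      then show "w \<in> plus_mult N (f ` K) x" using fe mod_hom_closed[OF f(1)] by (auto intro: plus_multI)
    qed
    have nz: "nzd N (f ` K) x" unfolding nzd_def
    proof (intro ballI impI)
      fix w assume "w \<in> carrier N" and xw: "x \<odot>\<^sub>N w \<in> f ` K"
      then obtain v where v: "v \<in> carrier M" "w = f v" unfolding f(2)[symmetric] by blast
      then have "f (x \<odot>\<^sub>M v) \<in> f ` K" using mod_hom_smult[OF f(1) xc v(1)] xw by simp
      then have "x \<odot>\<^sub>M v \<in> K" using mem[OF K Suc.prems(2), of "x \<odot>\<^sub>M v"] xc v by simp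
      then show "w \<in> f ` K" using nzdD[OF x(2) v(1)] v(2) by blast
    qed
    have "depth_is R N t (plus_mult N (f ` K) x)" unfolding eq
      using Suc.IH[OF M.plus_mult_submodule[OF K xc] _ x(3)] M.plus_mult_incl(1)[OF K xc] Suc.prems(2) by blast
    then show ?case using x(1) nz by auto
  }
qed

lemma depth_image:
  assumes M: "noeth_module R M" and N: "module R N"
    and f: "f \<in> mod_hom R M N" "f ` carrier M = carrier N"
    and K: "submodule K R M" "!!x. x \<in> carrier M ==> f x = \<zero>\<^sub>N \<longleftrightarrow> x \<in> K"
    and d: "depth_is R M t K"
  shows "depth R N = enat t"
proof (rule depth_eqI[OF noeth_module_image[OF M N f]])
  have Mm: "module R M" using M by (rule noeth_module_module)
  have "f ` K = {\<zero>\<^sub>N}"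
    using K(2) module.submodule_closed(1,6)[OF Mm K(1)] by (force simp: image_iff)
  then show "depth_is R N t {\<zero>\<^sub>N}" using depth_is_image[OF Mm N f K(1) _ d] K(2) by simp
qed

lemma depth_is_power:
  assumes M: "module R M" and n: "0 < n"
    and K: "submodule K R M" and d: "depth_is R M t K"
  shows "depth_is R (power_module M n) t ({..<n} \<rightarrow>\<^sub>E K)"
  using K d
proof (induction t arbitrary: K)
  interpret M: module R M by (rule M)
  {
    case 0
    obtain z where z: "z \<in> carrier M" "z \<notin> K" "!!a. a \<in> max_ideal R ==> a \<odot>\<^sub>M z \<in> K"
      using 0(2) by (auto elim: has_socleE)
    show ?case unfolding depth_is.simps has_socle_def
    proof (intro bexI[of _ "\<lambda>i\<in>{..<n}. z"] conjI ballI)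
      show "(\<lambda>i\<in>{..<n}. z) \<notin> {..<n} \<rightarrow>\<^sub>E K" using z(2) n by (auto simp: PiE_iff)
      show "a \<odot>\<^bsub>power_module M n\<^esub> (\<lambda>i\<in>{..<n}. z) \<in> {..<n} \<rightarrow>\<^sub>E K" if "a \<in> max_ideal R" for a
        using z(3)[OF that] by (simp add: power_module_def PiE_iff)
    qed (simp add: power_module_def z(1))
  next
    case (Suc t)
    note K = Suc.prems(1)
    note Kc = M.submodule_closed[OF K]
    obtain x where x: "x \<in> max_ideal R" "nzd M K x" "depth_is R M t (plus_mult M K x)" using Suc.prems(2) by auto
    note xc = max_ideal_carr[OF x(1)]
    have eq: "plus_mult (power_module M n) ({..<n} \<rightarrow>\<^sub>E K) x = {..<n} \<rightarrow>\<^sub>E plus_mult M K x"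
    proof (intro equalityI subsetI)
      fix w assume "w \<in> plus_mult (power_module M n) ({..<n} \<rightarrow>\<^sub>E K) x"
      then obtain k v where kv: "k \<in> {..<n} \<rightarrow>\<^sub>E K" "v \<in> {..<n} \<rightarrow>\<^sub>E carrier M"
        "w = (\<lambda>i\<in>{..<n}. k i \<oplus>\<^sub>M (\<lambda>i\<in>{..<n}. x \<odot>\<^sub>M v i) i)"
        by (auto simp: power_module_def elim: plus_multE)
      have "k i \<oplus>\<^sub>M x \<odot>\<^sub>M v i \<in> plus_mult M K x" if "i \<in> {..<n}" for i
        using PiE_mem[OF kv(1) that] PiE_mem[OF kv(2) that] by (rule plus_multI)
      then show "w \<in> {..<n} \<rightarrow>\<^sub>E plus_mult M K x" unfolding kv(3) by simp
    next
      fix w assume w: "w \<in> {..<n} \<rightarrow>\<^sub>E plus_mult M K x"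
      then have "\<exists>k v. k \<in> K \<and> v \<in> carrier M \<and> w i = k \<oplus>\<^sub>M x \<odot>\<^sub>M v" if "i < n" for i
        using that by (auto simp: PiE_iff elim!: plus_multE)
      then obtain k v where kv: "!!i. i < n ==> k i \<in> K \<and> v i \<in> carrier M \<and> w i = k i \<oplus>\<^sub>M x \<odot>\<^sub>M v i" by metis
      have "w = (\<lambda>i\<in>{..<n}. k i) \<oplus>\<^bsub>power_module M n\<^esub> x \<odot>\<^bsub>power_module M n\<^esub> (\<lambda>i\<in>{..<n}. v i)"
        using kv w by (intro ext) (auto simp: power_module_def PiE_iff extensional_def)
      moreover have "(\<lambda>i\<in>{..<n}. k i) \<in> {..<n} \<rightarrow>\<^sub>E K" "(\<lambda>i\<in>{..<n}. v i) \<in> carrier (power_module M n)"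
        using kv by (auto simp: power_module_def)
      ultimately show "w \<in> plus_mult (power_module M n) ({..<n} \<rightarrow>\<^sub>E K) x" by (metis plus_multI)
    qed
    have "nzd (power_module M n) ({..<n} \<rightarrow>\<^sub>E K) x"
      unfolding nzd_def
    proof (intro ballI impI)
      fix v assume v: "v \<in> carrier (power_module M n)" "x \<odot>\<^bsub>power_module M n\<^esub> v \<in> {..<n} \<rightarrow>\<^sub>E K"
      have "v i \<in> K" if i: "i < n" for i
      proof (rule nzdD[OF x(2)])
        show "v i \<in> carrier M" using v(1) i by (auto simp: power_module_def)
        have "(x \<odot>\<^bsub>power_module M n\<^esub> v) i \<in> K" using v(2) i by (auto simp: PiE_iff)
        then show "x \<odot>\<^sub>M v i \<in> K" using i by (simp add: power_module_def)
      qed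
      then show "v \<in> {..<n} \<rightarrow>\<^sub>E K" using v(1) by (auto simp: power_module_def PiE_iff)
    qed
    then show ?case using x(1) Suc.IH[OF M.plus_mult_submodule[OF K xc] x(3)] by (auto simp: eq)
  }
qed

end

section \<open>The position of a socle element in a complex\<close>

text \<open>Complexes of modules that need not be finitely generated, such as the tensor product of a complex with an
  arbitrary module.\<close>
definition chain_complex :: "('a, 'r) ring_scheme \<Rightarrow> ('a, 'b) cpx \<Rightarrow> bool" where
  "chain_complex R X \<longleftrightarrow> (\<forall>i. module R (obj X i)) \<and>
     (\<forall>i. bd X i \<in> mod_hom R (obj X i) (obj X (i - 1))) \<and>
     (\<forall>i. \<forall>x\<in>elems X i. bd X (i - 1) (bd X i x) = \<zero>\<^bsub>obj X (i - 2)\<^esub>)"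

lemma chain_complexD:
  assumes "chain_complex R X"
  shows "module R (obj X i)"
    and "bd X i \<in> mod_hom R (obj X i) (obj X (i - 1))"
    and "bd X (i + 1) \<in> mod_hom R (obj X (i + 1)) (obj X i)"
    and "x \<in> elems X i ==> bd X (i - 1) (bd X i x) = \<zero>\<^bsub>obj X (i - 2)\<^esub>"
    and "x \<in> elems X (i + 1) ==> bd X i (bd X (i + 1) x) = \<zero>\<^bsub>obj X (i - 1)\<^esub>"
    and "x \<in> elems X i ==> bd X i x \<in> elems X (i - 1)"
    and "x \<in> elems X (i + 1) ==> bd X (i + 1) x \<in> elems X i"
proof -
  have h: "bd X i \<in> mod_hom R (obj X i) (obj X (i - 1))" for i
    using assms by (simp add: chain_complex_def)
  have d: "bd X (i - 1) (bd X i x) = \<zero>\<^bsub>obj X (i - 2)\<^esub>" if "x \<in> elems X i" for i x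
    using assms that by (simp add: chain_complex_def)
  show "module R (obj X i)" using assms by (simp add: chain_complex_def)
  show "bd X i \<in> mod_hom R (obj X i) (obj X (i - 1))" by (rule h)
  show h1: "bd X (i + 1) \<in> mod_hom R (obj X (i + 1)) (obj X i)" using h[of "i + 1"] by simp
  show "x \<in> elems X i ==> bd X (i - 1) (bd X i x) = \<zero>\<^bsub>obj X (i - 2)\<^esub>" by (rule d)
  show "x \<in> elems X (i + 1) ==> bd X i (bd X (i + 1) x) = \<zero>\<^bsub>obj X (i - 1)\<^esub>"
    using d[of x "i + 1"] by simp
  show "x \<in> elems X i ==> bd X i x \<in> elems X (i - 1)" using mod_hom_closed[OF h] .
  show "x \<in> elems X (i + 1) ==> bd X (i + 1) x \<in> elems X i" using mod_hom_closed[OF h1] .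
qed

context noeth_local_ring
begin

text \<open>The complex is \<open>X/K\<close>.  If \<open>z\<close> is a socle element of its top homology and \<open>x\<close> is regular on
  all \<open>X\<^sub>i/K\<^sub>i\<close>, then \<open>xz = k + dy\<close> for some \<open>y\<close>, and \<open>y\<close> is a socle element of the top homology
  of \<open>X/(K + xX)\<close>, which sits one degree higher.  Once the sequence is exhausted, the top
  homology is in degree \<open>s\<close>, because \<open>d\<close> kills the non-zero class of \<open>e\<close> in the top module.\<close>
lemma socle_shift:
  assumes X: "chain_complex R X"
    and K: "!!i. submodule (K i) R (obj X i)" "!!i v. v \<in> K i ==> bd X i v \<in> K (i - 1)"
    and xs: "set xs \<subseteq> max_ideal R" "!!i. regular_mod (obj X i) (K i) xs"
    and exact: "!!i v. u < i ==> v \<in> elems X i ==> bd X i v \<in> K (i - 1) ==>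
      \<exists>k\<in>K i. \<exists>w\<in>elems X (i + 1). v = k \<oplus>\<^bsub>obj X i\<^esub> bd X (i + 1) w"
    and z: "z \<in> elems X u" "bd X u z \<in> K (u - 1)"
      "!!k w. k \<in> K u ==> w \<in> elems X (u + 1) ==> z \<noteq> k \<oplus>\<^bsub>obj X u\<^esub> bd X (u + 1) w"
      "!!a. a \<in> max_ideal R ==>
        \<exists>k\<in>K u. \<exists>w\<in>elems X (u + 1). a \<odot>\<^bsub>obj X u\<^esub> z = k \<oplus>\<^bsub>obj X u\<^esub> bd X (u + 1) w"
    and top: "!!i. s < i ==> zero_module (obj X i)"
    and e: "e \<in> elems X s" "e \<notin> foldl (plus_mult (obj X s)) (K s) xs"
      "bd X s e \<in> foldl (plus_mult (obj X (s - 1))) (K (s - 1)) xs"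
  shows "s = u + int (length xs)"
  using K xs exact z e
proof (induction xs arbitrary: K u z)
  case Nil
  note prems = Nil.prems
  note cD = chain_complexD[OF X]
  have "s \<le> u"
  proof (rule ccontr)
    assume "\<not> s \<le> u"
    then obtain k w where kw: "k \<in> K s" "w \<in> elems X (s + 1)" "e = k \<oplus>\<^bsub>obj X s\<^esub> bd X (s + 1) w"
      using prems(5)[of s e] prems(10,12) by auto
    interpret S: module R "obj X s" by (rule cD)
    have "w = \<zero>\<^bsub>obj X (s + 1)\<^esub>" using top[of "s + 1"] kw(2) by (simp add: zero_module_def)
    then have "bd X (s + 1) w = \<zero>\<^bsub>obj X s\<^esub>" using mod_hom_zero[OF cD(1) cD(1) cD(3)] by simp
    then have "e = k" using kw S.submodule_closed(6)[OF prems(1) kw(1)] by simp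
    then show False using prems(11) kw(1) by simp
  qed
  moreover have "u \<le> s"
  proof (rule ccontr)
    assume "\<not> u \<le> s"
    then have zz: "z = \<zero>\<^bsub>obj X u\<^esub>" using top[of u] prems(6) by (simp add: zero_module_def)
    interpret U: module R "obj X u" by (rule cD)
    interpret U1: module R "obj X (u + 1)" by (rule cD)
    have "\<zero>\<^bsub>obj X u\<^esub> \<in> K u" by (rule U.submodule_closed(1)[OF prems(1)])
    moreover have "z = \<zero>\<^bsub>obj X u\<^esub> \<oplus>\<^bsub>obj X u\<^esub> bd X (u + 1) \<zero>\<^bsub>obj X (u + 1)\<^esub>"
      unfolding zz using mod_hom_zero[OF cD(1) cD(1) cD(3)] by simp
    ultimately show False using prems(8)[of "\<zero>\<^bsub>obj X u\<^esub>" "\<zero>\<^bsub>obj X (u + 1)\<^esub>"] by simp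
  qed
  ultimately show ?case by simp
next
  case (Cons x xs)
  note cD = chain_complexD[OF X]
  note K = Cons.prems(1) and Kd = Cons.prems(2) and exact = Cons.prems(5)
    and z = Cons.prems(6) and dz = Cons.prems(7) and zn = Cons.prems(8) and za = Cons.prems(9)
  have x: "x \<in> max_ideal R" "x \<in> carrier R" "!!i. nzd (obj X i) (K i) x"
    using Cons.prems(3,4) max_ideal_carr by auto
  note hd = mod_hom_add[OF cD(2)] and hs = mod_hom_smult[OF cD(2) x(2)]
  define K' where "K' i = plus_mult (obj X i) (K i) x" for i
  have K': "submodule (K' i) R (obj X i)" for i
    unfolding K'_def by (rule module.plus_mult_submodule[OF cD(1) K x(2)])
  have Kc: "k \<in> elems X i" if "k \<in> K i" for k i
    using module.submodule_closed(6)[OF cD(1) K that] .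
  have K'd: "bd X i v \<in> K' (i - 1)" if v: "v \<in> K' i" for i v
  proof -
    obtain k w where kw: "k \<in> K i" "w \<in> elems X i" "v = k \<oplus>\<^bsub>obj X i\<^esub> x \<odot>\<^bsub>obj X i\<^esub> w"
      using v unfolding K'_def by (rule plus_multE)
    interpret I: module R "obj X i" by (rule cD)
    have "bd X i v = bd X i k \<oplus>\<^bsub>obj X (i - 1)\<^esub> x \<odot>\<^bsub>obj X (i - 1)\<^esub> bd X i w"
      unfolding kw(3) using Kc[OF kw(1)] kw(2) x(2) by (simp add: hd hs)
    then show ?thesis using plus_multI[OF Kd[OF kw(1)] cD(6)[OF kw(2)]] by (simp add: K'_def)
  qed
  have exact': "\<exists>k\<in>K' i. \<exists>w\<in>elems X (i + 1). v = k \<oplus>\<^bsub>obj X i\<^esub> bd X (i + 1) w"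
    if i: "u + 1 < i" and v: "v \<in> elems X i" and dv: "bd X i v \<in> K' (i - 1)" for i v
  proof -
    obtain k w where kw: "k \<in> K (i - 1)" "w \<in> elems X (i - 1)"
      "bd X i v = k \<oplus>\<^bsub>obj X (i - 1)\<^esub> x \<odot>\<^bsub>obj X (i - 1)\<^esub> w" using dv unfolding K'_def by (rule plus_multE)
    interpret I: module R "obj X i" by (rule cD)
    interpret I1: module R "obj X (i - 1)" by (rule cD)
    interpret I2: module R "obj X (i - 2)" by (rule cD)
    note k = Kc[OF kw(1)]
    have "bd X (i - 1) (bd X i v) = bd X (i - 1) k \<oplus>\<^bsub>obj X (i - 2)\<^esub> x \<odot>\<^bsub>obj X (i - 2)\<^esub> bd X (i - 1) w"
      unfolding kw(3) using k kw(2) x(2) hd[of k "i - 1"] hs[of w "i - 1"] by simp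
    then have "\<zero>\<^bsub>obj X (i - 2)\<^esub> = bd X (i - 1) k \<oplus>\<^bsub>obj X (i - 2)\<^esub> x \<odot>\<^bsub>obj X (i - 2)\<^esub> bd X (i - 1) w"
      using cD(4)[OF v] by simp
    moreover have "bd X (i - 1) k \<in> K (i - 2)" using Kd[OF kw(1)] by simp
    moreover have dw: "bd X (i - 1) w \<in> elems X (i - 2)" using cD(6)[OF kw(2)] by simp
    ultimately have "x \<odot>\<^bsub>obj X (i - 2)\<^esub> bd X (i - 1) w \<in> K (i - 2)"
      using I2.submodule_add_iff(2)[OF K, of "x \<odot>\<^bsub>obj X (i - 2)\<^esub> bd X (i - 1) w" "bd X (i - 1) k"]
        I2.submodule_closed(1)[OF K] x(2) by simp
    then have "bd X (i - 1) w \<in> K (i - 1 - 1)" using nzdD[OF x(3) dw] by simp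
    then obtain k' w' where k': "k' \<in> K (i - 1)" "w' \<in> elems X i" "w = k' \<oplus>\<^bsub>obj X (i - 1)\<^esub> bd X i w'"
      using exact[of "i - 1" w] i kw(2) by auto
    note k'c = Kc[OF k'(1)]
    have dw': "bd X i w' \<in> elems X (i - 1)" using cD(6)[OF k'(2)] .
    have "bd X i (v \<ominus>\<^bsub>obj X i\<^esub> x \<odot>\<^bsub>obj X i\<^esub> w') = bd X i v \<ominus>\<^bsub>obj X (i - 1)\<^esub> x \<odot>\<^bsub>obj X (i - 1)\<^esub> bd X i w'"
      using v k'(2) x(2) by (simp add: mod_hom_diff[OF cD(1) cD(1) cD(2)] hs)
    also have "\<dots> = k \<oplus>\<^bsub>obj X (i - 1)\<^esub> x \<odot>\<^bsub>obj X (i - 1)\<^esub> k'"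
      unfolding kw(3) k'(3) using k k'c dw' x(2) by (simp add: I1.module_normalise)
    finally have "bd X i (v \<ominus>\<^bsub>obj X i\<^esub> x \<odot>\<^bsub>obj X i\<^esub> w') \<in> K (i - 1)"
      using I1.submodule_closed(2)[OF K kw(1) I1.submodule_closed(5)[OF K x(2) k'(1)]] by simp
    then obtain k2 w2 where w2: "k2 \<in> K i" "w2 \<in> elems X (i + 1)"
      "v \<ominus>\<^bsub>obj X i\<^esub> x \<odot>\<^bsub>obj X i\<^esub> w' = k2 \<oplus>\<^bsub>obj X i\<^esub> bd X (i + 1) w2"
      using exact[of i "v \<ominus>\<^bsub>obj X i\<^esub> x \<odot>\<^bsub>obj X i\<^esub> w'"] i v k'(2) x(2) by auto
    have "v = (v \<ominus>\<^bsub>obj X i\<^esub> x \<odot>\<^bsub>obj X i\<^esub> w') \<oplus>\<^bsub>obj X i\<^esub> x \<odot>\<^bsub>obj X i\<^esub> w'"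
      using v k'(2) x(2) by (simp add: I.module_normalise)
    also have "\<dots> = (k2 \<oplus>\<^bsub>obj X i\<^esub> x \<odot>\<^bsub>obj X i\<^esub> w') \<oplus>\<^bsub>obj X i\<^esub> bd X (i + 1) w2"
      unfolding w2(3) using Kc[OF w2(1)] k'(2) x(2) cD(7)[OF w2(2)] by (simp add: I.a_ac)
    finally have "v = (k2 \<oplus>\<^bsub>obj X i\<^esub> x \<odot>\<^bsub>obj X i\<^esub> w') \<oplus>\<^bsub>obj X i\<^esub> bd X (i + 1) w2" .
    moreover have "k2 \<oplus>\<^bsub>obj X i\<^esub> x \<odot>\<^bsub>obj X i\<^esub> w' \<in> K' i"
      unfolding K'_def by (rule plus_multI[OF w2(1) k'(2)])
    ultimately show ?thesis using w2(2) by blast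
  qed
  interpret U: module R "obj X u" by (rule cD)
  interpret U1: module R "obj X (u + 1)" by (rule cD)
  obtain k y where y: "k \<in> K u" "y \<in> elems X (u + 1)" "x \<odot>\<^bsub>obj X u\<^esub> z = k \<oplus>\<^bsub>obj X u\<^esub> bd X (u + 1) y"
    using za[OF x(1)] by blast
  note k = Kc[OF y(1)] and dy = cD(7)[OF y(2)]
  note hd1 = mod_hom_add[OF cD(3)] and hs1 = mod_hom_smult[OF cD(3)]
    and hm1 = mod_hom_diff[OF cD(1) cD(1) cD(3)]
  have dyeq: "bd X (u + 1) y = (\<ominus>\<^bsub>obj X u\<^esub> k) \<oplus>\<^bsub>obj X u\<^esub> x \<odot>\<^bsub>obj X u\<^esub> z"
    unfolding y(3) using k dy by (simp add: U.group_normalise)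
  have y1: "bd X (u + 1) y \<in> K' (u + 1 - 1)"
    unfolding dyeq K'_def using plus_multI[OF U.submodule_closed(3)[OF K y(1)] z] by simp
  have y2: "y \<noteq> k' \<oplus>\<^bsub>obj X (u + 1)\<^esub> bd X (u + 1 + 1) w'"
    if k': "k' \<in> K' (u + 1)" and w': "w' \<in> elems X (u + 1 + 1)" for k' w'
  proof
    assume yy: "y = k' \<oplus>\<^bsub>obj X (u + 1)\<^esub> bd X (u + 1 + 1) w'"
    obtain k2 v where v: "k2 \<in> K (u + 1)" "v \<in> elems X (u + 1)"
      "k' = k2 \<oplus>\<^bsub>obj X (u + 1)\<^esub> x \<odot>\<^bsub>obj X (u + 1)\<^esub> v" using k' unfolding K'_def by (rule plus_multE)
    note k2 = Kc[OF v(1)] and dv = cD(7)[OF v(2)]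
    note w'c = cD(7)[OF w']
    have dk2: "bd X (u + 1) k2 \<in> K u" using Kd[OF v(1)] by simp
    have "bd X (u + 1) y = bd X (u + 1) k2 \<oplus>\<^bsub>obj X u\<^esub> x \<odot>\<^bsub>obj X u\<^esub> bd X (u + 1) v"
      unfolding yy v(3) using k2 v(2) x(2) w'c dv cD(5)[OF w'] Kc[OF dk2] by (simp add: hd1 hs1)
    then have "x \<odot>\<^bsub>obj X u\<^esub> (z \<ominus>\<^bsub>obj X u\<^esub> bd X (u + 1) v) = k \<oplus>\<^bsub>obj X u\<^esub> bd X (u + 1) k2"
      using y(3) z k dy dv Kc[OF dk2] x(2) by (simp add: U.module_normalise)
    then have "x \<odot>\<^bsub>obj X u\<^esub> (z \<ominus>\<^bsub>obj X u\<^esub> bd X (u + 1) v) \<in> K u"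
      using U.submodule_closed(2)[OF K y(1) dk2] by simp
    then have d: "z \<ominus>\<^bsub>obj X u\<^esub> bd X (u + 1) v \<in> K u" using nzdD[OF x(3)] z dv by simp
    have "z = (z \<ominus>\<^bsub>obj X u\<^esub> bd X (u + 1) v) \<oplus>\<^bsub>obj X u\<^esub> bd X (u + 1) v"
      using z dv by (simp add: U.group_normalise)
    then show False using zn[OF d v(2)] by simp
  qed
  have y3: "\<exists>k\<in>K' (u + 1). \<exists>w\<in>elems X (u + 1 + 1).
      a \<odot>\<^bsub>obj X (u + 1)\<^esub> y = k \<oplus>\<^bsub>obj X (u + 1)\<^esub> bd X (u + 1 + 1) w" if a: "a \<in> max_ideal R" for a
  proof -
    have ac: "a \<in> carrier R" using a by (rule max_ideal_carr)
    obtain k' y' where y': "k' \<in> K u" "y' \<in> elems X (u + 1)" "a \<odot>\<^bsub>obj X u\<^esub> z = k' \<oplus>\<^bsub>obj X u\<^esub> bd X (u + 1) y'"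
      using za[OF a] by blast
    note k' = Kc[OF y'(1)] and dy' = cD(7)[OF y'(2)]
    have "bd X (u + 1) (a \<odot>\<^bsub>obj X (u + 1)\<^esub> y \<ominus>\<^bsub>obj X (u + 1)\<^esub> x \<odot>\<^bsub>obj X (u + 1)\<^esub> y') =
        a \<odot>\<^bsub>obj X u\<^esub> bd X (u + 1) y \<ominus>\<^bsub>obj X u\<^esub> x \<odot>\<^bsub>obj X u\<^esub> bd X (u + 1) y'"
      using ac x(2) y(2) y'(2) by (simp add: hm1 hs1)
    also have "\<dots> = x \<odot>\<^bsub>obj X u\<^esub> (a \<odot>\<^bsub>obj X u\<^esub> z) \<ominus>\<^bsub>obj X u\<^esub> a \<odot>\<^bsub>obj X u\<^esub> k \<ominus>\<^bsub>obj X u\<^esub> x \<odot>\<^bsub>obj X u\<^esub> bd X (u + 1) y'"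
      unfolding dyeq using ac x(2) z k dy' by (simp add: U.module_normalise)
    also have "\<dots> = x \<odot>\<^bsub>obj X u\<^esub> k' \<ominus>\<^bsub>obj X u\<^esub> a \<odot>\<^bsub>obj X u\<^esub> k"
      unfolding y'(3) using ac x(2) k k' dy' by (simp add: U.module_normalise)
    finally have inK: "bd X (u + 1) (a \<odot>\<^bsub>obj X (u + 1)\<^esub> y \<ominus>\<^bsub>obj X (u + 1)\<^esub> x \<odot>\<^bsub>obj X (u + 1)\<^esub> y') \<in> K (u + 1 - 1)"
      using U.submodule_closed(4)[OF K U.submodule_closed(5)[OF K x(2) y'(1)] U.submodule_closed(5)[OF K ac y(1)]]
      by simp
    have inX: "a \<odot>\<^bsub>obj X (u + 1)\<^esub> y \<ominus>\<^bsub>obj X (u + 1)\<^esub> x \<odot>\<^bsub>obj X (u + 1)\<^esub> y' \<in> elems X (u + 1)"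
      using ac x(2) y(2) y'(2) by simp
    obtain k2 w2 where w2: "k2 \<in> K (u + 1)" "w2 \<in> elems X (u + 1 + 1)"
      "a \<odot>\<^bsub>obj X (u + 1)\<^esub> y \<ominus>\<^bsub>obj X (u + 1)\<^esub> x \<odot>\<^bsub>obj X (u + 1)\<^esub> y' = k2 \<oplus>\<^bsub>obj X (u + 1)\<^esub> bd X (u + 1 + 1) w2"
      using exact[OF _ inX inK] by auto
    have "a \<odot>\<^bsub>obj X (u + 1)\<^esub> y = (a \<odot>\<^bsub>obj X (u + 1)\<^esub> y \<ominus>\<^bsub>obj X (u + 1)\<^esub> x \<odot>\<^bsub>obj X (u + 1)\<^esub> y') \<oplus>\<^bsub>obj X (u + 1)\<^esub> x \<odot>\<^bsub>obj X (u + 1)\<^esub> y'"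
      using ac x(2) y(2) y'(2) by (simp add: U1.group_normalise)
    also have "\<dots> = (k2 \<oplus>\<^bsub>obj X (u + 1)\<^esub> x \<odot>\<^bsub>obj X (u + 1)\<^esub> y') \<oplus>\<^bsub>obj X (u + 1)\<^esub> bd X (u + 1 + 1) w2"
      unfolding w2(3) using Kc[OF w2(1)] y'(2) x(2) cD(7)[OF w2(2)] by (simp add: U1.a_ac)
    finally show ?thesis using plus_multI[OF w2(1) y'(2)] w2(2) unfolding K'_def by blast
  qed
  have "s = u + 1 + int (length xs)"
  proof (rule Cons.IH[OF K' K'd _ _ exact' y(2) y1 y2 y3])
    show "set xs \<subseteq> max_ideal R" "!!i. regular_mod (obj X i) (K' i) xs"
      using Cons.prems(3,4) by (auto simp: K'_def)
    show "e \<in> elems X s" by (rule Cons.prems(10))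
    show "e \<notin> foldl (plus_mult (obj X s)) (K' s) xs"
      "bd X s e \<in> foldl (plus_mult (obj X (s - 1))) (K' (s - 1)) xs"
      using Cons.prems(11,12) by (simp_all add: K'_def)
  qed
  then show ?case by simp
qed

text \<open>When the top homology has depth one and \<open>x\<close> is regular on it, passing to \<open>X/xX\<close> produces a socle
  element without moving the top degree.\<close>
lemma socle_shift_depth_one:
  assumes X: "chain_complex R X"
    and xs: "set (x # xs) \<subseteq> max_ideal R" "!!i. regular_mod (obj X i) {\<zero>\<^bsub>obj X i\<^esub>} (x # xs)"
    and exact: "!!i. u < i ==> exact_at X i"
    and reg: "!!v. v \<in> cycles X u ==> x \<odot>\<^bsub>obj X u\<^esub> v \<in> boundaries X u ==> v \<in> boundaries X u"
    and z: "z \<in> cycles X u" "z \<notin> plus_mult (obj X u\<lparr>carrier := cycles X u\<rparr>) (boundaries X u) x"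
      "!!a. a \<in> max_ideal R ==> a \<odot>\<^bsub>obj X u\<^esub> z \<in> plus_mult (obj X u\<lparr>carrier := cycles X u\<rparr>) (boundaries X u) x"
    and top: "!!i. s < i ==> zero_module (obj X i)"
    and e: "e \<in> elems X s" "e \<notin> foldl (plus_mult (obj X s)) {\<zero>\<^bsub>obj X s\<^esub>} (x # xs)"
      "bd X s e \<in> foldl (plus_mult (obj X (s - 1))) {\<zero>\<^bsub>obj X (s - 1)\<^esub>} (x # xs)"
  shows "s = u + int (length xs)"
proof -
  note cD = chain_complexD[OF X]
  have x: "x \<in> max_ideal R" "x \<in> carrier R" "!!i. nzd (obj X i) {\<zero>\<^bsub>obj X i\<^esub>} x"
    using xs max_ideal_carr by auto
  define K where "K i = plus_mult (obj X i) {\<zero>\<^bsub>obj X i\<^esub>} x" for i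
  have memK: "v \<in> K i \<longleftrightarrow> (\<exists>w\<in>elems X i. v = x \<odot>\<^bsub>obj X i\<^esub> w)" for v i
  proof -
    interpret I: module R "obj X i" by (rule cD)
    have "\<zero>\<^bsub>obj X i\<^esub> \<oplus>\<^bsub>obj X i\<^esub> x \<odot>\<^bsub>obj X i\<^esub> w = x \<odot>\<^bsub>obj X i\<^esub> w" if "w \<in> elems X i" for w
      using x(2) that by simp
    then show ?thesis unfolding K_def plus_mult_def by auto metis
  qed
  have K: "submodule (K i) R (obj X i)" for i
    unfolding K_def by (rule module.plus_mult_submodule[OF cD(1) module.zero_submodule[OF cD(1)] x(2)])
  have Kd: "bd X i v \<in> K (i - 1)" if "v \<in> K i" for i v
    using that cD(6) mod_hom_smult[OF cD(2) x(2)] unfolding memK by blast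
  interpret U: module R "obj X u" by (rule cD)
  interpret U1: module R "obj X (u + 1)" by (rule cD)
  show ?thesis
  proof (rule socle_shift[OF X K Kd _ _ _ _ _ _ _ top e(1)])
    show "set xs \<subseteq> max_ideal R" "!!i. regular_mod (obj X i) (K i) xs" using xs by (auto simp: K_def)
    show "e \<notin> foldl (plus_mult (obj X s)) (K s) xs"
      "bd X s e \<in> foldl (plus_mult (obj X (s - 1))) (K (s - 1)) xs"
      using e by (simp_all add: K_def)
    show "z \<in> elems X u" using z(1) by (simp add: cycles_def)
    have "bd X u z = x \<odot>\<^bsub>obj X (u - 1)\<^esub> \<zero>\<^bsub>obj X (u - 1)\<^esub>"
      using z(1) module.smult_r_null[OF cD(1) x(2)] by (simp add: cycles_def)
    then show "bd X u z \<in> K (u - 1)"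
      unfolding memK using abelian_monoid.zero_closed[OF abelian_group.axioms(1)[OF module_abelian_group[OF cD(1)]]]
      by (intro bexI)
  next
    fix i v assume i: "u < i" and v: "v \<in> elems X i" and dv: "bd X i v \<in> K (i - 1)"
    interpret I: module R "obj X i" by (rule cD)
    interpret I1: module R "obj X (i - 1)" by (rule cD)
    interpret I2: module R "obj X (i - 2)" by (rule cD)
    obtain w where w: "w \<in> elems X (i - 1)" "bd X i v = x \<odot>\<^bsub>obj X (i - 1)\<^esub> w"
      using dv unfolding memK by blast
    have dw: "bd X (i - 1) w \<in> elems X (i - 2)" using cD(6)[OF w(1)] by simp
    have "x \<odot>\<^bsub>obj X (i - 2)\<^esub> bd X (i - 1) w = \<zero>\<^bsub>obj X (i - 2)\<^esub>"
      using cD(4)[OF v] unfolding w(2) using mod_hom_smult[OF cD(2) x(2) w(1)] by simp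
    then have "bd X (i - 1) w = \<zero>\<^bsub>obj X (i - 2)\<^esub>" using nzdD[OF x(3) dw] by simp
    then have wcy: "w \<in> cycles X (i - 1)" using w(1) by (simp add: cycles_def)
    have xw: "x \<odot>\<^bsub>obj X (i - 1)\<^esub> w \<in> boundaries X (i - 1)"
      unfolding w(2)[symmetric] boundaries_def using v by simp
    have "w \<in> boundaries X (i - 1)"
    proof (cases "u < i - 1")
      case True then show ?thesis using exact wcy by blast
    next
      case False
      then have "i - 1 = u" using i by simp
      then show ?thesis using reg[of w] wcy xw by simp
    qed
    then obtain w' where w': "w' \<in> elems X i" "w = bd X i w'" unfolding boundaries_def by auto
    have "bd X i (v \<ominus>\<^bsub>obj X i\<^esub> x \<odot>\<^bsub>obj X i\<^esub> w') = \<zero>\<^bsub>obj X (i - 1)\<^esub>"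
      using v w' w x(2) cD(6)[OF w'(1)]
      by (simp add: mod_hom_diff[OF cD(1) cD(1) cD(2)] mod_hom_smult[OF cD(2) x(2)] I1.minus_eq I1.r_neg)
    then have "v \<ominus>\<^bsub>obj X i\<^esub> x \<odot>\<^bsub>obj X i\<^esub> w' \<in> cycles X i" using v w'(1) x(2) by (simp add: cycles_def)
    then obtain w2 where w2: "w2 \<in> elems X (i + 1)" "v \<ominus>\<^bsub>obj X i\<^esub> x \<odot>\<^bsub>obj X i\<^esub> w' = bd X (i + 1) w2"
      using exact[OF i] unfolding boundaries_def by blast
    have "v = x \<odot>\<^bsub>obj X i\<^esub> w' \<oplus>\<^bsub>obj X i\<^esub> (v \<ominus>\<^bsub>obj X i\<^esub> x \<odot>\<^bsub>obj X i\<^esub> w')"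
      using v w'(1) x(2) by (simp add: I.group_normalise)
    then have "v = x \<odot>\<^bsub>obj X i\<^esub> w' \<oplus>\<^bsub>obj X i\<^esub> bd X (i + 1) w2" unfolding w2(2) .
    moreover have "x \<odot>\<^bsub>obj X i\<^esub> w' \<in> K i" unfolding memK using w'(1) by blast
    ultimately show "\<exists>k\<in>K i. \<exists>w\<in>elems X (i + 1). v = k \<oplus>\<^bsub>obj X i\<^esub> bd X (i + 1) w" using w2(1) by blast
  next
    fix k w assume k: "k \<in> K u" and w: "w \<in> elems X (u + 1)"
    interpret I2: module R "obj X (u - 1)" by (rule cD)
    obtain v where v: "v \<in> elems X u" "k = x \<odot>\<^bsub>obj X u\<^esub> v" using k unfolding memK by blast
    note dw = cD(7)[OF w] and dv = cD(6)[OF v(1)]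
    show "z \<noteq> k \<oplus>\<^bsub>obj X u\<^esub> bd X (u + 1) w"
    proof
      assume zz: "z = k \<oplus>\<^bsub>obj X u\<^esub> bd X (u + 1) w"
      have "bd X u z = x \<odot>\<^bsub>obj X (u - 1)\<^esub> bd X u v"
        unfolding zz v(2) using v(1) dw x(2) cD(5)[OF w] dv
        by (simp add: mod_hom_add[OF cD(2)] mod_hom_smult[OF cD(2) x(2)])
      then have "bd X u v = \<zero>\<^bsub>obj X (u - 1)\<^esub>" using nzdD[OF x(3) dv] z(1) by (simp add: cycles_def)
      then have "v \<in> cycles X u" using v(1) by (simp add: cycles_def)
      moreover have "bd X (u + 1) w \<in> boundaries X u" using w by (simp add: boundaries_def)
      moreover have "z = bd X (u + 1) w \<oplus>\<^bsub>obj X u\<^esub> x \<odot>\<^bsub>obj X u\<^esub> v"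
        unfolding zz v(2) using v(1) dw x(2) by (simp add: U.a_comm)
      ultimately show False using z(2) unfolding plus_mult_def by auto
    qed
  next
    fix a assume a: "a \<in> max_ideal R"
    obtain b v where bv: "b \<in> boundaries X u" "v \<in> cycles X u" "a \<odot>\<^bsub>obj X u\<^esub> z = b \<oplus>\<^bsub>obj X u\<^esub> x \<odot>\<^bsub>obj X u\<^esub> v"
      using z(3)[OF a] unfolding plus_mult_def by auto
    obtain w where w: "w \<in> elems X (u + 1)" "b = bd X (u + 1) w" using bv(1) by (auto simp: boundaries_def)
    have vc: "v \<in> elems X u" using bv(2) by (simp add: cycles_def)
    have "a \<odot>\<^bsub>obj X u\<^esub> z = x \<odot>\<^bsub>obj X u\<^esub> v \<oplus>\<^bsub>obj X u\<^esub> bd X (u + 1) w"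
      unfolding bv(3) w(2) using vc x(2) cD(7)[OF w(1)] by (simp add: U.a_comm)
    moreover have "x \<odot>\<^bsub>obj X u\<^esub> v \<in> K u" unfolding memK using vc by blast
    ultimately show "\<exists>k\<in>K u. \<exists>w\<in>elems X (u + 1). a \<odot>\<^bsub>obj X u\<^esub> z = k \<oplus>\<^bsub>obj X u\<^esub> bd X (u + 1) w"
      using w(1) by blast
  qed
qed

end

section \<open>Homology\<close>

lemma is_complex_chain: "is_complex R X ==> chain_complex R X"
  by (auto simp: is_complex_def chain_complex_def fin_gen_module_def)

lemma cycles_submodule:
  assumes X: "chain_complex R X"
  shows "submodule (cycles X i) R (obj X i)"
  unfolding cycles_def using chain_complexD(1,1,2)[OF X] by (rule kernel_submodule)

lemma boundaries_submodule:
  assumes X: "chain_complex R X"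
  shows "submodule (boundaries X i) R (obj X i)"
  unfolding boundaries_def
  using chain_complexD(1,1,3)[OF X] module.carrier_is_submodule[OF chain_complexD(1)[OF X]]
  by (rule image_submodule)

lemma boundaries_cycles:
  assumes X: "chain_complex R X"
  shows "boundaries X i \<subseteq> cycles X i"
  unfolding boundaries_def cycles_def using chain_complexD(5,7)[OF X] by blast

lemma boundaries_sub_cycles:
  assumes X: "chain_complex R X"
  shows "submodule (boundaries X i) R (obj X i\<lparr>carrier := cycles X i\<rparr>)"
  using chain_complexD(1)[OF X] cycles_submodule[OF X] boundaries_submodule[OF X] boundaries_cycles[OF X]
  by (rule submodule_of_sub)

lemma cycles_module:
  assumes X: "chain_complex R X"
  shows "module R (obj X i\<lparr>carrier := cycles X i\<rparr>)"
  using chain_complexD(1)[OF X] cycles_submodule[OF X] by (rule submodule_module)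

lemma homology_module:
  assumes X: "chain_complex R X"
  shows "module R (homology X i)"
  unfolding homology_def
  using module.quot_module_module[OF cycles_module[OF X] boundaries_sub_cycles[OF X]] .

lemma homology_zero_iff:
  assumes X: "chain_complex R X"
  shows "zero_module (homology X i) \<longleftrightarrow> exact_at X i"
  unfolding homology_def
  using module.zero_quot_iff[OF cycles_module[OF X] boundaries_sub_cycles[OF X], of i] by simp

lemma homology_iso_iff:
  assumes X: "chain_complex R X" and B: "module R B"
  shows "mod_iso R (homology X i) B \<longleftrightarrow>
    (\<exists>f\<in>mod_hom R (obj X i\<lparr>carrier := cycles X i\<rparr>) B. f ` cycles X i = carrier B \<and>
      (\<forall>x\<in>cycles X i. f x = \<zero>\<^sub>B \<longleftrightarrow> x \<in> boundaries X i))"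
  unfolding homology_def
  using module.quot_iso_iff[OF cycles_module[OF X] boundaries_sub_cycles[OF X] B, of i] by simp

lemma homology_proj:
  assumes X: "chain_complex R X"
  obtains f where "f \<in> mod_hom R (obj X i\<lparr>carrier := cycles X i\<rparr>) (homology X i)"
    "f ` cycles X i = carrier (homology X i)"
    "!!x. x \<in> cycles X i ==> f x = \<zero>\<^bsub>homology X i\<^esub> \<longleftrightarrow> x \<in> boundaries X i"
proof -
  have "\<exists>f\<in>mod_hom R (obj X i\<lparr>carrier := cycles X i\<rparr>) (homology X i). f ` cycles X i = carrier (homology X i) \<and>
      (\<forall>x\<in>cycles X i. f x = \<zero>\<^bsub>homology X i\<^esub> \<longleftrightarrow> x \<in> boundaries X i)"
    by (rule iffD1[OF homology_iso_iff[OF X homology_module[OF X]] mod_iso_refl])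
  then show ?thesis by (elim bexE conjE) (rule that, assumption, assumption, drule (1) bspec)
qed

section \<open>Free and projective modules\<close>

lemma free_module_simps:
  "\<phi> \<in> carrier (free_module R S) \<longleftrightarrow> (\<forall>s. \<phi> s \<in> carrier R) \<and> finite {s. \<phi> s \<noteq> \<zero>\<^sub>R} \<and> {s. \<phi> s \<noteq> \<zero>\<^sub>R} \<subseteq> S"
  "\<zero>\<^bsub>free_module R S\<^esub> = (\<lambda>s. \<zero>\<^sub>R)"
  "\<phi> \<oplus>\<^bsub>free_module R S\<^esub> \<psi> = (\<lambda>s. \<phi> s \<oplus>\<^sub>R \<psi> s)"
  "r \<odot>\<^bsub>free_module R S\<^esub> \<phi> = (\<lambda>s. r \<otimes>\<^bsub>R\<^esub> \<phi> s)"
  by (auto simp: free_module_def)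

lemma free_module_module:
  assumes "cring R"
  shows "module R (free_module R S)"
proof -
  interpret cring R by fact
  have add: "\<phi> \<oplus>\<^bsub>free_module R S\<^esub> \<psi> \<in> carrier (free_module R S)"
    if "\<phi> \<in> carrier (free_module R S)" "\<psi> \<in> carrier (free_module R S)" for \<phi> \<psi>
  proof -
    have "{s. \<phi> s \<oplus>\<^sub>R \<psi> s \<noteq> \<zero>\<^sub>R} \<subseteq> {s. \<phi> s \<noteq> \<zero>\<^sub>R} \<union> {s. \<psi> s \<noteq> \<zero>\<^sub>R}" by auto
    then show ?thesis using that unfolding free_module_simps
      by (auto intro: finite_subset)
  qed
  have sm: "r \<odot>\<^bsub>free_module R S\<^esub> \<phi> \<in> carrier (free_module R S)"
    if "r \<in> carrier R" "\<phi> \<in> carrier (free_module R S)" for r \<phi>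
  proof -
    have "{s. r \<otimes>\<^bsub>R\<^esub> \<phi> s \<noteq> \<zero>\<^sub>R} \<subseteq> {s. \<phi> s \<noteq> \<zero>\<^sub>R}" using that by auto
    then show ?thesis using that unfolding free_module_simps
      by (auto intro: finite_subset)
  qed
  have "abelian_group (free_module R S)"
  proof (rule abelian_groupI)
    fix \<phi> assume \<phi>: "\<phi> \<in> carrier (free_module R S)"
    have "(\<ominus>\<^sub>R \<one>\<^bsub>R\<^esub>) \<odot>\<^bsub>free_module R S\<^esub> \<phi> \<in> carrier (free_module R S)" using sm \<phi> by simp
    moreover have "(\<ominus>\<^sub>R \<one>\<^bsub>R\<^esub>) \<odot>\<^bsub>free_module R S\<^esub> \<phi> \<oplus>\<^bsub>free_module R S\<^esub> \<phi> = \<zero>\<^bsub>free_module R S\<^esub>"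
      using \<phi> by (intro ext) (simp add: free_module_simps l_minus l_neg)
    ultimately show "\<exists>\<psi>\<in>carrier (free_module R S). \<psi> \<oplus>\<^bsub>free_module R S\<^esub> \<phi> = \<zero>\<^bsub>free_module R S\<^esub>" by blast
  qed (use add in \<open>auto simp: free_module_simps a_ac\<close>)
  then show ?thesis
    by (intro moduleI is_cring sm) (auto simp: free_module_simps l_distr r_distr m_assoc)
qed

lemma free_basis_carrier:
  assumes "cring R" "s \<in> S"
  shows "free_basis R s \<in> carrier (free_module R S)"
proof -
  interpret cring R by fact
  have "{t. free_basis R s t \<noteq> \<zero>\<^sub>R} \<subseteq> {s}" by (auto simp: free_basis_def)
  then show ?thesis using assms(2) unfolding free_module_simps
    by (auto simp: free_basis_def intro: finite_subset)
qed

lemma free_module_apply_finsum: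
  assumes "cring R" "finite I" "g \<in> I \<rightarrow> carrier (free_module R S)"
  shows "finsum (free_module R S) g I t = finsum R (\<lambda>i. g i t) I"
  using assms(2,3)
proof (induction I rule: finite_induct)
  interpret cring R by fact
  interpret F: module R "free_module R S" using assms(1) by (rule free_module_module)
  {
    case empty then show ?case by (simp add: free_module_simps)
  next
    case (insert i I)
    have "(\<lambda>i. g i t) \<in> I \<rightarrow> carrier R" "g i t \<in> carrier R" "g i \<in> carrier (free_module R S)"
      "g \<in> I \<rightarrow> carrier (free_module R S)"
      using insert.prems unfolding Pi_iff free_module_simps(1) by auto
    then show ?case using insert by (simp add: free_module_simps(3))
  }
qed

lemma free_module_expand:
  assumes R: "cring R" and \<phi>: "\<phi> \<in> carrier (free_module R S)" and T: "finite T" "{s. \<phi> s \<noteq> \<zero>\<^sub>R} \<subseteq> T" "T \<subseteq> S"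
  shows "\<phi> = (\<Oplus>\<^bsub>free_module R S\<^esub>s\<in>T. \<phi> s \<odot>\<^bsub>free_module R S\<^esub> free_basis R s)"
proof
  interpret cring R by fact
  interpret F: module R "free_module R S" using R by (rule free_module_module)
  have \<phi>c: "\<phi> s \<in> carrier R" for s using \<phi> by (simp add: free_module_simps)
  fix t
  have "(\<Oplus>\<^bsub>free_module R S\<^esub>s\<in>T. \<phi> s \<odot>\<^bsub>free_module R S\<^esub> free_basis R s) t =
      (\<Oplus>\<^bsub>R\<^esub>s\<in>T. (\<phi> s \<odot>\<^bsub>free_module R S\<^esub> free_basis R s) t)"
  proof (intro free_module_apply_finsum R T(1) Pi_I F.smult_closed \<phi>c free_basis_carrier)
    show "!!s. s \<in> T ==> s \<in> S" using T(3) by blast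
  qed
  also have "\<dots> = (\<Oplus>\<^bsub>R\<^esub>s\<in>T. if t = s then \<phi> s else \<zero>\<^sub>R)"
    using \<phi>c by (intro finsum_cong') (auto simp: free_module_simps free_basis_def)
  also have "\<dots> = \<phi> t"
  proof (cases "t \<in> T")
    case True
    then show ?thesis using finsum_singleton[OF True T(1), of \<phi>] \<phi>c by simp
  next
    case False
    then have "(\<Oplus>\<^bsub>R\<^esub>s\<in>T. if t = s then \<phi> s else \<zero>\<^sub>R) = (\<Oplus>\<^bsub>R\<^esub>s\<in>T. \<zero>\<^sub>R)"
      by (intro finsum_cong') auto
    moreover have "\<phi> t = \<zero>\<^sub>R" using False T(2) by blast
    ultimately show ?thesis by simp
  qed
  finally show "\<phi> t = (\<Oplus>\<^bsub>free_module R S\<^esub>s\<in>T. \<phi> s \<odot>\<^bsub>free_module R S\<^esub> free_basis R s) t" by simp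
qed

lemma free_module_span:
  assumes R: "cring R"
  shows "mod_span R (free_module R S) (free_basis R ` S) = carrier (free_module R S)"
proof (rule antisym)
  interpret F: module R "free_module R S" using R by (rule free_module_module)
  have sub: "free_basis R ` S \<subseteq> carrier (free_module R S)" by (auto intro: free_basis_carrier R)
  note sm = F.mod_span_submodule[OF sub]
  show "mod_span R (free_module R S) (free_basis R ` S) \<subseteq> carrier (free_module R S)"
    using F.submodule_closed(6)[OF sm] by blast
  show "carrier (free_module R S) \<subseteq> mod_span R (free_module R S) (free_basis R ` S)"
  proof
    fix \<phi> assume \<phi>: "\<phi> \<in> carrier (free_module R S)"
    let ?T = "{s. \<phi> s \<noteq> \<zero>\<^sub>R}"
    have T: "finite ?T" "?T \<subseteq> S" "!!s. \<phi> s \<in> carrier R" using \<phi> by (auto simp: free_module_simps)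
    have "(\<Oplus>\<^bsub>free_module R S\<^esub>s\<in>?T. \<phi> s \<odot>\<^bsub>free_module R S\<^esub> free_basis R s) \<in>
        mod_span R (free_module R S) (free_basis R ` S)"
    proof (rule F.submodule_finsum[OF sm], rule Pi_I)
      fix s assume "s \<in> ?T"
      then have "free_basis R s \<in> mod_span R (free_module R S) (free_basis R ` S)"
        using T(2) mod_span_base[of "free_basis R ` S" R "free_module R S"] by blast
      then show "\<phi> s \<odot>\<^bsub>free_module R S\<^esub> free_basis R s \<in> mod_span R (free_module R S) (free_basis R ` S)"
        by (rule F.submodule_closed(5)[OF sm T(3)])
    qed
    then show "\<phi> \<in> mod_span R (free_module R S) (free_basis R ` S)"
      unfolding free_module_expand[OF R \<phi> T(1) order_refl T(2), symmetric] .
  qed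
qed

lemma free_module_hom:
  assumes B: "module R B" and f: "!!s. s \<in> S ==> f s \<in> carrier B"
  obtains h where "h \<in> mod_hom R (free_module R S) B" "!!s. s \<in> S ==> h (free_basis R s) = f s"
proof -
  interpret B: module R B by fact
  have R: "cring R" by (rule B.R.is_cring)
  define h where "h \<phi> = (\<Oplus>\<^bsub>B\<^esub>s\<in>{s. \<phi> s \<noteq> \<zero>\<^sub>R}. \<phi> s \<odot>\<^sub>B f s)" for \<phi>
  have hT: "h \<phi> = (\<Oplus>\<^bsub>B\<^esub>s\<in>T. \<phi> s \<odot>\<^sub>B f s)"
    if "\<phi> \<in> carrier (free_module R S)" "finite T" "{s. \<phi> s \<noteq> \<zero>\<^sub>R} \<subseteq> T" "T \<subseteq> S" for \<phi> T
    unfolding h_def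
    using that f by (intro B.add.finprod_mono_neutral_cong_left) (auto simp: free_module_simps subset_iff)
  have cl: "(\<lambda>s. \<phi> s \<odot>\<^sub>B f s) \<in> T \<rightarrow> carrier B" if "\<phi> \<in> carrier (free_module R S)" "T \<subseteq> S" for \<phi> T
    using that f by (auto simp: free_module_simps)
  have "h \<in> mod_hom R (free_module R S) B"
  proof (rule mod_homI)
    fix \<phi> assume \<phi>: "\<phi> \<in> carrier (free_module R S)"
    show "h \<phi> \<in> carrier B"
      unfolding h_def using \<phi> by (intro B.finsum_closed cl) (auto simp: free_module_simps)
  next
    fix \<phi> \<psi> assume \<phi>: "\<phi> \<in> carrier (free_module R S)" and \<psi>: "\<psi> \<in> carrier (free_module R S)"
    interpret F: module R "free_module R S" using R by (rule free_module_module)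
    let ?T = "{s. \<phi> s \<noteq> \<zero>\<^sub>R} \<union> {s. \<psi> s \<noteq> \<zero>\<^sub>R}"
    have T: "finite ?T" "?T \<subseteq> S" using \<phi> \<psi> by (auto simp: free_module_simps)
    have s: "{s. (\<phi> \<oplus>\<^bsub>free_module R S\<^esub> \<psi>) s \<noteq> \<zero>\<^sub>R} \<subseteq> ?T" by (auto simp: free_module_simps)
    have "h (\<phi> \<oplus>\<^bsub>free_module R S\<^esub> \<psi>) = (\<Oplus>\<^bsub>B\<^esub>s\<in>?T. (\<phi> \<oplus>\<^bsub>free_module R S\<^esub> \<psi>) s \<odot>\<^sub>B f s)"
      using \<phi> \<psi> by (intro hT T s) simp
    also have "\<dots> = (\<Oplus>\<^bsub>B\<^esub>s\<in>?T. \<phi> s \<odot>\<^sub>B f s \<oplus>\<^sub>B \<psi> s \<odot>\<^sub>B f s)"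
      using \<phi> \<psi> T f by (intro B.finsum_cong') (auto simp: free_module_simps B.smult_l_distr subset_iff)
    also have "\<dots> = (\<Oplus>\<^bsub>B\<^esub>s\<in>?T. \<phi> s \<odot>\<^sub>B f s) \<oplus>\<^sub>B (\<Oplus>\<^bsub>B\<^esub>s\<in>?T. \<psi> s \<odot>\<^sub>B f s)"
      by (intro B.finsum_addf cl \<phi> \<psi> T)
    also have "\<dots> = h \<phi> \<oplus>\<^sub>B h \<psi>"
      by (simp only: hT[OF \<phi> T(1) _ T(2)] hT[OF \<psi> T(1) _ T(2)] Un_upper1 Un_upper2)
    finally show "h (\<phi> \<oplus>\<^bsub>free_module R S\<^esub> \<psi>) = h \<phi> \<oplus>\<^sub>B h \<psi>" .
  next
    fix r \<phi> assume r: "r \<in> carrier R" and \<phi>: "\<phi> \<in> carrier (free_module R S)"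
    interpret F: module R "free_module R S" using R by (rule free_module_module)
    let ?T = "{s. \<phi> s \<noteq> \<zero>\<^sub>R}"
    have T: "finite ?T" "?T \<subseteq> S" using \<phi> by (auto simp: free_module_simps)
    have s: "{s. (r \<odot>\<^bsub>free_module R S\<^esub> \<phi>) s \<noteq> \<zero>\<^sub>R} \<subseteq> ?T" using r by (auto simp: free_module_simps)
    have "h (r \<odot>\<^bsub>free_module R S\<^esub> \<phi>) = (\<Oplus>\<^bsub>B\<^esub>s\<in>?T. (r \<odot>\<^bsub>free_module R S\<^esub> \<phi>) s \<odot>\<^sub>B f s)"
      using \<phi> r by (intro hT T s) simp
    also have "\<dots> = (\<Oplus>\<^bsub>B\<^esub>s\<in>?T. r \<odot>\<^sub>B (\<phi> s \<odot>\<^sub>B f s))"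
      using \<phi> r T f by (intro B.finsum_cong') (auto simp: free_module_simps B.smult_assoc1 subset_iff)
    also have "\<dots> = r \<odot>\<^sub>B h \<phi>"
      unfolding h_def by (intro B.finsum_smult_ldistr[symmetric] T r cl \<phi>)
    finally show "h (r \<odot>\<^bsub>free_module R S\<^esub> \<phi>) = r \<odot>\<^sub>B h \<phi>" .
  qed
  moreover have "h (free_basis R s) = f s" if s: "s \<in> S" for s
  proof -
    have "h (free_basis R s) = (\<Oplus>\<^bsub>B\<^esub>t\<in>{s}. free_basis R s t \<odot>\<^sub>B f t)"
      using s by (intro hT free_basis_carrier R) (auto simp: free_basis_def)
    then show ?thesis using f[OF s] by (simp add: free_basis_def)
  qed
  ultimately show ?thesis using that by blast
qed

lemma hom_eq_on_span:
  assumes A: "module R A" and B: "module R B" and f: "f \<in> mod_hom R A B" and g: "g \<in> mod_hom R A B"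
    and S: "mod_span R A S = carrier A" "S \<subseteq> carrier A" "!!s. s \<in> S ==> f s = g s" and x: "x \<in> carrier A"
  shows "f x = g x"
proof -
  interpret A: module R A by fact
  interpret B: module R B by fact
  let ?d = "\<lambda>x. f x \<ominus>\<^sub>B g x"
  have d: "?d \<in> mod_hom R A B" by (rule mod_hom_difff[OF B f g])
  have "mod_span R A S \<subseteq> {x \<in> carrier A. ?d x = \<zero>\<^sub>B}"
  proof (rule mod_span_least[OF kernel_submodule[OF A B d]])
    show "S \<subseteq> {x \<in> carrier A. ?d x = \<zero>\<^sub>B}"
      using S(2,3) mod_hom_closed[OF g] by (auto simp: B.minus_eq B.r_neg)
  qed
  then have "f x \<ominus>\<^sub>B g x = \<zero>\<^sub>B" using S(1) x by auto
  then show ?thesis using mod_hom_closed[OF f x] mod_hom_closed[OF g x]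
    by (metis B.a_inv_closed B.minus_eq B.minus_equality B.minus_minus)
qed

lemma fin_gen_free: "cring R ==> finite S ==> fin_gen_module R (free_module R S)"
  unfolding fin_gen_module_def
  using free_module_module[of R S] free_module_span[of R S] free_basis_carrier[of R _ S]
  by (intro conjI exI[of _ "free_basis R ` S"]) auto

lemma span_image:
  assumes A: "module R A" and B: "module R B" and f: "f \<in> mod_hom R A B" "f ` carrier A = carrier B"
    and S: "S \<subseteq> carrier A" "mod_span R A S = carrier A"
  shows "mod_span R B (f ` S) = carrier B"
proof -
  interpret B: module R B by fact
  have fS: "f ` S \<subseteq> carrier B" using S(1) f(2) by blast
  note sm = B.mod_span_submodule[OF fS]
  have "mod_span R A S \<subseteq> {x \<in> carrier A. f x \<in> mod_span R B (f ` S)}"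
    using S(1) mod_span_base[of "f ` S" R B]
    by (intro mod_span_least preimage_submodule[OF A B f(1) sm]) blast
  then have "carrier B \<subseteq> mod_span R B (f ` S)" unfolding f(2)[symmetric] S(2) by blast
  then show ?thesis using B.submodule_closed(6)[OF sm] by (intro equalityI subsetI) blast+
qed

lemma fin_gen_image:
  assumes A: "fin_gen_module R A" and B: "module R B" and f: "f \<in> mod_hom R A B" "f ` carrier A = carrier B"
  shows "fin_gen_module R B"
proof -
  obtain S where S: "module R A" "finite S" "S \<subseteq> carrier A" "mod_span R A S = carrier A"
    using A by (auto simp: fin_gen_module_def)
  have "f ` S \<subseteq> carrier B" using S(3) f(2) by blast
  then show ?thesis unfolding fin_gen_module_def using span_image[OF S(1) B f S(3,4)] S(2) B by blast
qed

lemma fin_gen_free_cover: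
  assumes M: "fin_gen_module R M"
  obtains n and f where "f \<in> mod_hom R (free_module R {..<n::nat}) M"
    "f ` carrier (free_module R {..<n}) = carrier M"
proof -
  interpret M: module R M using M by (simp add: fin_gen_module_def)
  have R: "cring R" by (rule M.R.is_cring)
  obtain S where S: "finite S" "S \<subseteq> carrier M" "mod_span R M S = carrier M"
    using M by (auto simp: fin_gen_module_def)
  obtain b where b: "bij_betw b {..<card S} S"
    using S(1) ex_bij_betw_nat_finite atLeast0LessThan by metis
  have bS: "b s \<in> S" if "s < card S" for s using b that by (auto simp: bij_betw_def)
  obtain f where f: "f \<in> mod_hom R (free_module R {..<card S}) M" "!!s. s \<in> {..<card S} ==> f (free_basis R s) = b s"
    using free_module_hom[OF M.module_axioms, of "{..<card S}" b] bS S(2) by blast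
  interpret F: module R "free_module R {..<card S}" using R by (rule free_module_module)
  have im: "submodule (f ` carrier (free_module R {..<card S})) R M"
    using F.module_axioms M.module_axioms f(1) F.carrier_is_submodule by (rule image_submodule)
  have "S \<subseteq> f ` carrier (free_module R {..<card S})"
  proof
    fix x assume "x \<in> S"
    then obtain s where "s \<in> {..<card S}" "x = b s" using b by (auto simp: bij_betw_def)
    then show "x \<in> f ` carrier (free_module R {..<card S})"
      using f(2) free_basis_carrier[OF R] by (metis imageI)
  qed
  then have "carrier M \<subseteq> f ` carrier (free_module R {..<card S})"
    using mod_span_least[OF im] S(3) by blast
  then have "f ` carrier (free_module R {..<card S}) = carrier M" using M.submodule_closed(6)[OF im] by blast
  then show ?thesis using that f(1) by blast
qed

lemma free_lift:
  assumes A: "module R A" and B: "module R B" and g: "g \<in> mod_hom R A B"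
    and h: "h \<in> mod_hom R (free_module R S) B" "h ` carrier (free_module R S) \<subseteq> g ` C" and C: "C \<subseteq> carrier A"
  obtains k where "k \<in> mod_hom R (free_module R S) A" "!!x. x \<in> carrier (free_module R S) ==> g (k x) = h x"
    "!!s. s \<in> S ==> k (free_basis R s) \<in> C"
proof -
  interpret A: module R A by fact
  have R: "cring R" by (rule A.R.is_cring)
  have "\<exists>a. a \<in> C \<and> g a = h (free_basis R s)" if "s \<in> S" for s
    using h(2) free_basis_carrier[OF R that] by (metis (no_types, lifting) imageE imageI subsetD)
  then obtain a where a: "!!s. s \<in> S ==> a s \<in> C" "!!s. s \<in> S ==> g (a s) = h (free_basis R s)" by metis
  obtain k where k: "k \<in> mod_hom R (free_module R S) A" "!!s. s \<in> S ==> k (free_basis R s) = a s"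
    using free_module_hom[OF A, of S a] a(1) C by blast
  have "g (k x) = h x" if x: "x \<in> carrier (free_module R S)" for x
  proof (rule hom_eq_on_span[OF free_module_module[OF R] B mod_hom_comp[OF k(1) g] h(1) free_module_span[OF R] _ _ x])
    show "free_basis R ` S \<subseteq> carrier (free_module R S)" by (auto intro: free_basis_carrier R)
  qed (use a k in auto)
  then show ?thesis using that k a by simp
qed

lemma projective_free:
  assumes "cring R"
  shows "projective_module R (free_module R S)"
  unfolding projective_module_def
proof (intro conjI allI ballI impI free_module_module assms)
  fix A B :: "'a univ_module" and g h
  assume g: "g \<in> mod_hom R A B" and h: "h \<in> mod_hom R (free_module R S) B"
    and AB: "module R A \<and> module R B \<and> g ` carrier A = carrier B"
  have "h ` carrier (free_module R S) \<subseteq> g ` carrier A" using AB mod_hom_closed[OF h] by blast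
  then show "\<exists>k\<in>mod_hom R (free_module R S) A. \<forall>x\<in>carrier (free_module R S). g (k x) = h x"
    using free_lift[OF _ _ g h _ order_refl] AB by metis
qed

lemma projective_lift:
  fixes A B :: "'a univ_module"
  assumes P: "projective_module R P" and AB: "module R A" "module R B"
    and g: "g \<in> mod_hom R A B" "g ` carrier A = carrier B" and h: "h \<in> mod_hom R P B"
  obtains k where "k \<in> mod_hom R P A" "!!x. x \<in> carrier P ==> g (k x) = h x"
proof -
  have "\<forall>(A :: 'a univ_module) (B :: 'a univ_module). \<forall>g\<in>mod_hom R A B. \<forall>h\<in>mod_hom R P B.
        module R A \<and> module R B \<and> g ` carrier A = carrier B \<longrightarrow>
        (\<exists>k\<in>mod_hom R P A. \<forall>x\<in>carrier P. g (k x) = h x)"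
    using P unfolding projective_module_def by (rule conjunct2)
  from this[rule_format, OF g(1) h] AB g(2)
  have "\<exists>k\<in>mod_hom R P A. \<forall>x\<in>carrier P. g (k x) = h x" by simp
  then show ?thesis by (elim bexE) (rule that, assumption, drule (1) bspec)
qed

lemma projective_retract:
  assumes P: "projective_module R P" and Q: "module R Q"
    and i: "i \<in> mod_hom R Q P" and p: "p \<in> mod_hom R P Q" "!!x. x \<in> carrier Q ==> p (i x) = x"
  shows "projective_module R Q"
  unfolding projective_module_def
proof (intro conjI allI ballI impI Q)
  fix A B :: "'a univ_module" and g h
  assume g: "g \<in> mod_hom R A B" and h: "h \<in> mod_hom R Q B"
    and AB: "module R A \<and> module R B \<and> g ` carrier A = carrier B"
  have "(\<lambda>x. h (p x)) \<in> mod_hom R P B" by (rule mod_hom_comp[OF p(1) h])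
  then obtain k where k: "k \<in> mod_hom R P A" "!!x. x \<in> carrier P ==> g (k x) = h (p x)"
    using projective_lift[OF P _ _ g] AB by metis
  have "(\<lambda>x. k (i x)) \<in> mod_hom R Q A" by (rule mod_hom_comp[OF i k(1)])
  then show "\<exists>k\<in>mod_hom R Q A. \<forall>x\<in>carrier Q. g (k x) = h x"
    using k(2) p(2) mod_hom_closed[OF i] by (intro bexI[of _ "\<lambda>x. k (i x)"]) auto
qed

lemma fin_gen_module_module: "fin_gen_module R M ==> module R M"
  by (simp add: fin_gen_module_def)

lemma projective_module_module: "projective_module R M ==> module R M"
  by (simp add: projective_module_def)

text \<open>Isomorphic copies in the universe, with the properties that the copy inherits.\<close>
lemma univ_copy:
  fixes R :: "('a, 'r) ring_scheme" and M :: "('a, 'b, 'm) module_scheme"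
  assumes M: "fin_gen_module R M"
  obtains M' :: "'a univ_module" and f g where "module R M'" "f \<in> mod_hom R M M'" "g \<in> mod_hom R M' M"
    "!!x. x \<in> carrier M ==> g (f x) = x" "!!y. y \<in> carrier M' ==> f (g y) = y"
    "fin_gen_module R M'" "projective_module R M ==> projective_module R M'"
proof -
  obtain M' :: "'a univ_module" where M': "module R M'" "mod_iso R M M'"
    using fin_gen_module_representable[OF M] by (elim exE conjE)
  then obtain f where f: "f \<in> mod_hom R M M'" "bij_betw f (carrier M) (carrier M')" by (auto simp: mod_iso_def)
  let ?g = "the_inv_into (carrier M) f"
  note Mm = fin_gen_module_module[OF M]
  have g: "?g \<in> mod_hom R M' M" using Mm M'(1) f by (rule mod_iso_inverse)
  have gf: "?g (f x) = x" if "x \<in> carrier M" for x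
    using f(2) that by (simp add: bij_betw_def the_inv_into_f_f)
  have fg: "f (?g y) = y" if "y \<in> carrier M'" for y
    using f(2) that by (simp add: bij_betw_def f_the_inv_into_f)
  have fin: "fin_gen_module R M'" using M M'(1) f(1) f(2)[unfolded bij_betw_def, THEN conjunct2] by (rule fin_gen_image)
  show ?thesis
  proof (rule that[OF M'(1) f(1) g gf fg fin])
    show "projective_module R M ==> projective_module R M'"
      using projective_retract[OF _ M'(1) g f(1) fg] .
  qed assumption+
qed

text \<open>The surjection from a finite free module splits by the lifting property, applied to copies of both modules in
  the universe of the test modules.\<close>
lemma projective_retract_of_free:
  fixes R :: "('a, 'r) ring_scheme" and P :: "('a, 'b, 'm) module_scheme"
  assumes P: "fin_gen_module R P" "projective_module R P"
  obtains n :: nat and f k where "f \<in> mod_hom R (free_module R {..<n}) P" "k \<in> mod_hom R P (free_module R {..<n})"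
    "!!x. x \<in> carrier P ==> f (k x) = x"
proof -
  note Pm = fin_gen_module_module[OF P(1)]
  have R: "cring R" using module_cring[OF Pm] .
  obtain n f where f: "f \<in> mod_hom R (free_module R {..<n::nat}) P"
    "f ` carrier (free_module R {..<n}) = carrier P" using fin_gen_free_cover[OF P(1)] .
  obtain P' :: "'a univ_module" and j j' where j: "module R P'" "j \<in> mod_hom R P P'" "j' \<in> mod_hom R P' P"
    "!!x. x \<in> carrier P ==> j' (j x) = x" "!!y. y \<in> carrier P' ==> j (j' y) = y" using univ_copy[OF P(1)] by metis
  obtain F' :: "'a univ_module" and l l' where l: "module R F'" "l \<in> mod_hom R (free_module R {..<n}) F'"
    "l' \<in> mod_hom R F' (free_module R {..<n})"
    "!!x. x \<in> carrier (free_module R {..<n}) ==> l' (l x) = x" "!!y. y \<in> carrier F' ==> l (l' y) = y"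
    using univ_copy[OF fin_gen_free[OF R finite_lessThan]] by metis
  have g: "(\<lambda>x. j (f (l' x))) \<in> mod_hom R F' P'" by (intro mod_hom_comp[OF mod_hom_comp[OF l(3) f(1)] j(2)])
  have onto: "(\<lambda>x. j (f (l' x))) ` carrier F' = carrier P'"
  proof (intro equalityI subsetI)
    fix y assume "y \<in> (\<lambda>x. j (f (l' x))) ` carrier F'"
    then show "y \<in> carrier P'" using mod_hom_closed[OF g] by auto
  next
    fix y assume y: "y \<in> carrier P'"
    then have "j' y \<in> carrier P" using mod_hom_closed[OF j(3)] by simp
    then obtain x where x: "x \<in> carrier (free_module R {..<n})" "j' y = f x" unfolding f(2)[symmetric] by blast
    then have "y = j (f (l' (l x)))" using j(5)[OF y] l(4)[OF x(1)] by simp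
    then show "y \<in> (\<lambda>x. j (f (l' x))) ` carrier F'" using mod_hom_closed[OF l(2) x(1)] by blast
  qed
  obtain k where k: "k \<in> mod_hom R P F'" "!!x. x \<in> carrier P ==> j (f (l' (k x))) = j x"
    using projective_lift[OF P(2) l(1) j(1) g onto j(2)] by metis
  have "f (l' (k x)) = x" if x: "x \<in> carrier P" for x
  proof -
    have "f (l' (k x)) \<in> carrier P"
      using mod_hom_closed[OF f(1) mod_hom_closed[OF l(3) mod_hom_closed[OF k(1) x]]] .
    then show ?thesis using k(2)[OF x] j(4) x by metis
  qed
  then show ?thesis using that[OF f(1) mod_hom_comp[OF k(1) l(3)]] by simp
qed

text \<open>The lifting property of finitely generated projective modules, without restriction on the test modules
  and with control over where the lift takes its values.\<close>
lemma projective_lift_into: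
  assumes P: "fin_gen_module R P" "projective_module R P"
    and A: "module R A" and B: "module R B" and g: "g \<in> mod_hom R A B" and h: "h \<in> mod_hom R P B"
    and C: "submodule C R A" "h ` carrier P \<subseteq> g ` C"
  obtains k where "k \<in> mod_hom R P A" "!!x. x \<in> carrier P ==> g (k x) = h x" "!!x. x \<in> carrier P ==> k x \<in> C"
proof -
  have R: "cring R" using module_cring[OF A] .
  obtain n f i where f: "f \<in> mod_hom R (free_module R {..<n::nat}) P" "i \<in> mod_hom R P (free_module R {..<n})"
    "!!x. x \<in> carrier P ==> f (i x) = x" using projective_retract_of_free[OF P] by metis
  let ?F = "free_module R {..<n}"
  note Fm = free_module_module[OF R, of "{..<n}"]
  have hf: "(\<lambda>x. h (f x)) \<in> mod_hom R ?F B" by (rule mod_hom_comp[OF f(1) h])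
  have "(\<lambda>x. h (f x)) ` carrier ?F \<subseteq> g ` C" using C(2) mod_hom_closed[OF f(1)] by blast
  moreover have "C \<subseteq> carrier A" using module.submodule_closed(6)[OF A C(1)] by (rule subsetI)
  ultimately obtain k where k: "k \<in> mod_hom R ?F A" "!!x. x \<in> carrier ?F ==> g (k x) = h (f x)"
    "!!s. s \<in> {..<n} ==> k (free_basis R s) \<in> C"
    using free_lift[OF A B g hf] by metis
  have "mod_span R ?F (free_basis R ` {..<n}) \<subseteq> {x \<in> carrier ?F. k x \<in> C}"
    by (rule mod_span_least[OF preimage_submodule[OF Fm A k(1) C(1)]])
      (use k(3) in \<open>auto intro: free_basis_carrier R\<close>)
  then have kC: "k x \<in> C" if "x \<in> carrier ?F" for x unfolding free_module_span[OF R] using that by blast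
  show ?thesis
  proof (rule that[OF mod_hom_comp[OF f(2) k(1)]])
    fix x assume x: "x \<in> carrier P"
    note ix = mod_hom_closed[OF f(2) x]
    show "g (k (i x)) = h x" using k(2)[OF ix] f(3)[OF x] by simp
    show "k (i x) \<in> C" by (rule kC[OF ix])
  qed
qed

definition ring_module :: "('a, 'r) ring_scheme \<Rightarrow> ('a, 'a) module" where
  "ring_module R = \<lparr>carrier = carrier R, mult = undefined, one = undefined, zero = \<zero>\<^sub>R,
     add = add R, smult = mult R\<rparr>"

lemma ring_module_simps [simp]:
  "carrier (ring_module R) = carrier R" "\<zero>\<^bsub>ring_module R\<^esub> = \<zero>\<^sub>R"
  "x \<oplus>\<^bsub>ring_module R\<^esub> y = x \<oplus>\<^sub>R y" "r \<odot>\<^bsub>ring_module R\<^esub> x = r \<otimes>\<^bsub>R\<^esub> x"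
  by (simp_all add: ring_module_def)

lemma ring_module_module:
  assumes "cring R"
  shows "module R (ring_module R)"
proof -
  interpret cring R by fact
  have "abelian_group (ring_module R)"
    by (rule abelian_groupI) (auto simp: a_ac intro: bexI[of _ "\<ominus>\<^sub>R _"] l_neg)
  then show ?thesis by (intro moduleI is_cring) (auto simp: l_distr r_distr m_assoc)
qed

lemma dual_basis:
  assumes P: "fin_gen_module R P" "projective_module R P"
  obtains n :: nat and e \<phi> where "!!i. i < n ==> e i \<in> carrier P"
    "!!i. i < n ==> \<phi> i \<in> mod_hom R P (ring_module R)"
    "!!x. x \<in> carrier P ==> x = (\<Oplus>\<^bsub>P\<^esub>i\<in>{..<n}. \<phi> i x \<odot>\<^sub>P e i)"
proof -
  note Pm = fin_gen_module_module[OF P(1)]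
  have R: "cring R" using module_cring[OF Pm] .
  interpret P: module R P by (rule Pm)
  obtain n f k where f: "f \<in> mod_hom R (free_module R {..<n::nat}) P" "k \<in> mod_hom R P (free_module R {..<n})"
    "!!x. x \<in> carrier P ==> f (k x) = x" using projective_retract_of_free[OF P] by metis
  let ?F = "free_module R {..<n}"
  note Fm = free_module_module[OF R, of "{..<n}"]
  interpret F: module R ?F by (rule Fm)
  have b: "free_basis R i \<in> carrier ?F" if "i < n" for i using that by (intro free_basis_carrier R) simp
  have kc: "k x i \<in> carrier R" if "x \<in> carrier P" for x i
    using mod_hom_closed[OF f(2) that] by (simp add: free_module_simps)
  show ?thesis
  proof (rule that[of n "\<lambda>i. f (free_basis R i)" "\<lambda>i x. k x i"])
    show "f (free_basis R i) \<in> carrier P" if "i < n" for i using mod_hom_closed[OF f(1) b[OF that]] .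
    show "(\<lambda>x. k x i) \<in> mod_hom R P (ring_module R)" for i
      by (rule mod_homI)
        (simp_all add: kc mod_hom_add[OF f(2)] mod_hom_smult[OF f(2)] free_module_simps)
    fix x assume x: "x \<in> carrier P"
    have kx: "k x \<in> carrier ?F" by (rule mod_hom_closed[OF f(2) x])
    have "{s. k x s \<noteq> \<zero>\<^sub>R} \<subseteq> {..<n}" using kx by (simp add: free_module_simps)
    then have "x = f (\<Oplus>\<^bsub>?F\<^esub>i\<in>{..<n}. k x i \<odot>\<^bsub>?F\<^esub> free_basis R i)"
      using f(3)[OF x] free_module_expand[OF R kx finite_lessThan _ order_refl] by metis
    also have "\<dots> = (\<Oplus>\<^bsub>P\<^esub>i\<in>{..<n}. f (k x i \<odot>\<^bsub>?F\<^esub> free_basis R i))"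
      using kc[OF x] b by (intro mod_hom_finsum[OF Fm Pm f(1)]) auto
    also have "\<dots> = (\<Oplus>\<^bsub>P\<^esub>i\<in>{..<n}. k x i \<odot>\<^sub>P f (free_basis R i))"
      using kc[OF x] b mod_hom_closed[OF f(1)] by (intro P.finsum_cong') (auto simp: mod_hom_smult[OF f(1)])
    finally show "x = (\<Oplus>\<^bsub>P\<^esub>i\<in>{..<n}. k x i \<odot>\<^sub>P f (free_basis R i))" .
  qed
qed

lemma projective_cover:
  fixes R :: "('a, 'r) ring_scheme" and M :: "('a, 'b, 'm) module_scheme"
  assumes M: "fin_gen_module R M"
  obtains F :: "'a univ_module" and f where "fin_gen_module R F" "projective_module R F"
    "f \<in> mod_hom R F M" "f ` carrier F = carrier M"
proof -
  have R: "cring R" using module_cring[OF fin_gen_module_module[OF M]] .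
  obtain n f where f: "f \<in> mod_hom R (free_module R {..<n::nat}) M"
    "f ` carrier (free_module R {..<n}) = carrier M" using fin_gen_free_cover[OF M] .
  obtain F :: "'a univ_module" and l l' where l: "module R F" "l \<in> mod_hom R (free_module R {..<n}) F"
    "l' \<in> mod_hom R F (free_module R {..<n})" "!!x. x \<in> carrier (free_module R {..<n}) ==> l' (l x) = x"
    "fin_gen_module R F" "projective_module R (free_module R {..<n}) ==> projective_module R F"
    using univ_copy[OF fin_gen_free[OF R finite_lessThan]] by metis
  have c: "(\<lambda>x. f (l' x)) \<in> mod_hom R F M" by (rule mod_hom_comp[OF l(3) f(1)])
  have "(\<lambda>x. f (l' x)) ` carrier F = carrier M"
  proof (intro equalityI subsetI)
    fix y assume "y \<in> carrier M"
    then obtain x where x: "x \<in> carrier (free_module R {..<n})" "y = f x" unfolding f(2)[symmetric] by blast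
    then have "y = f (l' (l x))" using l(4) by simp
    then show "y \<in> (\<lambda>x. f (l' x)) ` carrier F" using mod_hom_closed[OF l(2) x(1)] by blast
  qed (use mod_hom_closed[OF c] in auto)
  then show ?thesis using that[OF l(5) l(6)[OF projective_free[OF R]] c] by simp
qed

section \<open>Biproducts\<close>

definition biproduct :: "('a, 'r) ring_scheme \<Rightarrow> ('a, 'w, 'x) module_scheme \<Rightarrow> ('a, 'b, 'm) module_scheme \<Rightarrow>
    ('a, 'c, 'n) module_scheme \<Rightarrow> ('b \<Rightarrow> 'w) \<Rightarrow> ('c \<Rightarrow> 'w) \<Rightarrow> ('w \<Rightarrow> 'b) \<Rightarrow> ('w \<Rightarrow> 'c) \<Rightarrow> bool" where
  "biproduct R W A B i j p q \<longleftrightarrow>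
     i \<in> mod_hom R A W \<and> j \<in> mod_hom R B W \<and> p \<in> mod_hom R W A \<and> q \<in> mod_hom R W B \<and>
     (\<forall>x\<in>carrier A. p (i x) = x \<and> q (i x) = \<zero>\<^sub>B) \<and> (\<forall>y\<in>carrier B. q (j y) = y \<and> p (j y) = \<zero>\<^sub>A) \<and>
     (\<forall>w\<in>carrier W. w = i (p w) \<oplus>\<^sub>W j (q w))"

lemma biproductD:
  assumes "biproduct R W A B i j p q"
  shows "i \<in> mod_hom R A W" "j \<in> mod_hom R B W" "p \<in> mod_hom R W A" "q \<in> mod_hom R W B"
    "x \<in> carrier A ==> p (i x) = x" "x \<in> carrier A ==> q (i x) = \<zero>\<^sub>B"
    "y \<in> carrier B ==> q (j y) = y" "y \<in> carrier B ==> p (j y) = \<zero>\<^sub>A"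
    "w \<in> carrier W ==> i (p w) \<oplus>\<^sub>W j (q w) = w"
  using assms by (auto simp: biproduct_def)

definition prod_module :: "('a, 'b, 'm) module_scheme \<Rightarrow> ('a, 'c, 'n) module_scheme \<Rightarrow> ('a, 'b \<times> 'c) module" where
  "prod_module A B = \<lparr>carrier = carrier A \<times> carrier B, mult = undefined, one = undefined,
     zero = (\<zero>\<^sub>A, \<zero>\<^sub>B), add = (\<lambda>(x, y) (x', y'). (x \<oplus>\<^sub>A x', y \<oplus>\<^sub>B y')),
     smult = (\<lambda>r (x, y). (r \<odot>\<^sub>A x, r \<odot>\<^sub>B y))\<rparr>"

lemma prod_module_simps:
  "carrier (prod_module A B) = carrier A \<times> carrier B" "\<zero>\<^bsub>prod_module A B\<^esub> = (\<zero>\<^sub>A, \<zero>\<^sub>B)"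
  "(x, y) \<oplus>\<^bsub>prod_module A B\<^esub> (x', y') = (x \<oplus>\<^sub>A x', y \<oplus>\<^sub>B y')"
  "r \<odot>\<^bsub>prod_module A B\<^esub> (x, y) = (r \<odot>\<^sub>A x, r \<odot>\<^sub>B y)"
  by (simp_all add: prod_module_def)

lemma prod_module_module:
  assumes "module R A" "module R B"
  shows "module R (prod_module A B)"
proof -
  interpret A: module R A by fact
  interpret B: module R B by fact
  have "abelian_group (prod_module A B)"
  proof (rule abelian_groupI)
    fix w assume "w \<in> carrier (prod_module A B)"
    then obtain x y where "w = (x, y)" "x \<in> carrier A" "y \<in> carrier B" by (auto simp: prod_module_simps)
    then show "\<exists>v\<in>carrier (prod_module A B). v \<oplus>\<^bsub>prod_module A B\<^esub> w = \<zero>\<^bsub>prod_module A B\<^esub>"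
      by (intro bexI[of _ "(\<ominus>\<^sub>A x, \<ominus>\<^sub>B y)"]) (auto simp: prod_module_simps A.l_neg B.l_neg)
  qed (auto simp: prod_module_simps A.a_ac B.a_ac)
  then show ?thesis
    by (intro moduleI A.R.is_cring) (auto simp: prod_module_simps A.smult_l_distr B.smult_l_distr
        A.smult_r_distr B.smult_r_distr A.smult_assoc1 B.smult_assoc1)
qed

lemma prod_module_biproduct:
  assumes "module R A" "module R B"
  shows "biproduct R (prod_module A B) A B (\<lambda>x. (x, \<zero>\<^sub>B)) (\<lambda>y. (\<zero>\<^sub>A, y)) fst snd"
proof -
  interpret A: module R A by fact
  interpret B: module R B by fact
  show ?thesis unfolding biproduct_def
    by (intro conjI mod_homI ballI) (auto simp: prod_module_simps)
qed

lemma biproduct_fin_gen: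
  assumes A: "fin_gen_module R A" and B: "fin_gen_module R B" and W: "module R W"
    and b: "biproduct R W A B i j p q"
  shows "fin_gen_module R W"
proof -
  note Am = fin_gen_module_module[OF A] and Bm = fin_gen_module_module[OF B] and D = biproductD[OF b]
  interpret W: module R W by fact
  obtain S where S: "finite S" "S \<subseteq> carrier A" "mod_span R A S = carrier A" using A by (auto simp: fin_gen_module_def)
  obtain T where T: "finite T" "T \<subseteq> carrier B" "mod_span R B T = carrier B" using B by (auto simp: fin_gen_module_def)
  let ?U = "i ` S \<union> j ` T"
  have U: "?U \<subseteq> carrier W" using mod_hom_closed[OF D(1)] mod_hom_closed[OF D(2)] S(2) T(2) by blast
  note sm = W.mod_span_submodule[OF U]
  have base: "?U \<subseteq> mod_span R W ?U" by (rule mod_span_base)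
  have "mod_span R A S \<subseteq> {x \<in> carrier A. i x \<in> mod_span R W ?U}"
    using S(2) base by (intro mod_span_least preimage_submodule[OF Am W D(1) sm]) blast
  then have iU: "i x \<in> mod_span R W ?U" if "x \<in> carrier A" for x using that S(3) by blast
  have "mod_span R B T \<subseteq> {x \<in> carrier B. j x \<in> mod_span R W ?U}"
    using T(2) base by (intro mod_span_least preimage_submodule[OF Bm W D(2) sm]) blast
  then have jU: "j x \<in> mod_span R W ?U" if "x \<in> carrier B" for x using that T(3) by blast
  have "w \<in> mod_span R W ?U" if w: "w \<in> carrier W" for w
    using W.submodule_closed(2)[OF sm iU[OF mod_hom_closed[OF D(3) w]] jU[OF mod_hom_closed[OF D(4) w]]]
    unfolding D(9)[OF w] .
  then have "mod_span R W ?U = carrier W" using W.submodule_closed(6)[OF sm] by (intro equalityI subsetI)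
  moreover have "finite ?U" using S(1) T(1) by simp
  ultimately show ?thesis unfolding fin_gen_module_def using W U by (intro conjI exI[of _ ?U])
qed

lemma biproduct_projective:
  assumes A: "projective_module R A" and B: "projective_module R B" and W: "module R W"
    and b: "biproduct R W A B i j p q"
  shows "projective_module R W"
  unfolding projective_module_def
proof (intro conjI allI ballI impI W)
  fix C D :: "'a univ_module" and g h
  assume g: "g \<in> mod_hom R C D" and h: "h \<in> mod_hom R W D"
    and CD: "module R C \<and> module R D \<and> g ` carrier C = carrier D"
  note bD = biproductD[OF b]
  interpret C: module R C using CD by simp
  interpret D: module R D using CD by simp
  have gg: "g ` carrier C = carrier D" using CD by simp
  obtain k where k: "k \<in> mod_hom R A C" "!!x. x \<in> carrier A ==> g (k x) = h (i x)"
    using projective_lift[OF A C.module_axioms D.module_axioms g gg mod_hom_comp[OF bD(1) h]] by metis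
  obtain l where l: "l \<in> mod_hom R B C" "!!x. x \<in> carrier B ==> g (l x) = h (j x)"
    using projective_lift[OF B C.module_axioms D.module_axioms g gg mod_hom_comp[OF bD(2) h]] by metis
  show "\<exists>k\<in>mod_hom R W C. \<forall>x\<in>carrier W. g (k x) = h x"
  proof (intro bexI ballI)
    show "(\<lambda>w. k (p w) \<oplus>\<^sub>C l (q w)) \<in> mod_hom R W C"
      by (intro mod_hom_addf C.module_axioms mod_hom_comp[OF bD(3) k(1)] mod_hom_comp[OF bD(4) l(1)])
    fix w assume w: "w \<in> carrier W"
    note pw = mod_hom_closed[OF bD(3) w] and qw = mod_hom_closed[OF bD(4) w]
    have "g (k (p w) \<oplus>\<^sub>C l (q w)) = h (i (p w)) \<oplus>\<^sub>D h (j (q w))"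
      using mod_hom_add[OF g mod_hom_closed[OF k(1) pw] mod_hom_closed[OF l(1) qw]] k(2)[OF pw] l(2)[OF qw] by simp
    also have "\<dots> = h (i (p w) \<oplus>\<^sub>W j (q w))"
      using mod_hom_add[OF h mod_hom_closed[OF bD(1) pw] mod_hom_closed[OF bD(2) qw]] by simp
    finally show "g (k (p w) \<oplus>\<^sub>C l (q w)) = h w" using bD(9)[OF w] by simp
  qed
qed

lemma biproduct_univ:
  fixes R :: "('a, 'r) ring_scheme" and A :: "('a, 'b, 'm) module_scheme" and B :: "('a, 'c, 'n) module_scheme"
  assumes A: "fin_gen_module R A" "projective_module R A" and B: "fin_gen_module R B" "projective_module R B"
  obtains W :: "'a univ_module" and i j p q where "biproduct R W A B i j p q"
    "fin_gen_module R W" "projective_module R W"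
proof -
  note m = fin_gen_module_module[OF A(1)] fin_gen_module_module[OF B(1)]
  let ?W = "prod_module A B"
  note W = prod_module_module[OF m] and b = prod_module_biproduct[OF m]
  note bD = biproductD[OF b]
  note fg = biproduct_fin_gen[OF A(1) B(1) W b] and pr = biproduct_projective[OF A(2) B(2) W b]
  obtain W' :: "'a univ_module" and f g where f: "module R W'" "f \<in> mod_hom R ?W W'" "g \<in> mod_hom R W' ?W"
    "!!x. x \<in> carrier ?W ==> g (f x) = x" "!!y. y \<in> carrier W' ==> f (g y) = y"
    "fin_gen_module R W'" "projective_module R ?W ==> projective_module R W'" using univ_copy[OF fg] by metis
  have "biproduct R W' A B (\<lambda>x. f (x, \<zero>\<^sub>B)) (\<lambda>y. f (\<zero>\<^sub>A, y)) (\<lambda>w. fst (g w)) (\<lambda>w. snd (g w))"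
    unfolding biproduct_def
  proof (intro conjI ballI)
    show "(\<lambda>x. f (x, \<zero>\<^sub>B)) \<in> mod_hom R A W'" "(\<lambda>y. f (\<zero>\<^sub>A, y)) \<in> mod_hom R B W'"
      "(\<lambda>w. fst (g w)) \<in> mod_hom R W' A" "(\<lambda>w. snd (g w)) \<in> mod_hom R W' B"
      by (rule mod_hom_comp[OF bD(1) f(2)] mod_hom_comp[OF bD(2) f(2)]
          mod_hom_comp[OF f(3) bD(3)] mod_hom_comp[OF f(3) bD(4)])+
  next
    fix x assume "x \<in> carrier A"
    then show "fst (g (f (x, \<zero>\<^sub>B))) = x" "snd (g (f (x, \<zero>\<^sub>B))) = \<zero>\<^sub>B"
      using mod_hom_closed[OF bD(1)] f(4) by simp_all
  next
    fix y assume "y \<in> carrier B"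
    then show "fst (g (f (\<zero>\<^sub>A, y))) = \<zero>\<^sub>A" "snd (g (f (\<zero>\<^sub>A, y))) = y"
      using mod_hom_closed[OF bD(2)] f(4) by simp_all
  next
    fix w assume w: "w \<in> carrier W'"
    note gw = mod_hom_closed[OF f(3) w]
    have "f (fst (g w), \<zero>\<^sub>B) \<oplus>\<^bsub>W'\<^esub> f (\<zero>\<^sub>A, snd (g w)) = f (g w)"
      using mod_hom_add[OF f(2) mod_hom_closed[OF bD(1) mod_hom_closed[OF bD(3) gw]]
          mod_hom_closed[OF bD(2) mod_hom_closed[OF bD(4) gw]]] bD(9)[OF gw] by simp
    then show "w = f (fst (g w), \<zero>\<^sub>B) \<oplus>\<^bsub>W'\<^esub> f (\<zero>\<^sub>A, snd (g w))" using f(5)[OF w] by simp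
  qed
  then show ?thesis using that f(6) f(7)[OF pr] by simp
qed

section \<open>Projective resolutions\<close>

lemma is_complexI:
  assumes "!!i. fin_gen_module R (obj X i)" "!!i. bd X i \<in> mod_hom R (obj X i) (obj X (i - 1))"
    and "!!i x. x \<in> elems X i ==> bd X (i - 1) (bd X i x) = \<zero>\<^bsub>obj X (i - 2)\<^esub>"
  shows "is_complex R X"
  using assms by (simp add: is_complex_def)

definition zero_univ :: "'a univ_module" where
  "zero_univ = \<lparr>carrier = {undefined}, mult = undefined, one = undefined, zero = undefined,
     add = (\<lambda>_ _. undefined), smult = (\<lambda>_ _. undefined)\<rparr>"

lemma zero_univ_simps: "carrier zero_univ = {undefined}" "\<zero>\<^bsub>zero_univ\<^esub> = undefined"
  "x \<oplus>\<^bsub>zero_univ\<^esub> y = undefined" "r \<odot>\<^bsub>zero_univ\<^esub> y = undefined"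
  by (simp_all add: zero_univ_def)

lemma zero_univ_module: "cring R ==> module R zero_univ"
  by (intro moduleI abelian_groupI) (auto simp: zero_univ_simps)

lemma zero_univ_zero: "zero_module zero_univ"
  by (simp add: zero_module_def zero_univ_simps)

lemma fin_gen_zero:
  assumes "module R M" "zero_module M"
  shows "fin_gen_module R M"
proof -
  interpret M: module R M by fact
  have sm: "submodule (mod_span R M {}) R M" by (rule M.mod_span_submodule) simp
  have "carrier M \<subseteq> mod_span R M {}"
    using assms(2) M.submodule_closed(1)[OF sm] by (simp add: zero_module_def)
  then have "mod_span R M {} = carrier M"
    using M.submodule_closed(6)[OF sm] by (intro equalityI subsetI) auto
  then show ?thesis unfolding fin_gen_module_def using assms(1) by (intro conjI exI[of _ "{}"]) auto
qed

lemma projective_zero: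
  assumes "module R P" "zero_module P"
  shows "projective_module R P"
  unfolding projective_module_def
proof (intro conjI allI ballI impI assms(1))
  interpret P: module R P by fact
  fix A B :: "'a univ_module" and g h
  assume g: "g \<in> mod_hom R A B" and h: "h \<in> mod_hom R P B"
    and AB: "module R A \<and> module R B \<and> g ` carrier A = carrier B"
  interpret A: module R A using AB by simp
  interpret B: module R B using AB by simp
  have "g \<zero>\<^sub>A = h \<zero>\<^sub>P"
    using mod_hom_zero[OF A.module_axioms B.module_axioms g] mod_hom_zero[OF P.module_axioms B.module_axioms h] by simp
  then show "\<exists>k\<in>mod_hom R P A. \<forall>x\<in>carrier P. g (k x) = h x"
    using assms(2) mod_hom_zerof[OF A.module_axioms] unfolding zero_module_def
    by (intro bexI[of _ "\<lambda>_. \<zero>\<^sub>A"]) auto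
qed

text \<open>Every step covers the kernel of the previous map, which is finitely generated because the ring is
  Noetherian.  Dependent choice collects the steps.\<close>
lemma resolution_exists:
  fixes R :: "('a, 'r) ring_scheme" and M :: "('a, 'b, 'm) module_scheme"
  assumes R: "noetherian_ring R" and M: "fin_gen_module R M"
  shows "\<exists>P :: ('a, 'a univ_elem) cpx. projective_resolution R M P"
proof -
  note Mm = fin_gen_module_module[OF M]
  have Rc: "cring R" using module_cring[OF Mm] .
  obtain F0 :: "'a univ_module" and f0 where f0: "fin_gen_module R F0" "projective_module R F0"
    "f0 \<in> mod_hom R F0 M" "f0 ` carrier F0 = carrier M" using projective_cover[OF M] .
  note F0m = fin_gen_module_module[OF f0(1)]
  \<comment> \<open>the state is a projective module, the map out of it and the kernel of that map\<close>
  define good where "good = (\<lambda>(n :: nat) (A :: 'a univ_module, g :: 'a univ_elem \<Rightarrow> 'a univ_elem, K).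
    fin_gen_module R A \<and> projective_module R A \<and> submodule K R A \<and>
    (n = 0 \<longrightarrow> A = F0 \<and> K = {x \<in> carrier F0. f0 x = \<zero>\<^sub>M}))"
  define step where "step = (\<lambda>(n :: nat) (A :: 'a univ_module, g :: 'a univ_elem \<Rightarrow> 'a univ_elem, K)
    (A' :: 'a univ_module, g' :: 'a univ_elem \<Rightarrow> 'a univ_elem, K').
    g' \<in> mod_hom R A' A \<and> g' ` carrier A' = K \<and> K' = {x \<in> carrier A'. g' x = \<zero>\<^sub>A})"
  have "\<exists>S. \<forall>n. good n (S n) \<and> step n (S n) (S (Suc n))"
  proof (rule dependent_nat_choice)
    have "good 0 (F0, (\<lambda>x. x), {x \<in> carrier F0. f0 x = \<zero>\<^sub>M})"
      unfolding good_def using f0(1,2) kernel_submodule[OF F0m Mm f0(3)] by simp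
    then show "\<exists>S. good 0 S" by blast
  next
    fix S n assume "good n S"
    then obtain A g K where S: "S = (A, g, K)" and A: "fin_gen_module R A" "submodule K R A"
      by (cases S) (auto simp: good_def)
    note Am = fin_gen_module_module[OF A(1)]
    have "fin_gen_module R (A\<lparr>carrier := K\<rparr>)"
      by (rule noeth_module_fin_gen[OF noeth_module_sub[OF fin_gen_noeth_module[OF R A(1)] A(2)]])
    then obtain A' :: "'a univ_module" and g' where A': "fin_gen_module R A'" "projective_module R A'"
      "g' \<in> mod_hom R A' (A\<lparr>carrier := K\<rparr>)" "g' ` carrier A' = carrier (A\<lparr>carrier := K\<rparr>)"
      by (rule projective_cover)
    have KA: "K \<subseteq> carrier A" using module.submodule_closed(6)[OF Am A(2)] by (rule subsetI)
    have g': "g' \<in> mod_hom R A' A" using mod_hom_sub_codomainD[OF A'(3) KA] .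
    have "good (Suc n) (A', g', {x \<in> carrier A'. g' x = \<zero>\<^sub>A})"
      unfolding good_def using A'(1,2) kernel_submodule[OF fin_gen_module_module[OF A'(1)] Am g'] by simp
    moreover have "step n S (A', g', {x \<in> carrier A'. g' x = \<zero>\<^sub>A})"
      unfolding step_def S using g' A'(4) by simp
    ultimately show "\<exists>S'. good (Suc n) S' \<and> step n S S'" by blast
  qed
  then obtain S where S: "!!n. good n (S n)" "!!n. step n (S n) (S (Suc n))" by blast
  define A where "A n = fst (S n)" for n
  define g where "g n = fst (snd (S n))" for n
  define K where "K n = snd (snd (S n))" for n
  have Sn: "S n = (A n, g n, K n)" for n by (simp add: A_def g_def K_def)
  have A: "fin_gen_module R (A n)" "projective_module R (A n)" "submodule (K n) R (A n)"
    "A 0 = F0" "K 0 = {x \<in> carrier F0. f0 x = \<zero>\<^sub>M}" for n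
    using S(1)[of n] S(1)[of 0] unfolding Sn good_def by simp_all
  have g: "g (Suc n) \<in> mod_hom R (A (Suc n)) (A n)" "g (Suc n) ` carrier (A (Suc n)) = K n"
    "K (Suc n) = {x \<in> carrier (A (Suc n)). g (Suc n) x = \<zero>\<^bsub>A n\<^esub>}" for n
    using S(2)[of n] unfolding Sn step_def by simp_all
  note Zm = zero_univ_module[OF Rc]
  define P :: "('a, 'a univ_elem) cpx" where
    "P = \<lparr>obj = (\<lambda>i. if i < 0 then zero_univ else A (nat i)),
          bd = (\<lambda>i. if i \<le> 0 then (\<lambda>_. undefined) else g (nat i))\<rparr>"
  have oneg: "obj P i = zero_univ" if "i < 0" for i using that by (simp add: P_def)
  have opos: "obj P (int n) = A n" for n by (simp add: P_def)
  have bneg: "bd P i = (\<lambda>_. undefined)" if "i \<le> 0" for i using that by (simp add: P_def)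
  have bpos: "bd P (int (Suc n)) = g (Suc n)" for n unfolding P_def by (simp del: of_nat_Suc)
  have int_cases3: "i < 0 \<or> i = 0 \<or> (\<exists>n. i = int (Suc n))" for i :: int
    by (metis nat_0_le not_less not0_implies_Suc of_nat_0 linorder_cases order_less_imp_le)
  have om: "fin_gen_module R (obj P i)" "projective_module R (obj P i)" for i
    using A(1,2) fin_gen_zero[OF Zm zero_univ_zero] projective_zero[OF Zm zero_univ_zero]
    by (simp_all add: P_def)
  have hom: "bd P i \<in> mod_hom R (obj P i) (obj P (i - 1))" for i
  proof (cases "i \<le> 0")
    case True
    then have "obj P (i - 1) = zero_univ" by (intro oneg) simp
    then show ?thesis unfolding bneg[OF True]
      by (intro mod_homI) (auto simp: zero_univ_simps)
  next
    case False
    then obtain n where n: "i = int (Suc n)" using int_cases3[of i] by auto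
    have "obj P (i - 1) = A n" unfolding n using opos[of n] by simp
    then show ?thesis using g(1)[of n] opos[of "Suc n"] bpos[of n] unfolding n by simp
  qed
  have cpx: "is_complex R P"
  proof (rule is_complexI[OF om(1) hom])
    fix i x assume x: "x \<in> elems P i"
    show "bd P (i - 1) (bd P i x) = \<zero>\<^bsub>obj P (i - 2)\<^esub>"
    proof (cases "i \<le> 1")
      case True
      then show ?thesis using bneg[of "i - 1"] oneg[of "i - 2"] by (simp add: zero_univ_simps)
    next
      case False
      then obtain m where m: "i = int (Suc m)" "m \<noteq> 0" using int_cases3[of i] by force
      obtain n where n: "i = int (Suc (Suc n))" using m by (cases m) auto
      have i: "i - 1 = int (Suc n)" "i - 2 = int n" unfolding n by simp_all
      have "g (Suc (Suc n)) x \<in> K (Suc n)" using g(2)[of "Suc n"] x unfolding n opos by blast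
      then have "g (Suc n) (g (Suc (Suc n)) x) = \<zero>\<^bsub>A n\<^esub>" unfolding g(3) by blast
      then show ?thesis unfolding i opos bpos unfolding n bpos .
    qed
  qed
  note ch = is_complex_chain[OF cpx]
  have "zero_module (homology P i)" if i: "i \<noteq> 0" for i
    unfolding homology_zero_iff[OF ch]
  proof (cases "i < 0")
    case True
    interpret B: module R "obj P i" using fin_gen_module_module[OF om(1)] .
    have "elems P i = {\<zero>\<^bsub>obj P i\<^esub>}" using zero_univ_zero unfolding oneg[OF True] zero_module_def .
    then have "cycles P i \<subseteq> {\<zero>\<^bsub>obj P i\<^esub>}" unfolding cycles_def by auto
    moreover have "{\<zero>\<^bsub>obj P i\<^esub>} \<subseteq> boundaries P i"
      using B.submodule_closed(1)[OF boundaries_submodule[OF ch]] by simp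
    ultimately show "exact_at P i" by (rule subset_trans)
  next
    case False
    then obtain n where n: "i = int (Suc n)" using int_cases3[of i] i by blast
    have i': "i + 1 = int (Suc (Suc n))" "i - 1 = int n" unfolding n by simp_all
    have "cycles P i = K (Suc n)" unfolding cycles_def i' opos unfolding n opos bpos g(3) ..
    moreover have "boundaries P i = K (Suc n)" unfolding boundaries_def i' opos bpos g(2) ..
    ultimately show "exact_at P i" by simp
  qed
  moreover have "mod_iso R (homology P 0) M"
    unfolding homology_iso_iff[OF ch Mm]
  proof (intro bexI[of _ f0] conjI ballI)
    have ob: "obj P 0 = F0" using opos[of 0] A(4) by simp
    have cy: "cycles P 0 = carrier F0"
      unfolding cycles_def ob bneg[OF order_refl] using oneg[of "-1"] by (simp add: zero_univ_simps)
    have bo: "boundaries P 0 = K 0"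
      unfolding boundaries_def using opos[of "Suc 0"] bpos[of 0] g(2)[of 0] by simp
    show "f0 \<in> mod_hom R (obj P 0\<lparr>carrier := cycles P 0\<rparr>) M" unfolding cy ob using f0(3) by simp
    show "f0 ` cycles P 0 = carrier M" unfolding cy by (rule f0(4))
    show "f0 x = \<zero>\<^sub>M \<longleftrightarrow> x \<in> boundaries P 0" if "x \<in> cycles P 0" for x
      using that unfolding bo cy A(5) by simp
  qed
  ultimately have "projective_resolution R M P"
    unfolding projective_resolution_def using cpx om(2) oneg zero_univ_zero by auto
  then show ?thesis by blast
qed

lemma resolution:
  assumes "noetherian_ring R" and "fin_gen_module R M"
  shows "projective_resolution R M (resolution R M)"
  unfolding resolution_def using resolution_exists[OF assms] by (rule someI_ex)

section \<open>Tensor products\<close>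

locale tensor_pair = M: module R M + N: module R N
  for R :: "('a, 'r) ring_scheme" (structure) and M :: "('a, 'b, 'm) module_scheme"
    and N :: "('a, 'c, 'n) module_scheme"
begin

abbreviation "F \<equiv> free_module R (carrier M \<times> carrier N)"
abbreviation "e \<equiv> free_basis R"
abbreviation "rel \<equiv> bilinear_relations R M N"
abbreviation "pt \<equiv> pure_tensor R M N"

lemma F_module: "module R F"
  by (rule free_module_module[OF M.R.is_cring])

sublocale F: module R F
  by (rule F_module)

lemma basis_closed: "x \<in> carrier M ==> y \<in> carrier N ==> e (x, y) \<in> carrier F"
  by (intro free_basis_carrier M.R.is_cring) simp

lemma rel_submodule: "submodule rel R F"
  unfolding bilinear_relations_def Let_def
  by (intro F.mod_span_submodule Un_least subsetI; elim CollectE exE conjE)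
    (simp_all add: basis_closed)

lemma rel_base:
  "x \<in> carrier M ==> x' \<in> carrier M ==> y \<in> carrier N ==>
    e (x \<oplus>\<^sub>M x', y) \<ominus>\<^sub>F (e (x, y) \<oplus>\<^sub>F e (x', y)) \<in> rel"
  "x \<in> carrier M ==> y \<in> carrier N ==> y' \<in> carrier N ==>
    e (x, y \<oplus>\<^sub>N y') \<ominus>\<^sub>F (e (x, y) \<oplus>\<^sub>F e (x, y')) \<in> rel"
  "r \<in> carrier R ==> x \<in> carrier M ==> y \<in> carrier N ==> e (r \<odot>\<^sub>M x, y) \<ominus>\<^sub>F (r \<odot>\<^sub>F e (x, y)) \<in> rel"
  "r \<in> carrier R ==> x \<in> carrier M ==> y \<in> carrier N ==> e (x, r \<odot>\<^sub>N y) \<ominus>\<^sub>F (r \<odot>\<^sub>F e (x, y)) \<in> rel"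
  unfolding bilinear_relations_def Let_def
  by (rule subsetD[OF mod_span_base]; blast)+

lemma tensor_module: "module R (tensor R M N)"
  unfolding tensor_def by (rule F.quot_module_module[OF rel_submodule])

sublocale T: module R "tensor R M N"
  by (rule tensor_module)

lemma pt_closed: "x \<in> carrier M ==> y \<in> carrier N ==> pt x y \<in> carrier (tensor R M N)"
  unfolding tensor_def pure_tensor_def F.quot_simps(1)[OF rel_submodule]
  using basis_closed by blast

lemma pt_bilinear:
  "x \<in> carrier M ==> x' \<in> carrier M ==> y \<in> carrier N ==> pt (x \<oplus>\<^sub>M x') y = pt x y \<oplus>\<^bsub>tensor R M N\<^esub> pt x' y"
  "x \<in> carrier M ==> y \<in> carrier N ==> y' \<in> carrier N ==> pt x (y \<oplus>\<^sub>N y') = pt x y \<oplus>\<^bsub>tensor R M N\<^esub> pt x y'"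
  "r \<in> carrier R ==> x \<in> carrier M ==> y \<in> carrier N ==> pt (r \<odot>\<^sub>M x) y = r \<odot>\<^bsub>tensor R M N\<^esub> pt x y"
  "r \<in> carrier R ==> x \<in> carrier M ==> y \<in> carrier N ==> pt x (r \<odot>\<^sub>N y) = r \<odot>\<^bsub>tensor R M N\<^esub> pt x y"
  unfolding tensor_def pure_tensor_def
  by (simp_all add: F.quot_simps(2,3)[OF rel_submodule] basis_closed F.coset_eq_iff[OF rel_submodule] rel_base)

lemma pt_hom:
  "y \<in> carrier N ==> (\<lambda>x. pt x y) \<in> mod_hom R M (tensor R M N)"
  "x \<in> carrier M ==> (\<lambda>y. pt x y) \<in> mod_hom R N (tensor R M N)"
  by (auto intro!: mod_homI simp: pt_closed pt_bilinear)

lemma tensor_span: "mod_span R (tensor R M N) {pt x y | x y. x \<in> carrier M \<and> y \<in> carrier N} = carrier (tensor R M N)"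
proof -
  have "e ` (carrier M \<times> carrier N) \<subseteq> carrier F" using basis_closed by auto
  then have "mod_span R (tensor R M N) ((\<lambda>x. rel +>\<^bsub>F\<^esub> x) ` e ` (carrier M \<times> carrier N)) = carrier (tensor R M N)"
    unfolding tensor_def
    by (intro span_image[OF F_module F.quot_module_module[OF rel_submodule] F.quot_proj(1,2)[OF rel_submodule]]
        free_module_span M.R.is_cring)
  moreover have "(\<lambda>x. rel +>\<^bsub>F\<^esub> x) ` e ` (carrier M \<times> carrier N) = {pt x y | x y. x \<in> carrier M \<and> y \<in> carrier N}"
    unfolding pure_tensor_def by auto
  ultimately show ?thesis by simp
qed

lemma tensor_hom_eq:
  assumes "module R L" "f \<in> mod_hom R (tensor R M N) L" "g \<in> mod_hom R (tensor R M N) L"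
    and "!!x y. x \<in> carrier M ==> y \<in> carrier N ==> f (pt x y) = g (pt x y)" and "w \<in> carrier (tensor R M N)"
  shows "f w = g w"
  by (rule hom_eq_on_span[OF tensor_module assms(1-3) tensor_span]) (use assms(4,5) pt_closed in auto)

lemma tensor_universal:
  assumes L: "module R L" and c: "!!x y. x \<in> carrier M ==> y \<in> carrier N ==> \<beta> x y \<in> carrier L"
    and b: "!!x x' y. x \<in> carrier M ==> x' \<in> carrier M ==> y \<in> carrier N ==> \<beta> (x \<oplus>\<^sub>M x') y = \<beta> x y \<oplus>\<^sub>L \<beta> x' y"
    "!!x y y'. x \<in> carrier M ==> y \<in> carrier N ==> y' \<in> carrier N ==> \<beta> x (y \<oplus>\<^sub>N y') = \<beta> x y \<oplus>\<^sub>L \<beta> x y'"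
    "!!r x y. r \<in> carrier R ==> x \<in> carrier M ==> y \<in> carrier N ==> \<beta> (r \<odot>\<^sub>M x) y = r \<odot>\<^sub>L \<beta> x y"
    "!!r x y. r \<in> carrier R ==> x \<in> carrier M ==> y \<in> carrier N ==> \<beta> x (r \<odot>\<^sub>N y) = r \<odot>\<^sub>L \<beta> x y"
  obtains h where "h \<in> mod_hom R (tensor R M N) L" "!!x y. x \<in> carrier M ==> y \<in> carrier N ==> h (pt x y) = \<beta> x y"
proof -
  interpret L: module R L by fact
  obtain k where k: "k \<in> mod_hom R F L" "!!s. s \<in> carrier M \<times> carrier N ==> k (e s) = (\<lambda>(x, y). \<beta> x y) s"
    using free_module_hom[OF L, of "carrier M \<times> carrier N" "\<lambda>(x, y). \<beta> x y"] c by auto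
  have ke: "k (e (x, y)) = \<beta> x y" if "x \<in> carrier M" "y \<in> carrier N" for x y using k(2)[of "(x, y)"] that by simp
  have rel: "rel \<subseteq> {w \<in> carrier F. k w = \<zero>\<^sub>L}"
    unfolding bilinear_relations_def Let_def
  proof (rule mod_span_least[OF kernel_submodule[OF F_module L k(1)]], intro Un_least subsetI; elim CollectE exE conjE)
  qed (simp_all add: basis_closed ke c b mod_hom_diff[OF F_module L k(1)] mod_hom_add[OF k(1)]
      mod_hom_smult[OF k(1)] L.minus_eq L.r_neg)
  have T: "module R (quot_module F rel)" using tensor_module unfolding tensor_def .
  obtain h where h: "h \<in> mod_hom R (quot_module F rel) L" "!!x. x \<in> carrier F ==> h (rel +>\<^bsub>F\<^esub> x) = k x"
  proof (rule hom_factor[OF F_module T L F.quot_proj(1,2)[OF rel_submodule] k(1)])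
    fix x assume "x \<in> carrier F" "rel +>\<^bsub>F\<^esub> x = \<zero>\<^bsub>quot_module F rel\<^esub>"
    then show "k x = \<zero>\<^sub>L" using F.quot_proj(3)[OF rel_submodule] rel by auto
  qed (rule that)
  show ?thesis
    by (rule that[of h]) (use h ke basis_closed in \<open>simp_all add: tensor_def pure_tensor_def\<close>)
qed

lemma tensor_fin_gen:
  assumes M: "fin_gen_module R M" and N: "fin_gen_module R N"
  shows "fin_gen_module R (tensor R M N)"
proof -
  obtain S where S: "finite S" "S \<subseteq> carrier M" "mod_span R M S = carrier M" using M by (auto simp: fin_gen_module_def)
  obtain T where T: "finite T" "T \<subseteq> carrier N" "mod_span R N T = carrier N" using N by (auto simp: fin_gen_module_def)
  let ?U = "(\<lambda>(s, t). pt s t) ` (S \<times> T)"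
  let ?T = "tensor R M N"
  have U: "?U \<subseteq> carrier ?T" using S(2) T(2) pt_closed by auto
  note sm = T.mod_span_submodule[OF U]
  have base: "pt s t \<in> mod_span R ?T ?U" if "s \<in> S" "t \<in> T" for s t
    using mod_span_base[of ?U R ?T] that by auto
  have 1: "pt x t \<in> mod_span R ?T ?U" if x: "x \<in> carrier M" and t: "t \<in> T" for x t
  proof -
    have tN: "t \<in> carrier N" using t T(2) by blast
    have "mod_span R M S \<subseteq> {x \<in> carrier M. pt x t \<in> mod_span R ?T ?U}"
      by (rule mod_span_least[OF preimage_submodule[OF M.module_axioms tensor_module pt_hom(1)[OF tN] sm]])
        (use S(2) base t in auto)
    then show ?thesis using x S(3) by blast
  qed
  have 2: "pt x y \<in> mod_span R ?T ?U" if x: "x \<in> carrier M" and y: "y \<in> carrier N" for x y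
  proof -
    have "mod_span R N T \<subseteq> {y \<in> carrier N. pt x y \<in> mod_span R ?T ?U}"
      by (rule mod_span_least[OF preimage_submodule[OF N.module_axioms tensor_module pt_hom(2)[OF x] sm]])
        (use T(2) 1 x in auto)
    then show ?thesis using y T(3) by blast
  qed
  have "mod_span R ?T {pt x y | x y. x \<in> carrier M \<and> y \<in> carrier N} \<subseteq> mod_span R ?T ?U"
    by (rule mod_span_least[OF sm]) (use 2 in auto)
  then have "mod_span R ?T ?U = carrier ?T" unfolding tensor_span
    using T.submodule_closed(6)[OF sm] by (intro equalityI subsetI) auto
  moreover have "finite ?U" using S(1) T(1) by simp
  ultimately show ?thesis unfolding fin_gen_module_def using tensor_module U by (intro conjI exI[of _ ?U])
qed

lemma tensor_functional:
  assumes \<phi>: "\<phi> \<in> mod_hom R M (ring_module R)"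
  obtains h where "h \<in> mod_hom R (tensor R M N) N"
    "!!x y. x \<in> carrier M ==> y \<in> carrier N ==> h (pt x y) = \<phi> x \<odot>\<^sub>N y"
proof (rule tensor_universal[OF N.module_axioms])
  note c = mod_hom_closed[OF \<phi>, simplified]
  show "\<phi> x \<odot>\<^sub>N y \<in> carrier N" if "x \<in> carrier M" "y \<in> carrier N" for x y using c that by simp
  show "\<phi> (x \<oplus>\<^sub>M x') \<odot>\<^sub>N y = \<phi> x \<odot>\<^sub>N y \<oplus>\<^sub>N \<phi> x' \<odot>\<^sub>N y"
    if "x \<in> carrier M" "x' \<in> carrier M" "y \<in> carrier N" for x x' y
    using c that mod_hom_add[OF \<phi>] by (simp add: N.smult_l_distr)
  show "\<phi> x \<odot>\<^sub>N (y \<oplus>\<^sub>N y') = \<phi> x \<odot>\<^sub>N y \<oplus>\<^sub>N \<phi> x \<odot>\<^sub>N y'"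
    if "x \<in> carrier M" "y \<in> carrier N" "y' \<in> carrier N" for x y y'
    using c that by (simp add: N.smult_r_distr)
  show "\<phi> (r \<odot>\<^sub>M x) \<odot>\<^sub>N y = r \<odot>\<^sub>N (\<phi> x \<odot>\<^sub>N y)"
    if "r \<in> carrier R" "x \<in> carrier M" "y \<in> carrier N" for r x y
    using c that mod_hom_smult[OF \<phi>] by (simp add: N.smult_assoc1)
  show "\<phi> x \<odot>\<^sub>N (r \<odot>\<^sub>N y) = r \<odot>\<^sub>N (\<phi> x \<odot>\<^sub>N y)"
    if "r \<in> carrier R" "x \<in> carrier M" "y \<in> carrier N" for r x y
    using c that by (simp add: N.smult_assoc1[symmetric] M.R.m_comm)
qed (rule that)

end

lemma tensor_pairI: "module R M ==> module R N ==> tensor_pair R M N"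
  by (simp add: tensor_pair_def)

lemma tensor_map:
  assumes M: "module R M" "module R M'" and N: "module R N" and f: "f \<in> mod_hom R M M'"
  shows "tensor_map R M M' N f \<in> mod_hom R (tensor R M N) (tensor R M' N)"
    and "x \<in> carrier M ==> y \<in> carrier N ==>
      tensor_map R M M' N f (pure_tensor R M N x y) = pure_tensor R M' N (f x) y"
proof -
  interpret A: tensor_pair R M N using M(1) N by (rule tensor_pairI)
  interpret B: tensor_pair R M' N using M(2) N by (rule tensor_pairI)
  note c = mod_hom_closed[OF f]
  obtain h where h: "h \<in> mod_hom R (tensor R M N) (tensor R M' N)"
    "!!x y. x \<in> carrier M ==> y \<in> carrier N ==> h (pure_tensor R M N x y) = pure_tensor R M' N (f x) y"
    by (rule A.tensor_universal[OF B.tensor_module, of "\<lambda>x y. pure_tensor R M' N (f x) y"])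
      (simp_all add: B.pt_closed B.pt_bilinear c mod_hom_add[OF f] mod_hom_smult[OF f])
  then have "\<exists>h. h \<in> mod_hom R (tensor R M N) (tensor R M' N) \<and>
     (\<forall>x\<in>carrier M. \<forall>y\<in>carrier N. h (pure_tensor R M N x y) = pure_tensor R M' N (f x) y)"
    by (intro exI[of _ h]) simp
  from someI_ex[OF this]
  show "tensor_map R M M' N f \<in> mod_hom R (tensor R M N) (tensor R M' N)"
    "x \<in> carrier M ==> y \<in> carrier N ==>
      tensor_map R M M' N f (pure_tensor R M N x y) = pure_tensor R M' N (f x) y"
    unfolding tensor_map_def by simp_all
qed

lemma tensor_map_eqI:
  assumes M: "module R M" and L: "module R L" and N: "module R N"
    and "f \<in> mod_hom R (tensor R M N) L" "g \<in> mod_hom R (tensor R M N) L"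
    and "!!x y. x \<in> carrier M ==> y \<in> carrier N ==> f (pure_tensor R M N x y) = g (pure_tensor R M N x y)"
    and "w \<in> carrier (tensor R M N)"
  shows "f w = g w"
  using tensor_pair.tensor_hom_eq[OF tensor_pairI[OF M N] L assms(4-7)] .

lemma tensor_map_comp:
  assumes M: "module R M" "module R M'" "module R M''" and N: "module R N"
    and f: "f \<in> mod_hom R M M'" and g: "g \<in> mod_hom R M' M''" and w: "w \<in> carrier (tensor R M N)"
  shows "tensor_map R M' M'' N g (tensor_map R M M' N f w) = tensor_map R M M'' N (\<lambda>x. g (f x)) w"
proof (rule tensor_map_eqI[OF M(1) tensor_pair.tensor_module[OF tensor_pairI[OF M(3) N]] N _ _ _ w])
  note gf = mod_hom_comp[OF f g]
  show "(\<lambda>w. tensor_map R M' M'' N g (tensor_map R M M' N f w)) \<in> mod_hom R (tensor R M N) (tensor R M'' N)"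
    by (rule mod_hom_comp[OF tensor_map(1)[OF M(1,2) N f] tensor_map(1)[OF M(2,3) N g]])
  show "tensor_map R M M'' N (\<lambda>x. g (f x)) \<in> mod_hom R (tensor R M N) (tensor R M'' N)"
    by (rule tensor_map(1)[OF M(1,3) N gf])
qed (simp add: tensor_map(2)[OF M(1,2) N f] tensor_map(2)[OF M(2,3) N g] mod_hom_closed[OF f]
    tensor_map(2)[OF M(1,3) N mod_hom_comp[OF f g]])

lemma tensor_map_id:
  assumes M: "module R M" and N: "module R N" and f: "!!x. x \<in> carrier M ==> f x = x"
    and w: "w \<in> carrier (tensor R M N)"
  shows "tensor_map R M M N f w = w"
proof (rule tensor_map_eqI[OF M tensor_pair.tensor_module[OF tensor_pairI[OF M N]] N _ mod_hom_id _ w])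
  have h: "f \<in> mod_hom R M M"
  proof -
    interpret M: module R M by fact
    show ?thesis by (rule mod_homI) (simp_all add: f)
  qed
  show "tensor_map R M M N f \<in> mod_hom R (tensor R M N) (tensor R M N)" by (rule tensor_map(1)[OF M M N h])
  show "tensor_map R M M N f (pure_tensor R M N x y) = pure_tensor R M N x y"
    if "x \<in> carrier M" "y \<in> carrier N" for x y using tensor_map(2)[OF M M N h that] f[OF that(1)] by simp
qed

lemma tensor_map_add:
  assumes M: "module R M" "module R M'" and N: "module R N"
    and f: "f \<in> mod_hom R M M'" and g: "g \<in> mod_hom R M M'" and k: "k \<in> mod_hom R M M'"
    and kfg: "!!x. x \<in> carrier M ==> k x = f x \<oplus>\<^bsub>M'\<^esub> g x" and w: "w \<in> carrier (tensor R M N)"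
  shows "tensor_map R M M' N k w =
    tensor_map R M M' N f w \<oplus>\<^bsub>tensor R M' N\<^esub> tensor_map R M M' N g w"
proof -
  interpret B: tensor_pair R M' N using M(2) N by (rule tensor_pairI)
  show ?thesis
  proof (rule tensor_map_eqI[OF M(1) B.tensor_module N tensor_map(1)[OF M N k] _ _ w])
    show "(\<lambda>w. tensor_map R M M' N f w \<oplus>\<^bsub>tensor R M' N\<^esub> tensor_map R M M' N g w) \<in> mod_hom R (tensor R M N) (tensor R M' N)"
      by (rule mod_hom_addf[OF B.tensor_module tensor_map(1)[OF M N f] tensor_map(1)[OF M N g]])
  qed (simp add: tensor_map(2)[OF M N f] tensor_map(2)[OF M N g] tensor_map(2)[OF M N k] kfg
      B.pt_bilinear mod_hom_closed[OF f] mod_hom_closed[OF g])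
qed

lemma tensor_map_zero:
  assumes M: "module R M" "module R M'" and N: "module R N"
    and f: "!!x. x \<in> carrier M ==> f x = \<zero>\<^bsub>M'\<^esub>" and w: "w \<in> carrier (tensor R M N)"
  shows "tensor_map R M M' N f w = \<zero>\<^bsub>tensor R M' N\<^esub>"
proof -
  interpret A: module R M by fact
  interpret M': module R M' by fact
  interpret B: tensor_pair R M' N using M(2) N by (rule tensor_pairI)
  have h: "f \<in> mod_hom R M M'" by (rule mod_homI) (simp_all add: f)
  show ?thesis
  proof (rule tensor_map_eqI[OF M(1) B.tensor_module N tensor_map(1)[OF M N h] mod_hom_zerof[OF B.tensor_module] _ w])
    fix x y assume xy: "x \<in> carrier M" "y \<in> carrier N"
    show "tensor_map R M M' N f (pure_tensor R M N x y) = \<zero>\<^bsub>tensor R M' N\<^esub>"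
      using tensor_map(2)[OF M N h xy] f[OF xy(1)]
        mod_hom_zero[OF M(2) B.tensor_module B.pt_hom(1)[OF xy(2)]] by simp
  qed
qed

lemma tensor_cpx_simps:
  "obj (tensor_cpx R X N) i = tensor R (obj X i) N"
  "bd (tensor_cpx R X N) i = tensor_map R (obj X i) (obj X (i - 1)) N (bd X i)"
  by (simp_all add: tensor_cpx_def)

lemma tensor_cpx_chain:
  assumes X: "chain_complex R X" and N: "module R N"
  shows "chain_complex R (tensor_cpx R X N)"
  unfolding chain_complex_def tensor_cpx_simps
proof (intro conjI allI ballI)
  note D = chain_complexD[OF X]
  show "module R (tensor R (obj X i) N)" for i
    by (rule tensor_pair.tensor_module[OF tensor_pairI[OF D(1) N]])
  show "tensor_map R (obj X i) (obj X (i - 1)) N (bd X i) \<in>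
      mod_hom R (tensor R (obj X i) N) (tensor R (obj X (i - 1)) N)" for i
    by (rule tensor_map(1)[OF D(1,1) N D(2)])
  fix i w assume w: "w \<in> carrier (tensor R (obj X i) N)"
  have i: "i - 1 - 1 = i - 2" by simp
  have b: "bd X (i - 1) \<in> mod_hom R (obj X (i - 1)) (obj X (i - 2))" using D(2)[of "i - 1"] by simp
  show "tensor_map R (obj X (i - 1)) (obj X (i - 1 - 1)) N (bd X (i - 1))
      (tensor_map R (obj X i) (obj X (i - 1)) N (bd X i) w) = \<zero>\<^bsub>tensor R (obj X (i - 2)) N\<^esub>"
    unfolding i tensor_map_comp[OF D(1,1,1) N D(2) b w]
    by (rule tensor_map_zero[OF D(1,1) N D(4) w])
qed

section \<open>Complexes of projective modules\<close>

subsection \<open>Bounded below exact complexes are contractible\<close>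

lemma zero_module_carrier: "zero_module A ==> x \<in> carrier A ==> x = \<zero>\<^sub>A"
  by (simp add: zero_module_def)

lemma tensor_zero:
  assumes A: "module R A" and N: "module R N" and z: "zero_module A" and w: "w \<in> carrier (tensor R A N)"
  shows "w = \<zero>\<^bsub>tensor R A N\<^esub>"
proof -
  have "tensor_map R A A N (\<lambda>x. x) w = \<zero>\<^bsub>tensor R A N\<^esub>"
    by (rule tensor_map_zero[OF A A N _ w]) (rule zero_module_carrier[OF z])
  then show ?thesis using tensor_map_id[OF A N _ w, of "\<lambda>x. x"] by simp
qed

lemma tensor_zero_module:
  assumes A: "module R A" and N: "module R N" and z: "zero_module A"
  shows "zero_module (tensor R A N)"
proof -
  interpret T: module R "tensor R A N" by (rule tensor_pair.tensor_module[OF tensor_pairI[OF A N]])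
  show ?thesis unfolding zero_module_def using tensor_zero[OF A N z] T.zero_closed by auto
qed

text \<open>The map \<open>S\<^sub>n\<^sub>+\<^sub>1\<close> lifts \<open>1 - S\<^sub>nd\<close>, whose values are cycles and hence boundaries.  Below degree \<open>l\<close> the
  complex is zero, so the construction starts with the zero map.\<close>
lemma contraction_exists:
  assumes W: "is_complex R W" and pr: "!!i. projective_module R (obj W i)"
    and zero: "!!i. i < l ==> zero_module (obj W i)" and ex: "!!i. exact_at W i"
  obtains S where "!!n::nat. S n \<in> mod_hom R (obj W (l + int n - 1)) (obj W (l + int n))"
    "!!n x. x \<in> elems W (l + int n) ==>
      bd W (l + int n + 1) (S (Suc n) x) = x \<ominus>\<^bsub>obj W (l + int n)\<^esub> S n (bd W (l + int n) x)"
proof -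
  have ch: "chain_complex R W" using W by (rule is_complex_chain)
  note D = chain_complexD[OF ch]
  have fg: "fin_gen_module R (obj W i)" for i using W by (simp add: is_complex_def)
  \<comment> \<open>the recursion carries \<open>dSd = d\<close>, which says that the values of \<open>1 - Sd\<close> are cycles\<close>
  define Pr where "Pr n S \<longleftrightarrow> S \<in> mod_hom R (obj W (l + int n - 1)) (obj W (l + int n)) \<and>
    (\<forall>x\<in>elems W (l + int n). bd W (l + int n) (S (bd W (l + int n) x)) = bd W (l + int n) x)" for n S
  define Q where "Q n S S' \<longleftrightarrow> (\<forall>x\<in>elems W (l + int n).
    bd W (l + int n + 1) (S' x) = x \<ominus>\<^bsub>obj W (l + int n)\<^esub> S (bd W (l + int n) x))" for n S S'
  have "\<exists>S. \<forall>n. Pr n (S n) \<and> Q n (S n) (S (Suc n))"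
  proof (rule dependent_nat_choice)
    have z: "zero_module (obj W (l + int 0 - 1))" by (rule zero) simp
    have "Pr 0 (\<lambda>x. \<zero>\<^bsub>obj W (l + int 0)\<^esub>)"
      unfolding Pr_def
    proof (intro conjI ballI mod_hom_zerof D(1))
      fix x assume x: "x \<in> elems W (l + int 0)"
      show "bd W (l + int 0) \<zero>\<^bsub>obj W (l + int 0)\<^esub> = bd W (l + int 0) x"
        using zero_module_carrier[OF z D(6)[OF x]] mod_hom_zero[OF D(1,1,2), of "l + int 0"] by simp
    qed
    then show "\<exists>S. Pr 0 S" by blast
  next
    fix S n assume Sn: "Pr n S"
    define i where "i = l + int n"
    have S: "S \<in> mod_hom R (obj W (i - 1)) (obj W i)"
      "!!x. x \<in> elems W i ==> bd W i (S (bd W i x)) = bd W i x"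
      using Sn unfolding Pr_def i_def by auto
    interpret I: module R "obj W i" by (rule D(1))
    interpret I1: module R "obj W (i - 1)" by (rule D(1))
    have hh: "(\<lambda>x. x \<ominus>\<^bsub>obj W i\<^esub> S (bd W i x)) \<in> mod_hom R (obj W i) (obj W i)"
      by (rule mod_hom_difff[OF D(1) mod_hom_id mod_hom_comp[OF D(2) S(1)]])
    have "(\<lambda>x. x \<ominus>\<^bsub>obj W i\<^esub> S (bd W i x)) ` elems W i \<subseteq> bd W (i + 1) ` elems W (i + 1)"
    proof
      fix y assume "y \<in> (\<lambda>x. x \<ominus>\<^bsub>obj W i\<^esub> S (bd W i x)) ` elems W i"
      then obtain x where x: "x \<in> elems W i" "y = x \<ominus>\<^bsub>obj W i\<^esub> S (bd W i x)" by blast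
      have Sx: "S (bd W i x) \<in> elems W i" by (rule mod_hom_closed[OF S(1) D(6)[OF x(1)]])
      have "bd W i y = \<zero>\<^bsub>obj W (i - 1)\<^esub>"
        unfolding x(2) mod_hom_diff[OF D(1,1,2) x(1) Sx] S(2)[OF x(1)]
        using D(6)[OF x(1)] by (simp add: I1.minus_eq I1.r_neg)
      then have "y \<in> cycles W i" unfolding cycles_def using x Sx by simp
      then show "y \<in> bd W (i + 1) ` elems W (i + 1)" using ex unfolding boundaries_def by blast
    qed
    then obtain S' where S': "S' \<in> mod_hom R (obj W i) (obj W (i + 1))"
      "!!x. x \<in> elems W i ==> bd W (i + 1) (S' x) = x \<ominus>\<^bsub>obj W i\<^esub> S (bd W i x)"
      using projective_lift_into[OF fg pr D(1) D(1) D(3) hh module.carrier_is_submodule[OF D(1)]] by metis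
    have i: "l + int (Suc n) - 1 = i" "l + int (Suc n) = i + 1" by (simp_all add: i_def)
    have "Pr (Suc n) S'"
      unfolding Pr_def i add_diff_cancel_right'
    proof (intro conjI ballI S'(1))
      fix x assume x: "x \<in> elems W (i + 1)"
      have "bd W (i + 1) (S' (bd W (i + 1) x)) = bd W (i + 1) x \<ominus>\<^bsub>obj W i\<^esub> S \<zero>\<^bsub>obj W (i - 1)\<^esub>"
        using S'(2)[OF D(7)[OF x]] D(5)[OF x] by simp
      then show "bd W (i + 1) (S' (bd W (i + 1) x)) = bd W (i + 1) x"
        using D(7)[OF x] by (simp add: mod_hom_zero[OF D(1,1) S(1)] I.minus_eq)
    qed
    moreover have "Q n S S'" unfolding Q_def using S'(2) by (simp add: i_def)
    ultimately show "\<exists>S'. Pr (Suc n) S' \<and> Q n S S'" by blast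
  qed
  then obtain S where S: "!!n. Pr n (S n)" "!!n. Q n (S n) (S (Suc n))" by blast
  show ?thesis
  proof (rule that[of S])
    show "S n \<in> mod_hom R (obj W (l + int n - 1)) (obj W (l + int n))" for n
      using S(1)[of n] unfolding Pr_def by (rule conjunct1)
    show "bd W (l + int n + 1) (S (Suc n) x) = x \<ominus>\<^bsub>obj W (l + int n)\<^esub> S n (bd W (l + int n) x)"
      if "x \<in> elems W (l + int n)" for n x
      using S(2)[of n] that unfolding Q_def by (rule bspec)
  qed
qed

text \<open>Tensoring preserves the identity that says that \<open>S\<close> is a contraction.\<close>
lemma exact_tensor:
  assumes W: "is_complex R W" and pr: "!!i. projective_module R (obj W i)"
    and zero: "!!i. i < l ==> zero_module (obj W i)" and ex: "!!i. exact_at W i"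
    and N: "module R N"
  shows "exact_at (tensor_cpx R W N) i"
proof -
  have ch: "chain_complex R W" using W by (rule is_complex_chain)
  note D = chain_complexD[OF ch]
  note chT = tensor_cpx_chain[OF ch N]
  note DT = chain_complexD[OF chT]
  interpret T: module R "tensor R (obj W i) N" using DT(1)[of i] unfolding tensor_cpx_simps .
  show ?thesis
  proof (cases "i < l")
    case True
    have "cycles (tensor_cpx R W N) i \<subseteq> {\<zero>\<^bsub>tensor R (obj W i) N\<^esub>}"
      using tensor_zero[OF D(1) N zero[OF True]] unfolding cycles_def tensor_cpx_simps by blast
    moreover have "{\<zero>\<^bsub>tensor R (obj W i) N\<^esub>} \<subseteq> boundaries (tensor_cpx R W N) i"
      using module.submodule_closed(1)[OF DT(1) boundaries_submodule[OF chT]] unfolding tensor_cpx_simps by simp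
    ultimately show ?thesis by (rule subset_trans)
  next
    case False
    obtain S where S: "!!n::nat. S n \<in> mod_hom R (obj W (l + int n - 1)) (obj W (l + int n))"
      "!!n x. x \<in> elems W (l + int n) ==>
        bd W (l + int n + 1) (S (Suc n) x) = x \<ominus>\<^bsub>obj W (l + int n)\<^esub> S n (bd W (l + int n) x)"
      using contraction_exists[OF W pr zero ex] by metis
    define n where "n = nat (i - l)"
    have i: "l + int n = i" using False by (simp add: n_def)
    have i': "l + int (Suc n) - 1 = i" "l + int (Suc n) = i + 1" using i by simp_all
    have s: "S n \<in> mod_hom R (obj W (i - 1)) (obj W i)" "S (Suc n) \<in> mod_hom R (obj W i) (obj W (i + 1))"
      using S(1)[of n] S(1)[of "Suc n"] unfolding i i' add_diff_cancel_right' by simp_all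
    have id: "x = bd W (i + 1) (S (Suc n) x) \<oplus>\<^bsub>obj W i\<^esub> S n (bd W i x)" if x: "x \<in> elems W i" for x
    proof -
      interpret I: module R "obj W i" by (rule D(1))
      have "S n (bd W i x) \<in> elems W i" by (rule mod_hom_closed[OF s(1) D(6)[OF x]])
      then show ?thesis using S(2)[of x n] x unfolding i by (simp add: I.minus_eq I.a_assoc I.l_neg)
    qed
    show ?thesis
    proof
      fix w assume w: "w \<in> cycles (tensor_cpx R W N) i"
      then have wc: "w \<in> carrier (tensor R (obj W i) N)"
        and dw: "tensor_map R (obj W i) (obj W (i - 1)) N (bd W i) w = \<zero>\<^bsub>tensor R (obj W (i - 1)) N\<^esub>"
        unfolding cycles_def tensor_cpx_simps by auto
      let ?t = "tensor_map R (obj W i) (obj W (i + 1)) N (S (Suc n)) w"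
      have t: "?t \<in> carrier (tensor R (obj W (i + 1)) N)"
        by (rule mod_hom_closed[OF tensor_map(1)[OF D(1,1) N s(2)] wc])
      have "w = tensor_map R (obj W i) (obj W i) N (\<lambda>x. x) w"
        using tensor_map_id[OF D(1) N _ wc, of "\<lambda>x. x"] by simp
      also have "\<dots> = tensor_map R (obj W i) (obj W i) N (\<lambda>x. bd W (i + 1) (S (Suc n) x)) w
          \<oplus>\<^bsub>tensor R (obj W i) N\<^esub> tensor_map R (obj W i) (obj W i) N (\<lambda>x. S n (bd W i x)) w"
        by (rule tensor_map_add[OF D(1,1) N mod_hom_comp[OF s(2) D(3)] mod_hom_comp[OF D(2) s(1)] mod_hom_id id wc])
      also have "tensor_map R (obj W i) (obj W i) N (\<lambda>x. S n (bd W i x)) w =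
          tensor_map R (obj W (i - 1)) (obj W i) N (S n) \<zero>\<^bsub>tensor R (obj W (i - 1)) N\<^esub>"
        using tensor_map_comp[OF D(1,1,1) N D(2) s(1) wc] dw by simp
      also have "\<dots> = \<zero>\<^bsub>tensor R (obj W i) N\<^esub>"
        by (rule mod_hom_zero[OF _ _ tensor_map(1)[OF D(1,1) N s(1)]])
          (rule tensor_pair.tensor_module[OF tensor_pairI[OF D(1) N]])+
      also have "tensor_map R (obj W i) (obj W i) N (\<lambda>x. bd W (i + 1) (S (Suc n) x)) w =
          tensor_map R (obj W (i + 1)) (obj W i) N (bd W (i + 1)) ?t"
        using tensor_map_comp[OF D(1,1,1) N s(2) D(3) wc] by simp
      finally have "w = tensor_map R (obj W (i + 1)) (obj W i) N (bd W (i + 1)) ?t"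
        using mod_hom_closed[OF tensor_map(1)[OF D(1,1) N D(3)] t] by simp
      then show "w \<in> boundaries (tensor_cpx R W N) i"
        unfolding boundaries_def tensor_cpx_simps using t by simp
    qed
  qed
qed

subsection \<open>Chain maps\<close>

definition chain_map :: "('a, 'r) ring_scheme \<Rightarrow> ('a, 'b) cpx \<Rightarrow> ('a, 'c) cpx \<Rightarrow> (int \<Rightarrow> 'b \<Rightarrow> 'c) \<Rightarrow> bool" where
  "chain_map R X Y f \<longleftrightarrow> (\<forall>i. f i \<in> mod_hom R (obj X i) (obj Y i)) \<and>
     (\<forall>i. \<forall>x\<in>elems X i. f (i - 1) (bd X i x) = bd Y i (f i x))"

lemma chain_mapD:
  assumes "chain_map R X Y f"
  shows "f i \<in> mod_hom R (obj X i) (obj Y i)"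
    "x \<in> elems X i ==> f (i - 1) (bd X i x) = bd Y i (f i x)"
    "x \<in> elems X (i + 1) ==> f i (bd X (i + 1) x) = bd Y (i + 1) (f (i + 1) x)"
proof -
  show c: "x \<in> elems X i ==> f (i - 1) (bd X i x) = bd Y i (f i x)" for i x
    using assms by (simp add: chain_map_def)
  show "x \<in> elems X (i + 1) ==> f i (bd X (i + 1) x) = bd Y (i + 1) (f (i + 1) x)"
    using c[of x "i + 1"] by simp
qed (use assms in \<open>simp add: chain_map_def\<close>)

lemma chain_map_cycles:
  assumes X: "chain_complex R X" and Y: "chain_complex R Y" and f: "chain_map R X Y f" and x: "x \<in> cycles X i"
  shows "f i x \<in> cycles Y i"
  using x chain_mapD(2)[OF f, of x i] mod_hom_closed[OF chain_mapD(1)[OF f]]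
    mod_hom_zero[OF chain_complexD(1)[OF X] chain_complexD(1)[OF Y] chain_mapD(1)[OF f], of "i - 1"]
  unfolding cycles_def by simp

lemma chain_map_boundaries:
  assumes f: "chain_map R X Y f" and x: "x \<in> boundaries X i"
  shows "f i x \<in> boundaries Y i"
proof -
  obtain y where y: "y \<in> elems X (i + 1)" "x = bd X (i + 1) y" using x by (auto simp: boundaries_def)
  show ?thesis unfolding y(2) chain_mapD(3)[OF f y(1)] boundaries_def
    using mod_hom_closed[OF chain_mapD(1)[OF f] y(1)] by simp
qed

lemma chain_map_tensor:
  assumes X: "chain_complex R X" and Y: "chain_complex R Y" and N: "module R N" and f: "chain_map R X Y f"
  shows "chain_map R (tensor_cpx R X N) (tensor_cpx R Y N) (\<lambda>i. tensor_map R (obj X i) (obj Y i) N (f i))"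
  unfolding chain_map_def tensor_cpx_simps
proof (intro conjI allI ballI)
  note DX = chain_complexD[OF X] and DY = chain_complexD[OF Y] and Df = chain_mapD[OF f]
  show "tensor_map R (obj X i) (obj Y i) N (f i) \<in> mod_hom R (tensor R (obj X i) N) (tensor R (obj Y i) N)" for i
    by (rule tensor_map(1)[OF DX(1) DY(1) N Df(1)])
  fix i w assume w: "w \<in> carrier (tensor R (obj X i) N)"
  have "tensor_map R (obj X i) (obj Y (i - 1)) N (\<lambda>x. f (i - 1) (bd X i x)) w =
      tensor_map R (obj X i) (obj Y (i - 1)) N (\<lambda>x. bd Y i (f i x)) w"
  proof (rule tensor_map_eqI[OF DX(1) tensor_pair.tensor_module[OF tensor_pairI[OF DY(1) N]] N _ _ _ w])
    note a = mod_hom_comp[OF DX(2) Df(1)] and b = mod_hom_comp[OF Df(1) DY(2)]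
    show "tensor_map R (obj X i) (obj Y (i - 1)) N (\<lambda>x. f (i - 1) (bd X i x)) \<in>
        mod_hom R (tensor R (obj X i) N) (tensor R (obj Y (i - 1)) N)"
      "tensor_map R (obj X i) (obj Y (i - 1)) N (\<lambda>x. bd Y i (f i x)) \<in>
        mod_hom R (tensor R (obj X i) N) (tensor R (obj Y (i - 1)) N)"
      by (rule tensor_map(1)[OF DX(1) DY(1) N a] tensor_map(1)[OF DX(1) DY(1) N b])+
    fix x y assume xy: "x \<in> elems X i" "y \<in> carrier N"
    show "tensor_map R (obj X i) (obj Y (i - 1)) N (\<lambda>x. f (i - 1) (bd X i x)) (pure_tensor R (obj X i) N x y) =
        tensor_map R (obj X i) (obj Y (i - 1)) N (\<lambda>x. bd Y i (f i x)) (pure_tensor R (obj X i) N x y)"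
      unfolding tensor_map(2)[OF DX(1) DY(1) N a xy] tensor_map(2)[OF DX(1) DY(1) N b xy] Df(2)[OF xy(1)] ..
  qed
  then show "tensor_map R (obj X (i - 1)) (obj Y (i - 1)) N (f (i - 1))
      (tensor_map R (obj X i) (obj X (i - 1)) N (bd X i) w) =
    tensor_map R (obj Y i) (obj Y (i - 1)) N (bd Y i) (tensor_map R (obj X i) (obj Y i) N (f i) w)"
    unfolding tensor_map_comp[OF DX(1) DX(1) DY(1) N DX(2) Df(1) w]
      tensor_map_comp[OF DX(1) DY(1) DY(1) N Df(1) DY(2) w] .
qed

text \<open>The comparison theorem: \<open>\<epsilon>\<close> is lifted over \<open>f\<close> in degree \<open>h\<close>, and the lift is continued upwards through the exact
  part of \<open>P\<close>.\<close>
lemma lift_chain_map: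
  assumes G: "is_complex R G" "!!i. projective_module R (obj G i)" "!!i. i < h ==> zero_module (obj G i)"
    and P: "chain_complex R P" "!!i. h < i ==> exact_at P i"
    and B: "module R B"
    and \<epsilon>: "\<epsilon> \<in> mod_hom R (obj G h) B" "!!x. x \<in> boundaries G h ==> \<epsilon> x = \<zero>\<^sub>B"
    and f: "f \<in> mod_hom R (obj P h\<lparr>carrier := cycles P h\<rparr>) B" "\<epsilon> ` elems G h \<subseteq> f ` cycles P h"
      "!!x. x \<in> cycles P h ==> f x = \<zero>\<^sub>B \<longleftrightarrow> x \<in> boundaries P h"
  obtains \<phi> where "chain_map R G P \<phi>" "!!x. x \<in> elems G h ==> \<phi> h x \<in> cycles P h \<and> f (\<phi> h x) = \<epsilon> x"
proof -
  have chG: "chain_complex R G" using G(1) by (rule is_complex_chain)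
  note DG = chain_complexD[OF chG] and DP = chain_complexD[OF P(1)]
  have fg: "fin_gen_module R (obj G i)" for i using G(1) by (simp add: is_complex_def)
  note Zm = cycles_module[OF P(1), of h]
  obtain k where k: "k \<in> mod_hom R (obj G h) (obj P h\<lparr>carrier := cycles P h\<rparr>)"
    "!!x. x \<in> elems G h ==> f (k x) = \<epsilon> x"
  proof (rule projective_lift_into[OF fg G(2) Zm B f(1) \<epsilon>(1) module.carrier_is_submodule[OF Zm]])
    show "\<epsilon> ` elems G h \<subseteq> f ` carrier (obj P h\<lparr>carrier := cycles P h\<rparr>)" using f(2) by simp
  qed (rule that)
  have kc: "k x \<in> cycles P h" if "x \<in> elems G h" for x using mod_hom_closed[OF k(1) that] by simp
  have kh: "k \<in> mod_hom R (obj G h) (obj P h)"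
    by (rule mod_hom_sub_codomainD[OF k(1)]) (auto simp: cycles_def)
  \<comment> \<open>that boundaries go to boundaries is what makes the next lift possible\<close>
  define Pr where "Pr n \<psi> \<longleftrightarrow> \<psi> \<in> mod_hom R (obj G (h + int n)) (obj P (h + int n)) \<and>
    (\<forall>x\<in>boundaries G (h + int n). \<psi> x \<in> boundaries P (h + int n)) \<and> (n = 0 \<longrightarrow> \<psi> = k)" for n \<psi>
  define Q where "Q n \<psi> \<psi>' \<longleftrightarrow> (\<forall>x\<in>elems G (h + int n + 1).
    bd P (h + int n + 1) (\<psi>' x) = \<psi> (bd G (h + int n + 1) x))" for n \<psi> \<psi>'
  have "\<exists>\<psi>. \<forall>n. Pr n (\<psi> n) \<and> Q n (\<psi> n) (\<psi> (Suc n))"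
  proof (rule dependent_nat_choice)
    have "k x \<in> boundaries P h" if x: "x \<in> boundaries G h" for x
    proof -
      have xc: "x \<in> elems G h" using module.submodule_closed(6)[OF DG(1) boundaries_submodule[OF chG] x] .
      show ?thesis using f(3)[OF kc[OF xc]] k(2)[OF xc] \<epsilon>(2)[OF x] by simp
    qed
    then have "Pr 0 k" unfolding Pr_def using kh by simp
    then show "\<exists>\<psi>. Pr 0 \<psi>" by blast
  next
    fix \<psi> n assume \<psi>n: "Pr n \<psi>"
    define i where "i = h + int n"
    have \<psi>: "\<psi> \<in> mod_hom R (obj G i) (obj P i)" "!!x. x \<in> boundaries G i ==> \<psi> x \<in> boundaries P i"
      using \<psi>n unfolding Pr_def i_def by auto
    have hh: "(\<lambda>x. \<psi> (bd G (i + 1) x)) \<in> mod_hom R (obj G (i + 1)) (obj P i)" by (rule mod_hom_comp[OF DG(3) \<psi>(1)])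
    have "(\<lambda>x. \<psi> (bd G (i + 1) x)) ` elems G (i + 1) \<subseteq> bd P (i + 1) ` elems P (i + 1)"
      using \<psi>(2) unfolding boundaries_def by auto
    then obtain \<psi>' where \<psi>': "\<psi>' \<in> mod_hom R (obj G (i + 1)) (obj P (i + 1))"
      "!!x. x \<in> elems G (i + 1) ==> bd P (i + 1) (\<psi>' x) = \<psi> (bd G (i + 1) x)"
      using projective_lift_into[OF fg G(2) DP(1) DP(1) DP(3) hh module.carrier_is_submodule[OF DP(1)]] by metis
    have i: "h + int (Suc n) = i + 1" by (simp add: i_def)
    have "\<psi>' x \<in> boundaries P (i + 1)" if x: "x \<in> boundaries G (i + 1)" for x
    proof -
      have xc: "x \<in> cycles G (i + 1)" using x boundaries_cycles[OF chG] by blast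
      then have x': "x \<in> elems G (i + 1)" "bd G (i + 1) x = \<zero>\<^bsub>obj G i\<^esub>" by (auto simp: cycles_def)
      have "bd P (i + 1) (\<psi>' x) = \<zero>\<^bsub>obj P i\<^esub>"
        unfolding \<psi>'(2)[OF x'(1)] x'(2) by (rule mod_hom_zero[OF DG(1) DP(1) \<psi>(1)])
      then have "\<psi>' x \<in> cycles P (i + 1)" unfolding cycles_def using mod_hom_closed[OF \<psi>'(1) x'(1)] by simp
      moreover have "h < i + 1" by (simp add: i_def)
      ultimately show ?thesis using P(2) by blast
    qed
    then have "Pr (Suc n) \<psi>'" unfolding Pr_def i using \<psi>'(1) by simp
    moreover have "Q n \<psi> \<psi>'" unfolding Q_def using \<psi>'(2) by (simp add: i_def)
    ultimately show "\<exists>\<psi>'. Pr (Suc n) \<psi>' \<and> Q n \<psi> \<psi>'" by blast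
  qed
  then obtain \<psi> where \<psi>: "!!n. Pr n (\<psi> n)" "!!n. Q n (\<psi> n) (\<psi> (Suc n))" by blast
  define \<phi> where "\<phi> i = (if i < h then (\<lambda>_. \<zero>\<^bsub>obj P i\<^esub>) else \<psi> (nat (i - h)))" for i
  have \<phi>0: "\<phi> h = k" using \<psi>(1)[of 0] by (simp add: \<phi>_def Pr_def)
  have hom: "\<phi> i \<in> mod_hom R (obj G i) (obj P i)" for i
  proof (cases "i < h")
    case True then show ?thesis using mod_hom_zerof[OF DP(1)] by (simp add: \<phi>_def)
  next
    case False
    then have "h + int (nat (i - h)) = i" by simp
    then show ?thesis using \<psi>(1)[of "nat (i - h)"] False unfolding Pr_def by (simp add: \<phi>_def)
  qed
  have comm: "\<phi> (i - 1) (bd G i x) = bd P i (\<phi> i x)" if x: "x \<in> elems G i" for i x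
  proof -
    consider "i < h" | "i = h" | "h < i" by linarith
    then show ?thesis
    proof cases
      case 1
      then show ?thesis using mod_hom_zero[OF DP(1) DP(1) DP(2)] by (simp add: \<phi>_def)
    next
      case 2
      have "bd P h (\<phi> h x) = \<zero>\<^bsub>obj P (h - 1)\<^esub>" using kc[of x] x unfolding \<phi>0 2 cycles_def by simp
      then show ?thesis unfolding 2 by (simp add: \<phi>_def)
    next
      case 3
      define n where "n = nat (i - 1 - h)"
      have n: "h + int n + 1 = i" "h + int n = i - 1" "nat (i - h) = Suc n" using 3 by (simp_all add: n_def)
      have "bd P i (\<psi> (Suc n) x) = \<psi> n (bd G i x)" using \<psi>(2)[of n] x unfolding Q_def n(1) by blast
      moreover have "\<phi> i = \<psi> (Suc n)" using 3 n(3) by (simp add: \<phi>_def)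
      moreover have "\<phi> (i - 1) = \<psi> n"
      proof -
        have "\<not> i - 1 < h" "nat (i - 1 - h) = n" using 3 by (simp_all add: n_def)
        then show ?thesis by (simp only: \<phi>_def if_False)
      qed
      ultimately show ?thesis by simp
    qed
  qed
  have "chain_map R G P \<phi>" unfolding chain_map_def using hom comm by blast
  then show ?thesis using that[of \<phi>] kc k(2) unfolding \<phi>0 by simp
qed

subsection \<open>Shifts and powers of complexes\<close>

definition shift_cpx :: "int \<Rightarrow> ('a, 'b) cpx \<Rightarrow> ('a, 'b) cpx" where
  "shift_cpx h X = \<lparr>obj = (\<lambda>i. obj X (i - h)), bd = (\<lambda>i. bd X (i - h))\<rparr>"

lemma shift_cpx_simps:
  "obj (shift_cpx h X) i = obj X (i - h)" "bd (shift_cpx h X) i = bd X (i - h)"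
  "cycles (shift_cpx h X) i = cycles X (i - h)"
  "boundaries (shift_cpx h X) i = boundaries X (i - h)"
proof -
  have e: "i - 1 - h = i - h - 1" "i + 1 - h = i - h + 1" by simp_all
  show o: "obj (shift_cpx h X) i = obj X (i - h)" "bd (shift_cpx h X) i = bd X (i - h)" for i
    by (simp_all add: shift_cpx_def)
  show "cycles (shift_cpx h X) i = cycles X (i - h)" "boundaries (shift_cpx h X) i = boundaries X (i - h)"
    unfolding cycles_def boundaries_def o e by simp_all
qed

lemma shift_cpx_complex:
  assumes "is_complex R X"
  shows "is_complex R (shift_cpx h X)"
proof (rule is_complexI, unfold shift_cpx_simps)
  show "fin_gen_module R (obj X (i - h))" for i using assms by (simp add: is_complex_def)
  have e: "i - 1 - h = i - h - 1" "i - 2 - h = i - h - 2" for i by simp_all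
  show "bd X (i - h) \<in> mod_hom R (obj X (i - h)) (obj X (i - 1 - h))" for i
    unfolding e using assms by (simp add: is_complex_def)
  show "bd X (i - 1 - h) (bd X (i - h) x) = \<zero>\<^bsub>obj X (i - 2 - h)\<^esub>" if "x \<in> elems X (i - h)" for i x
    unfolding e using assms that by (simp add: is_complex_def)
qed

lemma tensor_shift_cpx: "tensor_cpx R (shift_cpx h X) N = shift_cpx h (tensor_cpx R X N)"
proof -
  have e: "i - 1 - h = i - h - 1" for i by simp
  show ?thesis unfolding tensor_cpx_def shift_cpx_def by (simp add: e)
qed

lemma power_module_simps:
  "carrier (power_module M n) = {..<n} \<rightarrow>\<^sub>E carrier M" "\<zero>\<^bsub>power_module M n\<^esub> = (\<lambda>i\<in>{..<n}. \<zero>\<^sub>M)"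
  "x \<oplus>\<^bsub>power_module M n\<^esub> y = (\<lambda>i\<in>{..<n}. x i \<oplus>\<^sub>M y i)" "r \<odot>\<^bsub>power_module M n\<^esub> x = (\<lambda>i\<in>{..<n}. r \<odot>\<^sub>M x i)"
  by (simp_all add: power_module_def)

lemma power_module_eqI:
  assumes "x \<in> carrier (power_module M n)" "y \<in> carrier (power_module M n)" "!!i. i < n ==> x i = y i"
  shows "x = y"
  using assms unfolding power_module_simps by (intro PiE_ext[of x "{..<n}" _ y]) auto

lemma power_module_module:
  assumes "module R M"
  shows "module R (power_module M n)"
proof -
  interpret M: module R M by fact
  have c: "x i \<in> carrier M" if "x \<in> {..<n} \<rightarrow>\<^sub>E carrier M" "i < n" for x i using that by auto
  have "abelian_group (power_module M n)"
  proof (rule abelian_groupI)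
    fix x assume x: "x \<in> carrier (power_module M n)"
    show "\<exists>y\<in>carrier (power_module M n). y \<oplus>\<^bsub>power_module M n\<^esub> x = \<zero>\<^bsub>power_module M n\<^esub>"
      using x c by (intro bexI[of _ "\<lambda>i\<in>{..<n}. \<ominus>\<^sub>M x i"]) (auto simp: power_module_simps M.l_neg intro!: restrict_ext)
    show "\<zero>\<^bsub>power_module M n\<^esub> \<oplus>\<^bsub>power_module M n\<^esub> x = x"
      using x c unfolding power_module_simps by (intro PiE_ext[of _ "{..<n}" "\<lambda>_. carrier M" x]) auto
  qed (use c in \<open>auto simp: power_module_simps M.a_ac intro!: restrict_ext\<close>)
  then show ?thesis
    by (intro moduleI M.R.is_cring) (use c in \<open>auto simp: power_module_simps M.smult_l_distr
      M.smult_r_distr M.smult_assoc1 intro!: restrict_ext PiE_ext[of _ "{..<n}" "\<lambda>_. carrier M"]\<close>)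
qed

definition power_in :: "('a, 'b, 'm) module_scheme \<Rightarrow> nat \<Rightarrow> nat \<Rightarrow> 'b \<Rightarrow> nat \<Rightarrow> 'b" where
  "power_in M n k x = (\<lambda>j\<in>{..<n}. if j = k then x else \<zero>\<^sub>M)"

lemma power_proj_hom: "k < n ==> (\<lambda>x. x k) \<in> mod_hom R (power_module M n) M"
  by (rule mod_homI) (auto simp: power_module_simps)

lemma power_in_hom:
  assumes "module R M"
  shows "power_in M n k \<in> mod_hom R M (power_module M n)"
proof -
  interpret M: module R M by fact
  show ?thesis by (rule mod_homI) (auto simp: power_module_simps power_in_def intro!: restrict_ext)
qed

lemma power_apply_finsum:
  assumes M: "module R M" and I: "finite I" "g \<in> I \<rightarrow> carrier (power_module M n)" and j: "j < n"
  shows "finsum (power_module M n) g I j = finsum M (\<lambda>i. g i j) I"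
  using mod_hom_finsum[OF power_module_module[OF M] M power_proj_hom[OF j] I] .

lemma power_expand:
  assumes M: "module R M" and x: "x \<in> carrier (power_module M n)"
  shows "x = (\<Oplus>\<^bsub>power_module M n\<^esub>k\<in>{..<n}. power_in M n k (x k))"
proof (rule power_module_eqI[OF x])
  interpret M: module R M by fact
  interpret P: module R "power_module M n" using M by (rule power_module_module)
  have xc: "x k \<in> carrier M" if "k < n" for k using x that by (auto simp: power_module_simps)
  have g: "(\<lambda>k. power_in M n k (x k)) \<in> {..<n} \<rightarrow> carrier (power_module M n)"
    using mod_hom_closed[OF power_in_hom[OF M]] xc by auto
  show "(\<Oplus>\<^bsub>power_module M n\<^esub>k\<in>{..<n}. power_in M n k (x k)) \<in> carrier (power_module M n)"
    by (rule P.finsum_closed[OF g])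
  fix j assume j: "j < n"
  have "(\<Oplus>\<^bsub>power_module M n\<^esub>k\<in>{..<n}. power_in M n k (x k)) j = (\<Oplus>\<^bsub>M\<^esub>k\<in>{..<n}. if j = k then x k else \<zero>\<^sub>M)"
    unfolding power_apply_finsum[OF M finite_lessThan g j]
    using j xc by (intro M.finsum_cong') (auto simp: power_in_def)
  also have "\<dots> = x j" using j xc by (intro M.finsum_singleton) auto
  finally show "x j = (\<Oplus>\<^bsub>power_module M n\<^esub>k\<in>{..<n}. power_in M n k (x k)) j" by simp
qed

lemma fin_gen_power:
  assumes M: "fin_gen_module R M"
  shows "fin_gen_module R (power_module M n)"
proof -
  note Mm = fin_gen_module_module[OF M]
  interpret P: module R "power_module M n" using Mm by (rule power_module_module)
  obtain S where S: "finite S" "S \<subseteq> carrier M" "mod_span R M S = carrier M" using M by (auto simp: fin_gen_module_def)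
  let ?U = "(\<lambda>(k, x). power_in M n k x) ` ({..<n} \<times> S)"
  let ?P = "power_module M n"
  have U: "?U \<subseteq> carrier ?P" using mod_hom_closed[OF power_in_hom[OF Mm]] S(2) by auto
  note sm = P.mod_span_submodule[OF U]
  have inU: "power_in M n k x \<in> mod_span R ?P ?U" if k: "k < n" and x: "x \<in> carrier M" for k x
  proof -
    have "mod_span R M S \<subseteq> {x \<in> carrier M. power_in M n k x \<in> mod_span R ?P ?U}"
      using S(2) mod_span_base[of ?U R ?P] k
      by (intro mod_span_least preimage_submodule[OF Mm P.module_axioms power_in_hom[OF Mm] sm]) auto
    then show ?thesis using x S(3) by blast
  qed
  have "x \<in> mod_span R ?P ?U" if x: "x \<in> carrier ?P" for x
  proof -
    have "(\<Oplus>\<^bsub>?P\<^esub>k\<in>{..<n}. power_in M n k (x k)) \<in> mod_span R ?P ?U"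
      using inU x by (intro P.submodule_finsum[OF sm] Pi_I) (auto simp: power_module_simps)
    then show ?thesis unfolding power_expand[OF Mm x, symmetric] .
  qed
  then have "mod_span R ?P ?U = carrier ?P" using P.submodule_closed(6)[OF sm] by (intro equalityI subsetI) auto
  moreover have "finite ?U" using S(1) by simp
  ultimately show ?thesis unfolding fin_gen_module_def using P.module_axioms U by (intro conjI exI[of _ ?U])
qed

lemma projective_power:
  assumes M: "projective_module R M"
  shows "projective_module R (power_module M n)"
  unfolding projective_module_def
proof (intro conjI allI ballI impI power_module_module projective_module_module[OF M])
  fix C D :: "'a univ_module" and g h
  assume g: "g \<in> mod_hom R C D" and h: "h \<in> mod_hom R (power_module M n) D"
    and CD: "module R C \<and> module R D \<and> g ` carrier C = carrier D"
  have Cm: "module R C" and Dm: "module R D" and gg: "g ` carrier C = carrier D" using CD by simp_all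
  interpret C: module R C by (rule Cm)
  interpret D: module R D by (rule Dm)
  note Mm = projective_module_module[OF M]
  note Pm = power_module_module[OF Mm]
  have "\<exists>l. l \<in> mod_hom R M C \<and> (\<forall>x\<in>carrier M. g (l x) = h (power_in M n k x))" for k
    using projective_lift[OF M Cm Dm g gg mod_hom_comp[OF power_in_hom[OF Mm] h]] by metis
  then obtain l where l: "!!k. l k \<in> mod_hom R M C" "!!k x. x \<in> carrier M ==> g (l k x) = h (power_in M n k x)" by metis
  show "\<exists>k\<in>mod_hom R (power_module M n) C. \<forall>x\<in>carrier (power_module M n). g (k x) = h x"
  proof (intro bexI ballI)
    show "(\<lambda>x. finsum C (\<lambda>k. l k (x k)) {..<n}) \<in> mod_hom R (power_module M n) C"
      using mod_hom_comp[OF power_proj_hom l(1)] by (intro mod_hom_finsumf Cm) auto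
    fix x assume x: "x \<in> carrier (power_module M n)"
    have xc: "x k \<in> carrier M" if "k < n" for k using x that by (auto simp: power_module_simps)
    have "g (finsum C (\<lambda>k. l k (x k)) {..<n}) = finsum D (\<lambda>k. g (l k (x k))) {..<n}"
      using xc mod_hom_closed[OF l(1)] by (intro mod_hom_finsum[OF Cm Dm g]) auto
    also have "\<dots> = finsum D (\<lambda>k. h (power_in M n k (x k))) {..<n}"
      using xc l(2) mod_hom_closed[OF h] mod_hom_closed[OF power_in_hom[OF Mm]] by (intro D.finsum_cong') auto
    also have "\<dots> = h (\<Oplus>\<^bsub>power_module M n\<^esub>k\<in>{..<n}. power_in M n k (x k))"
      using xc mod_hom_closed[OF power_in_hom[OF Mm]] by (intro mod_hom_finsum[OF Pm Dm h, symmetric]) auto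
    finally show "g (finsum C (\<lambda>k. l k (x k)) {..<n}) = h x" unfolding power_expand[OF Mm x, symmetric] .
  qed
qed

definition power_cpx :: "('a, 'b) cpx \<Rightarrow> nat \<Rightarrow> ('a, nat \<Rightarrow> 'b) cpx" where
  "power_cpx X n = \<lparr>obj = (\<lambda>i. power_module (obj X i) n), bd = (\<lambda>i x. \<lambda>k\<in>{..<n}. bd X i (x k))\<rparr>"

lemma power_cpx_simps:
  "obj (power_cpx X n) i = power_module (obj X i) n" "bd (power_cpx X n) i x = (\<lambda>k\<in>{..<n}. bd X i (x k))"
  by (simp_all add: power_cpx_def)

lemma power_cpx_complex:
  assumes X: "is_complex R X"
  shows "is_complex R (power_cpx X n)"
proof (rule is_complexI)
  note D = chain_complexD[OF is_complex_chain[OF X]]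
  have c: "x k \<in> elems X i" if "x \<in> {..<n} \<rightarrow>\<^sub>E elems X i" "k < n" for x k i
    using that by auto
  show "fin_gen_module R (obj (power_cpx X n) i)" for i
    unfolding power_cpx_simps using X by (intro fin_gen_power) (simp add: is_complex_def)
  show "bd (power_cpx X n) i \<in> mod_hom R (obj (power_cpx X n) i) (obj (power_cpx X n) (i - 1))" for i
  proof (rule mod_homI; unfold power_cpx_simps power_module_simps)
    show "(\<lambda>k\<in>{..<n}. bd X i (x k)) \<in> {..<n} \<rightarrow>\<^sub>E elems X (i - 1)"
      if x: "x \<in> {..<n} \<rightarrow>\<^sub>E elems X i" for x
      using D(6)[OF c[OF x]] by simp
    show "(\<lambda>k\<in>{..<n}. bd X i ((\<lambda>k\<in>{..<n}. x k \<oplus>\<^bsub>obj X i\<^esub> y k) k)) =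
        (\<lambda>k\<in>{..<n}. (\<lambda>k\<in>{..<n}. bd X i (x k)) k \<oplus>\<^bsub>obj X (i - 1)\<^esub> (\<lambda>k\<in>{..<n}. bd X i (y k)) k)"
      if x: "x \<in> {..<n} \<rightarrow>\<^sub>E elems X i" and y: "y \<in> {..<n} \<rightarrow>\<^sub>E elems X i" for x y
      using mod_hom_add[OF D(2) c[OF x] c[OF y]] by (intro restrict_ext) simp
    show "(\<lambda>k\<in>{..<n}. bd X i ((\<lambda>k\<in>{..<n}. r \<odot>\<^bsub>obj X i\<^esub> x k) k)) =
        (\<lambda>k\<in>{..<n}. r \<odot>\<^bsub>obj X (i - 1)\<^esub> (\<lambda>k\<in>{..<n}. bd X i (x k)) k)"
      if r: "r \<in> carrier R" and x: "x \<in> {..<n} \<rightarrow>\<^sub>E elems X i" for r x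
      using mod_hom_smult[OF D(2) r c[OF x]] by (intro restrict_ext) simp
  qed
  show "bd (power_cpx X n) (i - 1) (bd (power_cpx X n) i x) = \<zero>\<^bsub>obj (power_cpx X n) (i - 2)\<^esub>"
    if "x \<in> elems (power_cpx X n) i" for i x
  proof -
    have x: "x \<in> {..<n} \<rightarrow>\<^sub>E elems X i" using that by (simp add: power_cpx_simps power_module_simps)
    show ?thesis unfolding power_cpx_simps power_module_simps
      using D(4)[OF c[OF x]] by (intro restrict_ext) simp
  qed
qed

lemma power_cpx_cycles:
  assumes X: "is_complex R X"
  shows "x \<in> cycles (power_cpx X n) i \<longleftrightarrow> x \<in> {..<n} \<rightarrow>\<^sub>E cycles X i"
    "x \<in> boundaries (power_cpx X n) i \<longleftrightarrow> x \<in> {..<n} \<rightarrow>\<^sub>E boundaries X i"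
proof -
  have "(\<lambda>k\<in>{..<n}. bd X i (x k)) = (\<lambda>k\<in>{..<n}. \<zero>\<^bsub>obj X (i - 1)\<^esub>) \<longleftrightarrow> (\<forall>k<n. bd X i (x k) = \<zero>\<^bsub>obj X (i - 1)\<^esub>)"
    by (auto simp: fun_eq_iff restrict_def)
  then show "x \<in> cycles (power_cpx X n) i \<longleftrightarrow> x \<in> {..<n} \<rightarrow>\<^sub>E cycles X i"
    unfolding cycles_def power_cpx_simps power_module_simps mem_Collect_eq by (auto simp: PiE_iff)
  show "x \<in> boundaries (power_cpx X n) i \<longleftrightarrow> x \<in> {..<n} \<rightarrow>\<^sub>E boundaries X i"
  proof
    assume "x \<in> boundaries (power_cpx X n) i"
    then obtain y where "y \<in> {..<n} \<rightarrow>\<^sub>E elems X (i + 1)" "x = (\<lambda>k\<in>{..<n}. bd X (i + 1) (y k))"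
      unfolding boundaries_def power_cpx_simps power_module_simps by blast
    then show "x \<in> {..<n} \<rightarrow>\<^sub>E boundaries X i" unfolding boundaries_def by (auto simp: PiE_iff)
  next
    assume x: "x \<in> {..<n} \<rightarrow>\<^sub>E boundaries X i"
    then have "\<exists>y. y \<in> elems X (i + 1) \<and> x k = bd X (i + 1) y" if "k < n" for k
      using that unfolding boundaries_def by (auto simp: PiE_iff)
    then obtain y where y: "!!k. k < n ==> y k \<in> elems X (i + 1)" "!!k. k < n ==> x k = bd X (i + 1) (y k)" by metis
    have "x = (\<lambda>k\<in>{..<n}. bd X (i + 1) ((\<lambda>k\<in>{..<n}. y k) k))"
      using x y(2) by (intro ext) (auto simp: PiE_iff extensional_def)
    moreover have "(\<lambda>k\<in>{..<n}. y k) \<in> {..<n} \<rightarrow>\<^sub>E elems X (i + 1)" using y(1) by auto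
    ultimately show "x \<in> boundaries (power_cpx X n) i"
      unfolding boundaries_def power_cpx_simps power_module_simps by blast
  qed
qed

lemma power_cpx_homology:
  assumes X: "is_complex R X" and B: "module R B" and i: "mod_iso R (homology X i) B"
  shows "mod_iso R (homology (power_cpx X n) i) (power_module B n)"
proof -
  note ch = is_complex_chain[OF X] and chp = is_complex_chain[OF power_cpx_complex[OF X]]
  obtain f where f: "f \<in> mod_hom R (obj X i\<lparr>carrier := cycles X i\<rparr>) B" "f ` cycles X i = carrier B"
    "!!x. x \<in> cycles X i ==> f x = \<zero>\<^sub>B \<longleftrightarrow> x \<in> boundaries X i"
    using iffD1[OF homology_iso_iff[OF ch B] i] by (elim bexE conjE) (rule that, assumption, assumption, drule (1) bspec)
  note fc = mod_hom_closed[OF f(1), simplified] and fa = mod_hom_add[OF f(1), simplified] and fs = mod_hom_smult[OF f(1), simplified]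
  have cyc: "x k \<in> cycles X i" if "x \<in> cycles (power_cpx X n) i" "k < n" for x k
    using that power_cpx_cycles(1)[OF X] by (auto simp: PiE_iff)
  let ?g = "\<lambda>x. \<lambda>k\<in>{..<n}. f (x k)"
  show ?thesis unfolding homology_iso_iff[OF chp power_module_module[OF B]]
  proof (intro bexI[of _ ?g] conjI ballI)
    show "?g \<in> mod_hom R (obj (power_cpx X n) i\<lparr>carrier := cycles (power_cpx X n) i\<rparr>) (power_module B n)"
      by (rule mod_homI) (auto simp: power_cpx_simps power_module_simps cyc fc fa fs intro!: restrict_ext)
    show "?g ` cycles (power_cpx X n) i = carrier (power_module B n)"
    proof (intro equalityI subsetI)
      fix y assume "y \<in> ?g ` cycles (power_cpx X n) i"
      then obtain x where x: "x \<in> cycles (power_cpx X n) i" "y = ?g x" by blast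
      show "y \<in> carrier (power_module B n)"
        unfolding x(2) power_module_simps using fc[OF cyc[OF x(1)]] by simp
    next
      fix y assume y: "y \<in> carrier (power_module B n)"
      have "\<exists>x. x \<in> cycles X i \<and> y k = f x" if "k < n" for k
      proof -
        have "y k \<in> f ` cycles X i" unfolding f(2) using y that by (auto simp: power_module_simps)
        then show ?thesis by blast
      qed
      then obtain x where x: "!!k. k < n ==> x k \<in> cycles X i" "!!k. k < n ==> y k = f (x k)" by metis
      have "(\<lambda>k\<in>{..<n}. x k) \<in> cycles (power_cpx X n) i" unfolding power_cpx_cycles(1)[OF X] using x(1) by auto
      moreover have "y = ?g (\<lambda>k\<in>{..<n}. x k)"
        using y x(2) by (intro ext) (auto simp: power_module_simps PiE_iff extensional_def)
      ultimately show "y \<in> ?g ` cycles (power_cpx X n) i" by blast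
    qed
    fix x assume x: "x \<in> cycles (power_cpx X n) i"
    have "?g x = \<zero>\<^bsub>power_module B n\<^esub> \<longleftrightarrow> (\<forall>k<n. f (x k) = \<zero>\<^sub>B)"
      unfolding power_module_simps by (auto simp: fun_eq_iff restrict_def)
    also have "\<dots> \<longleftrightarrow> (\<forall>k<n. x k \<in> boundaries X i)" using f(3) cyc[OF x] by simp
    also have "\<dots> \<longleftrightarrow> x \<in> boundaries (power_cpx X n) i"
      using x unfolding power_cpx_cycles[OF X] by (auto simp: PiE_iff)
    finally show "?g x = \<zero>\<^bsub>power_module B n\<^esub> \<longleftrightarrow> x \<in> boundaries (power_cpx X n) i" .
  qed
qed

lemma tensor_map_finsum:
  assumes M: "module R M" "module R M'" and N: "module R N" and I: "finite I" "!!k. k \<in> I ==> f k \<in> mod_hom R M M'"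
    and w: "w \<in> carrier (tensor R M N)"
  shows "tensor_map R M M' N (\<lambda>x. finsum M' (\<lambda>k. f k x) I) w =
    finsum (tensor R M' N) (\<lambda>k. tensor_map R M M' N (f k) w) I"
  using I
proof (induction I rule: finite_induct)
  interpret M': module R M' by (rule M(2))
  interpret T: module R "tensor R M' N" by (rule tensor_pair.tensor_module[OF tensor_pairI[OF M(2) N]])
  {
    case empty
    show ?case using tensor_map_zero[OF M N _ w, of "\<lambda>x. \<zero>\<^bsub>M'\<^esub>"] by simp
  next
    case (insert k I)
    have h: "(\<lambda>x. finsum M' (\<lambda>k. f k x) I) \<in> mod_hom R M M'" using insert by (intro mod_hom_finsumf M(2)) auto
    have h': "(\<lambda>x. finsum M' (\<lambda>k. f k x) (insert k I)) \<in> mod_hom R M M'" using insert by (intro mod_hom_finsumf M(2)) auto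
    have fk: "f k \<in> mod_hom R M M'" using insert by simp
    have e: "finsum M' (\<lambda>k. f k x) (insert k I) = f k x \<oplus>\<^bsub>M'\<^esub> finsum M' (\<lambda>k. f k x) I" if "x \<in> carrier M" for x
      using insert that mod_hom_closed by (intro M'.finsum_insert) fastforce+
    have tc: "(\<lambda>k. tensor_map R M M' N (f k) w) \<in> I \<rightarrow> carrier (tensor R M' N)"
      "tensor_map R M M' N (f k) w \<in> carrier (tensor R M' N)"
      using mod_hom_closed[OF tensor_map(1)[OF M N insert.prems] w] by auto
    show ?case
      using tensor_map_add[OF M N fk h h' e w] insert.IH insert.prems
        T.finsum_insert[OF insert.hyps tc] by simp
  }
qed

text \<open>Tensoring commutes with powers, and so does taking homology.\<close>
lemma power_cpx_tensor:
  assumes X: "is_complex R X" and N: "module R N"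
  shows "mod_iso R (homology (tensor_cpx R (power_cpx X n) N) i) (power_module (homology (tensor_cpx R X N) i) n)"
    and "exact_at (tensor_cpx R X N) i ==>
      cycles (tensor_cpx R (power_cpx X n) N) i \<subseteq> boundaries (tensor_cpx R (power_cpx X n) N) i"
proof -
  note ch = is_complex_chain[OF X] and chp = is_complex_chain[OF power_cpx_complex[OF X]]
  note cT = tensor_cpx_chain[OF ch N] and cTp = tensor_cpx_chain[OF chp N, of n]
  note D = chain_complexD[OF ch]
  let ?X = "tensor_cpx R X N" and ?Y = "tensor_cpx R (power_cpx X n) N"
  have pr: "chain_map R (power_cpx X n) X (\<lambda>i x. x k)" if k: "k < n" for k
    unfolding chain_map_def power_cpx_simps using power_proj_hom[OF k] k by auto
  have inj: "chain_map R X (power_cpx X n) (\<lambda>i. power_in (obj X i) n k)" for k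
    unfolding chain_map_def
  proof (intro conjI allI ballI)
    show "power_in (obj X i) n k \<in> mod_hom R (obj X i) (obj (power_cpx X n) i)" for i
      unfolding power_cpx_simps by (rule power_in_hom[OF D(1)])
    show "power_in (obj X (i - 1)) n k (bd X i x) = bd (power_cpx X n) i (power_in (obj X i) n k x)" for i x
      unfolding power_cpx_simps power_in_def using mod_hom_zero[OF D(1,1,2)] by (auto intro!: restrict_ext)
  qed
  define p where "p k i = tensor_map R (obj (power_cpx X n) i) (obj X i) N (\<lambda>x. x k)" for k i
  define j where "j k i = tensor_map R (obj X i) (obj (power_cpx X n) i) N (power_in (obj X i) n k)" for k i
  have pc: "chain_map R ?Y ?X (p k)" if "k < n" for k
    using chain_map_tensor[OF chp ch N pr[OF that]] unfolding p_def .
  have jc: "chain_map R ?X ?Y (j k)" for k using chain_map_tensor[OF ch chp N inj] unfolding j_def .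
  have Pm: "module R (power_module (obj X i) n)" for i by (rule power_module_module[OF D(1)])
  have pj: "p k i (j l i w) = (if k = l then w else \<zero>\<^bsub>tensor R (obj X i) N\<^esub>)"
    if k: "k < n" and w: "w \<in> carrier (tensor R (obj X i) N)" for k l i w
  proof -
    have "p k i (j l i w) = tensor_map R (obj X i) (obj X i) N (\<lambda>x. power_in (obj X i) n l x k) w"
      unfolding p_def j_def power_cpx_simps
      by (rule tensor_map_comp[OF D(1) Pm D(1) N power_in_hom[OF D(1)] power_proj_hom[OF k] w])
    also have "\<dots> = (if k = l then w else \<zero>\<^bsub>tensor R (obj X i) N\<^esub>)"
    proof (cases "k = l")
      case True
      then show ?thesis using tensor_map_id[OF D(1) N _ w, of "\<lambda>x. power_in (obj X i) n l x k"] k by (simp add: power_in_def)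
    next
      case False
      then show ?thesis using tensor_map_zero[OF D(1) D(1) N _ w, of "\<lambda>x. power_in (obj X i) n l x k"] k by (simp add: power_in_def)
    qed
    finally show ?thesis .
  qed
  have jp: "w = finsum (obj ?Y i) (\<lambda>k. j k i (p k i w)) {..<n}" if w: "w \<in> elems ?Y i" for i w
  proof -
    have w': "w \<in> carrier (tensor R (power_module (obj X i) n) N)" using w unfolding tensor_cpx_simps power_cpx_simps .
    have h: "(\<lambda>x. power_in (obj X i) n k (x k)) \<in> mod_hom R (power_module (obj X i) n) (power_module (obj X i) n)" if "k < n" for k
      by (rule mod_hom_comp[OF power_proj_hom[OF that] power_in_hom[OF D(1)]])
    have "w = tensor_map R (power_module (obj X i) n) (power_module (obj X i) n) N
        (\<lambda>x. finsum (power_module (obj X i) n) (\<lambda>k. power_in (obj X i) n k (x k)) {..<n}) w"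
      by (rule tensor_map_id[OF Pm N _ w', symmetric]) (rule power_expand[OF D(1), symmetric])
    also have "\<dots> = finsum (tensor R (power_module (obj X i) n) N)
        (\<lambda>k. tensor_map R (power_module (obj X i) n) (power_module (obj X i) n) N (\<lambda>x. power_in (obj X i) n k (x k)) w) {..<n}"
      by (rule tensor_map_finsum[OF Pm Pm N finite_lessThan _ w']) (simp add: h)
    also have "\<dots> = finsum (tensor R (power_module (obj X i) n) N) (\<lambda>k. j k i (p k i w)) {..<n}"
    proof (rule abelian_monoid.finsum_cong'[OF abelian_group.axioms(1)[OF module_abelian_group[OF tensor_pair.tensor_module[OF tensor_pairI[OF Pm N]]]] refl])
      show "(\<lambda>k. j k i (p k i w)) \<in> {..<n} \<rightarrow> carrier (tensor R (power_module (obj X i) n) N)"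
        using mod_hom_closed[OF chain_mapD(1)[OF jc] mod_hom_closed[OF chain_mapD(1)[OF pc] w]]
        unfolding tensor_cpx_simps power_cpx_simps by simp
      show "tensor_map R (power_module (obj X i) n) (power_module (obj X i) n) N (\<lambda>x. power_in (obj X i) n k (x k)) w = j k i (p k i w)"
        if "k \<in> {..<n}" for k
        unfolding p_def j_def power_cpx_simps
        using tensor_map_comp[OF Pm D(1) Pm N power_proj_hom power_in_hom[OF D(1)] w'] that by simp
    qed
    finally show ?thesis unfolding tensor_cpx_simps power_cpx_simps .
  qed
  interpret Y: module R "obj ?Y i" by (rule chain_complexD(1)[OF cTp])
  have bdry: "w \<in> boundaries ?Y i" if w: "w \<in> cycles ?Y i" and b: "!!k. k < n ==> p k i w \<in> boundaries ?X i" for w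
  proof -
    have wc: "w \<in> elems ?Y i" using w by (simp add: cycles_def)
    have "finsum (obj ?Y i) (\<lambda>k. j k i (p k i w)) {..<n} \<in> boundaries ?Y i"
      using chain_map_boundaries[OF jc b] by (intro Y.submodule_finsum[OF boundaries_submodule[OF cTp]] Pi_I) simp
    then show ?thesis unfolding jp[OF wc, symmetric] .
  qed
  show "exact_at ?X i ==> exact_at ?Y i"
  proof
    fix w assume "exact_at ?X i" "w \<in> cycles ?Y i"
    then show "w \<in> boundaries ?Y i"
      by (intro bdry) (use chain_map_cycles[OF cTp cT pc, of _ w i] in auto)
  qed
  obtain f where f: "f \<in> mod_hom R (obj ?X i\<lparr>carrier := cycles ?X i\<rparr>) (homology ?X i)"
    "f ` cycles ?X i = carrier (homology ?X i)"
    "!!x. x \<in> cycles ?X i ==> f x = \<zero>\<^bsub>homology ?X i\<^esub> \<longleftrightarrow> x \<in> boundaries ?X i"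
    by (rule homology_proj[OF cT, of i]) (rule that)
  note fc = mod_hom_closed[OF f(1), simplified] and fa = mod_hom_add[OF f(1), simplified] and fs = mod_hom_smult[OF f(1), simplified]
  have pcy: "p k i w \<in> cycles ?X i" if "k < n" "w \<in> cycles ?Y i" for k w
    using chain_map_cycles[OF cTp cT pc[OF that(1)] that(2)] .
  have ph: "p k i \<in> mod_hom R (obj ?Y i) (obj ?X i)" if "k < n" for k by (rule chain_mapD(1)[OF pc[OF that]])
  have cyc: "w \<in> elems ?Y i" if "w \<in> cycles ?Y i" for w using that by (simp add: cycles_def)
  let ?g = "\<lambda>w. \<lambda>k\<in>{..<n}. f (p k i w)"
  show "mod_iso R (homology ?Y i) (power_module (homology ?X i) n)"
    unfolding homology_iso_iff[OF cTp power_module_module[OF homology_module[OF cT]]]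
  proof (intro bexI[of _ ?g] conjI ballI)
    show "?g \<in> mod_hom R (obj ?Y i\<lparr>carrier := cycles ?Y i\<rparr>) (power_module (homology ?X i) n)"
      by (rule mod_homI) (auto simp: power_module_simps fc fa fs pcy cyc mod_hom_add[OF ph] mod_hom_smult[OF ph] intro!: restrict_ext)
    show "?g ` cycles ?Y i = carrier (power_module (homology ?X i) n)"
    proof (intro equalityI subsetI)
      fix y assume "y \<in> ?g ` cycles ?Y i"
      then obtain w where w: "w \<in> cycles ?Y i" "y = ?g w" by blast
      show "y \<in> carrier (power_module (homology ?X i) n)"
        unfolding w(2) power_module_simps using fc[OF pcy[OF _ w(1)]] by simp
    next
      fix y assume y: "y \<in> carrier (power_module (homology ?X i) n)"
      have "\<exists>z. z \<in> cycles ?X i \<and> y k = f z" if "k < n" for k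
      proof -
        have "y k \<in> f ` cycles ?X i" unfolding f(2) using y that by (auto simp: power_module_simps)
        then show ?thesis by blast
      qed
      then obtain z where z: "!!k. k < n ==> z k \<in> cycles ?X i" "!!k. k < n ==> y k = f (z k)" by metis
      have zc: "z k \<in> carrier (tensor R (obj X i) N)" if "k < n" for k using z(1)[OF that] by (simp add: cycles_def tensor_cpx_simps)
      let ?w = "finsum (obj ?Y i) (\<lambda>k. j k i (z k)) {..<n}"
      have jz: "j k i (z k) \<in> cycles ?Y i" if "k < n" for k
        using chain_map_cycles[OF cT cTp jc z(1)[OF that]] .
      have w: "?w \<in> cycles ?Y i" using jz by (intro Y.submodule_finsum[OF cycles_submodule[OF cTp]] Pi_I) simp
      have "p l i ?w = z l" if l: "l < n" for l
      proof -
        interpret X: module R "obj ?X i" by (rule chain_complexD(1)[OF cT])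
        have "p l i ?w = finsum (obj ?X i) (\<lambda>k. p l i (j k i (z k))) {..<n}"
          using jz cyc by (intro mod_hom_finsum[OF Y.module_axioms X.module_axioms ph[OF l]]) auto
        also have "\<dots> = finsum (obj ?X i) (\<lambda>k. if l = k then z k else \<zero>\<^bsub>obj ?X i\<^esub>) {..<n}"
          using zc pj[OF l] X.zero_closed by (intro X.finsum_cong') (auto simp: tensor_cpx_simps)
        also have "\<dots> = z l" using zc l by (intro X.finsum_singleton) (auto simp: tensor_cpx_simps)
        finally show ?thesis .
      qed
      then have "y = ?g ?w" using y z(2) by (intro ext) (auto simp: power_module_simps PiE_iff extensional_def)
      then show "y \<in> ?g ` cycles ?Y i" using w by blast
    qed
    fix w assume w: "w \<in> cycles ?Y i"
    have "?g w = \<zero>\<^bsub>power_module (homology ?X i) n\<^esub> \<longleftrightarrow> (\<forall>k<n. f (p k i w) = \<zero>\<^bsub>homology ?X i\<^esub>)"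
      unfolding power_module_simps by (auto simp: fun_eq_iff restrict_def)
    also have "\<dots> \<longleftrightarrow> (\<forall>k<n. p k i w \<in> boundaries ?X i)" using f(3) pcy[OF _ w] by simp
    also have "\<dots> \<longleftrightarrow> w \<in> boundaries ?Y i" using bdry[OF w] chain_map_boundaries[OF pc] by blast
    finally show "?g w = \<zero>\<^bsub>power_module (homology ?X i) n\<^esub> \<longleftrightarrow> w \<in> boundaries ?Y i" .
  qed
qed

subsection \<open>Mapping cones\<close>

text \<open>The cone \<open>W\<close> of a chain map \<open>\<phi> : G \<rightarrow> P\<close>, with \<open>W\<^sub>n = P\<^sub>n \<oplus> G\<^sub>n\<^sub>-\<^sub>1\<close>.  The modules are given by
  biproduct diagrams and the differential by its two components, because in this form the data are preserved by
  tensoring with a module.\<close>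
locale cone =
  fixes R :: "('a, 'r) ring_scheme" and P :: "('a, 'b) cpx" and G :: "('a, 'c) cpx" and \<phi> :: "int \<Rightarrow> 'c \<Rightarrow> 'b"
    and W :: "('a, 'w) cpx" and i :: "int \<Rightarrow> 'b \<Rightarrow> 'w" and j :: "int \<Rightarrow> 'c \<Rightarrow> 'w" and p :: "int \<Rightarrow> 'w \<Rightarrow> 'b" and q :: "int \<Rightarrow> 'w \<Rightarrow> 'c"
  assumes P: "chain_complex R P" and G: "chain_complex R G" and \<phi>: "chain_map R G P \<phi>"
    and W: "!!n. module R (obj W n)"
    and bi: "!!n. biproduct R (obj W n) (obj P n) (obj G (n - 1)) (i n) (j n) (p n) (q n)"
    and bdW: "!!n. bd W n \<in> mod_hom R (obj W n) (obj W (n - 1))"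
    and p_bd: "!!n w. w \<in> elems W n ==>
      p (n - 1) (bd W n w) = bd P n (p n w) \<oplus>\<^bsub>obj P (n - 1)\<^esub> \<phi> (n - 1) (q n w)"
    and q_bd: "!!n w. w \<in> elems W n ==>
      q (n - 1) (bd W n w) = \<ominus>\<^bsub>obj G (n - 1 - 1)\<^esub> bd G (n - 1) (q n w)"
begin

lemmas DP = chain_complexD[OF P] and DG = chain_complexD[OF G] and D\<phi> = chain_mapD[OF \<phi>]

lemma comp_closed:
  "x \<in> elems P n ==> i n x \<in> elems W n" "e \<in> elems G (n - 1) ==> j n e \<in> elems W n"
  "w \<in> elems W n ==> p n w \<in> elems P n" "w \<in> elems W n ==> q n w \<in> elems G (n - 1)"
  by (rule mod_hom_closed[OF biproductD(1)[OF bi]] mod_hom_closed[OF biproductD(2)[OF bi]]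
      mod_hom_closed[OF biproductD(3)[OF bi]] mod_hom_closed[OF biproductD(4)[OF bi]]; assumption)+

lemma W_eqI:
  assumes "w \<in> elems W n" "w' \<in> elems W n" "p n w = p n w'" "q n w = q n w'"
  shows "w = w'"
proof -
  have "w = i n (p n w) \<oplus>\<^bsub>obj W n\<^esub> j n (q n w)" by (rule biproductD(9)[OF bi assms(1), symmetric])
  also have "\<dots> = w'" unfolding assms(3,4) by (rule biproductD(9)[OF bi assms(2)])
  finally show ?thesis .
qed

lemma W_pair:
  assumes x: "x \<in> elems P n" and e: "e \<in> elems G (n - 1)"
  obtains w where "w \<in> elems W n" "p n w = x" "q n w = e"
proof -
  interpret Wn: module R "obj W n" by (rule W)
  interpret Pn: module R "obj P n" by (rule DP)
  interpret Gn: module R "obj G (n - 1)" by (rule DG)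
  have ix: "i n x \<in> elems W n" and je: "j n e \<in> elems W n" using comp_closed(1)[OF x] comp_closed(2)[OF e] .
  show ?thesis
  proof (rule that[of "i n x \<oplus>\<^bsub>obj W n\<^esub> j n e"])
    show "i n x \<oplus>\<^bsub>obj W n\<^esub> j n e \<in> elems W n" using ix je by simp
    show "p n (i n x \<oplus>\<^bsub>obj W n\<^esub> j n e) = x"
      using mod_hom_add[OF biproductD(3)[OF bi] ix je] biproductD(5)[OF bi x] biproductD(8)[OF bi e] x by simp
    show "q n (i n x \<oplus>\<^bsub>obj W n\<^esub> j n e) = e"
      using mod_hom_add[OF biproductD(4)[OF bi] ix je] biproductD(6)[OF bi x] biproductD(7)[OF bi e] e by simp
  qed
qed

lemma p_bd1: "w \<in> elems W (n + 1) ==>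
    p n (bd W (n + 1) w) = bd P (n + 1) (p (n + 1) w) \<oplus>\<^bsub>obj P n\<^esub> \<phi> n (q (n + 1) w)"
  using p_bd[of w "n + 1"] by simp

lemma q_bd1: "w \<in> elems W (n + 1) ==> q n (bd W (n + 1) w) = \<ominus>\<^bsub>obj G (n - 1)\<^esub> bd G n (q (n + 1) w)"
  using q_bd[of w "n + 1"] by simp

lemma q1_closed: "w \<in> elems W (n + 1) ==> q (n + 1) w \<in> elems G n"
  using comp_closed(4)[of w "n + 1"] by simp

lemma W_pair1:
  assumes "x \<in> elems P (n + 1)" and "e \<in> elems G n"
  obtains w where "w \<in> elems W (n + 1)" "p (n + 1) w = x" "q (n + 1) w = e"
  using W_pair[of x "n + 1" e] assms by auto

lemma bdW1: "w \<in> elems W (n + 1) ==> bd W (n + 1) w \<in> elems W n"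
  using mod_hom_closed[OF bdW, of w "n + 1"] by simp

lemma p_zero: "p n \<zero>\<^bsub>obj W n\<^esub> = \<zero>\<^bsub>obj P n\<^esub>" and q_zero: "q n \<zero>\<^bsub>obj W n\<^esub> = \<zero>\<^bsub>obj G (n - 1)\<^esub>"
  by (rule mod_hom_zero[OF W DP(1) biproductD(3)[OF bi]] mod_hom_zero[OF W DG(1) biproductD(4)[OF bi]])+

lemma cycleI:
  assumes w: "w \<in> elems W n"
    and "bd P n (p n w) \<oplus>\<^bsub>obj P (n - 1)\<^esub> \<phi> (n - 1) (q n w) = \<zero>\<^bsub>obj P (n - 1)\<^esub>"
    and "bd G (n - 1) (q n w) = \<zero>\<^bsub>obj G (n - 1 - 1)\<^esub>"
  shows "w \<in> cycles W n"
proof -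
  interpret Wn: module R "obj W (n - 1)" by (rule W)
  interpret Gn: module R "obj G (n - 1 - 1)" by (rule DG)
  have "bd W n w = \<zero>\<^bsub>obj W (n - 1)\<^esub>"
    by (rule W_eqI[OF mod_hom_closed[OF bdW w]])
      (simp_all only: Wn.zero_closed p_bd[OF w] q_bd[OF w] p_zero q_zero assms Gn.neg_zero)
  then show ?thesis using w by (simp add: cycles_def)
qed

lemma cycleD:
  assumes "w \<in> cycles W n"
  shows "w \<in> elems W n" "bd P n (p n w) \<oplus>\<^bsub>obj P (n - 1)\<^esub> \<phi> (n - 1) (q n w) = \<zero>\<^bsub>obj P (n - 1)\<^esub>"
    "bd G (n - 1) (q n w) = \<zero>\<^bsub>obj G (n - 1 - 1)\<^esub>"
proof -
  show w: "w \<in> elems W n" using assms by (simp add: cycles_def)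
  have z: "bd W n w = \<zero>\<^bsub>obj W (n - 1)\<^esub>" using assms by (simp add: cycles_def)
  show "bd P n (p n w) \<oplus>\<^bsub>obj P (n - 1)\<^esub> \<phi> (n - 1) (q n w) = \<zero>\<^bsub>obj P (n - 1)\<^esub>"
    using p_bd[OF w] unfolding z p_zero by simp
  interpret Gn: module R "obj G (n - 1 - 1)" by (rule DG)
  have "\<ominus>\<^bsub>obj G (n - 1 - 1)\<^esub> bd G (n - 1) (q n w) = \<zero>\<^bsub>obj G (n - 1 - 1)\<^esub>"
    using q_bd[OF w] unfolding z q_zero by (rule sym)
  then show "bd G (n - 1) (q n w) = \<zero>\<^bsub>obj G (n - 1 - 1)\<^esub>"
    using Gn.minus_minus[OF DG(6)[OF comp_closed(4)[OF w]]] Gn.neg_zero by simp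
qed

lemma cone_chain: "chain_complex R W"
  unfolding chain_complex_def
proof (intro conjI allI ballI W bdW)
  fix n w assume w: "w \<in> elems W n"
  interpret P1: module R "obj P (n - 1 - 1)" by (rule DP)
  have dw: "bd W n w \<in> elems W (n - 1)" by (rule mod_hom_closed[OF bdW w])
  note pw = comp_closed(3)[OF w] and qw = comp_closed(4)[OF w]
  note bq = DG(6)[OF qw]
  have fq: "\<phi> (n - 1) (q n w) \<in> elems P (n - 1)" by (rule mod_hom_closed[OF D\<phi>(1) qw])
  have fbq: "\<phi> (n - 1 - 1) (bd G (n - 1) (q n w)) \<in> elems P (n - 1 - 1)" by (rule mod_hom_closed[OF D\<phi>(1) bq])
  have bbp: "bd P (n - 1) (bd P n (p n w)) = \<zero>\<^bsub>obj P (n - 1 - 1)\<^esub>" using DP(4)[OF pw] by simp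
  have bbq: "bd G (n - 1 - 1) (bd G (n - 1) (q n w)) = \<zero>\<^bsub>obj G (n - 1 - 1 - 1)\<^esub>"
    using DG(4)[OF qw] by simp
  have "bd W n w \<in> cycles W (n - 1)"
  proof (rule cycleI[OF dw])
    have "bd P (n - 1) (p (n - 1) (bd W n w)) = bd P (n - 1) (\<phi> (n - 1) (q n w))"
      unfolding p_bd[OF w] using mod_hom_add[OF DP(2) DP(6)[OF pw] fq] bbp P1.l_zero[OF mod_hom_closed[OF DP(2) fq]] by simp
    also have "\<dots> = \<phi> (n - 1 - 1) (bd G (n - 1) (q n w))" using D\<phi>(2)[OF qw] by simp
    finally show "bd P (n - 1) (p (n - 1) (bd W n w)) \<oplus>\<^bsub>obj P (n - 1 - 1)\<^esub>
        \<phi> (n - 1 - 1) (q (n - 1) (bd W n w)) = \<zero>\<^bsub>obj P (n - 1 - 1)\<^esub>"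
      unfolding q_bd[OF w] mod_hom_neg[OF DG(1) DP(1) D\<phi>(1) bq] using fbq by (simp only: P1.r_neg)
    show "bd G (n - 1 - 1) (q (n - 1) (bd W n w)) = \<zero>\<^bsub>obj G (n - 1 - 1 - 1)\<^esub>"
      unfolding q_bd[OF w] mod_hom_neg[OF DG(1) DG(1) DG(2) bq] bbq
      by (rule abelian_group.neg_zero[OF module_abelian_group[OF DG(1)]])
  qed
  then show "bd W (n - 1) (bd W n w) = \<zero>\<^bsub>obj W (n - 2)\<^esub>" by (simp add: cycles_def)
qed

text \<open>The long exact sequence of the cone, elementwise: the cone is exact in degree \<open>n\<close> if \<open>\<phi>\<close> is injective on homology in
  degree \<open>n - 1\<close> and surjective in degree \<open>n\<close>.  The two lemmas that follow are converses.\<close>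
lemma exact:
  assumes inj: "!!e. e \<in> cycles G (n - 1) ==> \<phi> (n - 1) e \<in> boundaries P (n - 1) ==> e \<in> boundaries G (n - 1)"
    and surj: "!!z. z \<in> cycles P n ==> \<exists>e\<in>cycles G n. \<exists>y\<in>elems P (n + 1). z = \<phi> n e \<oplus>\<^bsub>obj P n\<^esub> bd P (n + 1) y"
  shows "exact_at W n"
proof
  fix w assume w: "w \<in> cycles W n"
  interpret Pn: module R "obj P n" by (rule DP)
  interpret P1: module R "obj P (n - 1)" by (rule DP)
  interpret Gn: module R "obj G n" by (rule DG)
  interpret G1: module R "obj G (n - 1)" by (rule DG)
  note wc = cycleD(1)[OF w]
  define x where "x = p n w" define e where "e = q n w"
  have x: "x \<in> elems P n" and e: "e \<in> elems G (n - 1)"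
    using comp_closed(3,4)[OF wc] unfolding x_def e_def .
  have dx: "bd P n x \<oplus>\<^bsub>obj P (n - 1)\<^esub> \<phi> (n - 1) e = \<zero>\<^bsub>obj P (n - 1)\<^esub>" and de: "bd G (n - 1) e = \<zero>\<^bsub>obj G (n - 1 - 1)\<^esub>"
    using cycleD(2,3)[OF w] unfolding x_def e_def .
  note dxc = DP(6)[OF x]
  have fe: "\<phi> (n - 1) e \<in> elems P (n - 1)" by (rule mod_hom_closed[OF D\<phi>(1) e])
  have "\<phi> (n - 1) e = \<ominus>\<^bsub>obj P (n - 1)\<^esub> bd P n x" using dx dxc fe by (metis P1.a_comm P1.minus_equality)
  also have "\<dots> = bd P n (\<ominus>\<^bsub>obj P n\<^esub> x)" using mod_hom_neg[OF DP(1,1,2) x] by simp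
  finally have "\<phi> (n - 1) e \<in> boundaries P (n - 1)" unfolding boundaries_def using x by simp
  then have "e \<in> boundaries G (n - 1)" using inj e de by (simp add: cycles_def)
  then obtain e' where e': "e' \<in> elems G n" "e = bd G n e'" unfolding boundaries_def by auto
  have fe': "\<phi> n e' \<in> elems P n" by (rule mod_hom_closed[OF D\<phi>(1) e'(1)])
  have "bd P n (x \<oplus>\<^bsub>obj P n\<^esub> \<phi> n e') = \<zero>\<^bsub>obj P (n - 1)\<^esub>"
    using mod_hom_add[OF DP(2) x fe'] D\<phi>(2)[OF e'(1)] dx e'(2) by simp
  then have "x \<oplus>\<^bsub>obj P n\<^esub> \<phi> n e' \<in> cycles P n" unfolding cycles_def using x fe' by simp
  then obtain e2 y where y: "e2 \<in> cycles G n" "y \<in> elems P (n + 1)"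
    "x \<oplus>\<^bsub>obj P n\<^esub> \<phi> n e' = \<phi> n e2 \<oplus>\<^bsub>obj P n\<^esub> bd P (n + 1) y" using surj by blast
  have e2: "e2 \<in> elems G n" "bd G n e2 = \<zero>\<^bsub>obj G (n - 1)\<^esub>" using y(1) by (auto simp: cycles_def)
  have fe2: "\<phi> n e2 \<in> elems P n" by (rule mod_hom_closed[OF D\<phi>(1) e2(1)])
  note dy = DP(7)[OF y(2)]
  have "e2 \<ominus>\<^bsub>obj G n\<^esub> e' \<in> elems G n" using e2 e' by simp
  then obtain v where v: "v \<in> elems W (n + 1)" "p (n + 1) v = y" "q (n + 1) v = e2 \<ominus>\<^bsub>obj G n\<^esub> e'"
    using W_pair1[OF y(2)] by blast
  have "bd W (n + 1) v = w"
  proof (rule W_eqI[OF bdW1[OF v(1)] wc])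
    have "p n (bd W (n + 1) v) = bd P (n + 1) y \<oplus>\<^bsub>obj P n\<^esub> (\<phi> n e2 \<ominus>\<^bsub>obj P n\<^esub> \<phi> n e')"
      unfolding p_bd1[OF v(1)] v(2,3) mod_hom_diff[OF DG(1) DP(1) D\<phi>(1) e2(1) e'(1)] ..
    also have "\<dots> = (\<phi> n e2 \<oplus>\<^bsub>obj P n\<^esub> bd P (n + 1) y) \<ominus>\<^bsub>obj P n\<^esub> \<phi> n e'"
      using dy fe2 fe' by (simp add: Pn.group_normalise)
    also have "\<dots> = x" unfolding y(3)[symmetric] using x fe' by (simp add: Pn.minus_eq Pn.a_assoc Pn.r_neg)
    finally show "p n (bd W (n + 1) v) = p n w" unfolding x_def .
    have "q n (bd W (n + 1) v) = \<ominus>\<^bsub>obj G (n - 1)\<^esub> (\<zero>\<^bsub>obj G (n - 1)\<^esub> \<ominus>\<^bsub>obj G (n - 1)\<^esub> e)"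
      unfolding q_bd1[OF v(1)] v(3) mod_hom_diff[OF DG(1,1,2) e2(1) e'(1)] e2(2) e'(2) ..
    also have "\<dots> = e" using e by (simp add: G1.minus_eq)
    finally show "q n (bd W (n + 1) v) = q n w" unfolding e_def .
  qed
  then show "w \<in> boundaries W n" unfolding boundaries_def using v(1) by blast
qed

lemma surj_of_exact:
  assumes ex: "exact_at W n" and z: "z \<in> cycles P n"
  shows "\<exists>e\<in>cycles G n. \<exists>y\<in>elems P (n + 1). z = \<phi> n e \<oplus>\<^bsub>obj P n\<^esub> bd P (n + 1) y"
proof -
  interpret Pn: module R "obj P n" by (rule DP)
  interpret P1: module R "obj P (n - 1)" by (rule DP)
  interpret G1: module R "obj G (n - 1)" by (rule DG)
  have zc: "z \<in> elems P n" "bd P n z = \<zero>\<^bsub>obj P (n - 1)\<^esub>" using z by (auto simp: cycles_def)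
  obtain w where w: "w \<in> elems W n" "p n w = z" "q n w = \<zero>\<^bsub>obj G (n - 1)\<^esub>"
    using W_pair[OF zc(1) G1.zero_closed] .
  have "w \<in> cycles W n"
    by (rule cycleI[OF w(1)])
      (simp_all add: w(2,3) zc(2) mod_hom_zero[OF DG(1) DP(1) D\<phi>(1)] mod_hom_zero[OF DG(1,1,2)] del: diff_diff_eq diff_diff_add)
  then obtain v where v: "v \<in> elems W (n + 1)" "w = bd W (n + 1) v" using ex unfolding boundaries_def by blast
  note qv = q1_closed[OF v(1)]
  have "z = bd P (n + 1) (p (n + 1) v) \<oplus>\<^bsub>obj P n\<^esub> \<phi> n (q (n + 1) v)"
    unfolding w(2)[symmetric] v(2) p_bd1[OF v(1)] ..
  then have "z = \<phi> n (q (n + 1) v) \<oplus>\<^bsub>obj P n\<^esub> bd P (n + 1) (p (n + 1) v)"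
    using Pn.a_comm DP(7)[OF comp_closed(3)[OF v(1)]] mod_hom_closed[OF D\<phi>(1) qv] by simp
  moreover have "q (n + 1) v \<in> cycles G n"
  proof -
    have "\<ominus>\<^bsub>obj G (n - 1)\<^esub> bd G n (q (n + 1) v) = \<zero>\<^bsub>obj G (n - 1)\<^esub>"
      using q_bd1[OF v(1)] w(3) unfolding v(2) by simp
    then have "bd G n (q (n + 1) v) = \<zero>\<^bsub>obj G (n - 1)\<^esub>"
      using G1.minus_minus[OF DG(6)[OF qv]] G1.neg_zero by simp
    then show ?thesis unfolding cycles_def using qv by simp
  qed
  ultimately show ?thesis using comp_closed(3)[OF v(1)] by blast
qed

lemma inj_of_exact:
  assumes ex: "exact_at W (n + 1)" and e: "e \<in> cycles G n" and b: "\<phi> n e \<in> boundaries P n"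
  shows "e \<in> boundaries G n"
proof -
  interpret Pn: module R "obj P n" by (rule DP)
  interpret P1: module R "obj P (n + 1)" by (rule DP)
  have ec: "e \<in> elems G n" "bd G n e = \<zero>\<^bsub>obj G (n - 1)\<^esub>" using e by (auto simp: cycles_def)
  obtain y where y: "y \<in> elems P (n + 1)" "\<phi> n e = bd P (n + 1) y" using b unfolding boundaries_def by blast
  obtain w where w: "w \<in> elems W (n + 1)" "p (n + 1) w = \<ominus>\<^bsub>obj P (n + 1)\<^esub> y" "q (n + 1) w = e"
    using W_pair1[OF P1.a_inv_closed[OF y(1)] ec(1)] .
  have "w \<in> cycles W (n + 1)"
    by (rule cycleI[OF w(1)])
      (simp_all add: w(2,3) ec(2) y mod_hom_neg[OF DP(1,1,3) y(1)] Pn.l_neg DP(7))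
  then obtain v where v: "v \<in> elems W (n + 1 + 1)" "w = bd W (n + 1 + 1) v"
    using ex unfolding boundaries_def by blast
  have qv: "q (n + 1 + 1) v \<in> elems G (n + 1)" by (rule q1_closed[OF v(1)])
  have "e = \<ominus>\<^bsub>obj G n\<^esub> bd G (n + 1) (q (n + 1 + 1) v)"
    using q_bd1[OF v(1)] w(3) unfolding v(2) by simp
  also have "\<dots> = bd G (n + 1) (\<ominus>\<^bsub>obj G (n + 1)\<^esub> q (n + 1 + 1) v)"
    using mod_hom_neg[OF DG(1) DG(1) DG(3) qv] by simp
  finally show ?thesis
    unfolding boundaries_def using abelian_group.a_inv_closed[OF module_abelian_group[OF DG(1)] qv] by blast
qed

text \<open>The hypotheses say that \<open>G\<close> contributes nothing to the cone in the degrees \<open>n\<close> and \<open>n + 1\<close>.\<close>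
lemma homology_iso_below:
  assumes z: "zero_module (obj G n)" "zero_module (obj G (n - 1))"
    and B: "module R B" and iso: "mod_iso R (homology P n) B"
  shows "mod_iso R (homology W n) B"
proof -
  interpret Pn: module R "obj P n" by (rule DP)
  interpret Pn1: module R "obj P (n - 1)" by (rule DP)
  obtain f where f: "f \<in> mod_hom R (obj P n\<lparr>carrier := cycles P n\<rparr>) B" "f ` cycles P n = carrier B"
    "!!x. x \<in> cycles P n ==> f x = \<zero>\<^sub>B \<longleftrightarrow> x \<in> boundaries P n"
    using iffD1[OF homology_iso_iff[OF P B] iso] by (elim bexE conjE) (rule that, assumption, assumption, drule (1) bspec)
  have qz: "q n w = \<zero>\<^bsub>obj G (n - 1)\<^esub>" if "w \<in> elems W n" for w
    using zero_module_carrier[OF z(2) comp_closed(4)[OF that]] .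
  have \<phi>z: "\<phi> n e = \<zero>\<^bsub>obj P n\<^esub>" if "e \<in> elems G n" for e
    using zero_module_carrier[OF z(1) that] mod_hom_zero[OF DG(1) DP(1) D\<phi>(1)] by simp
  have \<phi>z': "\<phi> (n - 1) e = \<zero>\<^bsub>obj P (n - 1)\<^esub>" if "e \<in> elems G (n - 1)" for e
    using zero_module_carrier[OF z(2) that] mod_hom_zero[OF DG(1) DP(1) D\<phi>(1)] by simp
  have pcy: "p n w \<in> cycles P n" if w: "w \<in> cycles W n" for w
    using cycleD(1,2)[OF w] \<phi>z'[OF comp_closed(4)[OF cycleD(1)[OF w]]] comp_closed(3)[OF cycleD(1)[OF w]] DP(6)
    unfolding cycles_def by simp
  have bdry: "p n w \<in> boundaries P n \<longleftrightarrow> w \<in> boundaries W n" if w: "w \<in> cycles W n" for w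
  proof
    assume "p n w \<in> boundaries P n"
    then obtain y where y: "y \<in> elems P (n + 1)" "p n w = bd P (n + 1) y" unfolding boundaries_def by blast
    obtain v where v: "v \<in> elems W (n + 1)" "p (n + 1) v = y" "q (n + 1) v = \<zero>\<^bsub>obj G n\<^esub>"
      using W_pair1[OF y(1) abelian_monoid.zero_closed[OF abelian_group.axioms(1)[OF module_abelian_group[OF DG(1)]]]] .
    have "bd W (n + 1) v = w"
    proof (rule W_eqI[OF bdW1[OF v(1)] cycleD(1)[OF w]])
      show "p n (bd W (n + 1) v) = p n w"
        unfolding p_bd1[OF v(1)] y(2) v(2) using \<phi>z[OF q1_closed[OF v(1)]] DP(7)[OF y(1)] by simp
      show "q n (bd W (n + 1) v) = q n w" unfolding qz[OF bdW1[OF v(1)]] qz[OF cycleD(1)[OF w]] ..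
    qed
    then show "w \<in> boundaries W n" unfolding boundaries_def using v(1) by blast
  next
    assume "w \<in> boundaries W n"
    then obtain v where v: "v \<in> elems W (n + 1)" "w = bd W (n + 1) v" unfolding boundaries_def by blast
    have "p n w = bd P (n + 1) (p (n + 1) v)"
      unfolding v(2) p_bd1[OF v(1)] using \<phi>z[OF q1_closed[OF v(1)]] DP(7)[OF comp_closed(3)[OF v(1)]] by simp
    then show "p n w \<in> boundaries P n" unfolding boundaries_def using comp_closed(3)[OF v(1)] by blast
  qed
  have ph: "p n \<in> mod_hom R (obj W n\<lparr>carrier := cycles W n\<rparr>) (obj P n\<lparr>carrier := cycles P n\<rparr>)"
    by (rule mod_hom_sub_codomain[OF mod_hom_sub_domain[OF biproductD(3)[OF bi]]]) (use cycleD(1) pcy in auto)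
  show ?thesis unfolding homology_iso_iff[OF cone_chain B]
  proof (intro bexI conjI ballI)
    show "(\<lambda>w. f (p n w)) \<in> mod_hom R (obj W n\<lparr>carrier := cycles W n\<rparr>) B" by (rule mod_hom_comp[OF ph f(1)])
    show "(\<lambda>w. f (p n w)) ` cycles W n = carrier B"
    proof (intro equalityI subsetI)
      fix b assume "b \<in> (\<lambda>w. f (p n w)) ` cycles W n"
      then show "b \<in> carrier B" unfolding f(2)[symmetric] using pcy by blast
    next
      fix b assume "b \<in> carrier B"
      then obtain z where z: "z \<in> cycles P n" "b = f z" unfolding f(2)[symmetric] by blast
      have zc: "z \<in> elems P n" "bd P n z = \<zero>\<^bsub>obj P (n - 1)\<^esub>" using z(1) by (auto simp: cycles_def)
      interpret G1: module R "obj G (n - 1)" by (rule DG)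
      obtain w where w: "w \<in> elems W n" "p n w = z" "q n w = \<zero>\<^bsub>obj G (n - 1)\<^esub>"
        using W_pair[OF zc(1) G1.zero_closed] .
      have "w \<in> cycles W n"
        by (rule cycleI[OF w(1)])
          (simp_all add: w(2,3) zc(2) \<phi>z' mod_hom_zero[OF DG(1,1,2)] del: diff_diff_eq diff_diff_add)
      then show "b \<in> (\<lambda>w. f (p n w)) ` cycles W n" unfolding z(2) w(2)[symmetric] by blast
    qed
    show "f (p n w) = \<zero>\<^sub>B \<longleftrightarrow> w \<in> boundaries W n" if "w \<in> cycles W n" for w
      using f(3)[OF pcy[OF that]] bdry[OF that] by simp
  qed
qed

end

text \<open>The data of a cone are identities between sums of compositions of maps, and tensoring preserves these.\<close>
lemma cone_tensor:
  assumes "cone R P G \<phi> W i j p q" and N: "module R N"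
  shows "cone R (tensor_cpx R P N) (tensor_cpx R G N) (\<lambda>n. tensor_map R (obj G n) (obj P n) N (\<phi> n)) (tensor_cpx R W N)
    (\<lambda>n. tensor_map R (obj P n) (obj W n) N (i n)) (\<lambda>n. tensor_map R (obj G (n - 1)) (obj W n) N (j n))
    (\<lambda>n. tensor_map R (obj W n) (obj P n) N (p n)) (\<lambda>n. tensor_map R (obj W n) (obj G (n - 1)) N (q n))"
proof -
  interpret cone R P G \<phi> W i j p q by fact
  show ?thesis
  proof (rule cone.intro[OF tensor_cpx_chain[OF P N] tensor_cpx_chain[OF G N] chain_map_tensor[OF G P N \<phi>]],
      unfold tensor_cpx_simps)
    show "module R (tensor R (obj W n) N)" for n by (rule tensor_pair.tensor_module[OF tensor_pairI[OF W N]])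
    show "tensor_map R (obj W n) (obj W (n - 1)) N (bd W n) \<in> mod_hom R (tensor R (obj W n) N) (tensor R (obj W (n - 1)) N)" for n
      by (rule tensor_map(1)[OF W W N bdW])
    show "biproduct R (tensor R (obj W n) N) (tensor R (obj P n) N) (tensor R (obj G (n - 1)) N)
        (tensor_map R (obj P n) (obj W n) N (i n)) (tensor_map R (obj G (n - 1)) (obj W n) N (j n))
        (tensor_map R (obj W n) (obj P n) N (p n)) (tensor_map R (obj W n) (obj G (n - 1)) N (q n))" for n
    proof -
      note b = bi[of n]
      note h = biproductD(1-4)[OF b]
      show ?thesis unfolding biproduct_def
      proof (intro conjI ballI tensor_map(1)[OF DP(1) W N h(1)] tensor_map(1)[OF DG(1) W N h(2)]
          tensor_map(1)[OF W DP(1) N h(3)] tensor_map(1)[OF W DG(1) N h(4)])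
        fix x assume x: "x \<in> carrier (tensor R (obj P n) N)"
        show "tensor_map R (obj W n) (obj P n) N (p n) (tensor_map R (obj P n) (obj W n) N (i n) x) = x"
          unfolding tensor_map_comp[OF DP(1) W DP(1) N h(1,3) x]
          by (rule tensor_map_id[OF DP(1) N biproductD(5)[OF b] x])
        show "tensor_map R (obj W n) (obj G (n - 1)) N (q n) (tensor_map R (obj P n) (obj W n) N (i n) x) = \<zero>\<^bsub>tensor R (obj G (n - 1)) N\<^esub>"
          unfolding tensor_map_comp[OF DP(1) W DG(1) N h(1,4) x]
          by (rule tensor_map_zero[OF DP(1) DG(1) N biproductD(6)[OF b] x])
      next
        fix x assume x: "x \<in> carrier (tensor R (obj G (n - 1)) N)"
        show "tensor_map R (obj W n) (obj G (n - 1)) N (q n) (tensor_map R (obj G (n - 1)) (obj W n) N (j n) x) = x"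
          unfolding tensor_map_comp[OF DG(1) W DG(1) N h(2,4) x]
          by (rule tensor_map_id[OF DG(1) N biproductD(7)[OF b] x])
        show "tensor_map R (obj W n) (obj P n) N (p n) (tensor_map R (obj G (n - 1)) (obj W n) N (j n) x) = \<zero>\<^bsub>tensor R (obj P n) N\<^esub>"
          unfolding tensor_map_comp[OF DG(1) W DP(1) N h(2,3) x]
          by (rule tensor_map_zero[OF DG(1) DP(1) N biproductD(8)[OF b] x])
      next
        fix w assume w: "w \<in> carrier (tensor R (obj W n) N)"
        have "w = tensor_map R (obj W n) (obj W n) N (\<lambda>w. w) w" using tensor_map_id[OF W N _ w, of "\<lambda>w. w"] by simp
        also have "\<dots> = tensor_map R (obj W n) (obj W n) N (\<lambda>w. i n (p n w)) w \<oplus>\<^bsub>tensor R (obj W n) N\<^esub>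
            tensor_map R (obj W n) (obj W n) N (\<lambda>w. j n (q n w)) w"
          by (rule tensor_map_add[OF W W N mod_hom_comp[OF h(3,1)] mod_hom_comp[OF h(4,2)] mod_hom_id
                biproductD(9)[OF b, symmetric] w])
        finally show "w = tensor_map R (obj P n) (obj W n) N (i n) (tensor_map R (obj W n) (obj P n) N (p n) w) \<oplus>\<^bsub>tensor R (obj W n) N\<^esub>
            tensor_map R (obj G (n - 1)) (obj W n) N (j n) (tensor_map R (obj W n) (obj G (n - 1)) N (q n) w)"
          unfolding tensor_map_comp[OF W DP(1) W N h(3,1) w] tensor_map_comp[OF W DG(1) W N h(4,2) w] .
      qed
    qed
    fix n w assume w: "w \<in> carrier (tensor R (obj W n) N)"
    note h = biproductD(1-4)[OF bi]
    let ?pb = "\<lambda>w. p (n - 1) (bd W n w)" and ?qb = "\<lambda>w. q (n - 1) (bd W n w)"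
    have "tensor_map R (obj W n) (obj P (n - 1)) N ?pb w =
        tensor_map R (obj W n) (obj P (n - 1)) N (\<lambda>w. bd P n (p n w)) w \<oplus>\<^bsub>tensor R (obj P (n - 1)) N\<^esub>
        tensor_map R (obj W n) (obj P (n - 1)) N (\<lambda>w. \<phi> (n - 1) (q n w)) w"
      by (rule tensor_map_add[OF W DP(1) N mod_hom_comp[OF h(3) DP(2)] mod_hom_comp[OF h(4) D\<phi>(1)]
            mod_hom_comp[OF bdW h(3)] p_bd w])
    then show "tensor_map R (obj W (n - 1)) (obj P (n - 1)) N (p (n - 1)) (tensor_map R (obj W n) (obj W (n - 1)) N (bd W n) w) =
        tensor_map R (obj P n) (obj P (n - 1)) N (bd P n) (tensor_map R (obj W n) (obj P n) N (p n) w) \<oplus>\<^bsub>tensor R (obj P (n - 1)) N\<^esub>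
        tensor_map R (obj G (n - 1)) (obj P (n - 1)) N (\<phi> (n - 1)) (tensor_map R (obj W n) (obj G (n - 1)) N (q n) w)"
      unfolding tensor_map_comp[OF W W DP(1) N bdW h(3) w] tensor_map_comp[OF W DP(1) DP(1) N h(3) DP(2) w]
        tensor_map_comp[OF W DG(1) DP(1) N h(4) D\<phi>(1) w] .
    let ?T = "tensor R (obj G (n - 1 - 1)) N"
    let ?bq = "\<lambda>w. bd G (n - 1) (q n w)"
    interpret T: module R ?T by (rule tensor_pair.tensor_module[OF tensor_pairI[OF DG(1) N]])
    interpret G2: module R "obj G (n - 1 - 1)" by (rule DG(1))
    have bq: "?bq \<in> mod_hom R (obj W n) (obj G (n - 1 - 1))" by (rule mod_hom_comp[OF h(4) DG(2)])
    have qb: "?qb \<in> mod_hom R (obj W n) (obj G (n - 1 - 1))" by (rule mod_hom_comp[OF bdW h(4)])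
    have "tensor_map R (obj W n) (obj G (n - 1 - 1)) N (\<lambda>w. \<zero>\<^bsub>obj G (n - 1 - 1)\<^esub>) w =
        tensor_map R (obj W n) (obj G (n - 1 - 1)) N ?qb w \<oplus>\<^bsub>?T\<^esub> tensor_map R (obj W n) (obj G (n - 1 - 1)) N ?bq w"
    proof (rule tensor_map_add[OF W DG(1) N qb bq mod_hom_zerof[OF DG(1)] _ w])
      fix w assume w: "w \<in> elems W n"
      show "\<zero>\<^bsub>obj G (n - 1 - 1)\<^esub> = ?qb w \<oplus>\<^bsub>obj G (n - 1 - 1)\<^esub> ?bq w"
        unfolding q_bd[OF w] using G2.l_neg[OF mod_hom_closed[OF bq w]] by simp
    qed
    moreover have "tensor_map R (obj W n) (obj G (n - 1 - 1)) N (\<lambda>w. \<zero>\<^bsub>obj G (n - 1 - 1)\<^esub>) w = \<zero>\<^bsub>?T\<^esub>"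
      by (rule tensor_map_zero[OF W DG(1) N refl w])
    ultimately have "\<ominus>\<^bsub>?T\<^esub> tensor_map R (obj W n) (obj G (n - 1 - 1)) N ?bq w = tensor_map R (obj W n) (obj G (n - 1 - 1)) N ?qb w"
      using mod_hom_closed[OF tensor_map(1)[OF W DG(1) N bq] w] mod_hom_closed[OF tensor_map(1)[OF W DG(1) N qb] w]
      by (intro T.minus_equality) simp_all
    then show "tensor_map R (obj W (n - 1)) (obj G (n - 1 - 1)) N (q (n - 1)) (tensor_map R (obj W n) (obj W (n - 1)) N (bd W n) w) =
        \<ominus>\<^bsub>?T\<^esub> tensor_map R (obj G (n - 1)) (obj G (n - 1 - 1)) N (bd G (n - 1)) (tensor_map R (obj W n) (obj G (n - 1)) N (q n) w)"
      unfolding tensor_map_comp[OF W W DG(1) N bdW h(4) w] tensor_map_comp[OF W DG(1) DG(1) N h(4) DG(2) w] by simp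
  qed
qed

lemma cone_exists:
  fixes R :: "('a, 'r) ring_scheme" and P :: "('a, 'b) cpx" and G :: "('a, 'c) cpx"
  assumes P: "is_complex R P" "!!n. projective_module R (obj P n)"
    and G: "is_complex R G" "!!n. projective_module R (obj G n)" and \<phi>: "chain_map R G P \<phi>"
  obtains W :: "('a, 'a univ_elem) cpx" and i j p q where "cone R P G \<phi> W i j p q"
    "is_complex R W" "!!n. projective_module R (obj W n)"
proof -
  note chP = is_complex_chain[OF P(1)] and chG = is_complex_chain[OF G(1)]
  note DP = chain_complexD[OF chP] and DG = chain_complexD[OF chG]
  have fg: "fin_gen_module R (obj P n)" "fin_gen_module R (obj G n)" for n
    using P(1) G(1) by (simp_all add: is_complex_def)
  have "\<exists>D. case D of (W :: 'a univ_module, i, j, p, q) \<Rightarrow>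
      biproduct R W (obj P n) (obj G (n - 1)) i j p q \<and> fin_gen_module R W \<and> projective_module R W" for n
  proof -
    obtain W :: "'a univ_module" and i j p q where "biproduct R W (obj P n) (obj G (n - 1)) i j p q"
      "fin_gen_module R W" "projective_module R W" by (rule biproduct_univ[OF fg(1) P(2) fg(2) G(2)])
    then show ?thesis by (intro exI[of _ "(W, i, j, p, q)"]) simp
  qed
  then have "\<exists>D. \<forall>n. case D n of (W :: 'a univ_module, i, j, p, q) \<Rightarrow>
      biproduct R W (obj P n) (obj G (n - 1)) i j p q \<and> fin_gen_module R W \<and> projective_module R W"
    by (intro choice allI)
  then obtain D where D: "!!n. case D n of (W :: 'a univ_module, i, j, p, q) \<Rightarrow>
      biproduct R W (obj P n) (obj G (n - 1)) i j p q \<and> fin_gen_module R W \<and> projective_module R W"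
    by (elim exE) (rule that, drule spec)
  define w where "w n = fst (D n)" for n
  define i where "i n = fst (snd (D n))" for n
  define j where "j n = fst (snd (snd (D n)))" for n
  define p where "p n = fst (snd (snd (snd (D n))))" for n
  define q where "q n = snd (snd (snd (snd (D n))))" for n
  have b: "biproduct R (w n) (obj P n) (obj G (n - 1)) (i n) (j n) (p n) (q n)"
    and w: "fin_gen_module R (w n)" "projective_module R (w n)" for n
    using D[of n] unfolding w_def i_def j_def p_def q_def by (simp_all add: case_prod_beta)
  have wm: "module R (w n)" for n using fin_gen_module_module[OF w(1)] .
  define d where "d n x = i (n - 1) (bd P n (p n x) \<oplus>\<^bsub>obj P (n - 1)\<^esub> \<phi> (n - 1) (q n x)) \<oplus>\<^bsub>w (n - 1)\<^esub>
      j (n - 1) (\<ominus>\<^bsub>obj G (n - 1 - 1)\<^esub> bd G (n - 1) (q n x))" for n x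
  define W :: "('a, 'a univ_elem) cpx" where "W = \<lparr>obj = w, bd = d\<rparr>"
  have Ws: "obj W = w" "bd W = d" by (simp_all add: W_def)
  have h1: "(\<lambda>x. bd P n (p n x) \<oplus>\<^bsub>obj P (n - 1)\<^esub> \<phi> (n - 1) (q n x)) \<in> mod_hom R (w n) (obj P (n - 1))" for n
    by (rule mod_hom_addf[OF DP(1) mod_hom_comp[OF biproductD(3)[OF b] DP(2)]
          mod_hom_comp[OF biproductD(4)[OF b] chain_mapD(1)[OF \<phi>]]])
  have h2: "(\<lambda>x. \<ominus>\<^bsub>obj G (n - 1 - 1)\<^esub> bd G (n - 1) (q n x)) \<in> mod_hom R (w n) (obj G (n - 1 - 1))" for n
    by (rule mod_hom_negf[OF DG(1) mod_hom_comp[OF biproductD(4)[OF b] DG(2)]])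
  have dh: "d n \<in> mod_hom R (w n) (w (n - 1))" for n
    using mod_hom_addf[OF wm mod_hom_comp[OF h1 biproductD(1)[OF b]] mod_hom_comp[OF h2 biproductD(2)[OF b]]]
    unfolding d_def .
  have pd: "p (n - 1) (d n x) = bd P n (p n x) \<oplus>\<^bsub>obj P (n - 1)\<^esub> \<phi> (n - 1) (q n x)"
    and qd: "q (n - 1) (d n x) = \<ominus>\<^bsub>obj G (n - 1 - 1)\<^esub> bd G (n - 1) (q n x)" if x: "x \<in> carrier (w n)" for n x
  proof -
    interpret Pn: module R "obj P (n - 1)" by (rule DP)
    interpret Gn: module R "obj G (n - 1 - 1)" by (rule DG)
    note a = mod_hom_closed[OF h1 x] and c = mod_hom_closed[OF h2 x]
    note a' = mod_hom_closed[OF biproductD(1)[OF b] a] and c' = mod_hom_closed[OF biproductD(2)[OF b] c]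
    show "p (n - 1) (d n x) = bd P n (p n x) \<oplus>\<^bsub>obj P (n - 1)\<^esub> \<phi> (n - 1) (q n x)"
      unfolding d_def mod_hom_add[OF biproductD(3)[OF b] a' c'] biproductD(5)[OF b a] biproductD(8)[OF b c]
      by (rule Pn.r_zero[OF a])
    show "q (n - 1) (d n x) = \<ominus>\<^bsub>obj G (n - 1 - 1)\<^esub> bd G (n - 1) (q n x)"
      unfolding d_def mod_hom_add[OF biproductD(4)[OF b] a' c'] biproductD(6)[OF b a] biproductD(7)[OF b c]
      by (rule Gn.l_zero[OF c])
  qed
  have cone: "cone R P G \<phi> W i j p q"
    by (rule cone.intro[OF chP chG \<phi>]) (unfold Ws, (rule wm b dh pd qd | assumption)+)
  have "is_complex R W"
    unfolding is_complex_def Ws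
    using w(1) dh chain_complexD(4)[OF cone.cone_chain[OF cone]] unfolding Ws by blast
  then show ?thesis using that[OF cone] w(2) unfolding Ws by simp
qed

section \<open>The top homology of \<open>P \<otimes> N\<close>\<close>

lemma zero_module_power: "zero_module A ==> zero_module (power_module A n)"
  unfolding zero_module_def power_module_simps by (auto simp: PiE_eq_singleton)

lemma zero_module_cycles: "chain_complex R X ==> zero_module (obj X i) ==> exact_at X i"
  using module.submodule_closed(1)[OF chain_complexD(1) boundaries_submodule]
  unfolding cycles_def by (auto dest: zero_module_carrier)

text \<open>Killing the top homology \<open>H\<^sub>h(P) \<cong> M\<^sup>a\<close>: the comparison of the \<open>a\<close>-th power of a resolution of \<open>M\<close>,
  placed in degree \<open>h\<close>, with \<open>P\<close> is an isomorphism on \<open>H\<^sub>h\<close>, so its cone has the homology of \<open>P\<close> in degrees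
  below \<open>h\<close> and none in the others.\<close>
lemma kill_top_homology:
  fixes R :: "('a, 'r) ring_scheme" and M :: "('a, 'b, 'm) module_scheme"
    and P F :: "('a, 'a univ_elem) cpx"
  assumes M: "module R M" and F: "projective_resolution R M F"
    and Pc: "is_complex R P" "!!n. projective_module R (obj P n)" "!!n. n < l ==> zero_module (obj P n)"
    and ex: "!!n. h < n ==> exact_at P n" and top: "mod_iso R (homology P h) (power_module M a)" and lh: "l \<le> h"
  obtains \<phi> and W :: "('a, 'a univ_elem) cpx" and i j p q where
    "cone R P (shift_cpx h (power_cpx F a)) \<phi> W i j p q" "is_complex R W" "!!n. projective_module R (obj W n)"
    "!!n. n < l ==> zero_module (obj W n)" "!!n. h \<le> n ==> exact_at W n"
    "!!n b. n < h ==> mod_iso R (homology P n) (power_module M b) ==> mod_iso R (homology W n) (power_module M b)"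
proof -
  let ?E = "power_cpx F a" let ?G = "shift_cpx h ?E" let ?B = "power_module M a"
  have F1: "is_complex R F" and F2: "!!n. projective_module R (obj F n)" and F3: "!!n. n < 0 ==> zero_module (obj F n)"
    and F4: "!!n. n \<noteq> 0 ==> zero_module (homology F n)" and F5: "mod_iso R (homology F 0) M"
    using F by (auto simp: projective_resolution_def)
  note chP = is_complex_chain[OF Pc(1)]
  have E: "is_complex R ?E" by (rule power_cpx_complex[OF F1])
  have G: "is_complex R ?G" by (rule shift_cpx_complex[OF E])
  note chG = is_complex_chain[OF G] and chE = is_complex_chain[OF E]
  have Gp: "projective_module R (obj ?G n)" for n
    unfolding shift_cpx_simps power_cpx_simps by (rule projective_power[OF F2])
  have Gz: "zero_module (obj ?G n)" if "n < h" for n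
    unfolding shift_cpx_simps power_cpx_simps by (rule zero_module_power[OF F3]) (use that in simp)
  have Gex: "exact_at ?G n" if "n \<noteq> h" for n
  proof -
    have "n - h \<noteq> 0" using that by simp
    then have "exact_at F (n - h)" using F4 homology_zero_iff[OF is_complex_chain[OF F1]] by blast
    then have "({..<a} \<rightarrow>\<^sub>E cycles F (n - h)) \<subseteq> ({..<a} \<rightarrow>\<^sub>E boundaries F (n - h))" by (rule PiE_mono)
    then show ?thesis unfolding shift_cpx_simps subset_iff power_cpx_cycles[OF F1] .
  qed
  have Bm: "module R ?B" by (rule power_module_module[OF M])
  have isoE: "mod_iso R (homology ?E 0) ?B" by (rule power_cpx_homology[OF F1 M F5])
  have cE: "cycles ?E 0 = elems ?E 0"
  proof -
    have "zero_module (obj ?E (-1))" unfolding power_cpx_simps by (rule zero_module_power[OF F3]) simp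
    then show ?thesis unfolding cycles_def
      using chain_complexD(6)[OF chE, of _ 0] by (auto dest: zero_module_carrier)
  qed
  obtain \<epsilon> where \<epsilon>: "\<epsilon> \<in> mod_hom R (obj ?E 0\<lparr>carrier := cycles ?E 0\<rparr>) ?B" "\<epsilon> ` cycles ?E 0 = carrier ?B"
    "!!x. x \<in> cycles ?E 0 ==> \<epsilon> x = \<zero>\<^bsub>?B\<^esub> \<longleftrightarrow> x \<in> boundaries ?E 0"
    using iffD1[OF homology_iso_iff[OF chE Bm] isoE] by (elim bexE conjE) (rule that, assumption, assumption, drule (1) bspec)
  obtain f where f: "f \<in> mod_hom R (obj P h\<lparr>carrier := cycles P h\<rparr>) ?B" "f ` cycles P h = carrier ?B"
    "!!x. x \<in> cycles P h ==> f x = \<zero>\<^bsub>?B\<^esub> \<longleftrightarrow> x \<in> boundaries P h"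
    using iffD1[OF homology_iso_iff[OF chP Bm] top] by (elim bexE conjE) (rule that, assumption, assumption, drule (1) bspec)
  have oG: "obj ?G h = obj ?E 0" "boundaries ?G h = boundaries ?E 0" "cycles ?G h = cycles ?E 0"
    unfolding shift_cpx_simps by simp_all
  have \<epsilon>G: "\<epsilon> \<in> mod_hom R (obj ?G h) ?B" using \<epsilon>(1) unfolding cE oG(1) by simp
  have \<epsilon>b: "\<epsilon> x = \<zero>\<^bsub>?B\<^esub>" if "x \<in> boundaries ?G h" for x
  proof -
    have "x \<in> cycles ?E 0" using that boundaries_cycles[OF chE, of 0] unfolding oG by blast
    then show ?thesis using \<epsilon>(3) that unfolding oG by simp
  qed
  have \<epsilon>f: "\<epsilon> ` elems ?G h \<subseteq> f ` cycles P h" unfolding oG cE[symmetric] \<epsilon>(2) f(2) by (rule order_refl)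
  obtain \<phi> where cm: "chain_map R ?G P \<phi>" "!!x. x \<in> elems ?G h ==> \<phi> h x \<in> cycles P h \<and> f (\<phi> h x) = \<epsilon> x"
    using lift_chain_map[OF G Gp Gz chP ex Bm \<epsilon>G \<epsilon>b f(1) \<epsilon>f f(3)] by metis
  obtain W :: "('a, 'a univ_elem) cpx" and i j p q where Wc: "cone R P ?G \<phi> W i j p q"
    "is_complex R W" "!!n. projective_module R (obj W n)" using cone_exists[OF Pc(1,2) G Gp cm(1)] by metis
  interpret cone R P ?G \<phi> W i j p q by (rule Wc(1))
  interpret Ph: module R "obj P h" by (rule DP)
  interpret Bi: module R ?B by (rule Bm)
  have inj: "e \<in> boundaries ?G n" if e: "e \<in> cycles ?G n" "\<phi> n e \<in> boundaries P n" for n e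
  proof (cases "n = h")
    case False then show ?thesis using Gex e(1) by blast
  next
    case True
    have ec2: "e \<in> cycles ?E 0" using e(1) unfolding True oG(3) .
    have ec: "e \<in> elems ?G h" "e \<in> cycles ?E 0" using ec2 unfolding oG(1) cE[symmetric] by simp_all
    have "f (\<phi> h e) = \<zero>\<^bsub>?B\<^esub>" using f(3)[of "\<phi> h e"] cm(2)[OF ec(1)] e(2) True by simp
    then have "\<epsilon> e = \<zero>\<^bsub>?B\<^esub>" using cm(2)[OF ec(1)] by simp
    then show ?thesis using \<epsilon>(3)[OF ec(2)] unfolding True oG by simp
  qed
  have surj: "\<exists>e\<in>cycles ?G n. \<exists>y\<in>elems P (n + 1). z = \<phi> n e \<oplus>\<^bsub>obj P n\<^esub> bd P (n + 1) y"
    if n: "h \<le> n" and z: "z \<in> cycles P n" for n z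
  proof (cases "n = h")
    case False
    interpret Pn: module R "obj P n" by (rule DP)
    have "z \<in> boundaries P n" using ex[of n] n False z by auto
    then obtain y where y: "y \<in> elems P (n + 1)" "z = bd P (n + 1) y" unfolding boundaries_def by blast
    have "z = \<phi> n \<zero>\<^bsub>obj ?G n\<^esub> \<oplus>\<^bsub>obj P n\<^esub> bd P (n + 1) y"
      unfolding mod_hom_zero[OF DG(1) DP(1) D\<phi>(1)] y(2) using DP(7)[OF y(1)] by simp
    moreover have "\<zero>\<^bsub>obj ?G n\<^esub> \<in> cycles ?G n"
      by (rule module.submodule_closed(1)[OF DG(1) cycles_submodule[OF chG]])
    ultimately show ?thesis using y(1) by blast
  next
    case True
    have zh: "z \<in> cycles P h" using z True by simp
    then have zc: "z \<in> elems P h" by (simp add: cycles_def)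
    have "f z \<in> \<epsilon> ` cycles ?E 0" unfolding \<epsilon>(2) f(2)[symmetric] using zh by blast
    then obtain e where e: "e \<in> cycles ?E 0" "f z = \<epsilon> e" by blast
    have eG: "e \<in> elems ?G h" using e(1) unfolding cE oG .
    have fe: "\<phi> h e \<in> cycles P h" "f (\<phi> h e) = \<epsilon> e" using cm(2)[OF eG] by auto
    have fec: "\<phi> h e \<in> elems P h" using fe(1) by (simp add: cycles_def)
    have dc: "z \<ominus>\<^bsub>obj P h\<^esub> \<phi> h e \<in> cycles P h" by (rule Ph.submodule_closed(4)[OF cycles_submodule[OF chP] zh fe(1)])
    have zz: "z = \<phi> h e \<oplus>\<^bsub>obj P h\<^esub> (z \<ominus>\<^bsub>obj P h\<^esub> \<phi> h e)" using zc fec by (simp add: Ph.group_normalise)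
    have fd: "f (z \<ominus>\<^bsub>obj P h\<^esub> \<phi> h e) \<in> carrier ?B" "f (\<phi> h e) \<in> carrier ?B"
      using mod_hom_closed[OF f(1)] dc fe(1) by simp_all
    have "f z = f (\<phi> h e) \<oplus>\<^bsub>?B\<^esub> f (z \<ominus>\<^bsub>obj P h\<^esub> \<phi> h e)"
      using mod_hom_add[OF f(1), of "\<phi> h e" "z \<ominus>\<^bsub>obj P h\<^esub> \<phi> h e"] dc fe(1) zz by simp
    then have "f (z \<ominus>\<^bsub>obj P h\<^esub> \<phi> h e) = \<ominus>\<^bsub>?B\<^esub> f (\<phi> h e) \<oplus>\<^bsub>?B\<^esub> f z" using Bi.r_neg1[OF fd(2,1)] by simp
    also have "\<dots> = \<zero>\<^bsub>?B\<^esub>" unfolding e(2) fe(2)[symmetric] by (rule Bi.l_neg[OF fd(2)])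
    finally have "z \<ominus>\<^bsub>obj P h\<^esub> \<phi> h e \<in> boundaries P h" using f(3)[OF dc] by simp
    then obtain y where y: "y \<in> elems P (h + 1)" "z \<ominus>\<^bsub>obj P h\<^esub> \<phi> h e = bd P (h + 1) y" unfolding boundaries_def by blast
    have "z = \<phi> h e \<oplus>\<^bsub>obj P h\<^esub> bd P (h + 1) y" using zz unfolding y(2) .
    then show ?thesis using e(1) y(1) unfolding True oG by blast
  qed
  show ?thesis
  proof (rule that[OF Wc])
    fix n assume n: "n < l"
    have z1: "zero_module (obj P n)" by (rule Pc(3)[OF n])
    have z2: "zero_module (obj ?G (n - 1))" by (rule Gz) (use n lh in simp)
    interpret Wn: module R "obj W n" by (rule cone.W[OF Wc(1)])
    have "w = \<zero>\<^bsub>obj W n\<^esub>" if w: "w \<in> elems W n" for w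
    proof (rule W_eqI[OF w Wn.zero_closed])
      show "p n w = p n \<zero>\<^bsub>obj W n\<^esub>" unfolding p_zero using zero_module_carrier[OF z1 comp_closed(3)[OF w]] .
      show "q n w = q n \<zero>\<^bsub>obj W n\<^esub>" unfolding q_zero using zero_module_carrier[OF z2 comp_closed(4)[OF w]] .
    qed
    then show "zero_module (obj W n)" unfolding zero_module_def using Wn.zero_closed by blast
  next
    fix n assume n: "h \<le> n"
    show "exact_at W n" by (rule exact[OF inj surj[OF n]])
  next
    fix n b assume n: "n < h" and iso: "mod_iso R (homology P n) (power_module M b)"
    show "mod_iso R (homology W n) (power_module M b)"
      by (rule homology_iso_below[OF Gz Gz power_module_module[OF M] iso]) (use n in simp_all)
  qed
qed

text \<open>If \<open>Tor\<^sub>i(M, N)\<close> vanishes for \<open>i > q\<close>, then \<open>H\<^sub>i(P \<otimes> N)\<close> vanishes for \<open>i > h + q\<close>, by induction on the number of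
  degrees in which \<open>P\<close> may have homology: by the induction hypothesis the cone tensored with \<open>N\<close> has no homology there,
  so that the homology of \<open>P \<otimes> N\<close> comes from the shifted power of the resolution.\<close>
lemma tensor_vanishing:
  fixes R :: "('a, 'r) ring_scheme" and M :: "('a, 'b, 'm) module_scheme"
    and P F :: "('a, 'a univ_elem) cpx" and N :: "('a, 'c, 'n) module_scheme" and q :: nat
  assumes M: "module R M" and N: "module R N" and F: "projective_resolution R M F"
    and q: "!!i. int q < i ==> exact_at (tensor_cpx R F N) i"
    and P: "is_complex R P" "!!n. projective_module R (obj P n)" "!!n. n < l ==> zero_module (obj P n)"
    and iso: "!!i. i < l + int n ==> \<exists>a. mod_iso R (homology P i) (power_module M a)"
    and ex: "!!i. l + int n \<le> i ==> exact_at P i"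
    and k: "l + int n + int q \<le> k"
  shows "exact_at (tensor_cpx R P N) k"
  using P iso ex k
proof (induction n arbitrary: P k)
  case 0
  have ex0: "exact_at P i" for i
  proof (cases "i < l")
    case True then show ?thesis using zero_module_cycles[OF is_complex_chain[OF 0(1)] 0(3)] by blast
  next
    case False then show ?thesis using 0(5) by simp
  qed
  show ?case by (rule exact_tensor[OF 0(1) 0(2) 0(3) ex0 N])
next
  case (Suc n)
  define h where "h = l + int n"
  obtain a where a: "mod_iso R (homology P h) (power_module M a)" using Suc.prems(4)[of h] by (auto simp: h_def)
  have exh: "exact_at P i" if "h < i" for i using Suc.prems(5)[of i] that by (simp add: h_def)
  obtain \<phi> and W :: "('a, 'a univ_elem) cpx" and i j p r where
    W: "cone R P (shift_cpx h (power_cpx F a)) \<phi> W i j p r" "is_complex R W" "!!n. projective_module R (obj W n)"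
    "!!n. n < l ==> zero_module (obj W n)" "!!n. h \<le> n ==> exact_at W n"
    "!!n b. n < h ==> mod_iso R (homology P n) (power_module M b) ==> mod_iso R (homology W n) (power_module M b)"
    using kill_top_homology[OF M F Suc.prems(1-3) exh a] by (metis (no_types, lifting) h_def le_add_same_cancel1 of_nat_0_le_iff)
  have vW: "exact_at (tensor_cpx R W N) m" if "h + int q \<le> m" for m
  proof (rule Suc.IH[OF W(2-4)])
    fix i assume i: "i < l + int n"
    obtain b where "mod_iso R (homology P i) (power_module M b)" using Suc.prems(4)[of i] i by auto
    then show "\<exists>a. mod_iso R (homology W i) (power_module M a)" using W(6)[of i b] i by (auto simp: h_def)
  qed (use W(5) that in \<open>auto simp: h_def\<close>)
  let ?G = "shift_cpx h (power_cpx F a)"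
  interpret T: cone R "tensor_cpx R P N" "tensor_cpx R ?G N"
    "\<lambda>n. tensor_map R (obj ?G n) (obj P n) N (\<phi> n)" "tensor_cpx R W N"
    "\<lambda>n. tensor_map R (obj P n) (obj W n) N (i n)" "\<lambda>n. tensor_map R (obj ?G (n - 1)) (obj W n) N (j n)"
    "\<lambda>n. tensor_map R (obj W n) (obj P n) N (p n)" "\<lambda>n. tensor_map R (obj W n) (obj ?G (n - 1)) N (r n)"
    by (rule cone_tensor[OF W(1) N])
  have F1: "is_complex R F" using F by (simp add: projective_resolution_def)
  have k: "h + int q < k" using Suc.prems(6) by (simp add: h_def)
  show ?case
  proof
    fix z assume z: "z \<in> cycles (tensor_cpx R P N) k"
    obtain e y where e: "e \<in> cycles (tensor_cpx R ?G N) k" and y: "y \<in> elems (tensor_cpx R P N) (k + 1)"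
      and zz: "z = tensor_map R (obj ?G k) (obj P k) N (\<phi> k) e \<oplus>\<^bsub>obj (tensor_cpx R P N) k\<^esub> bd (tensor_cpx R P N) (k + 1) y"
      using T.surj_of_exact[OF vW z] k by auto
    have "cycles (tensor_cpx R (power_cpx F a) N) (k - h) \<subseteq> boundaries (tensor_cpx R (power_cpx F a) N) (k - h)"
      by (rule power_cpx_tensor(2)[OF F1 N q]) (use k in simp)
    then have "e \<in> boundaries (tensor_cpx R ?G N) k"
      using e unfolding tensor_shift_cpx shift_cpx_simps by blast
    then have "tensor_map R (obj ?G k) (obj P k) N (\<phi> k) e \<in> boundaries (tensor_cpx R P N) k"
      by (rule chain_map_boundaries[OF T.\<phi>])
    moreover have "bd (tensor_cpx R P N) (k + 1) y \<in> boundaries (tensor_cpx R P N) k" unfolding boundaries_def using y by blast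
    ultimately show "z \<in> boundaries (tensor_cpx R P N) k"
      unfolding zz by (rule module.submodule_closed(2)[OF T.DP(1) boundaries_submodule[OF T.P]])
  qed
qed

text \<open>The cone tensored with \<open>N\<close> is exact in degree \<open>h + q\<close> and above.  Its long exact sequence therefore identifies
  \<open>H\<^sub>h\<^sub>+\<^sub>q(P \<otimes> N)\<close> with the homology of the shifted power of the resolution.\<close>
lemma tensor_top_homology:
  fixes R :: "('a, 'r) ring_scheme" and M :: "('a, 'b, 'm) module_scheme"
    and P F :: "('a, 'a univ_elem) cpx" and N :: "('a, 'c, 'n) module_scheme" and q :: nat
  assumes M: "module R M" and N: "module R N" and F: "projective_resolution R M F"
    and q: "!!i. int q < i ==> exact_at (tensor_cpx R F N) i"
    and P: "is_complex R P" "!!n. projective_module R (obj P n)" "!!n. n < l ==> zero_module (obj P n)"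
    and iso: "!!i. i < h ==> \<exists>a. mod_iso R (homology P i) (power_module M a)"
    and ex: "!!i. h < i ==> exact_at P i" and lh: "l \<le> h"
    and top: "mod_iso R (homology P h) (power_module M a)"
  shows "mod_iso R (homology (tensor_cpx R P N) (h + int q)) (power_module (homology (tensor_cpx R F N) (int q)) a)"
proof -
  obtain \<phi> and W :: "('a, 'a univ_elem) cpx" and i j p r where
    W: "cone R P (shift_cpx h (power_cpx F a)) \<phi> W i j p r" "is_complex R W" "!!n. projective_module R (obj W n)"
    "!!n. n < l ==> zero_module (obj W n)" "!!n. h \<le> n ==> exact_at W n"
    "!!n b. n < h ==> mod_iso R (homology P n) (power_module M b) ==> mod_iso R (homology W n) (power_module M b)"
    using kill_top_homology[OF M F P ex top lh] by metis
  have lh': "l + int (nat (h - l)) = h" using lh by simp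
  have vW: "exact_at (tensor_cpx R W N) m" if "h + int q \<le> m" for m
  proof (rule tensor_vanishing[where n = "nat (h - l)" and q = q and l = l, OF M N F q W(2-4)], unfold lh')
    fix i assume i: "i < h"
    obtain b where "mod_iso R (homology P i) (power_module M b)" using iso[OF i] by auto
    then show "\<exists>a. mod_iso R (homology W i) (power_module M a)" using W(6)[OF i] by blast
  qed (use W(5) that in auto)
  let ?G = "shift_cpx h (power_cpx F a)" let ?k = "h + int q"
  let ?\<phi> = "\<lambda>n. tensor_map R (obj ?G n) (obj P n) N (\<phi> n)"
  interpret T: cone R "tensor_cpx R P N" "tensor_cpx R ?G N" ?\<phi> "tensor_cpx R W N"
    "\<lambda>n. tensor_map R (obj P n) (obj W n) N (i n)" "\<lambda>n. tensor_map R (obj ?G (n - 1)) (obj W n) N (j n)"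
    "\<lambda>n. tensor_map R (obj W n) (obj P n) N (p n)" "\<lambda>n. tensor_map R (obj W n) (obj ?G (n - 1)) N (r n)"
    by (rule cone_tensor[OF W(1) N])
  have F1: "is_complex R F" using F by (simp add: projective_resolution_def)
  note hP = homology_module[OF T.P] and hG = homology_module[OF T.G]
  obtain f where f: "f \<in> mod_hom R (obj (tensor_cpx R P N) ?k\<lparr>carrier := cycles (tensor_cpx R P N) ?k\<rparr>) (homology (tensor_cpx R P N) ?k)"
    "f ` cycles (tensor_cpx R P N) ?k = carrier (homology (tensor_cpx R P N) ?k)"
    "!!x. x \<in> cycles (tensor_cpx R P N) ?k ==> f x = \<zero>\<^bsub>homology (tensor_cpx R P N) ?k\<^esub> \<longleftrightarrow> x \<in> boundaries (tensor_cpx R P N) ?k"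
    by (rule homology_proj[OF T.P, of ?k]) (rule that)
  interpret H: module R "homology (tensor_cpx R P N) ?k" by (rule hP)
  have \<phi>c: "?\<phi> ?k e \<in> cycles (tensor_cpx R P N) ?k" if "e \<in> cycles (tensor_cpx R ?G N) ?k" for e
    by (rule chain_map_cycles[OF T.G T.P T.\<phi> that])
  have "mod_iso R (homology (tensor_cpx R ?G N) ?k) (homology (tensor_cpx R P N) ?k)"
    unfolding homology_iso_iff[OF T.G hP]
  proof (intro bexI conjI ballI)
    have "?\<phi> ?k \<in> mod_hom R (obj (tensor_cpx R ?G N) ?k\<lparr>carrier := cycles (tensor_cpx R ?G N) ?k\<rparr>)
        (obj (tensor_cpx R P N) ?k\<lparr>carrier := cycles (tensor_cpx R P N) ?k\<rparr>)"
      by (rule mod_hom_sub_codomain[OF mod_hom_sub_domain[OF chain_mapD(1)[OF T.\<phi>]]])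
        (use \<phi>c in \<open>auto simp: cycles_def\<close>)
    then show "(\<lambda>e. f (?\<phi> ?k e)) \<in> mod_hom R (obj (tensor_cpx R ?G N) ?k\<lparr>carrier := cycles (tensor_cpx R ?G N) ?k\<rparr>)
        (homology (tensor_cpx R P N) ?k)" by (rule mod_hom_comp[OF _ f(1)])
    show "(\<lambda>e. f (?\<phi> ?k e)) ` cycles (tensor_cpx R ?G N) ?k = carrier (homology (tensor_cpx R P N) ?k)"
    proof (intro equalityI subsetI)
      fix b assume "b \<in> (\<lambda>e. f (?\<phi> ?k e)) ` cycles (tensor_cpx R ?G N) ?k"
      then show "b \<in> carrier (homology (tensor_cpx R P N) ?k)" unfolding f(2)[symmetric] using \<phi>c by blast
    next
      fix b assume "b \<in> carrier (homology (tensor_cpx R P N) ?k)"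
      then obtain z where z: "z \<in> cycles (tensor_cpx R P N) ?k" "b = f z" unfolding f(2)[symmetric] by blast
      obtain e y where e: "e \<in> cycles (tensor_cpx R ?G N) ?k" and y: "y \<in> elems (tensor_cpx R P N) (?k + 1)"
        and zz: "z = ?\<phi> ?k e \<oplus>\<^bsub>obj (tensor_cpx R P N) ?k\<^esub> bd (tensor_cpx R P N) (?k + 1) y"
        using T.surj_of_exact[OF vW z(1)] by auto
      have yb: "bd (tensor_cpx R P N) (?k + 1) y \<in> boundaries (tensor_cpx R P N) ?k" unfolding boundaries_def using y by blast
      then have yc: "bd (tensor_cpx R P N) (?k + 1) y \<in> cycles (tensor_cpx R P N) ?k" using boundaries_cycles[OF T.P] by blast
      have "f z = f (?\<phi> ?k e) \<oplus>\<^bsub>homology (tensor_cpx R P N) ?k\<^esub> f (bd (tensor_cpx R P N) (?k + 1) y)"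
        unfolding zz using mod_hom_add[OF f(1), of "?\<phi> ?k e" "bd (tensor_cpx R P N) (?k + 1) y"] \<phi>c[OF e] yc by simp
      also have "f (bd (tensor_cpx R P N) (?k + 1) y) = \<zero>\<^bsub>homology (tensor_cpx R P N) ?k\<^esub>" using f(3)[OF yc] yb by blast
      finally have "b = f (?\<phi> ?k e)" unfolding z(2) using mod_hom_closed[OF f(1), of "?\<phi> ?k e"] \<phi>c[OF e] by simp
      then show "b \<in> (\<lambda>e. f (?\<phi> ?k e)) ` cycles (tensor_cpx R ?G N) ?k" using e by blast
    qed
    fix e assume e: "e \<in> cycles (tensor_cpx R ?G N) ?k"
    have ex1: "exact_at (tensor_cpx R W N) (?k + 1)" by (rule vW) simp
    have "f (?\<phi> ?k e) = \<zero>\<^bsub>homology (tensor_cpx R P N) ?k\<^esub> \<longleftrightarrow> ?\<phi> ?k e \<in> boundaries (tensor_cpx R P N) ?k"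
      by (rule f(3)[OF \<phi>c[OF e]])
    also have "\<dots> \<longleftrightarrow> e \<in> boundaries (tensor_cpx R ?G N) ?k"
      using T.inj_of_exact[OF ex1 e] chain_map_boundaries[OF T.\<phi>] by blast
    finally show "f (?\<phi> ?k e) = \<zero>\<^bsub>homology (tensor_cpx R P N) ?k\<^esub> \<longleftrightarrow> e \<in> boundaries (tensor_cpx R ?G N) ?k" .
  qed
  then have "mod_iso R (homology (tensor_cpx R P N) ?k) (homology (tensor_cpx R ?G N) ?k)"
    by (rule mod_iso_sym[OF hG hP])
  moreover have "homology (tensor_cpx R ?G N) ?k = homology (tensor_cpx R (power_cpx F a) N) (int q)"
    unfolding homology_def tensor_shift_cpx shift_cpx_simps by simp
  ultimately show ?thesis using mod_iso_trans[OF _ power_cpx_tensor(1)[OF F1 N]] by metis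
qed

section \<open>The depth formula for a complex with minimal top differential\<close>

subsection \<open>Regular sequences on \<open>P \<otimes> N\<close>\<close>

text \<open>A module \<open>T\<close> that is presented by coordinates \<open>h\<^sub>k : T \<rightarrow> N\<close> and vectors \<open>g\<^sub>k : N \<rightarrow> T\<close>, as
  \<open>P \<otimes> N\<close> is by a dual basis of \<open>P\<close>, behaves towards regular sequences like a direct summand of a power of \<open>N\<close>.\<close>
lemma coordinates_regular:
  fixes h :: "nat \<Rightarrow> 't \<Rightarrow> 'c" and g :: "nat \<Rightarrow> 'c \<Rightarrow> 't"
  assumes T: "module R T" and N: "module R N"
    and h: "!!k. k < n ==> h k \<in> mod_hom R T N" and g: "!!k. k < n ==> g k \<in> mod_hom R N T"
    and exp: "!!w. w \<in> carrier T ==> w = (\<Oplus>\<^bsub>T\<^esub>k\<in>{..<n}. g k (h k w))"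
    and hg: "!!k l. k < n ==> l < n ==> \<exists>r\<in>carrier R. \<forall>y\<in>carrier N. h l (g k y) = r \<odot>\<^sub>N y"
    and K: "submodule K R N" and L: "L = {w \<in> carrier T. \<forall>k<n. h k w \<in> K}"
    and xs: "set xs \<subseteq> carrier R"
  shows "foldl (plus_mult T) L xs = {w \<in> carrier T. \<forall>k<n. h k w \<in> foldl (plus_mult N) K xs}"
    and "regular_mod N K xs ==> regular_mod T L xs"
proof -
  interpret T: module R T by (rule T)
  interpret N: module R N by (rule N)
  have "foldl (plus_mult T) L xs = {w \<in> carrier T. \<forall>k<n. h k w \<in> foldl (plus_mult N) K xs} \<and>
    (regular_mod N K xs \<longrightarrow> regular_mod T L xs)"
    using K L xs
  proof (induction xs arbitrary: K L)
    case Nil then show ?case by simp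
  next
    case (Cons x xs)
    have x: "x \<in> carrier R" using Cons.prems(3) by simp
    note K = Cons.prems(1) and L = Cons.prems(2)
    note Kc = N.submodule_closed[OF K]
    have step: "plus_mult T L x = {w \<in> carrier T. \<forall>k<n. h k w \<in> plus_mult N K x}"
    proof (intro equalityI subsetI)
      fix w assume "w \<in> plus_mult T L x"
      then obtain l v where l: "l \<in> L" "v \<in> carrier T" "w = l \<oplus>\<^sub>T x \<odot>\<^sub>T v" by (rule plus_multE)
      have lc: "l \<in> carrier T" "!!k. k < n ==> h k l \<in> K" using l(1) unfolding L by auto
      have "h k w \<in> plus_mult N K x" if k: "k < n" for k
      proof -
        have "h k w = h k l \<oplus>\<^sub>N x \<odot>\<^sub>N h k v"
          unfolding l(3) using mod_hom_add[OF h[OF k] lc(1)] mod_hom_smult[OF h[OF k] x l(2)] x l(2) by simp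
        then show ?thesis using plus_multI[OF lc(2)[OF k] mod_hom_closed[OF h[OF k] l(2)]] by simp
      qed
      then show "w \<in> {w \<in> carrier T. \<forall>k<n. h k w \<in> plus_mult N K x}" unfolding l(3) using lc(1) l(2) x by simp
    next
      fix w assume "w \<in> {w \<in> carrier T. \<forall>k<n. h k w \<in> plus_mult N K x}"
      then have w: "w \<in> carrier T" "!!k. k < n ==> h k w \<in> plus_mult N K x" by auto
      have "\<exists>a v. a \<in> K \<and> v \<in> carrier N \<and> h k w = a \<oplus>\<^sub>N x \<odot>\<^sub>N v" if "k < n" for k
        using w(2)[OF that] unfolding plus_mult_def by blast
      then obtain a v where av: "!!k. k < n ==> a k \<in> K" "!!k. k < n ==> v k \<in> carrier N"
        "!!k. k < n ==> h k w = a k \<oplus>\<^sub>N x \<odot>\<^sub>N v k" by metis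
      have ac: "a k \<in> carrier N" if "k < n" for k using Kc(6)[OF av(1)[OF that]] .
      have ga: "(\<lambda>k. g k (a k)) \<in> {..<n} \<rightarrow> carrier T" using mod_hom_closed[OF g ac] by auto
      have gv: "(\<lambda>k. g k (v k)) \<in> {..<n} \<rightarrow> carrier T" using mod_hom_closed[OF g av(2)] by auto
      have gxv: "(\<lambda>k. x \<odot>\<^sub>T g k (v k)) \<in> {..<n} \<rightarrow> carrier T" using gv x by auto
      let ?a = "\<Oplus>\<^bsub>T\<^esub>k\<in>{..<n}. g k (a k)" and ?v = "\<Oplus>\<^bsub>T\<^esub>k\<in>{..<n}. g k (v k)"
      have "w = (\<Oplus>\<^bsub>T\<^esub>k\<in>{..<n}. g k (h k w))" by (rule exp[OF w(1)])
      also have "\<dots> = (\<Oplus>\<^bsub>T\<^esub>k\<in>{..<n}. g k (a k) \<oplus>\<^sub>T x \<odot>\<^sub>T g k (v k))"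
      proof (rule T.finsum_cong'[OF refl])
        show "(\<lambda>k. g k (a k) \<oplus>\<^sub>T x \<odot>\<^sub>T g k (v k)) \<in> {..<n} \<rightarrow> carrier T" using ga gxv by auto
        fix k assume "k \<in> {..<n}"
        then have k: "k < n" by simp
        show "g k (h k w) = g k (a k) \<oplus>\<^sub>T x \<odot>\<^sub>T g k (v k)"
          unfolding av(3)[OF k] using mod_hom_add[OF g[OF k] ac[OF k]] mod_hom_smult[OF g[OF k] x av(2)[OF k]] x av(2)[OF k] by simp
      qed
      also have "\<dots> = ?a \<oplus>\<^sub>T (\<Oplus>\<^bsub>T\<^esub>k\<in>{..<n}. x \<odot>\<^sub>T g k (v k))" by (rule T.finsum_addf[OF ga gxv])
      also have "(\<Oplus>\<^bsub>T\<^esub>k\<in>{..<n}. x \<odot>\<^sub>T g k (v k)) = x \<odot>\<^sub>T ?v"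
        by (rule T.finsum_smult_ldistr[OF finite_lessThan x gv, symmetric])
      finally have wav: "w = ?a \<oplus>\<^sub>T x \<odot>\<^sub>T ?v" .
      have "h l ?a \<in> K" if l: "l < n" for l
      proof -
        have "h l ?a = (\<Oplus>\<^bsub>N\<^esub>k\<in>{..<n}. h l (g k (a k)))"
          by (rule mod_hom_finsum[OF T N h[OF l] finite_lessThan ga])
        also have "\<dots> \<in> K"
        proof (rule N.submodule_finsum[OF K], rule Pi_I)
          fix k assume "k \<in> {..<n}"
          then have k: "k < n" by simp
          obtain r where "r \<in> carrier R" "\<forall>y\<in>carrier N. h l (g k y) = r \<odot>\<^sub>N y" using hg[OF k l] by blast
          then show "h l (g k (a k)) \<in> K" using ac[OF k] Kc(5) av(1)[OF k] by simp
        qed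
        finally show ?thesis .
      qed
      then have "?a \<in> L" unfolding L using T.finsum_closed[OF ga] by simp
      then show "w \<in> plus_mult T L x" unfolding wav using T.finsum_closed[OF gv] by (rule plus_multI)
    qed
    have "nzd T L x" if nz: "nzd N K x"
      unfolding nzd_def
    proof (intro ballI impI)
      fix v assume v: "v \<in> carrier T" "x \<odot>\<^sub>T v \<in> L"
      have "h k v \<in> K" if k: "k < n" for k
      proof -
        have "x \<odot>\<^sub>N h k v \<in> K" using v(2) k mod_hom_smult[OF h[OF k] x v(1)] unfolding L by auto
        then show ?thesis by (rule nzdD[OF nz mod_hom_closed[OF h[OF k] v(1)]])
      qed
      then show "v \<in> L" unfolding L using v(1) by blast
    qed
    then show ?case
      using Cons.IH[OF N.plus_mult_submodule[OF K x] step] Cons.prems(3) by simp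
  qed
  then show "foldl (plus_mult T) L xs = {w \<in> carrier T. \<forall>k<n. h k w \<in> foldl (plus_mult N) K xs}"
    "regular_mod N K xs ==> regular_mod T L xs" by auto
qed

text \<open>A dual basis \<open>e\<^sub>k, \<phi>\<^sub>k\<close> of \<open>P\<close> gives the coordinates \<open>v \<otimes> y \<mapsto> \<phi>\<^sub>k(v)y\<close> and the vectors \<open>y \<mapsto> e\<^sub>k \<otimes> y\<close>.\<close>
lemma tensor_regular:
  assumes P: "fin_gen_module R P" "projective_module R P" and N: "module R N"
  obtains n :: nat and \<phi> where "!!k. k < n ==> \<phi> k \<in> mod_hom R P (ring_module R)"
    "!!v. v \<in> carrier P ==> (\<forall>k<n. \<phi> k v \<in> I) ==> v \<in> scalars_times R I P"
    "!!xs. set xs \<subseteq> carrier R ==> regular_mod N {\<zero>\<^sub>N} xs ==> regular_mod (tensor R P N) {\<zero>\<^bsub>tensor R P N\<^esub>} xs"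
    "!!xs v z. set xs \<subseteq> carrier R ==> v \<in> carrier P ==> z \<in> carrier N ==>
      pure_tensor R P N v z \<in> foldl (plus_mult (tensor R P N)) {\<zero>\<^bsub>tensor R P N\<^esub>} xs \<longleftrightarrow>
      (\<forall>k<n. \<phi> k v \<odot>\<^sub>N z \<in> foldl (plus_mult N) {\<zero>\<^sub>N} xs)"
proof -
  have Pm: "module R P" using P(1) by (rule fin_gen_module_module)
  interpret T: tensor_pair R P N using Pm N by (rule tensor_pairI)
  obtain n :: nat and e \<phi> where e: "!!i. i < n ==> e i \<in> carrier P" and \<phi>: "!!i. i < n ==> \<phi> i \<in> mod_hom R P (ring_module R)"
    and ex: "!!x. x \<in> carrier P ==> x = (\<Oplus>\<^bsub>P\<^esub>i\<in>{..<n}. \<phi> i x \<odot>\<^sub>P e i)" by (rule dual_basis[OF P]) (rule that)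
  have "\<exists>h. k < n \<longrightarrow> h \<in> mod_hom R (tensor R P N) N \<and> (\<forall>x\<in>carrier P. \<forall>y\<in>carrier N. h (pure_tensor R P N x y) = \<phi> k x \<odot>\<^sub>N y)" for k
  proof (cases "k < n")
    case True
    obtain h where "h \<in> mod_hom R (tensor R P N) N" "!!x y. x \<in> carrier P ==> y \<in> carrier N ==> h (pure_tensor R P N x y) = \<phi> k x \<odot>\<^sub>N y"
      by (rule T.tensor_functional[OF \<phi>[OF True]]) (rule that)
    then show ?thesis by (intro exI[of _ h]) simp
  qed simp
  then have "\<exists>h. \<forall>k. k < n \<longrightarrow> h k \<in> mod_hom R (tensor R P N) N \<and> (\<forall>x\<in>carrier P. \<forall>y\<in>carrier N. h k (pure_tensor R P N x y) = \<phi> k x \<odot>\<^sub>N y)"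
    by (intro choice allI)
  then obtain h where h: "!!k. k < n ==> h k \<in> mod_hom R (tensor R P N) N"
    "!!k x y. k < n ==> x \<in> carrier P ==> y \<in> carrier N ==> h k (pure_tensor R P N x y) = \<phi> k x \<odot>\<^sub>N y" by blast
  define g where "g k y = pure_tensor R P N (e k) y" for k y
  have g: "g k \<in> mod_hom R N (tensor R P N)" if "k < n" for k unfolding g_def by (rule T.pt_hom(2)[OF e[OF that]])
  have \<phi>c: "\<phi> k x \<in> carrier R" if "k < n" "x \<in> carrier P" for k x using mod_hom_closed[OF \<phi>[OF that(1)] that(2)] by simp
  have sumh: "(\<lambda>w. \<Oplus>\<^bsub>tensor R P N\<^esub>k\<in>{..<n}. g k (h k w)) \<in> mod_hom R (tensor R P N) (tensor R P N)"
    using mod_hom_comp[OF h(1) g] by (intro mod_hom_finsumf T.tensor_module) auto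
  have exp: "w = (\<Oplus>\<^bsub>tensor R P N\<^esub>k\<in>{..<n}. g k (h k w))" if w: "w \<in> carrier (tensor R P N)" for w
  proof (rule T.tensor_hom_eq[OF T.tensor_module mod_hom_id sumh _ w])
    fix x y assume x: "x \<in> carrier P" and y: "y \<in> carrier N"
    have c: "(\<lambda>k. \<phi> k x \<odot>\<^sub>P e k) \<in> {..<n} \<rightarrow> carrier P" using \<phi>c[OF _ x] e by auto
    have "pure_tensor R P N x y = pure_tensor R P N (\<Oplus>\<^bsub>P\<^esub>i\<in>{..<n}. \<phi> i x \<odot>\<^sub>P e i) y" using ex[OF x] by simp
    also have "\<dots> = (\<Oplus>\<^bsub>tensor R P N\<^esub>k\<in>{..<n}. pure_tensor R P N (\<phi> k x \<odot>\<^sub>P e k) y)"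
      by (rule mod_hom_finsum[OF Pm T.tensor_module T.pt_hom(1)[OF y] finite_lessThan c])
    also have "\<dots> = (\<Oplus>\<^bsub>tensor R P N\<^esub>k\<in>{..<n}. g k (h k (pure_tensor R P N x y)))"
    proof (rule T.T.finsum_cong'[OF refl])
      show "(\<lambda>k. g k (h k (pure_tensor R P N x y))) \<in> {..<n} \<rightarrow> carrier (tensor R P N)"
        using mod_hom_closed[OF g mod_hom_closed[OF h(1) T.pt_closed[OF x y]]] by auto
      fix k assume "k \<in> {..<n}"
      then have k: "k < n" by simp
      show "pure_tensor R P N (\<phi> k x \<odot>\<^sub>P e k) y = g k (h k (pure_tensor R P N x y))"
        unfolding h(2)[OF k x y] g_def using T.pt_bilinear(3,4) \<phi>c[OF k x] e[OF k] y by simp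
    qed
    finally show "pure_tensor R P N x y = (\<Oplus>\<^bsub>tensor R P N\<^esub>k\<in>{..<n}. g k (h k (pure_tensor R P N x y)))" .
  qed
  have hg: "\<exists>r\<in>carrier R. \<forall>y\<in>carrier N. h l (g k y) = r \<odot>\<^sub>N y" if "k < n" "l < n" for k l
    unfolding g_def using h(2)[OF that(2) e[OF that(1)]] \<phi>c[OF that(2) e[OF that(1)]] by blast
  have z: "{\<zero>\<^bsub>tensor R P N\<^esub>} = {w \<in> carrier (tensor R P N). \<forall>k<n. h k w \<in> {\<zero>\<^sub>N}}"
  proof (intro equalityI subsetI)
    fix w assume "w \<in> {\<zero>\<^bsub>tensor R P N\<^esub>}"
    then show "w \<in> {w \<in> carrier (tensor R P N). \<forall>k<n. h k w \<in> {\<zero>\<^sub>N}}"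
      using mod_hom_zero[OF T.tensor_module N h(1)] by simp
  next
    fix w assume "w \<in> {w \<in> carrier (tensor R P N). \<forall>k<n. h k w \<in> {\<zero>\<^sub>N}}"
    then have w: "w \<in> carrier (tensor R P N)" "!!k. k < n ==> h k w = \<zero>\<^sub>N" by auto
    have "(\<Oplus>\<^bsub>tensor R P N\<^esub>k\<in>{..<n}. g k (h k w)) = (\<Oplus>\<^bsub>tensor R P N\<^esub>k\<in>{..<n}. \<zero>\<^bsub>tensor R P N\<^esub>)"
      using w(2) mod_hom_zero[OF N T.tensor_module g] by (intro T.T.finsum_cong') auto
    then show "w \<in> {\<zero>\<^bsub>tensor R P N\<^esub>}" using exp[OF w(1)] by simp
  qed
  have cr1: "foldl (plus_mult (tensor R P N)) {\<zero>\<^bsub>tensor R P N\<^esub>} xs =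
      {w \<in> carrier (tensor R P N). \<forall>k<n. h k w \<in> foldl (plus_mult N) {\<zero>\<^sub>N} xs}" if xs: "set xs \<subseteq> carrier R" for xs
    by (rule coordinates_regular(1)[OF T.tensor_module N h(1) g exp hg T.N.zero_submodule z]; (assumption | rule xs))
  have cr2: "regular_mod (tensor R P N) {\<zero>\<^bsub>tensor R P N\<^esub>} xs"
    if xs: "set xs \<subseteq> carrier R" "regular_mod N {\<zero>\<^sub>N} xs" for xs
    by (rule coordinates_regular(2)[OF T.tensor_module N h(1) g exp hg T.N.zero_submodule z]; (assumption | rule xs))
  show ?thesis
  proof (rule that[of n \<phi>, OF \<phi>])
    fix v assume v: "v \<in> carrier P" and vI: "\<forall>k<n. \<phi> k v \<in> I"
    let ?G = "{x \<odot>\<^sub>P m | x m. x \<in> I \<and> m \<in> carrier P}"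
    show "v \<in> scalars_times R I P"
      unfolding scalars_times_def mod_span_def
    proof (intro InterI, elim CollectE conjE)
      fix H assume H: "submodule H R P" "?G \<subseteq> H"
      have "(\<Oplus>\<^bsub>P\<^esub>i\<in>{..<n}. \<phi> i v \<odot>\<^sub>P e i) \<in> H"
        by (rule T.M.submodule_finsum[OF H(1)]) (use H(2) vI e in blast)
      then show "v \<in> H" using ex[OF v] by simp
    qed
  next
    fix xs assume xs: "set xs \<subseteq> carrier R"
    show "regular_mod (tensor R P N) {\<zero>\<^bsub>tensor R P N\<^esub>} xs" if "regular_mod N {\<zero>\<^sub>N} xs" by (rule cr2[OF xs that])
    fix v z assume v: "v \<in> carrier P" and z: "z \<in> carrier N"
    show "pure_tensor R P N v z \<in> foldl (plus_mult (tensor R P N)) {\<zero>\<^bsub>tensor R P N\<^esub>} xs \<longleftrightarrow>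
      (\<forall>k<n. \<phi> k v \<odot>\<^sub>N z \<in> foldl (plus_mult N) {\<zero>\<^sub>N} xs)"
      unfolding cr1[OF xs] using h(2)[OF _ v z] T.pt_closed[OF v z] by simp
  qed
qed

context noeth_local_ring
begin

text \<open>The element is \<open>v \<otimes> z\<close>, where \<open>z\<close> represents a socle element of \<open>N/(xs)N\<close> and \<open>v\<close> lies outside \<open>\<mm>P\<^sub>s\<close>.  As
  \<open>dv\<close> lies in \<open>\<mm>P\<^sub>s\<^sub>-\<^sub>1\<close> and \<open>\<mm>z\<close> in \<open>(xs)N\<close>, the differential kills it modulo \<open>xs\<close>.\<close>
lemma top_socle_element:
  assumes P: "is_complex R P" "!!i. projective_module R (obj P i)" and N: "module R N"
    and nz: "\<not> zero_module (obj P s)"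
    and min: "!!v. v \<in> elems P s ==> bd P s v \<in> scalars_times R (max_ideal R) (obj P (s - 1))"
    and xs: "set xs \<subseteq> max_ideal R" and soc: "has_socle R N (foldl (plus_mult N) {\<zero>\<^sub>N} xs)"
  obtains e where "e \<in> elems (tensor_cpx R P N) s"
    "e \<notin> foldl (plus_mult (obj (tensor_cpx R P N) s)) {\<zero>\<^bsub>obj (tensor_cpx R P N) s\<^esub>} xs"
    "bd (tensor_cpx R P N) s e \<in>
      foldl (plus_mult (obj (tensor_cpx R P N) (s - 1))) {\<zero>\<^bsub>obj (tensor_cpx R P N) (s - 1)\<^esub>} xs"
    "!!a. a \<in> max_ideal R ==> a \<odot>\<^bsub>obj (tensor_cpx R P N) s\<^esub> e \<in>
      foldl (plus_mult (obj (tensor_cpx R P N) s)) {\<zero>\<^bsub>obj (tensor_cpx R P N) s\<^esub>} xs"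
proof -
  note D = chain_complexD[OF is_complex_chain[OF P(1)]]
  have fg: "fin_gen_module R (obj P i)" for i using P(1) by (simp add: is_complex_def)
  have xsR: "set xs \<subseteq> carrier R" using xs max_ideal_carr by blast
  interpret N: module R N by (rule N)
  interpret Ps: module R "obj P s" by (rule D(1))
  interpret Pt: module R "obj P (s - 1)" by (rule D(1))
  let ?K = "foldl (plus_mult N) {\<zero>\<^sub>N} xs"
  have K: "submodule ?K R N" by (rule scalars_times_foldl(1)[OF N xsR])
  note Kc = N.submodule_closed[OF K]
  obtain z where z: "z \<in> carrier N" "z \<notin> ?K" "!!a. a \<in> max_ideal R ==> a \<odot>\<^sub>N z \<in> ?K" using soc by (rule has_socleE) blast
  have "{\<zero>\<^bsub>obj P s\<^esub>} \<noteq> elems P s" using nz unfolding zero_module_def by auto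
  then obtain L where L: "submodule L R (obj P s)" "L \<noteq> elems P s"
    "!!a v. a \<in> max_ideal R ==> v \<in> elems P s ==> a \<odot>\<^bsub>obj P s\<^esub> v \<in> L"
    using nakayama[OF fin_gen_noeth_module[OF noetherian_ring_axioms fg] Ps.zero_submodule] by metis
  have "scalars_times R (max_ideal R) (obj P s) \<subseteq> L"
    unfolding scalars_times_def using L(3) by (intro mod_span_least L(1)) blast
  then obtain v where v: "v \<in> elems P s" "v \<notin> scalars_times R (max_ideal R) (obj P s)"
    using L(2) Ps.submodule_closed(6)[OF L(1)] by blast
  obtain n \<phi> where \<phi>: "!!k. k < n ==> \<phi> k \<in> mod_hom R (obj P s) (ring_module R)"
    and \<phi>v: "!!v. v \<in> elems P s ==> (\<forall>k<n. \<phi> k v \<in> max_ideal R) ==> v \<in> scalars_times R (max_ideal R) (obj P s)"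
    and \<phi>t: "!!xs v z. set xs \<subseteq> carrier R ==> v \<in> elems P s ==> z \<in> carrier N ==>
      pure_tensor R (obj P s) N v z \<in> foldl (plus_mult (tensor R (obj P s) N)) {\<zero>\<^bsub>tensor R (obj P s) N\<^esub>} xs \<longleftrightarrow>
      (\<forall>k<n::nat. \<phi> k v \<odot>\<^sub>N z \<in> foldl (plus_mult N) {\<zero>\<^sub>N} xs)"
    by (rule tensor_regular[OF fg P(2) N, where I = "max_ideal R"]) (rule that)
  obtain n' \<phi>' where \<phi>': "!!k. k < n' ==> \<phi>' k \<in> mod_hom R (obj P (s - 1)) (ring_module R)"
    and \<phi>t': "!!xs v z. set xs \<subseteq> carrier R ==> v \<in> elems P (s - 1) ==> z \<in> carrier N ==>
      pure_tensor R (obj P (s - 1)) N v z \<in> foldl (plus_mult (tensor R (obj P (s - 1)) N)) {\<zero>\<^bsub>tensor R (obj P (s - 1)) N\<^esub>} xs \<longleftrightarrow>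
      (\<forall>k<n'::nat. \<phi>' k v \<odot>\<^sub>N z \<in> foldl (plus_mult N) {\<zero>\<^sub>N} xs)"
    by (rule tensor_regular[OF fg P(2) N, where I = "max_ideal R"]) (rule that)
  interpret T: tensor_pair R "obj P s" N using D(1) N by (rule tensor_pairI)
  let ?e = "pure_tensor R (obj P s) N v z"
  show ?thesis
  proof (rule that[of ?e], unfold tensor_cpx_simps)
    show "?e \<in> carrier (tensor R (obj P s) N)" by (rule T.pt_closed[OF v(1) z(1)])
    obtain k where k: "k < n" "\<phi> k v \<notin> max_ideal R" using \<phi>v[OF v(1)] v(2) by blast
    have kc: "\<phi> k v \<in> carrier R" using mod_hom_closed[OF \<phi>[OF k(1)] v(1)] by simp
    obtain u where u: "u \<in> carrier R" "u \<otimes> \<phi> k v = \<one>" using unit_of_not_max[OF kc k(2)] by blast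
    have "\<phi> k v \<odot>\<^sub>N z \<notin> ?K"
    proof
      assume "\<phi> k v \<odot>\<^sub>N z \<in> ?K"
      then have "u \<odot>\<^sub>N (\<phi> k v \<odot>\<^sub>N z) \<in> ?K" by (rule Kc(5)[OF u(1)])
      then show False using z(1,2) u kc by (simp add: N.smult_assoc1[symmetric])
    qed
    then show "?e \<notin> foldl (plus_mult (tensor R (obj P s) N)) {\<zero>\<^bsub>tensor R (obj P s) N\<^esub>} xs"
      unfolding \<phi>t[OF xsR v(1) z(1)] using k(1) by blast
    note dv = D(6)[OF v(1)]
    have "\<phi>' k (bd P s v) \<in> max_ideal R" if k: "k < n'" for k
    proof -
      have "submodule (max_ideal R) R (ring_module R)"
      proof (rule module.submoduleI[OF ring_module_module[OF is_cring]])
        have "\<ominus>\<^bsub>ring_module R\<^esub> a = (\<ominus> \<one>) \<otimes> a" if "a \<in> carrier R" for a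
        proof -
          interpret RM: module R "ring_module R" by (rule ring_module_module[OF is_cring])
          show ?thesis using RM.smult_l_minus[of \<one> a] RM.smult_one[of a] that by simp
        qed
        then show "\<ominus>\<^bsub>ring_module R\<^esub> a \<in> max_ideal R" if "a \<in> max_ideal R" for a
          using max_ideal_closed(3)[OF that] max_ideal_carr[OF that] by simp
      qed (use max_ideal_closed max_ideal_carr in auto)
      then have "scalars_times R (max_ideal R) (obj P (s - 1)) \<subseteq> {y \<in> elems P (s - 1). \<phi>' k y \<in> max_ideal R}"
        unfolding scalars_times_def
        using mod_hom_smult[OF \<phi>'[OF k]] mod_hom_closed[OF \<phi>'[OF k]] max_ideal_closed(4) max_ideal_carr
        by (intro mod_span_least preimage_submodule[OF D(1) ring_module_module[OF is_cring] \<phi>'[OF k]]) auto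
      then show ?thesis using min[OF v(1)] by blast
    qed
    then have "\<forall>k<n'. \<phi>' k (bd P s v) \<odot>\<^sub>N z \<in> ?K" using z(3) by blast
    then show "tensor_map R (obj P s) (obj P (s - 1)) N (bd P s) ?e \<in>
        foldl (plus_mult (tensor R (obj P (s - 1)) N)) {\<zero>\<^bsub>tensor R (obj P (s - 1)) N\<^esub>} xs"
      unfolding tensor_map(2)[OF D(1,1) N D(2) v(1) z(1)] \<phi>t'[OF xsR dv z(1)] .
    fix a assume a: "a \<in> max_ideal R"
    have ac: "a \<in> carrier R" using a by (rule max_ideal_carr)
    have "\<phi> k v \<odot>\<^sub>N (a \<odot>\<^sub>N z) \<in> ?K" if "k < n" for k
      using mod_hom_closed[OF \<phi>[OF that] v(1)] Kc(5) z(3)[OF a] by simp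
    then show "a \<odot>\<^bsub>tensor R (obj P s) N\<^esub> ?e \<in> foldl (plus_mult (tensor R (obj P s) N)) {\<zero>\<^bsub>tensor R (obj P s) N\<^esub>} xs"
      using \<phi>t[OF xsR v(1), of "a \<odot>\<^sub>N z"] ac z(1) unfolding T.pt_bilinear(4)[OF ac v(1) z(1), symmetric] by simp
  qed
qed

text \<open>Here \<open>u\<close> is the top degree in which \<open>P \<otimes> N\<close> has homology, and the formula reads
  \<open>depth N = depth H\<^sub>u(P \<otimes> N) + s - u\<close>.  A socle element of \<open>H\<^sub>u(P \<otimes> N)\<close>, or of its quotient by a regular element, is
  moved along a maximal \<open>N\<close>-regular sequence until it meets the element of \<open>top_socle_element\<close> in degree \<open>s\<close>.\<close>
lemma depth_formula:
  assumes P: "is_complex R P" "!!i. projective_module R (obj P i)" and N: "fin_gen_module R N"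
    and top: "!!i. s < i ==> zero_module (obj P i)" and nz: "\<not> zero_module (obj P s)"
    and min: "!!v. v \<in> elems P s ==> bd P s v \<in> scalars_times R (max_ideal R) (obj P (s - 1))"
    and exact: "!!i. u < i ==> exact_at (tensor_cpx R P N) i"
    and t: "depth_is R N t {\<zero>\<^sub>N}"
    and d: "depth_is R (obj (tensor_cpx R P N) u\<lparr>carrier := cycles (tensor_cpx R P N) u\<rparr>) d (boundaries (tensor_cpx R P N) u)"
    and d1: "d \<le> 1"
  shows "int t = int d + s - u"
proof -
  let ?X = "tensor_cpx R P N"
  let ?Z = "obj ?X u\<lparr>carrier := cycles ?X u\<rparr>" and ?B = "boundaries ?X u"
  note Nm = fin_gen_module_module[OF N]
  have fg: "fin_gen_module R (obj P i)" for i using P(1) by (simp add: is_complex_def)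
  note X = tensor_cpx_chain[OF is_complex_chain[OF P(1)] Nm]
  note D = chain_complexD[OF X]
  have Nn: "noeth_module R N" by (rule fin_gen_noeth_module[OF noetherian_ring_axioms N])
  have Xn: "noeth_module R (obj ?X u)" unfolding tensor_cpx_simps
    by (rule fin_gen_noeth_module[OF noetherian_ring_axioms tensor_pair.tensor_fin_gen[OF tensor_pairI[OF fin_gen_module_module[OF fg] Nm] fg N]])
  have Zn: "noeth_module R ?Z" by (rule noeth_module_sub[OF Xn cycles_submodule[OF X]])
  have BZ: "submodule ?B R ?Z" by (rule boundaries_sub_cycles[OF X])
  have zX: "zero_module (obj ?X i)" if "s < i" for i
    unfolding tensor_cpx_simps by (rule tensor_zero_module[OF fin_gen_module_module[OF fg] Nm top[OF that]])
  have reg: "regular_mod (obj ?X i) {\<zero>\<^bsub>obj ?X i\<^esub>} xs" if "set xs \<subseteq> carrier R" "regular_mod N {\<zero>\<^sub>N} xs" for i xs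
    unfolding tensor_cpx_simps
    by (rule tensor_regular[OF fg[of i] P(2) Nm, where I = "max_ideal R"]) (use that in blast)
  interpret U: module R "obj ?X u" by (rule D(1))
  interpret N: module R N by (rule Nm)
  have shift: "s = u + int (length xs)"
    if xs: "set xs \<subseteq> max_ideal R" "regular_mod N {\<zero>\<^sub>N} xs" "has_socle R N (foldl (plus_mult N) {\<zero>\<^sub>N} xs)"
      and soc: "has_socle R ?Z ?B" for xs
  proof -
    have xsR: "set xs \<subseteq> carrier R" using xs(1) max_ideal_carr by blast
    obtain e where e: "e \<in> elems ?X s" "e \<notin> foldl (plus_mult (obj ?X s)) {\<zero>\<^bsub>obj ?X s\<^esub>} xs"
      "bd ?X s e \<in> foldl (plus_mult (obj ?X (s - 1))) {\<zero>\<^bsub>obj ?X (s - 1)\<^esub>} xs"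
      using top_socle_element[OF P Nm nz min xs(1,3)] by metis
    obtain z where z: "z \<in> cycles ?X u" "z \<notin> ?B" "!!a. a \<in> max_ideal R ==> a \<odot>\<^bsub>obj ?X u\<^esub> z \<in> ?B"
      using soc by (rule has_socleE) auto
    have zc: "z \<in> elems ?X u" "bd ?X u z = \<zero>\<^bsub>obj ?X (u - 1)\<^esub>" using z(1) by (auto simp: cycles_def)
    have l0: "\<zero>\<^bsub>obj ?X i\<^esub> \<oplus>\<^bsub>obj ?X i\<^esub> bd ?X (i + 1) w = bd ?X (i + 1) w" if "w \<in> elems ?X (i + 1)" for i w
    proof -
      interpret I: module R "obj ?X i" by (rule D(1))
      show ?thesis using D(7)[OF that] by simp
    qed
    show ?thesis
    proof (rule socle_shift[OF X, where K = "\<lambda>i. {\<zero>\<^bsub>obj ?X i\<^esub>}" and z = z and e = e])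
      show "submodule {\<zero>\<^bsub>obj ?X i\<^esub>} R (obj ?X i)" for i by (rule module.zero_submodule[OF D(1)])
      show "bd ?X i v \<in> {\<zero>\<^bsub>obj ?X (i - 1)\<^esub>}" if "v \<in> {\<zero>\<^bsub>obj ?X i\<^esub>}" for i v
        using that mod_hom_zero[OF D(1,1,2)] by simp
      show "regular_mod (obj ?X i) {\<zero>\<^bsub>obj ?X i\<^esub>} xs" for i by (rule reg[OF xsR xs(2)])
      show "\<exists>k\<in>{\<zero>\<^bsub>obj ?X i\<^esub>}. \<exists>w\<in>elems ?X (i + 1). v = k \<oplus>\<^bsub>obj ?X i\<^esub> bd ?X (i + 1) w"
        if "u < i" "v \<in> elems ?X i" "bd ?X i v \<in> {\<zero>\<^bsub>obj ?X (i - 1)\<^esub>}" for i v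
      proof -
        have "v \<in> cycles ?X i" using that by (simp add: cycles_def)
        then have "v \<in> boundaries ?X i" using exact[OF that(1)] by blast
        then show ?thesis unfolding boundaries_def using l0 by auto
      qed
      show "z \<in> elems ?X u" "bd ?X u z \<in> {\<zero>\<^bsub>obj ?X (u - 1)\<^esub>}" using zc by simp_all
      show "z \<noteq> k \<oplus>\<^bsub>obj ?X u\<^esub> bd ?X (u + 1) w" if "k \<in> {\<zero>\<^bsub>obj ?X u\<^esub>}" "w \<in> elems ?X (u + 1)" for k w
        using z(2) l0[OF that(2)] that unfolding boundaries_def by auto
      show "\<exists>k\<in>{\<zero>\<^bsub>obj ?X u\<^esub>}. \<exists>w\<in>elems ?X (u + 1). a \<odot>\<^bsub>obj ?X u\<^esub> z = k \<oplus>\<^bsub>obj ?X u\<^esub> bd ?X (u + 1) w"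
        if "a \<in> max_ideal R" for a
        using z(3)[OF that] l0 unfolding boundaries_def by auto
    qed (use xs(1) zX e in auto)
  qed
  consider "d = 0" | "d = 1" using d1 by linarith
  then show ?thesis
  proof cases
    case 1
    obtain xs where xs: "length xs = t" "set xs \<subseteq> max_ideal R" "regular_mod N {\<zero>\<^sub>N} xs"
      "has_socle R N (foldl (plus_mult N) {\<zero>\<^sub>N} xs)" using t by (rule depth_is_sequence)
    show ?thesis using shift[OF xs(2-4)] d xs(1) unfolding 1 by simp
  next
    case 2
    have nsZ: "\<not> has_socle R ?Z ?B" using d nzd_no_socle unfolding 2 by auto
    show ?thesis
    proof (cases t)
      case 0
      \<comment> \<open>a socle element of \<open>N\<close> would give one of the top homology\<close>
      have soc: "has_socle R N {\<zero>\<^sub>N}" using t 0 by simp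
      obtain e where e: "e \<in> elems ?X s" "e \<notin> {\<zero>\<^bsub>obj ?X s\<^esub>}" "bd ?X s e \<in> {\<zero>\<^bsub>obj ?X (s - 1)\<^esub>}"
        "!!a. a \<in> max_ideal R ==> a \<odot>\<^bsub>obj ?X s\<^esub> e \<in> {\<zero>\<^bsub>obj ?X s\<^esub>}"
        using top_socle_element[OF P Nm nz min, of "[]"] soc by auto
      have ec: "e \<in> cycles ?X s" using e by (simp add: cycles_def)
      have bs: "boundaries ?X s \<subseteq> {\<zero>\<^bsub>obj ?X s\<^esub>}"
        unfolding boundaries_def using zero_module_carrier[OF zX[of "s + 1"]] mod_hom_zero[OF D(1,1,3)] by auto
      have "s \<le> u" using exact[of s] ec bs e(2) by force
      moreover have "u \<le> s"
      proof (rule ccontr)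
        assume "\<not> u \<le> s"
        then have "cycles ?X u \<subseteq> ?B" using zero_module_cycles[OF X zX] by simp
        then have "\<not> has_socle R ?Z K" if "?B \<subseteq> K" for K using that unfolding has_socle_def by auto
        moreover obtain x where x: "x \<in> max_ideal R" "depth_is R ?Z 0 (plus_mult ?Z ?B x)" using d unfolding 2 by auto
        moreover have "?B \<subseteq> plus_mult ?Z ?B x"
          using module.plus_mult_incl(1)[OF noeth_module_module[OF Zn] BZ max_ideal_carr[OF x(1)]] .
        ultimately show False by auto
      qed
      ultimately have "s = u" by simp
      then have "has_socle R ?Z ?B"
        unfolding has_socle_def using ec e(2,4) bs U.submodule_closed(1)[OF boundaries_submodule[OF X]]
        by (intro bexI[of _ e]) auto
      then show ?thesis using nsZ by blast
    next
      case (Suc t')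
      have nsN: "\<not> has_socle R N {\<zero>\<^sub>N}" using t nzd_no_socle unfolding Suc by auto
      obtain x where x: "x \<in> max_ideal R" "nzd N {\<zero>\<^sub>N} x" "nzd ?Z ?B x"
        using nzd_exists[OF Nn, of "{{\<zero>\<^sub>N}}", OF _ _ Zn, of "{?B}"] nsN nsZ BZ N.zero_submodule by auto
      have t': "depth_is R N t' (plus_mult N {\<zero>\<^sub>N} x)"
        using depth_is_cut[OF Nn N.zero_submodule x(1,2) t] unfolding Suc by auto
      have sZ: "has_socle R ?Z (plus_mult ?Z ?B x)"
        using depth_is_cut[OF Zn BZ x(1,3) d] unfolding 2 by auto
      obtain xs where xs: "length xs = t'" "set xs \<subseteq> max_ideal R" "regular_mod N (plus_mult N {\<zero>\<^sub>N} x) xs"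
        "has_socle R N (foldl (plus_mult N) (plus_mult N {\<zero>\<^sub>N} x) xs)" using t' by (rule depth_is_sequence)
      have xxs: "set (x # xs) \<subseteq> max_ideal R" "regular_mod N {\<zero>\<^sub>N} (x # xs)"
        "has_socle R N (foldl (plus_mult N) {\<zero>\<^sub>N} (x # xs))" using x xs by auto
      have xsR: "set (x # xs) \<subseteq> carrier R" using xxs(1) max_ideal_carr by blast
      obtain e where e: "e \<in> elems ?X s" "e \<notin> foldl (plus_mult (obj ?X s)) {\<zero>\<^bsub>obj ?X s\<^esub>} (x # xs)"
        "bd ?X s e \<in> foldl (plus_mult (obj ?X (s - 1))) {\<zero>\<^bsub>obj ?X (s - 1)\<^esub>} (x # xs)"
        using top_socle_element[OF P Nm nz min xxs(1,3)] by metis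
      obtain z where z: "z \<in> cycles ?X u" "z \<notin> plus_mult ?Z ?B x"
        "!!a. a \<in> max_ideal R ==> a \<odot>\<^bsub>obj ?X u\<^esub> z \<in> plus_mult ?Z ?B x"
        using sZ by (rule has_socleE) auto
      have "s = u + int (length xs)"
      proof (rule socle_shift_depth_one[OF X xxs(1) reg[OF xsR xxs(2)] exact _ z zX e])
        show "v \<in> ?B" if "v \<in> cycles ?X u" "x \<odot>\<^bsub>obj ?X u\<^esub> v \<in> ?B" for v
          using nzdD[OF x(3), of v] that by simp
      qed
      then show ?thesis using xs(1) Suc 2 by simp
    qed
  qed
qed

end

section \<open>Making the top differential minimal\<close>

lemma mod_iso_zero:
  assumes A: "module R A" and B: "module R B" and i: "mod_iso R A B"
  shows "zero_module A \<longleftrightarrow> zero_module B"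
proof -
  obtain f where f: "f \<in> mod_hom R A B" "bij_betw f (carrier A) (carrier B)" using i by (auto simp: mod_iso_def)
  have im: "f ` carrier A = carrier B" and inj: "inj_on f (carrier A)" using f(2) by (auto simp: bij_betw_def)
  note z = mod_hom_zero[OF A B f(1)]
  interpret A: module R A by (rule A)
  show ?thesis
  proof
    assume "zero_module A"
    then show "zero_module B" unfolding zero_module_def im[symmetric] using z by simp
  next
    assume "zero_module B"
    then have "f x = f \<zero>\<^sub>A" if "x \<in> carrier A" for x
      using mod_hom_closed[OF f(1) that] z by (simp add: zero_module_def)
    then have "x = \<zero>\<^sub>A" if "x \<in> carrier A" for x using inj that by (meson A.zero_closed inj_onD)
    then show "zero_module A" unfolding zero_module_def using A.zero_closed by blast
  qed
qed

definition sub_cpx :: "('a, 'b) cpx \<Rightarrow> (int \<Rightarrow> 'b set) \<Rightarrow> ('a, 'b) cpx" where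
  "sub_cpx P C = \<lparr>obj = (\<lambda>i. obj P i\<lparr>carrier := C i\<rparr>), bd = bd P\<rparr>"

lemma sub_cpx_simps:
  "obj (sub_cpx P C) i = obj P i\<lparr>carrier := C i\<rparr>" "bd (sub_cpx P C) = bd P"
  by (simp_all add: sub_cpx_def)

text \<open>The inclusion of the subcomplex and the retraction \<open>r\<close> are inverse to each other on homology.\<close>
lemma retract_subcomplex:
  assumes R: "noetherian_ring R" and P: "is_complex R P" "!!i. projective_module R (obj P i)"
    and C: "!!i. submodule (C i) R (obj P i)" "!!i x. x \<in> C i ==> bd P i x \<in> C (i - 1)"
    and r: "chain_map R P P r" "!!i x. x \<in> elems P i ==> r i x \<in> C i" "!!i x. x \<in> C i ==> r i x = x"
    and hom: "!!i z. z \<in> cycles P i ==> z \<ominus>\<^bsub>obj P i\<^esub> r i z \<in> boundaries P i"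
  shows "is_complex R (sub_cpx P C)" "projective_module R (obj (sub_cpx P C) i)"
    "module R B ==> mod_iso R (homology P i) B ==> mod_iso R (homology (sub_cpx P C) i) B"
proof -
  note chP = is_complex_chain[OF P(1)]
  note D = chain_complexD[OF chP] and Dr = chain_mapD[OF r(1)]
  have fg: "fin_gen_module R (obj P i)" for i using P(1) by (simp add: is_complex_def)
  have Cc: "x \<in> elems P i" if "x \<in> C i" for x i using module.submodule_closed(6)[OF D(1) C(1) that] .
  have Cs: "C i \<subseteq> elems P i" for i using Cc by (rule subsetI)
  show cpx: "is_complex R (sub_cpx P C)"
  proof (rule is_complexI, unfold sub_cpx_simps)
    show "fin_gen_module R (obj P i\<lparr>carrier := C i\<rparr>)" for i
      by (rule noeth_module_fin_gen[OF noeth_module_sub[OF fin_gen_noeth_module[OF R fg] C(1)]])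
    show "bd P i \<in> mod_hom R (obj P i\<lparr>carrier := C i\<rparr>) (obj P (i - 1)\<lparr>carrier := C (i - 1)\<rparr>)" for i
      by (rule mod_hom_sub_codomain[OF mod_hom_sub_domain[OF D(2) Cs]]) (use C(2) in auto)
    show "bd P (i - 1) (bd P i x) = \<zero>\<^bsub>obj P (i - 2)\<lparr>carrier := C (i - 2)\<rparr>\<^esub>" if "x \<in> carrier (obj P i\<lparr>carrier := C i\<rparr>)" for i x
      using D(4)[of x i] Cc that by simp
  qed
  note ch = is_complex_chain[OF cpx]
  show "projective_module R (obj (sub_cpx P C) i)" unfolding sub_cpx_simps
  proof (rule projective_retract[OF P(2)[of i] submodule_module[OF D(1) C(1)]])
    show "(\<lambda>x. x) \<in> mod_hom R (obj P i\<lparr>carrier := C i\<rparr>) (obj P i)" by (rule mod_hom_sub_domain[OF mod_hom_id Cs])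
    show "r i \<in> mod_hom R (obj P i) (obj P i\<lparr>carrier := C i\<rparr>)"
      by (rule mod_hom_sub_codomain[OF Dr(1)]) (use r(2) in auto)
    show "r i x = x" if "x \<in> carrier (obj P i\<lparr>carrier := C i\<rparr>)" for x using r(3) that by simp
  qed
  have cy: "x \<in> cycles (sub_cpx P C) i \<longleftrightarrow> x \<in> cycles P i \<and> x \<in> C i" for x
    unfolding cycles_def sub_cpx_simps using Cc by auto
  have bo: "x \<in> boundaries (sub_cpx P C) i \<longleftrightarrow> x \<in> boundaries P i" if x: "x \<in> C i" for x
  proof
    assume "x \<in> boundaries (sub_cpx P C) i"
    then show "x \<in> boundaries P i" unfolding boundaries_def sub_cpx_simps using Cc by auto
  next
    assume "x \<in> boundaries P i"
    then obtain y where y: "y \<in> elems P (i + 1)" "x = bd P (i + 1) y" unfolding boundaries_def by blast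
    have "x = bd P (i + 1) (r (i + 1) y)" using r(3)[OF x] Dr(3)[OF y(1)] y(2) by simp
    then show "x \<in> boundaries (sub_cpx P C) i" unfolding boundaries_def sub_cpx_simps using r(2)[OF y(1)] by simp
  qed
  assume B: "module R B" and iso: "mod_iso R (homology P i) B"
  obtain f where f: "f \<in> mod_hom R (obj P i\<lparr>carrier := cycles P i\<rparr>) B" "f ` cycles P i = carrier B"
    "!!x. x \<in> cycles P i ==> f x = \<zero>\<^sub>B \<longleftrightarrow> x \<in> boundaries P i"
    using iffD1[OF homology_iso_iff[OF chP B] iso] by (elim bexE conjE) (rule that, assumption, assumption, drule (1) bspec)
  interpret Pi: module R "obj P i" by (rule D(1))
  interpret B: module R B by (rule B)
  show "mod_iso R (homology (sub_cpx P C) i) B"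
    unfolding homology_iso_iff[OF ch B]
  proof (intro bexI[of _ f] conjI ballI)
    have "f \<in> mod_hom R (obj P i\<lparr>carrier := cycles P i\<rparr>\<lparr>carrier := cycles (sub_cpx P C) i\<rparr>) B"
      by (rule mod_hom_sub_domain[OF f(1)]) (use cy in auto)
    then show "f \<in> mod_hom R (obj (sub_cpx P C) i\<lparr>carrier := cycles (sub_cpx P C) i\<rparr>) B"
      unfolding sub_cpx_simps by simp
    show "f x = \<zero>\<^sub>B \<longleftrightarrow> x \<in> boundaries (sub_cpx P C) i" if "x \<in> cycles (sub_cpx P C) i" for x
      using f(3)[of x] bo[of x] that unfolding cy by blast
    show "f ` cycles (sub_cpx P C) i = carrier B"
    proof (intro equalityI subsetI)
      fix b assume "b \<in> f ` cycles (sub_cpx P C) i"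
      then show "b \<in> carrier B" unfolding f(2)[symmetric] using cy by blast
    next
      fix b assume "b \<in> carrier B"
      then obtain z where z: "z \<in> cycles P i" "b = f z" unfolding f(2)[symmetric] by blast
      have zc: "z \<in> elems P i" using z(1) by (simp add: cycles_def)
      have rz: "r i z \<in> cycles P i" by (rule chain_map_cycles[OF chP chP r(1) z(1)])
      have rzc: "r i z \<in> elems P i" using rz by (simp add: cycles_def)
      note db = hom[OF z(1)]
      then have dc: "z \<ominus>\<^bsub>obj P i\<^esub> r i z \<in> cycles P i" using boundaries_cycles[OF chP] by blast
      have "z = r i z \<oplus>\<^bsub>obj P i\<^esub> (z \<ominus>\<^bsub>obj P i\<^esub> r i z)" using zc rzc by (simp add: Pi.group_normalise)
      then have "f z = f (r i z) \<oplus>\<^sub>B f (z \<ominus>\<^bsub>obj P i\<^esub> r i z)"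
        using mod_hom_add[OF f(1), of "r i z" "z \<ominus>\<^bsub>obj P i\<^esub> r i z"] rz dc by simp
      also have "\<dots> = f (r i z)" using f(3)[OF dc] db mod_hom_closed[OF f(1), of "r i z"] rz by simp
      finally show "b \<in> f ` cycles (sub_cpx P C) i" unfolding z(2) using cy[of "r i z"] rz r(2)[OF zc] by blast
    qed
  qed
qed

text \<open>The bounds \<open>l\<close> and \<open>s\<close> need not be sharp, so that \<open>s\<close> can be lowered when \<open>P\<^sub>s\<close> vanishes.\<close>
definition bounded_qpr ::
  "('a, 'r) ring_scheme \<Rightarrow> ('a, 'b, 'm) module_scheme \<Rightarrow> ('a, 'c) cpx \<Rightarrow> int \<Rightarrow> int \<Rightarrow> int \<Rightarrow> bool" where
  "bounded_qpr R M P l s h \<longleftrightarrow> is_complex R P \<and> (\<forall>i. projective_module R (obj P i)) \<and>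
     (\<forall>i<l. zero_module (obj P i)) \<and> (\<forall>i>s. zero_module (obj P i)) \<and>
     (\<forall>i. \<exists>a. mod_iso R (homology P i) (power_module M a)) \<and>
     \<not> zero_module (homology P h) \<and> (\<forall>i>h. zero_module (homology P i))"

lemma bounded_qprD:
  assumes "bounded_qpr R M P l s h"
  shows "is_complex R P" "projective_module R (obj P i)"
    "i < l ==> zero_module (obj P i)" "s < i ==> zero_module (obj P i)"
    "\<exists>a. mod_iso R (homology P i) (power_module M a)"
    "\<not> zero_module (homology P h)" "h < i ==> zero_module (homology P i)"
  using assms unfolding bounded_qpr_def by auto

context noeth_local_ring
begin

text \<open>If \<open>dv\<close> is not in \<open>\<mm>P\<^sub>s\<^sub>-\<^sub>1\<close>, there is a functional \<open>\<psi>\<close> with \<open>\<psi>(dv) = 1\<close>, and the contractible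
  complex \<open>Rv \<rightarrow> R dv\<close> is a direct summand.  The complement needs one generator fewer in degree \<open>s\<close>.\<close>
lemma split_off_unit:
  assumes P: "bounded_qpr R M P l s h" and M: "module R M"
    and S: "finite S" "S \<subseteq> elems P s" "mod_span R (obj P s) S = elems P s"
    and v: "v \<in> S" "bd P s v \<notin> scalars_times R (max_ideal R) (obj P (s - 1))"
  obtains C T where "bounded_qpr R M (sub_cpx P C) l s h" "finite T" "card T < card S"
    "T \<subseteq> elems (sub_cpx P C) s" "mod_span R (obj (sub_cpx P C) s) T = elems (sub_cpx P C) s"
proof -
  note PD = bounded_qprD[OF P]
  note cpx = PD(1) and pr = PD(2) and zl = PD(3) and zs = PD(4) and iso = PD(5) and hh = PD(6,7)
  note chP = is_complex_chain[OF cpx]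
  note D = chain_complexD[OF chP]
  have fg: "fin_gen_module R (obj P i)" for i using cpx by (simp add: is_complex_def)
  interpret Ps: module R "obj P s" by (rule D(1))
  interpret Pt: module R "obj P (s - 1)" by (rule D(1))
  have vc: "v \<in> elems P s" using v(1) S(2) by blast
  note dvc = D(6)[OF vc]
  obtain n \<phi> where \<phi>: "!!k. k < n ==> \<phi> k \<in> mod_hom R (obj P (s - 1)) (ring_module R)"
    and \<phi>v: "!!v. v \<in> elems P (s - 1) ==> (\<forall>k<n::nat. \<phi> k v \<in> max_ideal R) ==> v \<in> scalars_times R (max_ideal R) (obj P (s - 1))"
    by (rule tensor_regular[OF fg[of "s - 1"] pr M, where I = "max_ideal R"]) (rule that)
  obtain k where k: "k < n" "\<phi> k (bd P s v) \<notin> max_ideal R" using \<phi>v[OF dvc] v(2) by blast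
  note \<phi>k = \<phi>[OF k(1)]
  have \<phi>c: "\<phi> k x \<in> carrier R" if "x \<in> elems P (s - 1)" for x using mod_hom_closed[OF \<phi>k that] by simp
  obtain u where u: "u \<in> carrier R" "u \<otimes> \<phi> k (bd P s v) = \<one>" using unit_of_not_max[OF \<phi>c[OF dvc] k(2)] by blast
  define \<psi> where "\<psi> x = u \<otimes> \<phi> k x" for x
  have \<psi>: "\<psi> \<in> mod_hom R (obj P (s - 1)) (ring_module R)"
    unfolding \<psi>_def using u(1) \<phi>c mod_hom_add[OF \<phi>k] mod_hom_smult[OF \<phi>k]
    by (intro mod_homI) (simp_all add: r_distr m_lcomm)
  have \<psi>c: "\<psi> x \<in> carrier R" if "x \<in> elems P (s - 1)" for x using mod_hom_closed[OF \<psi> that] by simp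
  have \<psi>1: "\<psi> (bd P s v) = \<one>" using u(2) by (simp add: \<psi>_def)
  note RM = ring_module_module[OF is_cring]
  have \<psi>d: "(\<lambda>x. \<psi> (bd P s x)) \<in> mod_hom R (obj P s) (ring_module R)" by (rule mod_hom_comp[OF D(2) \<psi>])
  have \<psi>dc: "\<psi> (bd P s x) \<in> carrier R" if "x \<in> elems P s" for x by (rule \<psi>c[OF D(6)[OF that]])
  define C where "C i = (if i = s then {x \<in> elems P s. \<psi> (bd P s x) = \<zero>\<^bsub>ring_module R\<^esub>}
    else if i = s - 1 then {y \<in> elems P (s - 1). \<psi> y = \<zero>\<^bsub>ring_module R\<^esub>} else elems P i)" for i
  define r where "r i x = (if i = s then x \<ominus>\<^bsub>obj P s\<^esub> \<psi> (bd P s x) \<odot>\<^bsub>obj P s\<^esub> v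
    else if i = s - 1 then x \<ominus>\<^bsub>obj P (s - 1)\<^esub> \<psi> x \<odot>\<^bsub>obj P (s - 1)\<^esub> bd P s v else x)" for i x
  have Cs: "C s = {x \<in> elems P s. \<psi> (bd P s x) = \<zero>\<^bsub>ring_module R\<^esub>}"
    and Ct: "C (s - 1) = {y \<in> elems P (s - 1). \<psi> y = \<zero>\<^bsub>ring_module R\<^esub>}"
    and Co: "!!i. i \<noteq> s ==> i \<noteq> s - 1 ==> C i = elems P i" by (simp_all add: C_def)
  have rs: "r s x = x \<ominus>\<^bsub>obj P s\<^esub> \<psi> (bd P s x) \<odot>\<^bsub>obj P s\<^esub> v"
    and rt: "r (s - 1) x = x \<ominus>\<^bsub>obj P (s - 1)\<^esub> \<psi> x \<odot>\<^bsub>obj P (s - 1)\<^esub> bd P s v"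
    and ro: "!!i. i \<noteq> s ==> i \<noteq> s - 1 ==> r i x = x" for x by (simp_all add: r_def)
  have hmul: "(\<lambda>x. f x \<odot>\<^sub>A w) \<in> mod_hom R B A" if "f \<in> mod_hom R B (ring_module R)" "module R A" "w \<in> carrier A" for f B A w
  proof -
    interpret A: module R A by (rule that(2))
    show ?thesis
      by (rule mod_homI) (use mod_hom_closed[OF that(1)] mod_hom_add[OF that(1)] mod_hom_smult[OF that(1)] that(3)
        in \<open>simp_all add: A.smult_l_distr A.smult_assoc1\<close>)
  qed
  have rh: "r i \<in> mod_hom R (obj P i) (obj P i)" for i
  proof -
    consider "i = s" | "i = s - 1" | "i \<noteq> s" "i \<noteq> s - 1" by blast
    then show ?thesis
    proof cases
      case 1
      have "(\<lambda>x. x \<ominus>\<^bsub>obj P s\<^esub> \<psi> (bd P s x) \<odot>\<^bsub>obj P s\<^esub> v) \<in> mod_hom R (obj P s) (obj P s)"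
        by (rule mod_hom_difff[OF D(1) mod_hom_id hmul[OF \<psi>d D(1) vc]])
      then show ?thesis unfolding 1 r_def by simp
    next
      case 2
      have "(\<lambda>x. x \<ominus>\<^bsub>obj P (s - 1)\<^esub> \<psi> x \<odot>\<^bsub>obj P (s - 1)\<^esub> bd P s v) \<in> mod_hom R (obj P (s - 1)) (obj P (s - 1))"
        by (rule mod_hom_difff[OF D(1) mod_hom_id hmul[OF \<psi> D(1) dvc]])
      then show ?thesis unfolding 2 r_def by simp
    next
      case 3
      then have "r i = (\<lambda>x. x)" using ro by (intro ext)
      then show ?thesis using mod_hom_id by simp
    qed
  qed
  have C1: "submodule (C i) R (obj P i)" for i
  proof -
    consider "i = s" | "i = s - 1" | "i \<noteq> s" "i \<noteq> s - 1" by blast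
    then show ?thesis
    proof cases
      case 1 then show ?thesis using kernel_submodule[OF D(1) RM \<psi>d] by (simp add: C_def)
    next
      case 2 then show ?thesis using kernel_submodule[OF D(1) RM \<psi>] by (simp add: C_def)
    next
      case 3 then show ?thesis using module.carrier_is_submodule[OF D(1)] by (simp add: C_def)
    qed
  qed
  have \<psi>0: "\<psi> \<zero>\<^bsub>obj P (s - 1)\<^esub> = \<zero>" using mod_hom_zero[OF D(1) RM \<psi>] by simp
  have C2: "bd P i x \<in> C (i - 1)" if x: "x \<in> C i" for i x
  proof -
    have xc: "x \<in> elems P i" using module.submodule_closed(6)[OF D(1) C1 x] .
    note b = D(6)[OF xc]
    consider "i = s" | "i = s + 1" | "i \<noteq> s" "i \<noteq> s + 1" by blast
    then show ?thesis
    proof cases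
      case 1 then show ?thesis using x b unfolding 1 Cs Ct by simp
    next
      case 2
      have "bd P s (bd P (s + 1) x) = \<zero>\<^bsub>obj P (s - 1)\<^esub>" using D(5)[of x s] xc unfolding 2 by simp
      then show ?thesis using b \<psi>0 unfolding 2 by (simp add: C_def)
    next
      case 3
      then have "C (i - 1) = elems P (i - 1)" by (intro Co) simp_all
      then show ?thesis using b by simp
    qed
  qed
  have r2: "r i x \<in> C i" if x: "x \<in> elems P i" for i x
  proof -
    note rc = mod_hom_closed[OF rh x]
    consider "i = s" | "i = s - 1" | "i \<noteq> s" "i \<noteq> s - 1" by blast
    then show ?thesis
    proof cases
      case 1
      have xs: "x \<in> elems P s" using x 1 by simp
      have "\<psi> (bd P s (r s x)) = \<psi> (bd P s x) \<ominus>\<^bsub>ring_module R\<^esub> \<psi> (\<psi> (bd P s x) \<odot>\<^bsub>obj P (s - 1)\<^esub> bd P s v)"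
        unfolding rs using xs vc \<psi>dc[OF xs] D(6)[OF xs] dvc
        by (simp add: mod_hom_diff[OF D(1) D(1) D(2)] mod_hom_smult[OF D(2)] mod_hom_diff[OF D(1) RM \<psi>])
      also have "\<psi> (\<psi> (bd P s x) \<odot>\<^bsub>obj P (s - 1)\<^esub> bd P s v) = \<psi> (bd P s x)"
        using mod_hom_smult[OF \<psi> \<psi>dc[OF xs] dvc] \<psi>1 \<psi>dc[OF xs] by simp
      also have "\<psi> (bd P s x) \<ominus>\<^bsub>ring_module R\<^esub> \<psi> (bd P s x) = \<zero>\<^bsub>ring_module R\<^esub>"
        using module.submodule_closed(4)[OF RM module.zero_submodule[OF RM]]
          abelian_group.r_neg[OF module_abelian_group[OF RM], of "\<psi> (bd P s x)"] \<psi>dc[OF xs]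
        by (simp add: abelian_group.minus_eq[OF module_abelian_group[OF RM]])
      finally show ?thesis using rc unfolding 1 Cs by simp
    next
      case 2
      have xt: "x \<in> elems P (s - 1)" using x 2 by simp
      have "\<psi> (r (s - 1) x) = \<psi> x \<ominus>\<^bsub>ring_module R\<^esub> \<psi> (\<psi> x \<odot>\<^bsub>obj P (s - 1)\<^esub> bd P s v)"
        unfolding rt using xt \<psi>c[OF xt] dvc by (simp add: mod_hom_diff[OF D(1) RM \<psi>])
      also have "\<psi> (\<psi> x \<odot>\<^bsub>obj P (s - 1)\<^esub> bd P s v) = \<psi> x"
        using mod_hom_smult[OF \<psi> \<psi>c[OF xt] dvc] \<psi>1 \<psi>c[OF xt] by simp
      also have "\<psi> x \<ominus>\<^bsub>ring_module R\<^esub> \<psi> x = \<zero>\<^bsub>ring_module R\<^esub>"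
        using abelian_group.r_neg[OF module_abelian_group[OF RM], of "\<psi> x"] \<psi>c[OF xt]
        by (simp add: abelian_group.minus_eq[OF module_abelian_group[OF RM]])
      finally show ?thesis using rc unfolding 2 Ct by simp
    next
      case 3 then show ?thesis using x by (simp add: Co ro)
    qed
  qed
  have r3: "r i x = x" if x: "x \<in> C i" for i x
  proof -
    have xc: "x \<in> elems P i" using module.submodule_closed(6)[OF D(1) C1 x] .
    consider "i = s" | "i = s - 1" | "i \<noteq> s" "i \<noteq> s - 1" by blast
    then show ?thesis
    proof cases
      case 1 then show ?thesis using x xc vc unfolding 1 Cs rs by (simp add: Ps.minus_eq)
    next
      case 2 then show ?thesis using x xc dvc unfolding 2 Ct rt by (simp add: Pt.minus_eq)
    next
      case 3 then show ?thesis by (rule ro)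
    qed
  qed
  have rc: "chain_map R P P r"
    unfolding chain_map_def
  proof (intro conjI allI ballI rh)
    fix i x assume x: "x \<in> elems P i"
    note b = D(6)[OF x]
    consider "i = s" | "i = s + 1" | "i = s - 1" | "i \<noteq> s" "i \<noteq> s + 1" "i \<noteq> s - 1" by blast
    then show "r (i - 1) (bd P i x) = bd P i (r i x)"
    proof cases
      case 1
      have xs: "x \<in> elems P s" using x 1 by simp
      show ?thesis unfolding 1 rs rt using xs vc \<psi>dc[OF xs]
        by (simp add: mod_hom_diff[OF D(1) D(1) D(2)] mod_hom_smult[OF D(2)])
    next
      case 2
      have "r (i - 1) (bd P i x) = bd P i x"
      proof (rule r3)
        have "x \<in> C i" using x by (simp add: C_def 2)
        then show "bd P i x \<in> C (i - 1)" by (rule C2)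
      qed
      moreover have "r i x = x" by (rule ro) (simp_all add: 2)
      ultimately show ?thesis by simp
    next
      case 3
      have xt: "x \<in> elems P (s - 1)" using x 3 by simp
      have "bd P (s - 1) (bd P s v) = \<zero>\<^bsub>obj P (s - 1 - 1)\<^esub>" using D(4)[OF vc] by simp
      then have "bd P (s - 1) (r (s - 1) x) = bd P (s - 1) x \<ominus>\<^bsub>obj P (s - 1 - 1)\<^esub> \<zero>\<^bsub>obj P (s - 1 - 1)\<^esub>"
        unfolding rt using xt \<psi>c[OF xt] dvc module.smult_r_null[OF D(1) \<psi>c[OF xt]]
        by (simp add: mod_hom_diff[OF D(1) D(1) D(2)] mod_hom_smult[OF D(2)])
      also have "\<dots> = bd P (s - 1) x"
        using D(6)[OF xt] abelian_group.neg_zero[OF module_abelian_group[OF D(1)], of "s - 1 - 1"]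
          abelian_monoid.r_zero[OF abelian_group.axioms(1)[OF module_abelian_group[OF D(1)]], of _ "s - 1 - 1"]
        by (simp only: abelian_group.minus_eq[OF module_abelian_group[OF D(1)]])
      finally show ?thesis unfolding 3 by (simp add: ro)
    next
      case 4
      then have "r (i - 1) (bd P i x) = bd P i x" "r i x = x" by (auto intro!: ro)
      then show ?thesis by simp
    qed
  qed
  have rb: "z \<ominus>\<^bsub>obj P i\<^esub> r i z \<in> boundaries P i" if z: "z \<in> cycles P i" for i z
  proof -
    interpret Pi: module R "obj P i" by (rule D(1))
    have zc: "z \<in> elems P i" "bd P i z = \<zero>\<^bsub>obj P (i - 1)\<^esub>" using z by (auto simp: cycles_def)
    have b0: "\<zero>\<^bsub>obj P i\<^esub> \<in> boundaries P i" by (rule Pi.submodule_closed(1)[OF boundaries_submodule[OF chP]])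
    consider "i = s - 1" | "r i z = z"
    proof (cases "i = s")
      case True
      have "z \<in> C s" using zc \<psi>0 unfolding True Cs by simp
      then show ?thesis using that r3 True by blast
    next
      case False then show ?thesis using that ro by blast
    qed
    then show ?thesis
    proof cases
      case 1
      have zt: "z \<in> elems P (s - 1)" using zc 1 by simp
      have "z \<ominus>\<^bsub>obj P (s - 1)\<^esub> r (s - 1) z = \<psi> z \<odot>\<^bsub>obj P (s - 1)\<^esub> bd P s v"
        unfolding rt using zt dvc \<psi>c[OF zt] by (simp add: Pt.group_normalise)
      also have "\<dots> = bd P s (\<psi> z \<odot>\<^bsub>obj P s\<^esub> v)" using mod_hom_smult[OF D(2) \<psi>c[OF zt] vc] by simp
      finally show ?thesis unfolding 1 boundaries_def using \<psi>c[OF zt] vc by simp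
    next
      case 2
      then show ?thesis using b0 zc(1) by (simp add: Pi.minus_eq Pi.r_neg)
    qed
  qed
  note facts = noetherian_ring_axioms cpx pr C1 C2 rc r2 r3 rb
  have sub: "is_complex R (sub_cpx P C)" "projective_module R (obj (sub_cpx P C) i)" for i
    by (rule retract_subcomplex(1,2)[OF facts]; assumption)+
  have sub3: "mod_iso R (homology (sub_cpx P C) i) (homology P i)" for i
    by (rule retract_subcomplex(3)[OF facts]; (assumption | rule homology_module[OF chP] mod_iso_refl))
  let ?P = "sub_cpx P C"
  note ch' = is_complex_chain[OF sub(1)]
  have zC: "zero_module (obj ?P i)" if "zero_module (obj P i)" for i
  proof -
    have "C i \<subseteq> {\<zero>\<^bsub>obj P i\<^esub>}"
      using zero_module_carrier[OF that module.submodule_closed(6)[OF D(1) C1[of i]]] by (intro subsetI) simp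
    moreover have "\<zero>\<^bsub>obj P i\<^esub> \<in> C i" by (rule module.submodule_closed(1)[OF D(1) C1])
    ultimately have "C i = {\<zero>\<^bsub>obj P i\<^esub>}" by blast
    then show ?thesis unfolding sub_cpx_simps zero_module_def by simp
  qed
  have hz: "zero_module (homology ?P i) \<longleftrightarrow> zero_module (homology P i)" for i
    by (rule mod_iso_zero[OF homology_module[OF ch'] homology_module[OF chP] sub3])
  have good: "bounded_qpr R M ?P l s h"
    unfolding bounded_qpr_def
  proof (intro conjI allI impI sub(1,2))
    show "\<exists>a. mod_iso R (homology ?P i) (power_module M a)" for i
      using iso[of i] mod_iso_trans[OF sub3] by blast
  qed (use zC zl zs hz hh in auto)
  let ?T = "r s ` (S - {v})"
  have rv: "r s v = \<zero>\<^bsub>obj P s\<^esub>" unfolding rs \<psi>1 using vc by (simp add: Ps.minus_eq Ps.r_neg)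
  have Pm': "module R (obj ?P s)" by (rule chain_complexD(1)[OF ch'])
  have rs': "r s \<in> mod_hom R (obj P s) (obj ?P s)" unfolding sub_cpx_simps
    by (rule mod_hom_sub_codomain[OF rh]) (use r2 in auto)
  have onto: "r s ` elems P s = elems ?P s"
  proof (intro equalityI subsetI)
    fix y assume "y \<in> elems ?P s"
    then have "y \<in> C s" by (simp add: sub_cpx_simps)
    then show "y \<in> r s ` elems P s"
      using r3 Ps.submodule_closed(6)[OF C1] by (intro image_eqI[of _ _ y]) auto
  qed (use mod_hom_closed[OF rs'] in auto)
  have Tc: "?T \<subseteq> elems ?P s" using S(2) mod_hom_closed[OF rs'] by blast
  have span: "mod_span R (obj ?P s) (r s ` S) = elems ?P s"
    by (rule span_image[OF D(1) Pm' rs' onto S(2,3)])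
  note smT = module.mod_span_submodule[OF Pm' Tc]
  have "mod_span R (obj ?P s) (r s ` S) \<subseteq> mod_span R (obj ?P s) ?T"
  proof (rule mod_span_least[OF smT], intro subsetI)
    fix y assume "y \<in> r s ` S"
    then obtain x where x: "x \<in> S" "y = r s x" by blast
    show "y \<in> mod_span R (obj ?P s) ?T"
    proof (cases "x = v")
      case True
      then show ?thesis using module.submodule_closed(1)[OF Pm' smT] rv x(2) by (simp add: sub_cpx_simps)
    next
      case False
      then show ?thesis using mod_span_base[of ?T R "obj ?P s"] x by blast
    qed
  qed
  then have sT: "mod_span R (obj ?P s) ?T = elems ?P s"
    unfolding span using module.submodule_closed(6)[OF Pm' smT] by (intro equalityI subsetI) auto
  have "card ?T \<le> card (S - {v})" using S(1) by (intro card_image_le) simp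
  also have "\<dots> < card S" using S(1) v(1) by (intro psubset_card_mono) auto
  finally show ?thesis using that[OF good _ _ Tc sT] S(1) by simp
qed

text \<open>Each generator of \<open>P\<^sub>s\<close> that \<open>d\<close> maps outside \<open>\<mm>P\<^sub>s\<^sub>-\<^sub>1\<close> is split off.  If \<open>P\<^sub>s\<close> becomes zero in this way, the argument
  is repeated in degree \<open>s - 1\<close>, which is at least \<open>h\<close>.\<close>
lemma minimal_top:
  fixes P :: "('a, 'c) cpx"
  assumes M: "module R M" and P: "bounded_qpr R M P l s h"
  shows "\<exists>(P' :: ('a, 'c) cpx) s'. s' \<le> s \<and> bounded_qpr R M P' l s' h \<and> \<not> zero_module (obj P' s') \<and>
    (\<forall>v\<in>elems P' s'. bd P' s' v \<in> scalars_times R (max_ideal R) (obj P' (s' - 1)))"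
  using P
proof (induction "nat (s - h)" arbitrary: P s rule: less_induct)
  case (less s P)
  have "[|bounded_qpr R M P l s h; finite S; S \<subseteq> elems P s; mod_span R (obj P s) S = elems P s|] ==> ?case"
    for P :: "('a, 'c) cpx" and S
  proof (induction "card S" arbitrary: P S rule: less_induct)
    case inner: (less S P)
    note good = inner.prems(1) and S = inner.prems(2-4)
    have cpx: "is_complex R P" using good by (simp add: bounded_qpr_def)
    note chP = is_complex_chain[OF cpx]
    note D = chain_complexD[OF chP]
    show ?case
    proof (cases "zero_module (obj P s)")
      case True
      have hz: "\<not> zero_module (homology P h)" using good by (simp add: bounded_qpr_def)
      have "h < s"
      proof (rule ccontr)
        assume "\<not> h < s"
        then have "zero_module (obj P h)" using good True by (cases "h = s") (auto simp: bounded_qpr_def)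
        then have "zero_module (homology P h)"
          unfolding homology_zero_iff[OF chP] by (rule zero_module_cycles[OF chP])
        then show False using hz by simp
      qed
      then have lt: "nat (s - 1 - h) < nat (s - h)" by simp
      have "zero_module (obj P i)" if "s - 1 < i" for i
        using good True that by (cases "i = s") (auto simp: bounded_qpr_def)
      then have g: "bounded_qpr R M P l (s - 1) h" using good by (auto simp: bounded_qpr_def)
      show ?thesis using less.hyps[OF lt g] by (meson dual_order.trans le_add_same_cancel1 zle_diff1_eq less_imp_le)
    next
      case False
      show ?thesis
      proof (cases "\<exists>v\<in>S. bd P s v \<notin> scalars_times R (max_ideal R) (obj P (s - 1))")
        case True
        then obtain v where v: "v \<in> S" "bd P s v \<notin> scalars_times R (max_ideal R) (obj P (s - 1))" by blast
        obtain C T where T: "bounded_qpr R M (sub_cpx P C) l s h" "finite T" "card T < card S"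
          "T \<subseteq> elems (sub_cpx P C) s" "mod_span R (obj (sub_cpx P C) s) T = elems (sub_cpx P C) s"
          by (rule split_off_unit[OF good M S v]) (rule that)
        show ?thesis by (rule inner.hyps[OF T(3,1,2,4,5)])
      next
        case all: False
        let ?H = "scalars_times R (max_ideal R) (obj P (s - 1))"
        have Hs: "submodule ?H R (obj P (s - 1))"
        proof -
          interpret Pt: module R "obj P (s - 1)" by (rule D(1))
          show ?thesis unfolding scalars_times_def
            by (rule Pt.mod_span_submodule) (use max_ideal_carr in auto)
        qed
        have "mod_span R (obj P s) S \<subseteq> {v \<in> elems P s. bd P s v \<in> ?H}"
          using all S(2) by (intro mod_span_least preimage_submodule[OF D(1,1,2) Hs]) blast
        then have "\<forall>v\<in>elems P s. bd P s v \<in> ?H" unfolding S(3) by blast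
        then show ?thesis using good False by (intro exI[of _ P] exI[of _ s]) simp
      qed
    qed
  qed
  moreover obtain S where "finite S" "S \<subseteq> elems P s" "mod_span R (obj P s) S = elems P s"
    using less.prems unfolding bounded_qpr_def is_complex_def fin_gen_module_def by blast
  ultimately show ?case using less.prems by blast
qed

end

section \<open>Quasi-projective dimension as an integer\<close>

lemma SUP_ereal_int:
  fixes J :: "int set"
  assumes "finite J" "J \<noteq> {}"
  shows "(SUP i\<in>J. ereal (of_int i)) = ereal (of_int (Max J))" "(INF i\<in>J. ereal (of_int i)) = ereal (of_int (Min J))"
proof -
  note in_J = Max_in[OF assms] Min_in[OF assms]
  show "(SUP i\<in>J. ereal (of_int i)) = ereal (of_int (Max J))"
    using assms by (intro antisym SUP_least SUP_upper in_J) simp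
  show "(INF i\<in>J. ereal (of_int i)) = ereal (of_int (Min J))"
    using assms by (intro antisym INF_greatest INF_lower in_J) simp
qed

lemma power_module_zero_iff:
  assumes M: "module R M" and nz: "\<not> zero_module M"
  shows "zero_module (power_module M a) \<longleftrightarrow> a = 0"
proof
  interpret M: module R M by (rule M)
  assume z: "zero_module (power_module M a)"
  obtain m where m: "m \<in> carrier M" "m \<noteq> \<zero>\<^sub>M" using nz M.zero_closed by (auto simp: zero_module_def)
  show "a = 0"
  proof (rule ccontr)
    assume "a \<noteq> 0"
    have "(\<lambda>i\<in>{..<a}. m) \<in> carrier (power_module M a)" using m(1) by (simp add: power_module_simps)
    then have "(\<lambda>i\<in>{..<a}. m) = \<zero>\<^bsub>power_module M a\<^esub>" by (rule zero_module_carrier[OF z])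
    then have "(\<lambda>i\<in>{..<a}. m) 0 = (\<lambda>i\<in>{..<a}. \<zero>\<^sub>M) 0" unfolding power_module_simps by simp
    then show False using \<open>a \<noteq> 0\<close> m(2) by simp
  qed
next
  assume "a = 0"
  then show "zero_module (power_module M a)" by (simp add: zero_module_def power_module_simps restrict_def)
qed

lemma zero_modules_iso:
  assumes "module R A" "module R B" "zero_module A" "zero_module B"
  shows "mod_iso R A B"
proof -
  have "(\<lambda>_. \<zero>\<^sub>B) \<in> mod_hom R A B" by (rule mod_hom_zerof[OF assms(2)])
  moreover have "bij_betw (\<lambda>_. \<zero>\<^sub>B) (carrier A) (carrier B)"
    using assms(3,4) by (auto simp: bij_betw_def zero_module_def)
  ultimately show ?thesis unfolding mod_iso_def by blast
qed

lemma homology_zero_of_obj: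
  assumes "chain_complex R X" "zero_module (obj X i)"
  shows "zero_module (homology X i)"
  unfolding homology_zero_iff[OF assms(1)] by (rule zero_module_cycles[OF assms])

lemma bounded_qpr_exists:
  assumes M: "module R M" "\<not> zero_module M"
    and P: "quasi_projective_resolution R M P" "bounded_cpx P"
  obtains l s h where "bounded_qpr R M P l s h" "csup P - hsup P = ereal (of_int (s - h))"
proof -
  have cpx: "is_complex R P" and bb: "bounded_below_cpx P" and pr: "!!i. projective_module R (obj P i)"
    using P(1) by (auto simp: quasi_projective_resolution_def)
  note ch = is_complex_chain[OF cpx]
  obtain a where a: "!!i. ereal (of_int i) \<ge> cinf P ==> mod_iso R (homology P i) (power_module M (a i))"
    and a0: "\<exists>i. ereal (of_int i) \<ge> cinf P \<and> a i \<noteq> 0"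
    using P(1) unfolding quasi_projective_resolution_def by blast
  define I where "I = {i. \<not> zero_module (obj P i)}"
  define J where "J = {i. \<not> zero_module (homology P i)}"
  have JI: "J \<subseteq> I" using homology_zero_of_obj[OF ch] unfolding I_def J_def by blast
  obtain i0 where i0: "ereal (of_int i0) \<ge> cinf P" "a i0 \<noteq> 0" using a0 by blast
  have "\<not> zero_module (homology P i0)"
    using mod_iso_zero[OF homology_module[OF ch] power_module_module[OF M(1)] a[OF i0(1)]]
      power_module_zero_iff[OF M, of "a i0"] i0(2) by simp
  then have J0: "i0 \<in> J" by (simp add: J_def)
  then have I0: "i0 \<in> I" using JI by blast
  have lowI: "cinf P \<le> ereal (of_int i)" if "i \<in> I" for i
    unfolding cinf_def using that by (intro INF_lower) (simp add: I_def)
  have uppI: "ereal (of_int i) \<le> csup P" if "i \<in> I" for i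
    unfolding csup_def using that by (intro SUP_upper) (simp add: I_def)
  have "cinf P \<noteq> -\<infinity>" using bb by (auto simp: bounded_below_cpx_def)
  moreover have "cinf P \<noteq> \<infinity>" using lowI[OF I0] by auto
  ultimately obtain x where x: "cinf P = ereal x" by (cases "cinf P") auto
  have "csup P \<noteq> \<infinity>" using P(2) unfolding bounded_cpx_def x by auto
  moreover have "csup P \<noteq> -\<infinity>" using uppI[OF I0] by auto
  ultimately obtain y where y: "csup P = ereal y" by (cases "csup P") auto
  have "I \<subseteq> {\<lfloor>x\<rfloor>..\<lceil>y\<rceil>}"
  proof
    fix i assume i: "i \<in> I"
    have "x \<le> of_int i" "of_int i \<le> y" using lowI[OF i] uppI[OF i] unfolding x y by simp_all
    then show "i \<in> {\<lfloor>x\<rfloor>..\<lceil>y\<rceil>}" by simp linarith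
  qed
  then have finI: "finite I" by (rule finite_subset) simp
  have finJ: "finite J" by (rule finite_subset[OF JI finI])
  have Ine: "I \<noteq> {}" and Jne: "J \<noteq> {}" using I0 J0 by auto
  have cs: "csup P = ereal (of_int (Max I))" unfolding csup_def I_def[symmetric] by (rule SUP_ereal_int[OF finI Ine])
  have ci: "cinf P = ereal (of_int (Min I))" unfolding cinf_def I_def[symmetric] by (rule SUP_ereal_int[OF finI Ine])
  have hs: "hsup P = ereal (of_int (Max J))" unfolding hsup_def J_def[symmetric] by (rule SUP_ereal_int[OF finJ Jne])
  have "bounded_qpr R M P (Min I) (Max I) (Max J)"
    unfolding bounded_qpr_def
  proof (intro conjI allI impI cpx pr)
    show "zero_module (obj P i)" if "i < Min I" for i
    proof (rule ccontr)
      assume "\<not> zero_module (obj P i)"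
      then have "Min I \<le> i" using finI by (intro Min_le) (simp_all add: I_def)
      then show False using that by simp
    qed
    show "zero_module (obj P i)" if "Max I < i" for i
    proof (rule ccontr)
      assume "\<not> zero_module (obj P i)"
      then have "i \<le> Max I" using finI by (intro Max_ge) (simp_all add: I_def)
      then show False using that by simp
    qed
    show "zero_module (homology P i)" if "Max J < i" for i
    proof (rule ccontr)
      assume "\<not> zero_module (homology P i)"
      then have "i \<le> Max J" using finJ by (intro Max_ge) (simp_all add: J_def)
      then show False using that by simp
    qed
    show "\<not> zero_module (homology P (Max J))" using Max_in[OF finJ Jne] by (simp add: J_def)
    show "\<exists>b. mod_iso R (homology P i) (power_module M b)" for i
    proof (cases "Min I \<le> i")
      case True
      then show ?thesis using a[of i] unfolding ci by auto
    next
      case False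
      then have "i \<notin> I" using finI Min_le by auto
      then have "zero_module (homology P i)" using homology_zero_of_obj[OF ch] by (simp add: I_def)
      then have "mod_iso R (homology P i) (power_module M 0)"
        using power_module_zero_iff[OF M, of 0] by (intro zero_modules_iso homology_module[OF ch] power_module_module[OF M(1)]) simp_all
      then show ?thesis by blast
    qed
  qed
  then show ?thesis using that cs hs by simp
qed

lemma bounded_qpr_quasi_projective:
  assumes M: "module R M" "\<not> zero_module M"
    and P: "bounded_qpr R M P l s h" and nz: "\<not> zero_module (obj P s)"
  shows "quasi_projective_resolution R M P" "bounded_cpx P" "csup P - hsup P = ereal (of_int (s - h))" "h \<le> s" "l \<le> h"
proof -
  note PD = bounded_qprD[OF P]
  note cpx = PD(1) and pr = PD(2) and zl = PD(3) and zs = PD(4) and iso = PD(5) and hh = PD(6,7)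
  note ch = is_complex_chain[OF cpx]
  define I where "I = {i. \<not> zero_module (obj P i)}"
  define J where "J = {i. \<not> zero_module (homology P i)}"
  have JI: "J \<subseteq> I" using homology_zero_of_obj[OF ch] unfolding I_def J_def by blast
  have Iin: "I \<subseteq> {l..s}" unfolding I_def using zl zs by force
  then have finI: "finite I" by (rule finite_subset) simp
  have finJ: "finite J" by (rule finite_subset[OF JI finI])
  have sI: "s \<in> I" and hJ: "h \<in> J" using nz hh(1) by (simp_all add: I_def J_def)
  have hI: "h \<in> I" using hJ JI by blast
  have MI: "Max I = s" using finI sI Iin by (intro Max_eqI) auto
  have MJ: "Max J = h" using finJ hJ hh(2) unfolding J_def by (intro Max_eqI) (auto simp: not_less[symmetric])
  show "h \<le> s" "l \<le> h" using hI Iin by auto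
  have Ine: "I \<noteq> {}" and Jne: "J \<noteq> {}" using sI hJ by auto
  have cs: "csup P = ereal (of_int s)" unfolding csup_def I_def[symmetric] using SUP_ereal_int(1)[OF finI Ine] MI by simp
  have ci: "cinf P = ereal (of_int (Min I))" unfolding cinf_def I_def[symmetric] by (rule SUP_ereal_int[OF finI Ine])
  have hs: "hsup P = ereal (of_int h)" unfolding hsup_def J_def[symmetric] using SUP_ereal_int(1)[OF finJ Jne] MJ by simp
  show "csup P - hsup P = ereal (of_int (s - h))" unfolding cs hs by simp
  show "bounded_cpx P" unfolding bounded_cpx_def cs ci by simp
  obtain a where a: "!!i. mod_iso R (homology P i) (power_module M (a i))" using iso by metis
  have "a h \<noteq> 0"
    using mod_iso_zero[OF homology_module[OF ch] power_module_module[OF M(1)] a[of h]] hh(1)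
      power_module_zero_iff[OF M, of "a h"] by simp
  moreover have "cinf P \<le> ereal (of_int h)" unfolding ci using finI hI by simp
  ultimately show "quasi_projective_resolution R M P"
    unfolding quasi_projective_resolution_def bounded_below_cpx_def using cpx pr a ci by auto
qed

context noeth_local_ring
begin

text \<open>After \<open>minimal_top\<close> the competing values \<open>s - h\<close> are natural numbers, and the smallest of them is the infimum.\<close>
lemma qpd_attained:
  fixes M :: "('a, 'c, 'm) module_scheme"
  assumes M: "module R M" "\<not> zero_module M" and fin: "qpd R M < \<infinity>"
  obtains P :: "('a, 'a univ_elem) cpx" and l s h where "bounded_qpr R M P l s h" "\<not> zero_module (obj P s)"
    "!!v. v \<in> elems P s ==> bd P s v \<in> scalars_times R (max_ideal R) (obj P (s - 1))"
    "qpd R M = ereal (of_int (s - h))"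
proof -
  let ?Q = "{P :: ('a, 'a univ_elem) cpx. quasi_projective_resolution R M P \<and> bounded_cpx P}"
  have q: "qpd R M = (INF P\<in>?Q. csup P - hsup P)" using M(2) by (simp add: qpd_def)
  have "?Q \<noteq> {}"
  proof
    assume "?Q = {}"
    then show False using fin unfolding q by (simp only: image_empty Inf_empty) (simp add: top_ereal_def)
  qed
  define V where "V n \<longleftrightarrow> (\<exists>(P :: ('a, 'a univ_elem) cpx) l s h. bounded_qpr R M P l s h \<and> \<not> zero_module (obj P s) \<and>
    (\<forall>v\<in>elems P s. bd P s v \<in> scalars_times R (max_ideal R) (obj P (s - 1))) \<and> int n = s - h)" for n
  have min: "\<exists>n. V n \<and> ereal (real n) \<le> csup P - hsup P" if PQ: "P \<in> ?Q" for P
  proof -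
    obtain l s h where P: "bounded_qpr R M P l s h" "csup P - hsup P = ereal (of_int (s - h))"
      using PQ bounded_qpr_exists[OF M, of P] by blast
    obtain P' :: "('a, 'a univ_elem) cpx" and s' where P': "s' \<le> s" "bounded_qpr R M P' l s' h" "\<not> zero_module (obj P' s')"
      "\<forall>v\<in>elems P' s'. bd P' s' v \<in> scalars_times R (max_ideal R) (obj P' (s' - 1))"
      using minimal_top[OF M(1) P(1)] by blast
    have "h \<le> s'" by (rule bounded_qpr_quasi_projective(4)[OF M P'(2,3)])
    then have n: "int (nat (s' - h)) = s' - h" by simp
    have "V (nat (s' - h))" unfolding V_def n using P'(2-4) by blast
    moreover have "real (nat (s' - h)) \<le> of_int (s - h)" using n P'(1) \<open>h \<le> s'\<close> by linarith
    ultimately show ?thesis unfolding P(2) by (intro exI[of _ "nat (s' - h)"]) simp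
  qed
  then have ex: "\<exists>n. V n" using \<open>?Q \<noteq> {}\<close> by blast
  define n where "n = (LEAST n. V n)"
  have Vn: "V n" unfolding n_def using ex by (rule LeastI_ex)
  then obtain P :: "('a, 'a univ_elem) cpx" and l s h where P: "bounded_qpr R M P l s h" "\<not> zero_module (obj P s)"
    "\<forall>v\<in>elems P s. bd P s v \<in> scalars_times R (max_ideal R) (obj P (s - 1))" "int n = s - h"
    unfolding V_def by blast
  note B = bounded_qpr_quasi_projective[OF M P(1,2)]
  have n': "ereal (real n) = ereal (of_int (s - h))" unfolding P(4)[symmetric] by simp
  have "qpd R M = ereal (of_int (s - h))"
  proof (rule antisym)
    have "P \<in> ?Q" using B(1,2) by simp
    then have "qpd R M \<le> csup P - hsup P" unfolding q by (rule INF_lower)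
    then show "qpd R M \<le> ereal (of_int (s - h))" unfolding B(3) .
    show "ereal (of_int (s - h)) \<le> qpd R M" unfolding q n'[symmetric]
    proof (rule INF_greatest)
      fix P assume "P \<in> ?Q"
      then obtain k where k: "V k" "ereal (real k) \<le> csup P - hsup P" using min by blast
      have "n \<le> k" unfolding n_def using k(1) by (rule Least_le)
      then have "ereal (real n) \<le> ereal (real k)" by simp
      then show "ereal (real n) \<le> csup P - hsup P" using k(2) by (rule order_trans)
    qed
  qed
  then show ?thesis using that[of P l s h] P by blast
qed

end

theorem theorem1p3:
  fixes R :: "('a, 'r) ring_scheme"
    and M :: "('a, 'b, 'm) module_scheme"
    and N :: "('a, 'c, 'n) module_scheme"
    and q :: nat
  assumes "noetherian_ring R" and "local_ring R"
    and "fin_gen_module R M" and "\<not> zero_module M"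
    and "fin_gen_module R N" and "\<not> zero_module N"
    and "tor_sup R M N = enat q"
    and "qpd R M < \<infinity>"
    and "depth R (Tor R q M N) \<le> 1"
  shows "ereal_of_enat (depth R N) =
    ereal_of_enat (depth R (Tor R q M N)) + qpd R M - ereal (real q)"
proof -
  note M = assms(3) and M0 = assms(4) and N = assms(5) and N0 = assms(6)
    and q = assms(7) and fin = assms(8) and dT = assms(9)
  note Mm = fin_gen_module_module[OF M] and Nm = fin_gen_module_module[OF N]
  interpret noeth_local_ring R
    using assms(1,2) module_cring[OF Mm] by (intro noeth_local_ring.intro noeth_local_ring_axioms.intro)
  interpret N: module R N by (rule Nm)
  let ?F = "resolution R M"
  have F: "projective_resolution R M ?F" by (rule resolution[OF assms(1) M])
  have F1: "is_complex R ?F" using F by (simp add: projective_resolution_def)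
  have fgF: "fin_gen_module R (obj ?F i)" for i using F1 by (simp add: is_complex_def)
  note chF = is_complex_chain[OF F1]
  note chT = tensor_cpx_chain[OF chF Nm]
  let ?T = "homology (tensor_cpx R ?F N) (int q)"
  have Tm: "module R ?T" by (rule homology_module[OF chT])
  have TorT: "Tor R q M N = ?T" by (simp add: Tor_def)
  have van: "exact_at (tensor_cpx R ?F N) i" if i: "int q < i" for i
  proof -
    have "zero_module (Tor R (nat i) M N)"
    proof (rule ccontr)
      assume "\<not> zero_module (Tor R (nat i) M N)"
      then have "enat (nat i) \<le> tor_sup R M N" unfolding tor_sup_def by (intro SUP_upper) simp
      then show False using i unfolding q by simp
    qed
    then show ?thesis using i unfolding Tor_def homology_zero_iff[OF chT] by simp
  qed
  have T0: "\<not> zero_module ?T"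
  proof
    assume "zero_module ?T"
    then have "depth R (Tor R q M N) = \<infinity>" unfolding TorT depth_def by simp
    then show False using dT by simp
  qed
  have nT: "noeth_module R ?T"
    unfolding homology_def
  proof (rule noeth_module_quot[OF noeth_module_sub[OF _ cycles_submodule[OF chT]] boundaries_sub_cycles[OF chT]])
    show "noeth_module R (obj (tensor_cpx R ?F N) (int q))"
      unfolding tensor_cpx_simps
      by (rule fin_gen_noeth_module[OF assms(1) tensor_pair.tensor_fin_gen[OF tensor_pairI[OF fin_gen_module_module[OF fgF] Nm] fgF N]])
  qed
  have "{\<zero>\<^bsub>?T\<^esub>} \<noteq> carrier ?T" using T0 unfolding zero_module_def by auto
  then obtain d where d: "depth_is R ?T d {\<zero>\<^bsub>?T\<^esub>}"
    using depth_is_exists[OF nT module.zero_submodule[OF Tm]] by blast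
  have dTd: "depth R ?T = enat d" by (rule depth_eqI[OF nT d])
  have d1: "d \<le> 1" using dT unfolding TorT dTd by (simp add: one_enat_def)
  have nN: "noeth_module R N" by (rule fin_gen_noeth_module[OF assms(1) N])
  have "{\<zero>\<^sub>N} \<noteq> carrier N" using N0 unfolding zero_module_def by auto
  then obtain t where t: "depth_is R N t {\<zero>\<^sub>N}" using depth_is_exists[OF nN N.zero_submodule] by blast
  have dN: "depth R N = enat t" by (rule depth_eqI[OF nN t])
  obtain P :: "('a, 'a univ_elem) cpx" and l s h where P: "bounded_qpr R M P l s h" "\<not> zero_module (obj P s)"
    "!!v. v \<in> elems P s ==> bd P s v \<in> scalars_times R (max_ideal R) (obj P (s - 1))"
    "qpd R M = ereal (of_int (s - h))" using qpd_attained[OF Mm M0 fin] by metis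
  note PD = bounded_qprD[OF P(1)]
  note cpx = PD(1) and pr = PD(2) and zl = PD(3) and zs = PD(4) and iso = PD(5) and hh = PD(6,7)
  note chP = is_complex_chain[OF cpx]
  have lh: "l \<le> h" by (rule bounded_qpr_quasi_projective(5)[OF Mm M0 P(1,2)])
  have exP: "exact_at P i" if "h < i" for i using hh(2)[OF that] homology_zero_iff[OF chP] by blast
  let ?X = "tensor_cpx R P N" let ?u = "h + int q"
  note chX = tensor_cpx_chain[OF chP Nm]
  have exX: "exact_at ?X k" if k: "?u < k" for k
  proof -
    have n: "l + int (nat (h + 1 - l)) = h + 1" using lh by simp
    have ex': "exact_at P i" if "l + int (nat (h + 1 - l)) \<le> i" for i
      using that unfolding n by (intro exP) simp
    have k': "l + int (nat (h + 1 - l)) + int q \<le> k" unfolding n using k by simp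
    show ?thesis
      by (rule tensor_vanishing[OF Mm Nm F van cpx pr zl iso ex' k'])
  qed
  obtain a where a: "mod_iso R (homology P h) (power_module M a)" using iso by blast
  have a0: "0 < a"
    using mod_iso_zero[OF homology_module[OF chP] power_module_module[OF Mm] a] hh(1) power_module_zero_iff[OF Mm M0, of a] by simp
  have isoT: "mod_iso R (homology ?X ?u) (power_module ?T a)"
    by (rule tensor_top_homology[OF Mm Nm F van cpx pr zl iso exP lh a])
  let ?Z = "obj ?X ?u\<lparr>carrier := cycles ?X ?u\<rparr>" and ?B = "boundaries ?X ?u"
  have fgP: "fin_gen_module R (obj P i)" for i using cpx by (simp add: is_complex_def)
  have nZ: "noeth_module R ?Z"
  proof (rule noeth_module_sub[OF _ cycles_submodule[OF chX]])
    show "noeth_module R (obj ?X ?u)"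
      unfolding tensor_cpx_simps
      by (rule fin_gen_noeth_module[OF assms(1) tensor_pair.tensor_fin_gen[OF tensor_pairI[OF fin_gen_module_module[OF fgP] Nm] fgP N]])
  qed
  note BZ = boundaries_sub_cycles[OF chX, of ?u]
  have Pm: "module R (power_module ?T a)" by (rule power_module_module[OF Tm])
  have hX: "\<not> zero_module (homology ?X ?u)"
    using mod_iso_zero[OF homology_module[OF chX] Pm isoT] power_module_zero_iff[OF Tm T0, of a] a0 by simp
  then have "?B \<noteq> carrier ?Z" unfolding homology_zero_iff[OF chX] by auto
  then obtain d' where d': "depth_is R ?Z d' ?B" using depth_is_exists[OF nZ BZ] by blast
  obtain f where f: "f \<in> mod_hom R ?Z (power_module ?T a)" "f ` cycles ?X ?u = carrier (power_module ?T a)"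
    "!!x. x \<in> cycles ?X ?u ==> f x = \<zero>\<^bsub>power_module ?T a\<^esub> \<longleftrightarrow> x \<in> ?B"
    using iffD1[OF homology_iso_iff[OF chX Pm] isoT] by (elim bexE conjE) (rule that, assumption, assumption, drule (1) bspec)
  have onto: "f ` carrier ?Z = carrier (power_module ?T a)" using f(2) by simp
  have "depth R (power_module ?T a) = enat d'"
    by (rule depth_image[OF nZ Pm f(1) onto BZ _ d']) (use f(3) in simp)
  moreover have "depth R (power_module ?T a) = enat d"
  proof (rule depth_eqI[OF noeth_module_image[OF nZ Pm f(1) onto]])
    have "({..<a} \<rightarrow>\<^sub>E {\<zero>\<^bsub>?T\<^esub>}) = {\<zero>\<^bsub>power_module ?T a\<^esub>}" unfolding power_module_simps by (simp add: PiE_eq_singleton)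
    then show "depth_is R (power_module ?T a) d {\<zero>\<^bsub>power_module ?T a\<^esub>}"
      using depth_is_power[OF Tm a0 module.zero_submodule[OF Tm] d] by simp
  qed
  ultimately have dd: "d' = d" by simp
  have "int t = int d + s - ?u"
    by (rule depth_formula[OF cpx pr N zs P(2,3) exX t d'[unfolded dd] d1])
  then have "real t = real d + of_int (s - h) - real q" by linarith
  then show ?thesis unfolding TorT dTd dN P(4) by simp
qed

end
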